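(* Assume (H0) and (H1), $S_2^\star\in(\underline S_2,M)$ and $S_1^{\min}>S_1^\star>0$. Consider a point $S^0=(S_1^0,S_2^0)\in\mathcal D$ such that $S_1^0\in(S_1^\star,\overline S_1)$ and $S_2^0>\xi^\star(S_1^0)$. Then any optimal trajectory $\gamma$ steering $S^0$ to the extended target $\mathcal E_0$ has (before reaching $\mathcal E_0$) a unique switching time $t_0$ such that $S_2(t_0)>S_2^\star$, and $u(t)=0$ for $t\in[0,t_0]$ and $u(t)=1$ for $t>t_0$ (until $\mathcal E_0$ is reached).
   Context: Setting. Let $M>0$ and $\underline S_1,\underline S_2>0$ with $\underline S_1+\underline S_2<M$. The functions $f,\mu:\mathbb R_+\to\mathbb R_+$ are continuously differentiable and satisfy: (H0) $f$ is increasing and $f(0)=0$; (H1) $\mu$ is non-negative and vanishes only at $0$, and either there is $S_2^\star>0$ such that $\mu$ is increasing on $[0,S_2^\star)$ and decreasing on $(S_2^\star,+\infty)$, or $\mu$ is increasing and one puts $S_2^\star=+\infty$. Consider $$\dot S_1=-u f(S_1),\qquad \dot S_2=u f(S_1)-\mu(S_2)(M-S_1-S_2)$$ on the invariant domain $\mathcal D=\{(S_1,S_2)\in\mathbb R_+\times\mathbb R_+:0<S_1+S_2<M\}$, with measurable controls $u:[0,\infty)\to[0,1]$. The target is $\mathcal T=[0,\underline S_1]\times[0,\underline S_2]$. The problem is to reach $\mathcal T$ in minimal time $t_f$ from a given point of $\mathcal D\setminus\mathcal T$; a trajectory (or control) is optimal if it achieves this minimal time. A switching time is a time $t_0$ such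 that the control is non-constant in any neighbourhood of $t_0$. Let $\mathcal Z_0=\{(S_1,S_2)\in\mathcal D\setminus\mathcal T: S_1\le\underline S_1,\ S_2>\underline S_2\}$. On $\mathcal Z_0$ let $$\varphi(S_1,S_2)=\int_{\underline S_2}^{S_2}\frac{\mu'(s)\,\mu(\underline S_2)(M-S_1-\underline S_2)}{\mu(s)^2(M-S_1-s)}\,ds,$$ $\mathcal C_0=\{(S_1,S_2)\in\mathcal Z_0:\varphi(S_1,S_2)=1\}$ and $\mathcal E_0=\overline{\{(S_1,S_2)\in\mathcal Z_0: (S_1,s_2)\notin\mathcal C_0\ \forall s_2<S_2\}}$ (the extended target; from any state of $\mathcal E_0$ the constant control $u=0$ is optimal). For $S_2^\star<M$: $u_s(S_1)=\mu(S_2^\star)(M-S_1-S_2^\star)/f(S_1)$ for $S_1>0$; $S_1^{\min}$ is the unique root in $(0,M-S_2^\star)$ of $\nu(S_1)=f(S_1)-\mu(S_2^\star)(M-S_1-S_2^\star)$. For $S_2^\star\in(\underline S_2,M)$: $S_1^\star=\underline S_1$ if $\mathcal C_0=\emptyset$, and $S_1^\star=\inf\{S_1>0:\varphi(S_1,S_2^\star)>1\}$ if $\varphi(\underline S_1,S_2^\star)\ge1$ (where it is understood that $\underline S_1+S_2^\star<M$ whenever $\varphi(\underline S_1,S_2^\star)$ is used). A singular trajectory is one with $S_2\equiv S_2^\star$ and $u=u_s(S_1)\in[0,1]$ (so $S_1\ge S_1^{\min}$ and $S_1$ is decreasing in time); it is not optimal if it is not part of any optimal trajectory. $\overline S_1$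 denotes the largest point of $(S_1^{\min},M-S_2^\star)$ such that no singular trajectory defined over a set $[S_1,S_1']\times\{S_2^\star\}$ with $S_1^{\min}\le S_1<S_1'\le\overline S_1$ is optimal. The function $\xi^\star$, defined for $S_1\ge S_1^\star$ (as long as it stays in $\mathcal D$), is the solution of $$\frac{ds_2}{ds_1}=-1+\frac{\mu(s_2)(M-s_1-s_2)}{f(s_1)},\qquad s_2(S_1^\star)=S_2^\star.$$ *)

theory Defs
  imports "HOL-Analysis.Analysis"
begin

text \<open>
  Throughout, \<open>B1\<close> and \<open>B2\<close> are the underlined thresholds bounding the target, and \<open>S2s\<close>
  is \<open>S\<^sub>2\<^sup>\<star>\<close>. ``Increasing'' and ``decreasing'' are strict. Functions on the half-line are total
  functions on the reals of which only the values on \<open>{0..}\<close> matter, so derivatives at \<open>0\<close> are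
  one-sided.
\<close>

definition C1_half_line :: "(real \<Rightarrow> real) \<Rightarrow> bool" where
  "C1_half_line g \<longleftrightarrow>
     (\<exists>g'. continuous_on {0..} g' \<and>
           (\<forall>x\<ge>0. (g has_real_derivative g' x) (at x within {0..})))"

definition H0 :: "(real \<Rightarrow> real) \<Rightarrow> bool" where
  "H0 f \<longleftrightarrow> strict_mono_on {0..} f \<and> f 0 = 0"

definition H1 :: "(real \<Rightarrow> real) \<Rightarrow> ereal \<Rightarrow> bool" where
  "H1 \<mu> S2s \<longleftrightarrow>
     (\<forall>s\<ge>0. \<mu> s \<ge> 0) \<and> (\<forall>s\<ge>0. \<mu> s = 0 \<longleftrightarrow> s = 0) \<and>
     ((\<exists>s>0. S2s = ereal s \<and> strict_mono_on {0..<s} \<mu> \<and> strict_antimono_on {s<..} \<mu>) \<or>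
      (S2s = \<infinity> \<and> strict_mono_on {0..} \<mu>))"

definition state_domain :: "real \<Rightarrow> (real \<times> real) set" where
  "state_domain M = {(s1, s2). 0 \<le> s1 \<and> 0 \<le> s2 \<and> 0 < s1 + s2 \<and> s1 + s2 < M}"

definition target :: "real \<Rightarrow> real \<Rightarrow> (real \<times> real) set" where
  "target B1 B2 = {0..B1} \<times> {0..B2}"

text \<open>
  The differential equation is imposed in integral form, which for bounded measurable controls
  says exactly that \<open>S1\<close>, \<open>S2\<close> are locally absolutely continuous and satisfy it almost everywhere.
\<close>

definition trajectory ::
  "real \<Rightarrow> (real \<Rightarrow> real) \<Rightarrow> (real \<Rightarrow> real) \<Rightarrow>
   (real \<Rightarrow> real) \<Rightarrow> (real \<Rightarrow> real) \<Rightarrow> (real \<Rightarrow> real) \<Rightarrow> bool" where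
  "trajectory M f \<mu> u S1 S2 \<longleftrightarrow>
     u \<in> borel_measurable (lebesgue_on {0..}) \<and>
     (\<forall>t\<ge>0. u t \<in> {0..1}) \<and>
     (\<forall>t\<ge>0. (S1 t, S2 t) \<in> state_domain M) \<and>
     (\<forall>t\<ge>0. ((\<lambda>s. - u s * f (S1 s)) has_integral (S1 t - S1 0)) {0..t}) \<and>
     (\<forall>t\<ge>0. ((\<lambda>s. u s * f (S1 s) - \<mu> (S2 s) * (M - S1 s - S2 s))
                has_integral (S2 t - S2 0)) {0..t})"

definition optimal ::
  "real \<Rightarrow> real \<Rightarrow> real \<Rightarrow> (real \<Rightarrow> real) \<Rightarrow> (real \<Rightarrow> real) \<Rightarrow>
   (real \<Rightarrow> real) \<Rightarrow> (real \<Rightarrow> real) \<Rightarrow> (real \<Rightarrow> real) \<Rightarrow> real \<Rightarrow> bool" where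
  "optimal M B1 B2 f \<mu> u S1 S2 tf \<longleftrightarrow>
     trajectory M f \<mu> u S1 S2 \<and>
     (S1 0, S2 0) \<in> state_domain M - target B1 B2 \<and>
     0 \<le> tf \<and> (S1 tf, S2 tf) \<in> target B1 B2 \<and>
     (\<forall>v R1 R2 t. trajectory M f \<mu> v R1 R2 \<and> R1 0 = S1 0 \<and> R2 0 = S2 0 \<and>
                  0 \<le> t \<and> (R1 t, R2 t) \<in> target B1 B2 \<longrightarrow> tf \<le> t)"

text \<open>
  Controls matter only up to null sets, so ``non-constant near \<open>t0\<close>'' means not almost everywhere
  equal to a constant.
\<close>

definition switching_time :: "(real \<Rightarrow> real) \<Rightarrow> real \<Rightarrow> bool" where
  "switching_time u t0 \<longleftrightarrow>
     (\<forall>\<epsilon>>0. \<not> (\<exists>c. AE t in lebesgue. 0 \<le> t \<and> \<bar>t - t0\<bar> < \<epsilon> \<longrightarrow> u t = c))"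

definition Z0 :: "real \<Rightarrow> real \<Rightarrow> real \<Rightarrow> (real \<times> real) set" where
  "Z0 M B1 B2 = {(s1, s2) \<in> state_domain M - target B1 B2. s1 \<le> B1 \<and> B2 < s2}"

definition phi :: "real \<Rightarrow> real \<Rightarrow> (real \<Rightarrow> real) \<Rightarrow> real \<Rightarrow> real \<Rightarrow> real" where
  "phi M B2 \<mu> s1 s2 =
     integral {B2..s2}
       (\<lambda>s. deriv \<mu> s * \<mu> B2 * (M - s1 - B2) / ((\<mu> s)\<^sup>2 * (M - s1 - s)))"

definition C0 :: "real \<Rightarrow> real \<Rightarrow> real \<Rightarrow> (real \<Rightarrow> real) \<Rightarrow> (real \<times> real) set" where
  "C0 M B1 B2 \<mu> = {(s1, s2) \<in> Z0 M B1 B2. phi M B2 \<mu> s1 s2 = 1}"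

definition E0 :: "real \<Rightarrow> real \<Rightarrow> real \<Rightarrow> (real \<Rightarrow> real) \<Rightarrow> (real \<times> real) set" where
  "E0 M B1 B2 \<mu> =
     closure {(S1, S2) \<in> Z0 M B1 B2. \<forall>s2<S2. (S1, s2) \<notin> C0 M B1 B2 \<mu>}"

definition u_sing ::
  "real \<Rightarrow> (real \<Rightarrow> real) \<Rightarrow> (real \<Rightarrow> real) \<Rightarrow> real \<Rightarrow> real \<Rightarrow> real" where
  "u_sing M f \<mu> S2s s1 = \<mu> S2s * (M - s1 - S2s) / f s1"

definition S1_min ::
  "real \<Rightarrow> (real \<Rightarrow> real) \<Rightarrow> (real \<Rightarrow> real) \<Rightarrow> real \<Rightarrow> real" where
  "S1_min M f \<mu> S2s =
     (THE s1. 0 < s1 \<and> s1 < M - S2s \<and> f s1 - \<mu> S2s * (M - s1 - S2s) = 0)"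

text \<open>
  Under the standing convention \<open>B1 + S2s < M\<close>, the second branch is the case
  \<open>phi M B2 \<mu> B1 S2s \<ge> 1\<close>. The infimum ranges over all \<open>s1\<close> for which the integral
  makes sense, not only \<open>s1 \<le> B1\<close>, so that it equals \<open>B1\<close> in the borderline case
  \<open>phi M B2 \<mu> B1 S2s = 1\<close>.
\<close>

definition S1_star :: "real \<Rightarrow> real \<Rightarrow> real \<Rightarrow> (real \<Rightarrow> real) \<Rightarrow> real \<Rightarrow> real" where
  "S1_star M B1 B2 \<mu> S2s =
     (if C0 M B1 B2 \<mu> = {} then B1
      else Inf {s1. 0 < s1 \<and> s1 + S2s < M \<and> phi M B2 \<mu> s1 S2s > 1})"

definition singular_on ::
  "real \<Rightarrow> (real \<Rightarrow> real) \<Rightarrow> (real \<Rightarrow> real) \<Rightarrow> real \<Rightarrow>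
   (real \<Rightarrow> real) \<Rightarrow> (real \<Rightarrow> real) \<Rightarrow> (real \<Rightarrow> real) \<Rightarrow> real \<Rightarrow> real \<Rightarrow> bool" where
  "singular_on M f \<mu> S2s u S1 S2 t1 t2 \<longleftrightarrow>
     (\<forall>t\<in>{t1..t2}. S2 t = S2s \<and> u_sing M f \<mu> S2s (S1 t) \<in> {0..1}) \<and>
     (AE t in lebesgue. t \<in> {t1..t2} \<longrightarrow> u t = u_sing M f \<mu> S2s (S1 t))"

text \<open>
  The singular trajectory over \<open>{x..y} \<times> {S2s}\<close>, traversed from \<open>y\<close> down to \<open>x\<close>, is part of
  some optimal trajectory.
\<close>

definition singular_optimal ::
  "real \<Rightarrow> real \<Rightarrow> real \<Rightarrow> (real \<Rightarrow> real) \<Rightarrow> (real \<Rightarrow> real) \<Rightarrow> real \<Rightarrow>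
   real \<Rightarrow> real \<Rightarrow> bool" where
  "singular_optimal M B1 B2 f \<mu> S2s x y \<longleftrightarrow>
     (\<exists>u S1 S2 tf t1 t2. optimal M B1 B2 f \<mu> u S1 S2 tf \<and>
        0 \<le> t1 \<and> t1 < t2 \<and> t2 \<le> tf \<and>
        singular_on M f \<mu> S2s u S1 S2 t1 t2 \<and> S1 t1 = y \<and> S1 t2 = x)"

definition no_singular_below ::
  "real \<Rightarrow> real \<Rightarrow> real \<Rightarrow> (real \<Rightarrow> real) \<Rightarrow> (real \<Rightarrow> real) \<Rightarrow> real \<Rightarrow> real set" where
  "no_singular_below M B1 B2 f \<mu> S2s =
     {z. S1_min M f \<mu> S2s < z \<and> z < M - S2s \<and>
         (\<forall>x y. S1_min M f \<mu> S2s \<le> x \<and> x < y \<and> y \<le> z \<longrightarrow>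
                \<not> singular_optimal M B1 B2 f \<mu> S2s x y)}"

definition is_S1_bar ::
  "real \<Rightarrow> real \<Rightarrow> real \<Rightarrow> (real \<Rightarrow> real) \<Rightarrow> (real \<Rightarrow> real) \<Rightarrow> real \<Rightarrow> real \<Rightarrow> bool" where
  "is_S1_bar M B1 B2 f \<mu> S2s S1bar \<longleftrightarrow>
     S1bar \<in> no_singular_below M B1 B2 f \<mu> S2s \<and>
     (\<forall>z\<in>no_singular_below M B1 B2 f \<mu> S2s. z \<le> S1bar)"

text \<open>
  \<open>\<xi>\<close> is the function \<open>\<xi>\<^sup>\<star>\<close> on \<open>{S1_star .. b}\<close>; in particular \<open>\<xi>\<^sup>\<star>\<close> stays in the domain
  up to abscissa \<open>b\<close>.
\<close>

definition xi_star_on ::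
  "real \<Rightarrow> real \<Rightarrow> real \<Rightarrow> (real \<Rightarrow> real) \<Rightarrow> (real \<Rightarrow> real) \<Rightarrow> real \<Rightarrow>
   real \<Rightarrow> (real \<Rightarrow> real) \<Rightarrow> bool" where
  "xi_star_on M B1 B2 f \<mu> S2s b \<xi> \<longleftrightarrow>
     \<xi> (S1_star M B1 B2 \<mu> S2s) = S2s \<and>
     (\<forall>s\<in>{S1_star M B1 B2 \<mu> S2s..b}.
        (s, \<xi> s) \<in> state_domain M \<and>
        (\<xi> has_real_derivative (- 1 + \<mu> (\<xi> s) * (M - s - \<xi> s) / f s))
          (at s within {S1_star M B1 B2 \<mu> S2s..b}))"

definition first_entry ::
  "(real \<times> real) set \<Rightarrow> (real \<Rightarrow> real) \<Rightarrow> (real \<Rightarrow> real) \<Rightarrow> real \<Rightarrow> bool" where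
  "first_entry A S1 S2 \<tau> \<longleftrightarrow>
     0 \<le> \<tau> \<and> (S1 \<tau>, S2 \<tau>) \<in> A \<and> (\<forall>t. 0 \<le> t \<and> t < \<tau> \<longrightarrow> (S1 t, S2 t) \<notin> A)"

end

theory Submission
  imports Defs
begin

text \<open>
  Put \<open>x = ln (M - S1 - S2)\<close>. Then \<open>x\<close> grows along trajectories with speed \<open>\<mu> S2\<close>, a trajectory is
  the graph of \<open>S1\<close> as a function of \<open>x\<close>, and it takes the time \<open>\<integral> dx / \<mu> (S2)\<close>. Since \<open>\<mu>\<close> is
  maximal at \<open>S2s\<close>, staying closer to the line \<open>S2 = S2s\<close> is faster. Among the profiles with given
  end points the fastest one is therefore explicit: control 0, possibly a stretch of the line,
  control 1, and control 0 again.

  The derivative of the duration with respect to the last value of \<open>S1\<close> has the sign of \<open>phi - 1\<close>,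
  which puts the beginning of the last arc into the extended target and excludes that the line is crossed
  at \<open>S1 < S1_star\<close>. A crossing at or above \<open>S1_star\<close>, together with \<open>S20 > \<xi> S10\<close>, forces an initial arc of
  control 0. That arc ends above the line: where \<open>S1 < S1_min\<close>, delaying the control 1 until the
  line is reached costs time to first order, and where \<open>S1 \<ge> S1_min\<close>, an optimal trajectory through
  the line could be continued backwards by one that starts on the line, at a place
  where no singular arc is optimal, and the result would not have the explicit form.
\<close>

subsection \<open>Differential equations and integrals on the line\<close>

text \<open>Two obstacles shape the development. Controls are only measurable, so a trajectory is
  kept as a differential inclusion for its profile, in integrated form, and comparison with an
  explicit curve is a Gronwall estimate started where the two meet. And the slope of control 1 blows
  up as \<open>S2\<close> tends to 0, while the line can be followed only while
  \<open>S1 \<ge> S1_min\<close>; hence the clamped flow and the special role of the abscissa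
  \<open>xm\<close> at which the line reaches \<open>S1_min\<close>. The backward continuation
  requires an optimal trajectory to exist. Compactness is found in finite dimension: every
  competitor is dominated by an explicit profile, so the minimum runs over three real parameters
  (crossing point, last value of \<open>S1\<close>, end point), and exponential lower bounds on
  \<open>S1\<close> and \<open>S2\<close> make their range compact. Strict monotonicity of
  \<open>\<mu>\<close> gives no sign of \<open>\<mu>'\<close> at a prescribed point, so strict gains
  come from some point where \<open>\<mu>'\<close> is positive.\<close>

lemma nonneg_deriv_imp_le:
  fixes w :: "real \<Rightarrow> real"
  assumes "p \<le> q" "\<And>t. t \<in> {p..q} \<Longrightarrow> (w has_real_derivative w' t) (at t within {p..q})"
    "\<And>t. t \<in> {p..q} \<Longrightarrow> 0 \<le> w' t"
  shows "w p \<le> w q"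
proof (rule DERIV_nonneg_imp_increasing_open[OF assms(1)])
  show "continuous_on {p..q} w" by (rule DERIV_continuous_on[OF assms(2)])
  show "\<exists>y. (w has_real_derivative y) (at x) \<and> 0 \<le> y" if "p < x" "x < q" for x
    using assms(2,3)[of x] that by (auto simp: at_within_Icc_at)
qed

text \<open>The majorant \<open>W\<close> times a decreasing exponential is nonincreasing. The
  function \<open>h\<close> may take either sign, which suits differences of curves.\<close>

lemma gronwall_forward:
  fixes h :: "real \<Rightarrow> real"
  assumes cont: "continuous_on {p..q} h" and K: "0 \<le> K"
    and bd: "\<And>t. t \<in> {p..q} \<Longrightarrow> h t \<le> C + K * integral {p..t} h"
    and t: "t \<in> {p..q}"
  shows "h t \<le> C * exp (K * (t - p))"
proof -
  define W where "W t = C + K * integral {p..t} h" for t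
  have "((\<lambda>t. - (W t * exp (- K * (t - p)))) has_real_derivative
     - (K * h s * exp (- K * (s - p)) + W s * (- K * exp (- K * (s - p))))) (at s within {p..q})"
    if "s \<in> {p..q}" for s
    unfolding W_def
    by (rule derivative_eq_intros integral_has_real_derivative[OF cont that] refl | simp add: algebra_simps)+
  then have "((\<lambda>t. - (W t * exp (- K * (t - p)))) has_real_derivative
     - (K * h s * exp (- K * (s - p)) + W s * (- K * exp (- K * (s - p))))) (at s within {p..t})"
    if "s \<in> {p..t}" for s
    using that t by (meson DERIV_subset atLeastatMost_subset_iff atLeastAtMost_iff order_trans order_refl)
  moreover have "0 \<le> - (K * h s * exp (- K * (s - p)) + W s * (- K * exp (- K * (s - p))))"
    if "s \<in> {p..t}" for s
  proof -
    have "K * h s \<le> K * W s" using bd[of s] that t K unfolding W_def by (intro mult_left_mono) auto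
    then have "0 \<le> (K * W s - K * h s) * exp (- K * (s - p))" by simp
    then show ?thesis by (simp add: algebra_simps)
  qed
  ultimately have "- (W p * exp (- K * (p - p))) \<le> - (W t * exp (- K * (t - p)))"
    using t by (intro nonneg_deriv_imp_le[of p t "\<lambda>t. - (W t * exp (- K * (t - p)))"]) auto
  then have "W t * exp (- K * (t - p)) \<le> C" by (simp add: W_def)
  then have "W t * exp (- K * (t - p)) * exp (K * (t - p)) \<le> C * exp (K * (t - p))"
    by (intro mult_right_mono) auto
  then have "W t \<le> C * exp (K * (t - p))" by (simp add: mult.assoc flip: exp_add)
  then show ?thesis using bd[OF t] unfolding W_def by linarith
qed

lemma gronwall_backward:
  fixes h :: "real \<Rightarrow> real"
  assumes cont: "continuous_on {p..q} h" and K: "0 \<le> K"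
    and bd: "\<And>t. t \<in> {p..q} \<Longrightarrow> h t \<le> C + K * integral {t..q} h"
    and t: "t \<in> {p..q}"
  shows "h t \<le> C * exp (K * (q - t))"
proof -
  have "h (- (-t)) \<le> C * exp (K * (- t - (- q)))"
  proof (rule gronwall_forward[of "-q" "-p" "\<lambda>t. h (- t)" K C "- t"])
    show "continuous_on {-q..-p} (\<lambda>t. h (- t))"
      by (intro continuous_on_compose2[OF cont] continuous_intros) auto
    show "h (- s) \<le> C + K * integral {- q..s} (\<lambda>t. h (- t))" if "s \<in> {-q..-p}" for s
      using bd[of "-s"] that Henstock_Kurzweil_Integration.integral_reflect_real[of q "-s" h] by auto
  qed (use K t in auto)
  then show ?thesis by simp
qed

section \<open>Global solutions of Lipschitz differential equations\<close>

definition signed_integral :: "(real \<Rightarrow> real) \<Rightarrow> real \<Rightarrow> real" where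
  "signed_integral h t = integral {0..t} h - integral {t..0} h"

text \<open>An integral over \<open>{a..b}\<close> with \<open>b < a\<close> is 0, so one of the two
  terms of \<open>signed_integral\<close> always vanishes and their difference is the primitive with
  value 0 at 0. Near \<open>t\<close> it differs from \<open>integral {-N..s} h\<close> by a
  constant.\<close>

lemma signed_integral_has_real_derivative:
  assumes "continuous_on UNIV h"
  shows "(signed_integral h has_real_derivative h t) (at t)"
proof -
  define N where "N = \<bar>t\<bar> + 1"
  have int: "h integrable_on {a..b}" for a b
    using assms by (intro integrable_continuous_interval) (auto intro: continuous_on_subset)
  have "signed_integral h s = integral {-N..s} h - integral {-N..0} h" if "s \<in> {-N<..<N}" for s
  proof (cases "s \<ge> 0")
    case True
    then show ?thesis
      using Henstock_Kurzweil_Integration.integral_combine[of "-N" 0 s h] int that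
      by (cases "s = 0") (auto simp: signed_integral_def)
  next
    case False
    then show ?thesis
      using Henstock_Kurzweil_Integration.integral_combine[of "-N" s 0 h] int that
      by (auto simp: signed_integral_def)
  qed
  moreover have "((\<lambda>s. integral {-N..s} h - integral {-N..0} h) has_real_derivative h t - 0) (at t)"
    using integral_has_real_derivative[of "-N" N h t] continuous_on_subset[OF assms subset_UNIV]
    by (intro derivative_intros) (simp add: at_within_Icc_at N_def abs_if split: if_splits)
  moreover have "t \<in> {-N<..<N}" by (auto simp: N_def)
  ultimately show ?thesis
    using has_field_derivative_transform_within_open[of "\<lambda>s. integral {-N..s} h - integral {-N..0} h" "h t" t "{-N<..<N}" "signed_integral h"]
    by auto
qed

text \<open>Banach's fixed point theorem in the space of bounded continuous functions. The unknown
  is \<open>z\<close> with \<open>y t = y0 + exp (2 * L * t) * z t\<close>: this weight makes the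
  integral operator a contraction with factor 1/2 on the whole half-line at once, in place of a
  continuation of local solutions.\<close>

lemma picard_forward:
  fixes F :: "real \<Rightarrow> real \<Rightarrow> real"
  assumes cont: "continuous_on UNIV (\<lambda>(t, y). F t y)"
    and lip: "\<And>t y z. \<bar>F t y - F t z\<bar> \<le> L * \<bar>y - z\<bar>" and L: "L > 0"
    and bdd: "\<And>t y. \<bar>F t y\<bar> \<le> B"
  shows "\<exists>y. continuous_on UNIV y \<and> (\<forall>t\<ge>0. y t = y0 + integral {0..t} (\<lambda>s. F s (y s)))"
proof -
  \<comment> \<open>The bounded continuous functions live on all of \<open>real\<close>, hence
    \<open>max 0 t\<close>, which makes the operator vanish at negative times.\<close>
  define T where "T z t = exp (- 2 * L * max 0 t) * integral {0..max 0 t} (\<lambda>s. F s (y0 + exp (2 * L * s) * z s))"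
    for z :: "real \<Rightarrow> real" and t
  have contF: "continuous_on X (\<lambda>s. F s (g s))" if "continuous_on X g" for X g
    using continuous_on_compose2[OF cont, of X "\<lambda>s. (s, g s)"] continuous_on_Pair[OF continuous_on_id that] by auto
  have cz: "continuous_on X (\<lambda>s. F s (y0 + exp (2 * L * s) * z s))" if "continuous_on UNIV z" for X z
    by (intro contF continuous_intros continuous_on_subset[OF that]) auto
  have contI: "continuous_on UNIV (\<lambda>t. integral {0..max 0 t} h)" if h: "continuous_on UNIV h" for h :: "real \<Rightarrow> real"
  proof -
    have "continuous_on UNIV (signed_integral h)"
      using signed_integral_has_real_derivative[OF h]
      by (meson DERIV_isCont continuous_at_imp_continuous_on)
    then have "continuous_on UNIV (\<lambda>t. signed_integral h (max 0 t))"
      by (rule continuous_on_compose2) (auto intro!: continuous_intros)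
    moreover have "signed_integral h (max 0 t) = integral {0..max 0 t} h" for t
      by (cases "t \<le> 0") (auto simp: signed_integral_def)
    ultimately show ?thesis by simp
  qed
  have contT: "continuous_on UNIV (T z)" if "continuous_on UNIV z" for z
    unfolding T_def by (intro continuous_intros contI cz that)
  have bnd: "\<bar>integral {0..t} h\<bar> \<le> B * t" if "continuous_on UNIV h" "\<And>s. \<bar>h s\<bar> \<le> B" "t \<ge> 0" for h :: "real \<Rightarrow> real" and t
    using integral_bound[of 0 t h B] that by (auto intro: continuous_on_subset)
  have bT: "\<bar>T z t\<bar> \<le> B / (2 * L)" if "continuous_on UNIV z" for z t
  proof -
    let ?t = "max 0 t"
    have B: "B \<ge> 0" using bdd[of 0 0] by linarith
    have "\<bar>T z t\<bar> \<le> exp (- 2 * L * ?t) * (B * ?t)"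
      unfolding T_def abs_mult using bnd[OF cz[OF that] bdd, of ?t] by (simp add: mult_left_mono)
    also have "\<dots> = exp (- 2 * L * ?t) * (2 * L * ?t) * (B / (2 * L))" using L by (simp add: field_simps)
    also have "\<dots> \<le> 1 * (B / (2 * L))"
    proof (intro mult_right_mono)
      have "2 * L * ?t \<le> exp (2 * L * ?t)" using exp_ge_add_one_self[of "2 * L * ?t"] by linarith
      then have "exp (- 2 * L * ?t) * (2 * L * ?t) \<le> exp (- 2 * L * ?t) * exp (2 * L * ?t)"
        by (intro mult_left_mono) auto
      then show "exp (- 2 * L * ?t) * (2 * L * ?t) \<le> 1" by (simp flip: exp_add)
    qed (use B L in auto)
    finally show ?thesis by simp
  qed
  define \<Phi> where "\<Phi> z = Bcontfun (T (apply_bcontfun z))" for z :: "real \<Rightarrow>\<^sub>C real"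
  have czz: "continuous_on UNIV (apply_bcontfun z)" for z :: "real \<Rightarrow>\<^sub>C real"
    using apply_bcontfun[of z] by (auto simp: bcontfun_def)
  have ap: "apply_bcontfun (\<Phi> z) = T (apply_bcontfun z)" for z
    unfolding \<Phi>_def
    by (rule Bcontfun_inverse) (auto simp: bcontfun_def contT[OF czz] bounded_iff intro!: exI[of _ "B / (2 * L)"] bT[OF czz])
  have contr: "dist (\<Phi> z) (\<Phi> w) \<le> 1/2 * dist z w" for z w
  proof (rule dist_bound)
    fix t :: real
    let ?t = "max 0 t" and ?D = "dist z w"
    have "\<bar>integral {0..?t} (\<lambda>s. F s (y0 + exp (2 * L * s) * z s)) - integral {0..?t} (\<lambda>s. F s (y0 + exp (2 * L * s) * w s))\<bar>
      = \<bar>integral {0..?t} (\<lambda>s. F s (y0 + exp (2 * L * s) * z s) - F s (y0 + exp (2 * L * s) * w s))\<bar>"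
      by (subst Henstock_Kurzweil_Integration.integral_diff) (auto intro!: integrable_continuous_interval cz czz)
    also have "\<dots> \<le> integral {0..?t} (\<lambda>s. L * ?D * exp (2 * L * s))"
    proof (rule Henstock_Kurzweil_Integration.integral_norm_bound_integral[where 'a=real, unfolded real_norm_def])
      fix s
      have "\<bar>F s (y0 + exp (2 * L * s) * z s) - F s (y0 + exp (2 * L * s) * w s)\<bar>
        \<le> L * \<bar>exp (2 * L * s) * (z s - w s)\<bar>"
        using lip[of s "y0 + exp (2 * L * s) * z s" "y0 + exp (2 * L * s) * w s"] by (simp add: algebra_simps)
      also have "\<dots> \<le> L * (exp (2 * L * s) * ?D)"
        using dist_bounded[of z s w] L by (intro mult_left_mono) (auto simp: abs_mult dist_real_def)
      finally show "\<bar>F s (y0 + exp (2 * L * s) * z s) - F s (y0 + exp (2 * L * s) * w s)\<bar> \<le> L * ?D * exp (2 * L * s)"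
        by (simp add: mult_ac)
    qed (auto intro!: integrable_continuous_interval continuous_intros cz czz)
    also have "\<dots> = ?D / 2 * exp (2 * L * ?t) - ?D / 2 * exp (2 * L * 0)"
    proof (rule integral_unique, rule fundamental_theorem_of_calculus)
      show "((\<lambda>s. ?D / 2 * exp (2 * L * s)) has_vector_derivative L * ?D * exp (2 * L * x)) (at x within {0..?t})" for x
        unfolding has_real_derivative_iff_has_vector_derivative[symmetric]
        by (rule derivative_eq_intros refl | simp)+
    qed simp
    also have "\<dots> \<le> ?D / 2 * exp (2 * L * ?t)" by simp
    finally have "exp (- 2 * L * ?t) * \<bar>integral {0..?t} (\<lambda>s. F s (y0 + exp (2 * L * s) * z s)) - integral {0..?t} (\<lambda>s. F s (y0 + exp (2 * L * s) * w s))\<bar>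
      \<le> exp (- 2 * L * ?t) * (?D / 2 * exp (2 * L * ?t))" by (intro mult_left_mono) auto
    also have "\<dots> = ?D / 2" by (simp add: exp_minus)
    finally show "dist (\<Phi> z t) (\<Phi> w t) \<le> 1 / 2 * ?D"
      by (simp add: ap T_def dist_real_def abs_mult flip: right_diff_distrib)
  qed
  have "\<exists>!x. \<Phi> x = x" using banach_fix_type[of "1/2" \<Phi>] contr by auto
  then obtain z where z: "\<Phi> z = z" by blast
  define y where "y t = y0 + exp (2 * L * t) * z t" for t
  have "continuous_on UNIV y" unfolding y_def
    by (intro continuous_on_add continuous_on_mult continuous_on_const continuous_on_exp continuous_on_id czz)
  moreover have "y t = y0 + integral {0..t} (\<lambda>s. F s (y s))" if "t \<ge> 0" for t
  proof -
    have "z t = exp (- 2 * L * t) * integral {0..t} (\<lambda>s. F s (y s))"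
    proof -
      have "apply_bcontfun z t = T (apply_bcontfun z) t" using arg_cong[OF ap[of z], of "\<lambda>g. g t"] unfolding z .
      also have "\<dots> = exp (- 2 * L * t) * integral {0..t} (\<lambda>s. F s (y s))"
        using that unfolding T_def y_def by (simp add: max_absorb2)
      finally show ?thesis .
    qed
    then show ?thesis unfolding y_def by (simp add: exp_minus)
  qed
  ultimately show ?thesis by blast
qed

text \<open>Forward solutions of the field and of the time-reversed field are glued at
  \<open>t0\<close>. The integral equation with \<open>signed_integral\<close> makes the glued
  function differentiable at the junction too.\<close>

lemma picard:
  fixes F :: "real \<Rightarrow> real \<Rightarrow> real"
  assumes cont: "continuous_on UNIV (\<lambda>(t, y). F t y)"
    and lip: "\<And>t y z. \<bar>F t y - F t z\<bar> \<le> L * \<bar>y - z\<bar>" and L: "L > 0"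
    and bdd: "\<And>t y. \<bar>F t y\<bar> \<le> B"
  shows "\<exists>y. y t0 = y0 \<and> (\<forall>t. (y has_real_derivative F t (y t)) (at t))"
proof -
  have p1: "continuous_on UNIV (\<lambda>p :: real \<times> real. (t0 + fst p, snd p))"
    and p2: "continuous_on UNIV (\<lambda>p :: real \<times> real. (t0 - fst p, snd p))"
    by (intro continuous_intros)+
  have c1: "continuous_on UNIV (\<lambda>(t, y). F (t0 + t) y)"
    using continuous_on_compose2[OF cont p1] by (simp add: case_prod_beta)
  have c2: "continuous_on UNIV (\<lambda>(t, y). - F (t0 - t) y)"
    using continuous_on_minus[OF continuous_on_compose2[OF cont p2]] by (simp add: case_prod_beta)
  obtain y1 where y1: "continuous_on UNIV y1" "\<And>t. t \<ge> 0 \<Longrightarrow> y1 t = y0 + integral {0..t} (\<lambda>s. F (t0 + s) (y1 s))"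
    using picard_forward[of "\<lambda>t. F (t0 + t)", OF c1 lip L bdd] by blast
  have l2: "\<bar>- F (t0 - t) y - - F (t0 - t) z\<bar> \<le> L * \<bar>y - z\<bar>" for t y z
    using lip[of "t0 - t" y z] by linarith
  have b2: "\<bar>- F (t0 - t) y\<bar> \<le> B" for t y
    using bdd[of "t0 - t" y] by linarith
  obtain y2 where y2: "continuous_on UNIV y2" "\<And>t. t \<ge> 0 \<Longrightarrow> y2 t = y0 + integral {0..t} (\<lambda>s. - F (t0 - s) (y2 s))"
    using picard_forward[of "\<lambda>t y. - F (t0 - t) y", OF c2 l2 L b2] by blast
  define w where "w t = (if t \<ge> 0 then y1 t else y2 (- t))" for t
  have w0: "y1 0 = y0" "y2 0 = y0" using y1(2)[of 0] y2(2)[of 0] by auto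
  have "continuous_on ({0..} \<union> {..0}) (\<lambda>t. if t \<ge> 0 then y1 t else y2 (- t))"
  proof (rule continuous_on_If)
    show "continuous_on {0..} y1" by (rule continuous_on_subset[OF y1(1)]) simp
    have "continuous_on {..0} (uminus :: real \<Rightarrow> real)" by (intro continuous_intros)
    then show "continuous_on {..0} (\<lambda>t. y2 (- t))" by (rule continuous_on_compose2[OF y2(1)]) simp
  qed (use w0 in auto)
  moreover have "{0..} \<union> {..0} = (UNIV :: real set)" by auto
  ultimately have cw: "continuous_on UNIV w" by (simp add: w_def[abs_def])
  define h where "h t = F (t0 + t) (w t)" for t
  have ch: "continuous_on UNIV h"
    using continuous_on_compose2[OF cont, of UNIV "\<lambda>s. (t0 + s, w s)"] cw
    by (simp add: h_def[abs_def] continuous_on_Pair continuous_on_add continuous_on_id)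
  have weq: "w t = y0 + signed_integral h t" for t
  proof (cases "t \<ge> 0")
    case True
    have "integral {0..t} (\<lambda>s. F (t0 + s) (y1 s)) = integral {0..t} h"
      by (rule integral_cong) (auto simp: h_def w_def)
    then show ?thesis using True y1(2)[of t] by (cases "t = 0") (auto simp: w_def signed_integral_def)
  next
    case False
    have "integral {0..-t} (\<lambda>s. - F (t0 - s) (y2 s)) = integral {0..-t} (\<lambda>s. - h (- s))"
      by (rule integral_cong) (auto simp: h_def w_def w0)
    also have "\<dots> = - integral {t..0} h"
      using Henstock_Kurzweil_Integration.integral_reflect_real[of 0 t h] by simp
    finally show ?thesis using False y2(2)[of "-t"] by (auto simp: w_def signed_integral_def)
  qed
  define y where "y t = w (t - t0)" for t
  have "(w has_real_derivative h s) (at s)" for s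
  proof -
    have "((\<lambda>t. y0 + signed_integral h t) has_real_derivative 0 + h s) (at s)"
      by (intro DERIV_add DERIV_const signed_integral_has_real_derivative ch)
    moreover have "(\<lambda>t. y0 + signed_integral h t) = w" by (simp add: weq fun_eq_iff)
    ultimately show ?thesis by simp
  qed
  then have dw: "(w has_real_derivative h (t - t0)) (at (t + - t0))" for t
    by simp
  have "(y has_real_derivative F t (y t)) (at t)" for t
    using iffD1[OF DERIV_shift[of w "h (t - t0)" t "- t0"] dw[of t]] by (simp add: y_def[abs_def] h_def)
  moreover have "y t0 = y0" by (simp add: y_def w_def w0)
  ultimately show ?thesis by blast
qed

lemma half_line_lipschitz:
  fixes g g' :: "real \<Rightarrow> real"
  assumes "continuous_on {0..} g'"
    and "\<And>x. 0 \<le> x \<Longrightarrow> (g has_real_derivative g' x) (at x within {0..})"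
  shows "\<exists>L>0. \<forall>a\<in>{0..M}. \<forall>b\<in>{0..M}. \<bar>g a - g b\<bar> \<le> L * \<bar>a - b\<bar>"
proof -
  have "compact (g' ` {0..M})"
    by (intro compact_continuous_image continuous_on_subset[OF assms(1)]) auto
  then obtain B where B: "\<And>x. x \<in> {0..M} \<Longrightarrow> \<bar>g' x\<bar> \<le> B"
    unfolding compact_eq_bounded_closed bounded_iff by force
  define L where "L = max 1 B"
  have "\<bar>g a - g b\<bar> \<le> L * \<bar>a - b\<bar>" if "a \<in> {0..M}" "b \<in> {0..M}" for a b
  proof -
    have "norm (g a - g b) \<le> L * norm (a - b)"
    proof (rule field_differentiable_bound[of "{0..M}" g g'])
      show "(g has_field_derivative g' z) (at z within {0..M})" if "z \<in> {0..M}" for z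
        using assms(2)[of z] that by (auto intro: DERIV_subset)
      show "norm (g' z) \<le> L" if "z \<in> {0..M}" for z
        using B[OF that] by (simp add: L_def)
    qed (use that in auto)
    then show ?thesis by simp
  qed
  moreover have "L > 0" by (simp add: L_def)
  ultimately show ?thesis by blast
qed

lemma inverse_max_lipschitz:
  fixes a b m :: real
  assumes "0 < m"
  shows "\<bar>1 / max m a - 1 / max m b\<bar> \<le> \<bar>a - b\<bar> / m\<^sup>2"
proof -
  have p: "0 < max m a" "0 < max m b" using assms by auto
  have "1 / max m a - 1 / max m b = (max m b - max m a) / (max m a * max m b)"
    using p by (simp add: field_simps)
  then have "\<bar>1 / max m a - 1 / max m b\<bar> = \<bar>max m b - max m a\<bar> / (max m a * max m b)"
    using p by (simp add: abs_mult)
  also have "\<dots> \<le> \<bar>a - b\<bar> / m\<^sup>2"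
    using assms unfolding power2_eq_square by (intro frac_le mult_mono) auto
  finally show ?thesis .
qed

text \<open>\<open>H1\<close> gives monotonicity on a half-open interval; continuity includes the
  end point \<open>s\<close>, and the midpoint \<open>c\<close> keeps the inequality strict.\<close>

lemma strict_mono_on_extend_right:
  fixes g :: "real \<Rightarrow> real"
  assumes "strict_mono_on {0..<s} g" "continuous_on {0..} g" "0 \<le> a" "a < b" "b \<le> s"
  shows "g a < g b"
proof (cases "b < s")
  case True
  then show ?thesis using assms by (intro strict_mono_onD[OF assms(1)]) auto
next
  case False
  then have b: "b = s" using assms by simp
  define c where "c = (a + b) / 2"
  have c: "a < c" "c < b" using assms(4) by (auto simp: c_def)
  have "g a < g c" using assms b c by (intro strict_mono_onD[OF assms(1)]) auto
  moreover have "g c \<le> g b"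
  proof (rule tendsto_lowerbound[of g _ "at b within {c<..<b}"])
    show "(g \<longlongrightarrow> g b) (at b within {c<..<b})"
      by (rule tendsto_within_subset[of _ _ b "{0..}"]) (use assms c in \<open>auto simp: continuous_on\<close>)
    show "\<forall>\<^sub>F x in at b within {c<..<b}. g c \<le> g x"
      unfolding eventually_at_topological
      using assms b c by (intro exI[of _ UNIV]) (auto intro!: less_imp_le strict_mono_onD[OF assms(1)])
    have "b islimpt {c<..<b}" using c by (simp add: islimpt_greaterThanLessThan2)
    then show "at b within {c<..<b} \<noteq> bot" by (simp add: trivial_limit_within)
  qed
  ultimately show ?thesis by simp
qed

lemma strict_antimono_on_extend_left:
  fixes g :: "real \<Rightarrow> real"
  assumes "strict_antimono_on {s<..} g" "continuous_on {0..} g" "0 \<le> s" "s \<le> a" "a < b"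
  shows "g b < g a"
proof (cases "s < a")
  case True
  then show ?thesis using assms monotone_onD[OF assms(1), of a b] by auto
next
  case False
  then have a: "a = s" using assms by simp
  define c where "c = (a + b) / 2"
  have c: "a < c" "c < b" using assms(5) by (auto simp: c_def)
  have "g b < g c" using assms a c monotone_onD[OF assms(1), of c b] by auto
  moreover have "g c \<le> g a"
  proof (rule tendsto_lowerbound[of g _ "at a within {a<..<c}"])
    show "(g \<longlongrightarrow> g a) (at a within {a<..<c})"
      by (rule tendsto_within_subset[of _ _ a "{0..}"]) (use assms c in \<open>auto simp: continuous_on\<close>)
    show "\<forall>\<^sub>F x in at a within {a<..<c}. g c \<le> g x"
      unfolding eventually_at_topological
      using a monotone_onD[OF assms(1), of _ c] c by (intro exI[of _ UNIV]) (auto intro!: less_imp_le)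
    have "a islimpt {a<..<c}" using c by (simp add: islimpt_greaterThanLessThan1)
    then show "at a within {a<..<c} \<noteq> bot" by (simp add: trivial_limit_within)
  qed
  ultimately show ?thesis by simp
qed

section \<open>Increments, zeros and distances of curves; null sets\<close>

lemma has_integral_increment:
  fixes F g :: "real \<Rightarrow> real"
  assumes "\<And>t. 0 \<le> t \<Longrightarrow> (g has_integral (F t - F 0)) {0..t}" "0 \<le> p" "p \<le> q"
  shows "(g has_integral (F q - F p)) {p..q}"
proof -
  have i: "g integrable_on {0..q}" using has_integral_integrable[OF assms(1)[of q]] assms(2,3) by auto
  then have ip: "g integrable_on {p..q}" by (rule integrable_on_subinterval) (use assms in auto)
  have "integral {0..p} g + integral {p..q} g = integral {0..q} g"
    using assms i by (intro Henstock_Kurzweil_Integration.integral_combine) auto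
  then have "integral {p..q} g = F q - F p"
    using integral_unique[OF assms(1)[of p]] integral_unique[OF assms(1)[of q]] assms(2,3) by simp
  then show ?thesis using ip by (simp add: has_integral_integral flip: integral_unique)
qed

lemma has_integral_cont:
  fixes F g :: "real \<Rightarrow> real"
  assumes "\<And>t. 0 \<le> t \<Longrightarrow> (g has_integral (F t - F 0)) {0..t}"
  shows "continuous_on {0..T} F"
proof (cases "0 \<le> T")
  case True
  have "continuous_on {0..T} (\<lambda>x. F 0 + integral {0..x} g)"
    using assms[OF True] by (intro continuous_intros indefinite_integral_continuous_1) (auto intro: has_integral_integrable)
  moreover have "F 0 + integral {0..x} g = F x" if "x \<in> {0..T}" for x
    using integral_unique[OF assms[of x]] that by simp
  ultimately show ?thesis by (rule continuous_on_eq)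
qed simp

lemma last_zero:
  fixes h :: "real \<Rightarrow> real"
  assumes cont: "continuous_on {a..b} h" and "a \<le> b" "h a \<le> 0" "0 < h b"
  shows "\<exists>p. a \<le> p \<and> p < b \<and> h p = 0 \<and> (\<forall>t. p < t \<longrightarrow> t \<le> b \<longrightarrow> 0 < h t)"
proof -
  define S where "S = {a..b} \<inter> h -` {..0}"
  have cS: "closed S" unfolding S_def by (rule continuous_closed_preimage[OF cont]) auto
  have aS: "a \<in> S" using assms by (simp add: S_def)
  have bdd: "bdd_above S" unfolding S_def by (auto intro!: bdd_aboveI[of _ b])
  define p where "p = Sup S"
  have pS: "p \<in> S" unfolding p_def using closed_contains_Sup[OF _ bdd cS] aS by auto
  have pos: "0 < h t" if "p < t" "t \<le> b" for t
  proof (rule ccontr)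
    assume "\<not> 0 < h t"
    then have "t \<in> S" using pS that by (auto simp: S_def)
    then show False using cSup_upper[OF _ bdd, of t] that by (simp add: p_def)
  qed
  have "p < b" using pS assms(4) by (cases "p = b") (auto simp: S_def)
  moreover have "h p = 0"
  proof -
    have "continuous_on {p..b} h" by (rule continuous_on_subset[OF cont]) (use pS in \<open>auto simp: S_def\<close>)
    then obtain z where "p \<le> z" "z \<le> b" "h z = 0"
      using IVT'[of h p 0 b] pS assms(4) by (auto simp: S_def)
    then show ?thesis using pos[of z] by (cases "z = p") auto
  qed
  ultimately show ?thesis using pS pos by (auto simp: S_def)
qed

lemma first_zero:
  fixes h :: "real \<Rightarrow> real"
  assumes cont: "continuous_on {a..b} h" and "a \<le> b" "0 < h a" "h b \<le> 0"
  shows "\<exists>q. a < q \<and> q \<le> b \<and> h q = 0 \<and> (\<forall>t. a \<le> t \<longrightarrow> t < q \<longrightarrow> 0 < h t)"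
proof -
  have "continuous_on {-b..-a} (\<lambda>t. h (- t))"
    by (rule continuous_on_compose2[OF cont]) (auto intro!: continuous_intros)
  then obtain p where p: "- b \<le> p" "p < - a" "h (- p) = 0" "\<And>t. p < t \<Longrightarrow> t \<le> - a \<Longrightarrow> 0 < h (- t)"
    using last_zero[of "-b" "-a" "\<lambda>t. h (- t)"] assms by auto
  have "0 < h t" if "a \<le> t" "t < - p" for t using p(4)[of "- t"] that by simp
  then show ?thesis using p by (intro exI[of _ "- p"]) auto
qed

text \<open>The square of the difference is differentiable where the absolute value is not. Its
  derivative is bounded in absolute value by \<open>2 * K\<close> times itself, which serves both
  directions of time.\<close>

lemma solution_distance:
  fixes y z :: "real \<Rightarrow> real"
  assumes y: "\<And>t. (y has_real_derivative F t (y t)) (at t)" and z: "\<And>t. (z has_real_derivative F t (z t)) (at t)"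
    and lip: "\<And>t a b. \<bar>F t a - F t b\<bar> \<le> K * \<bar>a - b\<bar>"
  shows "\<bar>y x - z x\<bar> \<le> \<bar>y p - z p\<bar> * exp (K * \<bar>x - p\<bar>)"
proof -
  define d where "d t = (y t - z t)\<^sup>2" for t
  have dd: "(d has_real_derivative 2 * (y t - z t) * (F t (y t) - F t (z t))) (at t)" for t
    unfolding d_def[abs_def] by (rule derivative_eq_intros y z refl | simp)+
  have b: "\<bar>2 * (y t - z t) * (F t (y t) - F t (z t))\<bar> \<le> 2 * K * d t" for t
  proof -
    have "\<bar>y t - z t\<bar> * \<bar>F t (y t) - F t (z t)\<bar> \<le> \<bar>y t - z t\<bar> * (K * \<bar>y t - z t\<bar>)"
      by (intro mult_left_mono lip) auto
    moreover have "\<bar>2 * (y t - z t) * (F t (y t) - F t (z t))\<bar> = 2 * (\<bar>y t - z t\<bar> * \<bar>F t (y t) - F t (z t)\<bar>)"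
      by (simp only: abs_mult)
    moreover have "2 * K * d t = 2 * (\<bar>y t - z t\<bar> * (K * \<bar>y t - z t\<bar>))"
      by (simp add: d_def power2_eq_square)
    ultimately show ?thesis by linarith
  qed
  have "d x \<le> d p * exp (2 * K * \<bar>x - p\<bar>)"
  proof (cases "p \<le> x")
    case True
    have "- (d p * exp (- (2 * K) * (p - p))) \<le> - (d x * exp (- (2 * K) * (x - p)))"
    proof (rule nonneg_deriv_imp_le[OF True])
      fix t assume "t \<in> {p..x}"
      show "((\<lambda>t. - (d t * exp (- (2 * K) * (t - p)))) has_real_derivative
          (2 * K * d t - 2 * (y t - z t) * (F t (y t) - F t (z t))) * exp (- (2 * K) * (t - p))) (at t within {p..x})"
        by (rule derivative_eq_intros has_field_derivative_at_within[OF dd] refl | simp add: algebra_simps)+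
      show "0 \<le> (2 * K * d t - 2 * (y t - z t) * (F t (y t) - F t (z t))) * exp (- (2 * K) * (t - p))"
        using b[of t] by (intro mult_nonneg_nonneg) auto
    qed
    then have "d x * exp (- (2 * K) * (x - p)) * exp (2 * K * (x - p)) \<le> d p * exp (2 * K * (x - p))"
      by (intro mult_right_mono) auto
    then show ?thesis using True by (simp add: mult.assoc flip: exp_add)
  next
    case False
    then have xp: "x \<le> p" by simp
    have "d x * exp (2 * K * (x - p)) \<le> d p * exp (2 * K * (p - p))"
    proof (rule nonneg_deriv_imp_le[OF xp])
      fix t assume "t \<in> {x..p}"
      show "((\<lambda>t. d t * exp (2 * K * (t - p))) has_real_derivative
          (2 * K * d t + 2 * (y t - z t) * (F t (y t) - F t (z t))) * exp (2 * K * (t - p))) (at t within {x..p})"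
        by (rule derivative_eq_intros has_field_derivative_at_within[OF dd] refl | simp add: algebra_simps)+
      show "0 \<le> (2 * K * d t + 2 * (y t - z t) * (F t (y t) - F t (z t))) * exp (2 * K * (t - p))"
        using b[of t] by (intro mult_nonneg_nonneg) auto
    qed
    then have "d x * exp (2 * K * (x - p)) * exp (2 * K * (p - x)) \<le> d p * exp (2 * K * (p - x))"
      by (intro mult_right_mono) auto
    moreover have "exp (2 * K * (x - p)) * exp (2 * K * (p - x)) = 1"
      by (simp add: algebra_simps flip: exp_add)
    ultimately show ?thesis using xp by (simp only: mult.assoc mult_1_right abs_minus_commute[of x p] abs_of_nonneg diff_ge_0_iff_ge)
  qed
  also have "\<dots> = (\<bar>y p - z p\<bar> * exp (K * \<bar>x - p\<bar>))\<^sup>2"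
    by (simp add: d_def power_mult_distrib exp_double[symmetric] mult.assoc)
  finally have "\<bar>y x - z x\<bar>\<^sup>2 \<le> (\<bar>y p - z p\<bar> * exp (K * \<bar>x - p\<bar>))\<^sup>2" by (simp add: d_def)
  then show ?thesis by (rule power2_le_imp_le) simp
qed

lemma integral_pos:
  fixes g :: "real \<Rightarrow> real"
  assumes c: "continuous_on {a..b} g" and nn: "\<And>x. x \<in> {a..b} \<Longrightarrow> 0 \<le> g x" and r: "r \<in> {a..b}" "0 < g r" and ab: "a < b"
  shows "0 < integral {a..b} g"
proof -
  have "0 \<le> integral {a..b} g" by (intro Henstock_Kurzweil_Integration.integral_nonneg integrable_continuous_interval c nn)
  moreover have "integral {a..b} g \<noteq> 0" using integral_eq_0_iff[OF c ab nn] r by force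
  ultimately show ?thesis by simp
qed

lemma isCont_pos_nbhd:
  fixes g :: "real \<Rightarrow> real"
  assumes "isCont g x" "0 < g x"
  shows "\<exists>d>0. \<forall>t. \<bar>t - x\<bar> \<le> d \<longrightarrow> 0 < g t"
proof -
  have "eventually (\<lambda>t. 0 < g t) (at x)" using assms by (simp add: isCont_def order_tendstoD(1))
  then obtain d where d: "d > 0" "\<And>t. t \<noteq> x \<Longrightarrow> dist t x < d \<Longrightarrow> 0 < g t"
    unfolding eventually_at by blast
  have "0 < g t" if "\<bar>t - x\<bar> \<le> d / 2" for t
    using d(2)[of t] that d(1) assms(2) by (cases "t = x") (auto simp: dist_real_def)
  then show ?thesis using d(1) by (intro exI[of _ "d / 2"]) auto
qed

lemma AE_lebesgue_except:
  fixes F :: "real set"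
  assumes "finite F" "\<And>t. t \<notin> F \<Longrightarrow> P t"
  shows "AE t in lebesgue. P t"
proof -
  have "F \<in> null_sets lborel" using assms(1) by (rule finite_imp_null_set_lborel)
  then have "F \<in> null_sets lebesgue" by (rule null_sets_completionI)
  then have "AE t in lebesgue. t \<notin> F" by (rule AE_not_in)
  then show ?thesis by eventually_elim (rule assms(2))
qed

lemma has_integral_0_nonneg_AE:
  fixes g :: "real \<Rightarrow> real"
  assumes i: "(g has_integral 0) S" and nn: "\<And>x. x \<in> S \<Longrightarrow> 0 \<le> g x"
  shows "AE x in lebesgue. x \<in> S \<longrightarrow> g x = 0"
proof -
  have a: "g absolutely_integrable_on S"
    using i nn by (intro nonnegative_absolutely_integrable_1) (auto intro: has_integral_integrable)
  have "(LINT x:S|lebesgue. g x) = integral S g" by (rule set_lebesgue_integral_eq_integral(2)[OF a])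
  then have "(LINT x|lebesgue. indicat_real S x *\<^sub>R g x) = 0"
    using i by (simp add: set_lebesgue_integral_def integral_unique)
  moreover have "integrable lebesgue (\<lambda>x. indicat_real S x *\<^sub>R g x)" using a by (simp add: set_integrable_def)
  moreover have "AE x in lebesgue. 0 \<le> indicat_real S x *\<^sub>R g x" using nn by (simp add: indicator_def)
  ultimately have "AE x in lebesgue. indicat_real S x *\<^sub>R g x = 0"
    using integral_nonneg_eq_0_iff_AE by blast
  then show ?thesis by eventually_elim (auto simp: indicator_def)
qed

lemma not_AE_False_interval:
  fixes a b :: real
  assumes "a < b"
  shows "\<not> (AE t in lebesgue. t \<notin> {a<..<b})"
proof
  assume "AE t in lebesgue. t \<notin> {a<..<b}"
  then obtain N where N: "{t \<in> space lebesgue. \<not> t \<notin> {a<..<b}} \<subseteq> N" "emeasure lebesgue N = 0" "N \<in> sets lebesgue"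
    by (rule AE_E)
  have "emeasure lebesgue {a<..<b} \<le> emeasure lebesgue N" by (rule emeasure_mono) (use N in auto)
  then show False using assms N(2) by simp
qed

subsection \<open>The logarithm of the biomass as independent variable\<close>

text \<open>The model with its derivatives as fixed functions on the half-line. \<open>S2s\<close>
  is a real number here, so of the alternatives in \<open>H1\<close> the one with a finite maximum
  is present.\<close>

locale chemostat =
  fixes M S2s B1 B2 :: real and f \<mu> f' \<mu>' :: "real \<Rightarrow> real"
  assumes B1_pos: "0 < B1" and B2_pos: "0 < B2" and B2_less: "B2 < S2s" and S2s_less: "S2s < M"
    and B1_S2s: "B1 + S2s < M"
    and f'_cont: "continuous_on {0..} f'"
    and f_deriv: "\<And>x. 0 \<le> x \<Longrightarrow> (f has_real_derivative f' x) (at x within {0..})"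
    and \<mu>'_cont: "continuous_on {0..} \<mu>'"
    and \<mu>_deriv: "\<And>x. 0 \<le> x \<Longrightarrow> (\<mu> has_real_derivative \<mu>' x) (at x within {0..})"
    and f_mono: "strict_mono_on {0..} f" and f_0: "f 0 = 0"
    and \<mu>_pos: "\<And>s. 0 < s \<Longrightarrow> 0 < \<mu> s" and \<mu>_0: "\<mu> 0 = 0"
    and \<mu>_up: "strict_mono_on {0..<S2s} \<mu>" and \<mu>_down: "strict_antimono_on {S2s<..} \<mu>"
begin

lemma M_pos: "0 < M" and S2s_pos: "0 < S2s"
  using B2_pos B2_less S2s_less by auto

lemma f_cont: "continuous_on {0..} f"
  using f_deriv by (intro DERIV_continuous_on) auto

lemma \<mu>_cont: "continuous_on {0..} \<mu>"
  using \<mu>_deriv by (intro DERIV_continuous_on) auto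

lemma f_less: "0 \<le> a \<Longrightarrow> a < b \<Longrightarrow> f a < f b"
  using strict_mono_onD[OF f_mono, of a b] by auto

lemma f_le: "0 \<le> a \<Longrightarrow> a \<le> b \<Longrightarrow> f a \<le> f b"
  using f_less[of a b] by (cases "a = b") auto

lemma f_pos: "0 < a \<Longrightarrow> 0 < f a"
  using f_less[of 0 a] by (simp add: f_0)

lemma f_nonneg: "0 \<le> a \<Longrightarrow> 0 \<le> f a"
  using f_le[of 0 a] by (simp add: f_0)

lemma \<mu>_less: "0 \<le> a \<Longrightarrow> a < b \<Longrightarrow> b \<le> S2s \<Longrightarrow> \<mu> a < \<mu> b"
  by (rule strict_mono_on_extend_right[OF \<mu>_up \<mu>_cont])

lemma \<mu>_greater: "S2s \<le> a \<Longrightarrow> a < b \<Longrightarrow> \<mu> b < \<mu> a"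
  using S2s_pos by (intro strict_antimono_on_extend_left[OF \<mu>_down \<mu>_cont]) auto

lemma \<mu>_le: "0 \<le> a \<Longrightarrow> a \<le> b \<Longrightarrow> b \<le> S2s \<Longrightarrow> \<mu> a \<le> \<mu> b"
  using \<mu>_less[of a b] by (cases "a = b") auto

lemma \<mu>_ge: "S2s \<le> a \<Longrightarrow> a \<le> b \<Longrightarrow> \<mu> b \<le> \<mu> a"
  using \<mu>_greater[of a b] by (cases "a = b") auto

lemma \<mu>_max: "0 \<le> s \<Longrightarrow> \<mu> s \<le> \<mu> S2s"
  using \<mu>_le[of s S2s] \<mu>_ge[of S2s s] by (cases "s \<le> S2s") auto

lemma \<mu>_nonneg: "0 \<le> s \<Longrightarrow> 0 \<le> \<mu> s"
  using \<mu>_pos[of s] \<mu>_0 by (cases "s = 0") auto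

lemma \<mu>_S2s_pos: "0 < \<mu> S2s"
  using \<mu>_pos S2s_pos by simp

lemma f_lipschitz: "\<exists>L>0. \<forall>a\<in>{0..M}. \<forall>b\<in>{0..M}. \<bar>f a - f b\<bar> \<le> L * \<bar>a - b\<bar>"
  by (rule half_line_lipschitz[OF f'_cont f_deriv])

lemma \<mu>_lipschitz: "\<exists>L>0. \<forall>a\<in>{0..M}. \<forall>b\<in>{0..M}. \<bar>\<mu> a - \<mu> b\<bar> \<le> L * \<bar>a - b\<bar>"
  by (rule half_line_lipschitz[OF \<mu>'_cont \<mu>_deriv])

text \<open>
  At the point \<open>(x, c)\<close>, where \<open>c\<close> is the value of \<open>S1\<close>, \<open>S2\<close> has the value \<open>s2 x c\<close>. The line
  \<open>S2 = S2s\<close> is the graph of \<open>E\<close>; the control 1 means the slope \<open>- G x c\<close>.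
\<close>

definition s2 :: "real \<Rightarrow> real \<Rightarrow> real" where "s2 x c = M - c - exp x"

definition E :: "real \<Rightarrow> real" where "E x = M - S2s - exp x"

definition G :: "real \<Rightarrow> real \<Rightarrow> real" where "G x c = f c / \<mu> (s2 x c)"

lemma s2_E [simp]: "s2 x (E x) = S2s"
  by (simp add: s2_def E_def)

lemma E_le_iff: "E x \<le> c \<longleftrightarrow> s2 x c \<le> S2s" and le_E_iff: "c \<le> E x \<longleftrightarrow> S2s \<le> s2 x c"
  and E_less_iff: "E x < c \<longleftrightarrow> s2 x c < S2s" and less_E_iff: "c < E x \<longleftrightarrow> S2s < s2 x c"
  by (auto simp: E_def s2_def)

lemma E_less: "E y < E x \<longleftrightarrow> x < y" and E_le: "E y \<le> E x \<longleftrightarrow> x \<le> y"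
  by (auto simp: E_def)

lemma E_deriv: "(E has_real_derivative - exp x) (at x within X)"
  unfolding E_def[abs_def] by (auto intro!: derivative_eq_intros)

lemma E_cont: "continuous_on X E"
  unfolding E_def[abs_def] by (intro continuous_intros)

lemma E_ln: "c < M - S2s \<Longrightarrow> E (ln (M - S2s - c)) = c"
  by (simp add: E_def)

definition S1m :: real where "S1m = S1_min M f \<mu> S2s"

text \<open>\<open>E\<close> is decreasing, so \<open>x \<le> xm\<close> is the part of the line
  with \<open>S1 \<ge> S1m\<close>, where the singular control is admissible.\<close>

definition xm :: real where "xm = ln (M - S2s - S1m)"

lemma S1m: "0 < S1m" "S1m < M - S2s" "f S1m = \<mu> S2s * (M - S2s - S1m)"
proof -
  let ?\<nu> = "\<lambda>s. f s - \<mu> S2s * (M - s - S2s)"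
  have mono: "?\<nu> a < ?\<nu> b" if "0 \<le> a" "a < b" for a b
    using f_less[OF that] mult_strict_left_mono[of "M - b - S2s" "M - a - S2s" "\<mu> S2s"] \<mu>_S2s_pos that by linarith
  have "\<exists>s\<ge>0. s \<le> M - S2s \<and> ?\<nu> s = 0"
  proof (rule IVT')
    show "?\<nu> 0 \<le> 0" using \<mu>_S2s_pos S2s_less by (simp add: f_0)
    show "0 \<le> ?\<nu> (M - S2s)" using f_nonneg[of "M - S2s"] S2s_less by simp
    show "continuous_on {0..M - S2s} ?\<nu>"
      by (intro continuous_intros continuous_on_subset[OF f_cont]) auto
  qed (use S2s_less in auto)
  then obtain s where s: "0 \<le> s" "s \<le> M - S2s" "?\<nu> s = 0" by blast
  have "s \<noteq> 0" using s \<mu>_S2s_pos S2s_less by (auto simp: f_0)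
  moreover have "s \<noteq> M - S2s" using s f_pos[of "M - S2s"] S2s_less by auto
  ultimately have s': "0 < s \<and> s < M - S2s \<and> ?\<nu> s = 0" using s by auto
  have "S1m = s" unfolding S1m_def S1_min_def
    using s' mono by (intro the_equality) (auto, smt (verit) mono)
  then show "0 < S1m" "S1m < M - S2s" "f S1m = \<mu> S2s * (M - S2s - S1m)" using s' by (auto simp: algebra_simps)
qed

lemma E_xm: "E xm = S1m" and exp_xm: "exp xm = M - S2s - S1m"
  using S1m by (auto simp: xm_def E_def)

text \<open>Staying on the line takes the slope \<open>exp x\<close>, control 1 provides
  \<open>G x (E x)\<close>, and the quotient is the singular control. As \<open>x\<close> grows,
  \<open>f (E x)\<close> decreases and \<open>exp x\<close> increases, with balance at
  \<open>xm\<close> by the choice of \<open>S1m\<close>.\<close>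

lemma singular_slope_le: "x \<le> xm \<Longrightarrow> exp x \<le> G x (E x)"
  and singular_slope_less: "x < xm \<Longrightarrow> exp x < G x (E x)"
proof -
  have *: "exp x \<le> G x (E x) \<and> (x < xm \<longrightarrow> exp x < G x (E x))" if "x \<le> xm"
  proof -
    have "S1m \<le> E x" using that E_le[of xm x] by (simp add: E_xm)
    then have "f S1m \<le> f (E x)" using S1m by (intro f_le) auto
    moreover have "\<mu> S2s * exp x \<le> \<mu> S2s * exp xm" "x < xm \<longrightarrow> \<mu> S2s * exp x < \<mu> S2s * exp xm"
      using that \<mu>_S2s_pos by auto
    ultimately have "\<mu> S2s * exp x \<le> f (E x) \<and> (x < xm \<longrightarrow> \<mu> S2s * exp x < f (E x))"
      using S1m(3) unfolding exp_xm by linarith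
    then show ?thesis using \<mu>_S2s_pos by (simp add: G_def field_simps)
  qed
  show "x \<le> xm \<Longrightarrow> exp x \<le> G x (E x)" "x < xm \<Longrightarrow> exp x < G x (E x)" using * by auto
qed

text \<open>Both factors are clamped so that the control 1 defines a global flow.\<close>

definition Gc :: "real \<Rightarrow> real \<Rightarrow> real \<Rightarrow> real \<Rightarrow> real" where
  "Gc cm m x c = f (max cm (min M c)) / max m (\<mu> (max 0 (min M (s2 x c))))"

lemma Gc_eq: "cm \<le> c \<Longrightarrow> c \<le> M \<Longrightarrow> 0 \<le> s2 x c \<Longrightarrow> s2 x c \<le> M \<Longrightarrow> m \<le> \<mu> (s2 x c) \<Longrightarrow> Gc cm m x c = G x c"
  by (simp add: Gc_def G_def max_absorb2 max_absorb1 min_absorb2)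

lemma Gc_bounds:
  assumes "0 < cm" "cm \<le> M" "0 < m"
  shows "f cm / max m (\<mu> S2s) \<le> Gc cm m x c" "Gc cm m x c \<le> f M / m" "0 < Gc cm m x c"
proof -
  let ?c = "max cm (min M c)" and ?s = "max 0 (min M (s2 x c))"
  have 1: "f cm \<le> f ?c" "f ?c \<le> f M" "0 < f cm" using assms by (auto intro!: f_le f_pos)
  have 2: "\<mu> ?s \<le> \<mu> S2s" by (intro \<mu>_max) auto
  show "f cm / max m (\<mu> S2s) \<le> Gc cm m x c"
    unfolding Gc_def using 1 2 assms by (intro frac_le) auto
  show "Gc cm m x c \<le> f M / m"
    unfolding Gc_def using 1 2 assms by (intro frac_le) auto
  show "0 < Gc cm m x c" unfolding Gc_def using 1 assms by (intro divide_pos_pos) auto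
qed

lemma Gc_cont:
  assumes "0 < cm" "cm \<le> M" "0 < m"
  shows "continuous_on UNIV (\<lambda>(x, c). Gc cm m x c)"
proof -
  have 1: "continuous_on UNIV (\<lambda>p :: real \<times> real. f (max cm (min M (snd p))))"
    by (rule continuous_on_compose2[OF f_cont]) (use assms in \<open>auto intro!: continuous_intros\<close>)
  have 2: "continuous_on UNIV (\<lambda>p :: real \<times> real. \<mu> (max 0 (min M (s2 (fst p) (snd p)))))"
    unfolding s2_def by (rule continuous_on_compose2[OF \<mu>_cont]) (auto intro!: continuous_intros)
  have "continuous_on UNIV (\<lambda>p. Gc cm m (fst p) (snd p))"
    unfolding Gc_def using assms by (intro continuous_on_divide 1 continuous_on_max continuous_on_const 2) (auto simp: max_def)
  then show ?thesis by (simp add: case_prod_beta)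
qed

lemma Gc_lipschitz:
  assumes "0 < cm" "cm \<le> M" "0 < m"
  shows "\<exists>K>0. \<forall>x c d. \<bar>Gc cm m x c - Gc cm m x d\<bar> \<le> K * \<bar>c - d\<bar>"
proof -
  obtain Lf where Lf: "Lf > 0" "\<And>a b. a \<in> {0..M} \<Longrightarrow> b \<in> {0..M} \<Longrightarrow> \<bar>f a - f b\<bar> \<le> Lf * \<bar>a - b\<bar>"
    using f_lipschitz by blast
  obtain Lm where Lm: "Lm > 0" "\<And>a b. a \<in> {0..M} \<Longrightarrow> b \<in> {0..M} \<Longrightarrow> \<bar>\<mu> a - \<mu> b\<bar> \<le> Lm * \<bar>a - b\<bar>"
    using \<mu>_lipschitz by blast
  define K where "K = Lf / m + f M * (Lm / m\<^sup>2)"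
  have "\<bar>Gc cm m x c - Gc cm m x d\<bar> \<le> K * \<bar>c - d\<bar>" for x c d
  proof -
    define k where "k = (\<lambda>c. max cm (min M c))"
    define s where "s = (\<lambda>c. max 0 (min M (s2 x c)))"
    define w where "w = (\<lambda>c. 1 / max m (\<mu> (s c)))"
    have Gc: "Gc cm m x c = f (k c) * w c" for c by (simp add: Gc_def k_def w_def s_def)
    have k: "k c \<in> {0..M}" "k d \<in> {0..M}" "s c \<in> {0..M}" "s d \<in> {0..M}"
      using assms M_pos by (auto simp: k_def s_def)
    have "\<bar>f (k c) - f (k d)\<bar> \<le> Lf * \<bar>k c - k d\<bar>" using Lf k by blast
    also have "\<dots> \<le> Lf * \<bar>c - d\<bar>" using Lf by (intro mult_left_mono) (auto simp: k_def)
    finally have 1: "\<bar>f (k c) - f (k d)\<bar> \<le> Lf * \<bar>c - d\<bar>" .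
    have "\<bar>\<mu> (s c) - \<mu> (s d)\<bar> \<le> Lm * \<bar>s c - s d\<bar>" using Lm k by blast
    also have "\<dots> \<le> Lm * \<bar>c - d\<bar>" using Lm by (intro mult_left_mono) (auto simp: s2_def s_def)
    finally have "\<bar>\<mu> (s c) - \<mu> (s d)\<bar> / m\<^sup>2 \<le> Lm * \<bar>c - d\<bar> / m\<^sup>2" by (intro divide_right_mono) auto
    then have 2: "\<bar>w c - w d\<bar> \<le> Lm * \<bar>c - d\<bar> / m\<^sup>2"
      unfolding w_def by (rule order_trans[OF inverse_max_lipschitz[OF assms(3)]])
    have fk: "0 \<le> f (k d)" "f (k d) \<le> f M" using k(2) by (auto intro!: f_nonneg f_le)
    have wc: "0 \<le> w c" "w c \<le> 1 / m" using assms by (auto simp: w_def intro!: frac_le)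
    have "Gc cm m x c - Gc cm m x d = (f (k c) - f (k d)) * w c + f (k d) * (w c - w d)"
      unfolding Gc by algebra
    then have "\<bar>Gc cm m x c - Gc cm m x d\<bar> \<le> \<bar>f (k c) - f (k d)\<bar> * w c + f (k d) * \<bar>w c - w d\<bar>"
      using abs_triangle_ineq[of "(f (k c) - f (k d)) * w c" "f (k d) * (w c - w d)"] wc fk
      by (simp only: abs_mult abs_of_nonneg)
    also have "\<dots> \<le> (Lf * \<bar>c - d\<bar>) * (1 / m) + f M * (Lm * \<bar>c - d\<bar> / m\<^sup>2)"
      using 1 2 wc fk Lf by (intro add_mono mult_mono) auto
    also have "\<dots> = K * \<bar>c - d\<bar>" by (simp add: K_def algebra_simps)
    finally show ?thesis .
  qed
  moreover have "K > 0" unfolding K_def using Lf Lm assms f_pos[OF M_pos] by (intro add_pos_pos mult_pos_pos divide_pos_pos) auto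
  ultimately show ?thesis by blast
qed

lemma Gc_cont_comp:
  assumes "0 < cm" "cm \<le> M" "0 < m" "continuous_on X g"
  shows "continuous_on X (\<lambda>x. Gc cm m x (g x))"
  using continuous_on_compose2[OF Gc_cont[OF assms(1-3)] continuous_on_Pair[OF continuous_on_id assms(4)]]
  by auto

subsection \<open>Profiles and their cost\<close>

definition reg :: "(real \<Rightarrow> real) \<Rightarrow> real \<Rightarrow> real \<Rightarrow> bool" where
  "reg \<rho> a b \<longleftrightarrow> continuous_on {a..b} \<rho> \<and> (\<forall>x\<in>{a..b}. 0 < \<rho> x \<and> 0 < s2 x (\<rho> x))"

definition cost :: "(real \<Rightarrow> real) \<Rightarrow> real \<Rightarrow> real \<Rightarrow> real" where
  "cost \<rho> a b = integral {a..b} (\<lambda>x. 1 / \<mu> (s2 x (\<rho> x)))"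

text \<open>The differential inclusion with slopes between \<open>- G x (\<rho> x)\<close> and 0, in
  integrated form: what remains of the equation when the control is dropped, stated for a function
  that is merely continuous.\<close>

definition prof :: "(real \<Rightarrow> real) \<Rightarrow> real \<Rightarrow> real \<Rightarrow> bool" where
  "prof \<rho> a b \<longleftrightarrow> reg \<rho> a b \<and>
     (\<forall>p q. a \<le> p \<longrightarrow> p \<le> q \<longrightarrow> q \<le> b \<longrightarrow>
        \<rho> q \<le> \<rho> p \<and> \<rho> p - \<rho> q \<le> integral {p..q} (\<lambda>x. G x (\<rho> x)))"

lemma reg_subset: "reg \<rho> a b \<Longrightarrow> a \<le> p \<Longrightarrow> q \<le> b \<Longrightarrow> reg \<rho> p q"
  unfolding reg_def by (auto intro: continuous_on_subset)

lemma reg_cong: "reg \<rho> a b \<Longrightarrow> (\<And>x. x \<in> {a..b} \<Longrightarrow> \<rho> x = \<sigma> x) \<Longrightarrow> reg \<sigma> a b"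
  unfolding reg_def using continuous_on_cong[of "{a..b}" "{a..b}" \<rho> \<sigma>] by auto

lemma cost_cong: "(\<And>x. x \<in> {a..b} \<Longrightarrow> \<rho> x = \<sigma> x) \<Longrightarrow> cost \<rho> a b = cost \<sigma> a b"
  unfolding cost_def by (intro integral_cong) auto

lemma s2_cont: "continuous_on X \<rho> \<Longrightarrow> continuous_on X (\<lambda>x. s2 x (\<rho> x))"
  unfolding s2_def by (intro continuous_intros)

lemma reg_mu_cont: "reg \<rho> a b \<Longrightarrow> continuous_on {a..b} (\<lambda>x. \<mu> (s2 x (\<rho> x)))"
  unfolding reg_def by (intro continuous_on_compose2[OF \<mu>_cont s2_cont]) (auto intro: less_imp_le)

lemma reg_mu_pos: "reg \<rho> a b \<Longrightarrow> x \<in> {a..b} \<Longrightarrow> 0 < \<mu> (s2 x (\<rho> x))"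
  unfolding reg_def by (auto intro!: \<mu>_pos)

lemma reg_cost_cont: "reg \<rho> a b \<Longrightarrow> continuous_on {a..b} (\<lambda>x. 1 / \<mu> (s2 x (\<rho> x)))"
  using reg_mu_pos[of \<rho> a b] by (intro continuous_on_divide continuous_on_const reg_mu_cont) force+

lemma reg_G_cont: "reg \<rho> a b \<Longrightarrow> continuous_on {a..b} (\<lambda>x. G x (\<rho> x))"
  unfolding G_def using reg_mu_pos[of \<rho> a b]
  by (intro continuous_on_divide reg_mu_cont continuous_on_compose2[OF f_cont])
    (force simp: reg_def intro: less_imp_le)+

lemma cost_combine: "reg \<rho> a c \<Longrightarrow> a \<le> b \<Longrightarrow> b \<le> c \<Longrightarrow> cost \<rho> a c = cost \<rho> a b + cost \<rho> b c"
  unfolding cost_def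
  by (intro Henstock_Kurzweil_Integration.integral_combine[symmetric] integrable_continuous_interval reg_cost_cont)

lemma cost_self [simp]: "cost \<rho> a a = 0"
  by (simp add: cost_def)

lemma cost_deriv:
  "reg \<rho> a b \<Longrightarrow> x \<in> {a..b} \<Longrightarrow> (cost \<rho> a has_real_derivative 1 / \<mu> (s2 x (\<rho> x))) (at x within {a..b})"
  unfolding cost_def[abs_def] by (intro integral_has_real_derivative reg_cost_cont)

lemma cost_pos:
  assumes "reg \<rho> a b" "a < b"
  shows "0 < cost \<rho> a b"
proof -
  have "integral {a..b} (\<lambda>x. 0 :: real) < integral {a..b} (\<lambda>x. 1 / \<mu> (s2 x (\<rho> x)))"
    using assms reg_mu_pos[OF assms(1)]
    by (intro integral_less_real) (auto intro!: integrable_continuous_interval reg_cost_cont)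
  then show ?thesis by (simp add: cost_def)
qed

lemma cost_nonneg: "reg \<rho> a b \<Longrightarrow> a \<le> b \<Longrightarrow> 0 \<le> cost \<rho> a b"
  using cost_pos[of \<rho> a b] by (cases "a = b") auto

lemma cost_strict_mono: "reg \<rho> a c \<Longrightarrow> a \<le> b \<Longrightarrow> b < c \<Longrightarrow> cost \<rho> a b < cost \<rho> a c"
  using cost_combine[of \<rho> a c b] cost_pos[OF reg_subset[of \<rho> a c b c]] by auto

text \<open>Along a parametrisation by time the derivative of the cost is \<open>1 / \<mu>\<close>
  times \<open>\<mu>\<close>.\<close>

lemma cost_along:
  assumes reg: "reg \<rho> a b" and T: "0 \<le> T" and x0: "x 0 = a"
    and x: "\<And>t. t \<in> {0..T} \<Longrightarrow> x t \<in> {a..b}"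
    and dx: "\<And>t. t \<in> {0..T} \<Longrightarrow> (x has_real_derivative \<mu> (s2 (x t) (\<rho> (x t)))) (at t within {0..T})"
  shows "cost \<rho> a (x T) = T"
proof -
  have d: "((\<lambda>t. cost \<rho> a (x t)) has_real_derivative 1) (at t within {0..T})" if t: "t \<in> {0..T}" for t
  proof -
    have "(cost \<rho> a has_real_derivative 1 / \<mu> (s2 (x t) (\<rho> (x t)))) (at (x t) within x ` {0..T})"
      by (rule DERIV_subset[OF cost_deriv[OF reg x[OF t]]]) (use x in auto)
    from DERIV_image_chain[OF this dx[OF t]] show ?thesis
      using reg_mu_pos[OF reg x[OF t]] by (simp add: o_def)
  qed
  have "cost \<rho> a (x 0) - 0 \<le> cost \<rho> a (x T) - T"
    by (rule nonneg_deriv_imp_le[of 0 T "\<lambda>t. cost \<rho> a (x t) - t" "\<lambda>t. 1 - 1"]) (rule T, intro derivative_intros d, auto)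
  moreover have "0 - cost \<rho> a (x 0) \<le> T - cost \<rho> a (x T)"
    by (rule nonneg_deriv_imp_le[of 0 T "\<lambda>t. t - cost \<rho> a (x t)" "\<lambda>t. 1 - 1"]) (rule T, intro derivative_intros d, auto)
  ultimately show ?thesis by (simp add: x0)
qed

text \<open>\<open>k\<close> lies between the line and \<open>r\<close>. By the shape of
  \<open>\<mu>\<close> this is the pointwise relation that makes \<open>k\<close> at least as fast
  as \<open>r\<close>.\<close>

definition closer :: "real \<Rightarrow> real \<Rightarrow> real \<Rightarrow> bool" where
  "closer x k r \<longleftrightarrow> r \<le> k \<and> k \<le> E x \<or> E x \<le> k \<and> k \<le> r"

lemma closer_mu:
  assumes "closer x k r" "0 < s2 x r"
  shows "\<mu> (s2 x r) \<le> \<mu> (s2 x k)" "r \<noteq> k \<Longrightarrow> \<mu> (s2 x r) < \<mu> (s2 x k)"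
proof -
  have "(s2 x r < s2 x k \<and> s2 x k \<le> S2s) \<or> (S2s \<le> s2 x k \<and> s2 x k < s2 x r) \<or> r = k"
    using assms(1) unfolding closer_def by (auto simp: s2_def E_def)
  then show "\<mu> (s2 x r) \<le> \<mu> (s2 x k)" "r \<noteq> k \<Longrightarrow> \<mu> (s2 x r) < \<mu> (s2 x k)"
    using \<mu>_less[of "s2 x r" "s2 x k"] \<mu>_greater[of "s2 x k" "s2 x r"] assms(2) by auto
qed

lemma cost_le:
  assumes "reg \<rho> a b" "reg \<kappa> a b" "\<And>x. x \<in> {a..b} \<Longrightarrow> closer x (\<kappa> x) (\<rho> x)"
  shows "cost \<kappa> a b \<le> cost \<rho> a b"
  unfolding cost_def
proof (rule integral_le)
  show "1 / \<mu> (s2 x (\<kappa> x)) \<le> 1 / \<mu> (s2 x (\<rho> x))" if "x \<in> {a..b}" for x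
    using reg_mu_pos[OF assms(1) that] closer_mu(1)[OF assms(3)[OF that]] assms(1) that
    by (intro frac_le) (auto simp: reg_def)
qed (intro integrable_continuous_interval reg_cost_cont assms)+

text \<open>Two continuous integrands in order, with integrals in the opposite order, coincide; and
  \<open>\<mu>\<close> is strictly monotone on either side of \<open>S2s\<close>. This turns
  domination of an optimal profile into equality with the explicit one.\<close>

lemma cost_eq_imp_eq:
  assumes reg: "reg \<rho> a b" "reg \<kappa> a b" and cl: "\<And>x. x \<in> {a..b} \<Longrightarrow> closer x (\<kappa> x) (\<rho> x)"
    and le: "cost \<rho> a b \<le> cost \<kappa> a b" and x: "x \<in> {a..b}" and "a < b"
  shows "\<rho> x = \<kappa> x"
proof (rule ccontr)
  let ?g = "\<lambda>x. 1 / \<mu> (s2 x (\<rho> x)) - 1 / \<mu> (s2 x (\<kappa> x))"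
  assume ne: "\<rho> x \<noteq> \<kappa> x"
  have cg: "continuous_on {a..b} ?g" by (intro continuous_intros reg_cost_cont reg)
  have nn: "0 \<le> ?g y" if "y \<in> {a..b}" for y
    using reg_mu_pos[OF reg(1) that] closer_mu(1)[OF cl[OF that]] reg(1) that
      frac_le[of 1 1 "\<mu> (s2 y (\<rho> y))" "\<mu> (s2 y (\<kappa> y))"] by (auto simp: reg_def)
  have "integral {a..b} ?g = cost \<rho> a b - cost \<kappa> a b"
    unfolding cost_def
    by (intro Henstock_Kurzweil_Integration.integral_diff integrable_continuous_interval reg_cost_cont reg)
  moreover have "0 \<le> integral {a..b} ?g"
    by (intro Henstock_Kurzweil_Integration.integral_nonneg integrable_continuous_interval cg nn)
  ultimately have "integral {a..b} ?g = 0" using le by simp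
  then have "?g x = 0" using integral_eq_0_iff[OF cg \<open>a < b\<close> nn] x by blast
  then show False
    using closer_mu(2)[OF cl[OF x]] ne reg_mu_pos[OF reg(1) x] reg_mu_pos[OF reg(2) x] reg(1) x
    by (auto simp: reg_def field_simps)
qed

text \<open>On a compact interval a regular profile stays away from both clamps. All smaller clamps
  are included, so that two profiles can share one pair of them.\<close>

lemma reg_Gc:
  assumes "reg \<rho> a b"
  shows "\<exists>cm m. 0 < cm \<and> cm \<le> M \<and> 0 < m \<and>
    (\<forall>cm' m' x. cm' \<le> cm \<longrightarrow> m' \<le> m \<longrightarrow> x \<in> {a..b} \<longrightarrow> Gc cm' m' x (\<rho> x) = G x (\<rho> x))"
proof (cases "a \<le> b")
  case True
  have c: "compact {a..b}" "{a..b} \<noteq> {}" using True by auto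
  obtain p where p: "p \<in> {a..b}" "\<And>x. x \<in> {a..b} \<Longrightarrow> \<rho> p \<le> \<rho> x"
    using continuous_attains_inf[OF c, of \<rho>] assms unfolding reg_def by blast
  obtain q where q: "q \<in> {a..b}" "\<And>x. x \<in> {a..b} \<Longrightarrow> \<mu> (s2 q (\<rho> q)) \<le> \<mu> (s2 x (\<rho> x))"
    using continuous_attains_inf[OF c reg_mu_cont[OF assms]] by blast
  have bd: "0 < \<rho> x \<and> 0 < s2 x (\<rho> x) \<and> \<rho> x \<le> M \<and> s2 x (\<rho> x) \<le> M" if "x \<in> {a..b}" for x
  proof -
    have "0 < \<rho> x" "0 < s2 x (\<rho> x)" using assms that unfolding reg_def by blast+
    then show ?thesis using exp_gt_zero[of x] unfolding s2_def by linarith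
  qed
  have "Gc cm' m' x (\<rho> x) = G x (\<rho> x)" if "cm' \<le> \<rho> p" "m' \<le> \<mu> (s2 q (\<rho> q))" "x \<in> {a..b}" for cm' m' x
    using p(2)[OF that(3)] q(2)[OF that(3)] bd[OF that(3)] that by (intro Gc_eq) auto
  moreover have "0 < \<mu> (s2 q (\<rho> q))" using reg_mu_pos[OF assms q(1)] .
  ultimately show ?thesis using bd[OF p(1)] by blast
next
  case False
  then show ?thesis using M_pos by (intro exI[of _ M] exI[of _ "1 :: real"]) auto
qed

lemma reg_G_lipschitz:
  assumes "reg \<rho> p q" "reg \<beta> p q"
  shows "\<exists>K>0. \<forall>x\<in>{p..q}. \<bar>G x (\<rho> x) - G x (\<beta> x)\<bar> \<le> K * \<bar>\<rho> x - \<beta> x\<bar>"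
proof -
  obtain c1 m1 where 1: "0 < c1" "c1 \<le> M" "0 < m1"
    "\<And>cm' m' x. cm' \<le> c1 \<Longrightarrow> m' \<le> m1 \<Longrightarrow> x \<in> {p..q} \<Longrightarrow> Gc cm' m' x (\<rho> x) = G x (\<rho> x)"
    using reg_Gc[OF assms(1)] by blast
  obtain c2 m2 where 2: "0 < c2" "c2 \<le> M" "0 < m2"
    "\<And>cm' m' x. cm' \<le> c2 \<Longrightarrow> m' \<le> m2 \<Longrightarrow> x \<in> {p..q} \<Longrightarrow> Gc cm' m' x (\<beta> x) = G x (\<beta> x)"
    using reg_Gc[OF assms(2)] by blast
  define cm m where "cm = min c1 c2" and "m = min m1 m2"
  obtain K where "K > 0" "\<And>x c d. \<bar>Gc cm m x c - Gc cm m x d\<bar> \<le> K * \<bar>c - d\<bar>"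
    using Gc_lipschitz[of cm m] 1(1-3) 2(1-3) by (auto simp: cm_def m_def min_le_iff_disj)
  moreover have "Gc cm m x (\<rho> x) = G x (\<rho> x)" "Gc cm m x (\<beta> x) = G x (\<beta> x)" if "x \<in> {p..q}" for x
    using 1(4)[of cm m x] 2(4)[of cm m x] that by (auto simp: cm_def m_def)
  ultimately show ?thesis by metis
qed

text \<open>To reach the common point \<open>q\<close> from above \<open>\<beta>\<close>, the
  profile \<open>\<rho>\<close> would have to fall faster than its bound \<open>G\<close> allows;
  the gap satisfies a backward Gronwall inequality with initial value 0. In the applications
  \<open>\<beta>\<close> is a curve of control 1 and \<open>\<rho>\<close> a profile or the line
  itself.\<close>

lemma no_cross_left:
  assumes reg: "reg \<rho> p q" "reg \<beta> p q"
    and \<rho>: "\<And>t. t \<in> {p..q} \<Longrightarrow> \<rho> t - \<rho> q \<le> integral {t..q} (\<lambda>x. G x (\<rho> x))"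
    and \<beta>: "\<And>t. t \<in> {p..q} \<Longrightarrow> integral {t..q} (\<lambda>x. G x (\<beta> x)) \<le> \<beta> t - \<beta> q"
    and le: "\<And>t. t \<in> {p..q} \<Longrightarrow> \<beta> t \<le> \<rho> t" and eq: "\<rho> q = \<beta> q" and t: "t \<in> {p..q}"
  shows "\<rho> t = \<beta> t"
proof -
  obtain K where K: "K > 0" "\<And>x. x \<in> {p..q} \<Longrightarrow> \<bar>G x (\<rho> x) - G x (\<beta> x)\<bar> \<le> K * \<bar>\<rho> x - \<beta> x\<bar>"
    using reg_G_lipschitz[OF reg] by blast
  define h where "h t = \<rho> t - \<beta> t" for t
  have ch: "continuous_on {p..q} h"
    unfolding h_def using reg by (intro continuous_intros) (auto simp: reg_def)
  have "h t \<le> 0 * exp (K * (q - t))"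
  proof (rule gronwall_backward[OF ch _ _ t])
    show "h s \<le> 0 + K * integral {s..q} h" if s: "s \<in> {p..q}" for s
    proof -
      have sub: "{s..q} \<subseteq> {p..q}" using s by auto
      have int: "(\<lambda>x. G x (\<rho> x)) integrable_on {s..q}" "(\<lambda>x. G x (\<beta> x)) integrable_on {s..q}"
        by (intro integrable_continuous_interval continuous_on_subset[OF reg_G_cont sub] reg)+
      have "h s \<le> integral {s..q} (\<lambda>x. G x (\<rho> x)) - integral {s..q} (\<lambda>x. G x (\<beta> x))"
        using \<rho>[OF s] \<beta>[OF s] eq by (simp add: h_def)
      also have "\<dots> = integral {s..q} (\<lambda>x. G x (\<rho> x) - G x (\<beta> x))"
        using int by (intro Henstock_Kurzweil_Integration.integral_diff[symmetric])
      also have "\<dots> \<le> integral {s..q} (\<lambda>x. K * h x)"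
      proof (rule integral_le)
        show "G x (\<rho> x) - G x (\<beta> x) \<le> K * h x" if "x \<in> {s..q}" for x
          using K(2)[of x] le[of x] that sub by (auto simp: h_def)
      qed (auto intro!: integrable_continuous_interval continuous_intros continuous_on_subset[OF ch sub]
          continuous_on_subset[OF reg_G_cont[OF reg(1)] sub] continuous_on_subset[OF reg_G_cont[OF reg(2)] sub])
      finally show ?thesis by simp
    qed
  qed (use K in auto)
  then show ?thesis using le[OF t] by (simp add: h_def)
qed

lemma no_cross_right:
  assumes reg: "reg \<rho> p q" "reg \<beta> p q"
    and \<rho>: "\<And>t. t \<in> {p..q} \<Longrightarrow> \<rho> p - \<rho> t \<le> integral {p..t} (\<lambda>x. G x (\<rho> x))"
    and \<beta>: "\<And>t. t \<in> {p..q} \<Longrightarrow> integral {p..t} (\<lambda>x. G x (\<beta> x)) \<le> \<beta> p - \<beta> t"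
    and le: "\<And>t. t \<in> {p..q} \<Longrightarrow> \<rho> t \<le> \<beta> t" and eq: "\<rho> p = \<beta> p" and t: "t \<in> {p..q}"
  shows "\<rho> t = \<beta> t"
proof -
  obtain K where K: "K > 0" "\<And>x. x \<in> {p..q} \<Longrightarrow> \<bar>G x (\<rho> x) - G x (\<beta> x)\<bar> \<le> K * \<bar>\<rho> x - \<beta> x\<bar>"
    using reg_G_lipschitz[OF reg] by blast
  define h where "h t = \<beta> t - \<rho> t" for t
  have ch: "continuous_on {p..q} h"
    unfolding h_def using reg by (intro continuous_intros) (auto simp: reg_def)
  have "h t \<le> 0 * exp (K * (t - p))"
  proof (rule gronwall_forward[OF ch _ _ t])
    show "h s \<le> 0 + K * integral {p..s} h" if s: "s \<in> {p..q}" for s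
    proof -
      have sub: "{p..s} \<subseteq> {p..q}" using s by auto
      have int: "(\<lambda>x. G x (\<rho> x)) integrable_on {p..s}" "(\<lambda>x. G x (\<beta> x)) integrable_on {p..s}"
        by (intro integrable_continuous_interval continuous_on_subset[OF reg_G_cont sub] reg)+
      have "h s \<le> integral {p..s} (\<lambda>x. G x (\<rho> x)) - integral {p..s} (\<lambda>x. G x (\<beta> x))"
        using \<rho>[OF s] \<beta>[OF s] eq by (simp add: h_def)
      also have "\<dots> = integral {p..s} (\<lambda>x. G x (\<rho> x) - G x (\<beta> x))"
        using int by (intro Henstock_Kurzweil_Integration.integral_diff[symmetric])
      also have "\<dots> \<le> integral {p..s} (\<lambda>x. K * h x)"
      proof (rule integral_le)
        show "G x (\<rho> x) - G x (\<beta> x) \<le> K * h x" if "x \<in> {p..s}" for x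
          using K(2)[of x] le[of x] that sub by (auto simp: h_def)
      qed (auto intro!: integrable_continuous_interval continuous_intros continuous_on_subset[OF ch sub]
          continuous_on_subset[OF reg_G_cont[OF reg(1)] sub] continuous_on_subset[OF reg_G_cont[OF reg(2)] sub])
      finally show ?thesis by simp
    qed
  qed (use K in auto)
  then show ?thesis using le[OF t] by (simp add: h_def)
qed

lemma integral_slope:
  assumes "continuous_on {p..q} g" "p \<le> q"
    and "\<And>x. x \<in> {p..q} \<Longrightarrow> (\<beta> has_real_derivative - g x) (at x within {p..q})"
  shows "integral {p..q} g = \<beta> p - \<beta> q"
proof -
  have "((\<lambda>x. - g x) has_integral (\<beta> q - \<beta> p)) {p..q}"
    using assms by (intro fundamental_theorem_of_calculus)
      (auto simp: has_real_derivative_iff_has_vector_derivative)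
  then have "((\<lambda>x. - (- g x)) has_integral - (\<beta> q - \<beta> p)) {p..q}" by (rule has_integral_neg)
  then show ?thesis by (simp add: integral_unique)
qed

text \<open>Up to \<open>xm\<close> the line satisfies the inclusion and can play the part of
  \<open>\<rho>\<close> in \<open>no_cross_left\<close>.\<close>

lemma prof_E:
  assumes "p \<le> q" "q \<le> xm"
  shows "reg E p q" "\<And>a b. p \<le> a \<Longrightarrow> a \<le> b \<Longrightarrow> b \<le> q \<Longrightarrow> E a - E b \<le> integral {a..b} (\<lambda>x. G x (E x))"
proof -
  have pos: "0 < E x" if "x \<le> xm" for x
    using E_le[of xm x] that S1m(1) by (simp add: E_xm)
  show reg: "reg E p q" unfolding reg_def using pos assms S2s_pos by (auto intro!: E_cont)
  fix a b assume ab: "p \<le> a" "a \<le> b" "b \<le> q"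
  have "E a - E b = integral {a..b} exp"
    by (rule integral_slope[symmetric]) (use ab in \<open>auto intro!: E_deriv continuous_intros\<close>)
  also have "\<dots> \<le> integral {a..b} (\<lambda>x. G x (E x))"
    using ab assms singular_slope_le
    by (intro integral_le integrable_continuous_interval continuous_intros reg_G_cont reg_subset[OF reg]) auto
  finally show "E a - E b \<le> integral {a..b} (\<lambda>x. G x (E x))" .
qed

section \<open>From trajectories in time to profiles\<close>

context
  fixes u S1 S2 :: "real \<Rightarrow> real"
  assumes tr: "trajectory M f \<mu> u S1 S2"
begin

lemma trajectory_dom: "0 \<le> t \<Longrightarrow> 0 \<le> S1 t \<and> 0 \<le> S2 t \<and> S1 t + S2 t < M"
  using tr unfolding trajectory_def state_domain_def by auto

lemma trajectory_S1: "0 \<le> p \<Longrightarrow> p \<le> q \<Longrightarrow> ((\<lambda>s. - u s * f (S1 s)) has_integral (S1 q - S1 p)) {p..q}"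
  by (rule has_integral_increment[where F = S1]) (use tr in \<open>simp_all add: trajectory_def\<close>)

lemma trajectory_S2: "0 \<le> p \<Longrightarrow> p \<le> q \<Longrightarrow>
  ((\<lambda>s. u s * f (S1 s) - \<mu> (S2 s) * (M - S1 s - S2 s)) has_integral (S2 q - S2 p)) {p..q}"
  by (rule has_integral_increment[where F = S2]) (use tr in \<open>simp_all add: trajectory_def\<close>)

lemma trajectory_cont: "continuous_on {0..T} S1" "continuous_on {0..T} S2"
  by (rule has_integral_cont[OF trajectory_S1]; simp) (rule has_integral_cont[OF trajectory_S2]; simp)

lemma trajectory_f_cont: "0 \<le> p \<Longrightarrow> continuous_on {p..q} (\<lambda>s. f (S1 s))"
proof (rule continuous_on_compose2[OF f_cont])
  assume p: "0 \<le> p"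
  show "continuous_on {p..q} S1"
    by (rule continuous_on_subset[OF trajectory_cont(1)[of q]]) (use p in auto)
  show "S1 ` {p..q} \<subseteq> {0..}"
  proof (rule image_subsetI)
    show "S1 x \<in> {0..}" if "x \<in> {p..q}" for x
      using trajectory_dom[of x] that p by simp
  qed
qed

lemma trajectory_\<mu>_cont: "0 \<le> p \<Longrightarrow> continuous_on {p..q} (\<lambda>s. \<mu> (S2 s))"
proof (rule continuous_on_compose2[OF \<mu>_cont])
  assume p: "0 \<le> p"
  show "continuous_on {p..q} S2"
    by (rule continuous_on_subset[OF trajectory_cont(2)[of q]]) (use p in auto)
  show "S2 ` {p..q} \<subseteq> {0..}"
  proof (rule image_subsetI)
    show "S2 x \<in> {0..}" if "x \<in> {p..q}" for x
      using trajectory_dom[of x] that p by simp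
  qed
qed

lemma trajectory_u: "0 \<le> t \<Longrightarrow> 0 \<le> u t \<and> u t \<le> 1"
  using tr unfolding trajectory_def by auto

lemma trajectory_S1_step:
  assumes "0 \<le> p" "p \<le> q"
  shows "S1 q \<le> S1 p" "S1 p - S1 q \<le> integral {p..q} (\<lambda>s. f (S1 s))"
proof -
  have b: "0 \<le> u s * f (S1 s) \<and> u s * f (S1 s) \<le> f (S1 s)" if "s \<in> {p..q}" for s
    using trajectory_u[of s] trajectory_dom[of s] f_nonneg[of "S1 s"] that assms
    by (auto intro: mult_left_le_one_le)
  have i: "((\<lambda>s. u s * f (S1 s)) has_integral (S1 p - S1 q)) {p..q}"
    using has_integral_neg[OF trajectory_S1[OF assms]] by simp
  show "S1 q \<le> S1 p" using has_integral_nonneg[OF i] b by force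
  show "S1 p - S1 q \<le> integral {p..q} (\<lambda>s. f (S1 s))"
    using b by (intro has_integral_le[OF i integrable_integral])
      (auto intro!: integrable_continuous_interval trajectory_f_cont assms)
qed

text \<open>Whatever the control, \<open>S1\<close> decays at a rate of at most
  \<open>f (S1) \<le> L * S1\<close>. Besides positivity this gives a lower bound at the final time
  that is uniform over all controls; it later confines the parameters of the competitors.\<close>

lemma trajectory_S1_lower:
  assumes L: "0 \<le> L" "\<And>a. a \<in> {0..M} \<Longrightarrow> f a \<le> L * a" and t: "0 \<le> t"
  shows "S1 0 \<le> S1 t * exp (L * t)"
proof -
  have "S1 0 \<le> S1 t * exp (L * (t - 0))"
  proof (rule gronwall_backward[OF trajectory_cont(1)])
    show "S1 s \<le> S1 t + L * integral {s..t} S1" if s: "s \<in> {0..t}" for s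
    proof -
      have dom: "0 \<le> S1 r \<and> S1 r \<le> M" if "s \<le> r" for r
        using trajectory_dom[of r] s that by auto
      have "integral {s..t} (\<lambda>s. f (S1 s)) \<le> integral {s..t} (\<lambda>s. L * S1 s)"
        using s
        by (intro integral_le integrable_continuous_interval trajectory_f_cont continuous_intros
            continuous_on_subset[OF trajectory_cont(1)[of t]]) (auto intro!: L(2) simp: dom)
      then show ?thesis using trajectory_S1_step(2)[of s t] s by simp
    qed
  qed (use L t in auto)
  then show ?thesis by simp
qed

lemma trajectory_S1_pos:
  assumes "0 < S1 0" "0 \<le> t"
  shows "0 < S1 t"
proof -
  obtain L where L: "L > 0" "\<And>a b. a \<in> {0..M} \<Longrightarrow> b \<in> {0..M} \<Longrightarrow> \<bar>f a - f b\<bar> \<le> L * \<bar>a - b\<bar>"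
    using f_lipschitz by blast
  have "f a \<le> L * a" if "a \<in> {0..M}" for a
    using L(2)[of a 0] that M_pos by (auto simp: f_0)
  then have "S1 0 \<le> S1 t * exp (L * t)" using L assms by (intro trajectory_S1_lower) auto
  then show ?thesis using assms trajectory_dom[of t] by (cases "S1 t = 0") auto
qed

lemma trajectory_S2_lower:
  assumes L: "0 \<le> L" "\<And>a. a \<in> {0..M} \<Longrightarrow> \<mu> a \<le> L * a" and t: "0 \<le> t"
  shows "S2 0 \<le> S2 t * exp (L * M * t)"
proof -
  have "S2 0 \<le> S2 t * exp (L * M * (t - 0))"
  proof (rule gronwall_backward[OF trajectory_cont(2)])
    show "S2 s \<le> S2 t + L * M * integral {s..t} S2" if s: "s \<in> {0..t}" for s
    proof -
      have "((\<lambda>s. - (u s * f (S1 s) - \<mu> (S2 s) * (M - S1 s - S2 s))) has_integral - (S2 t - S2 s)) {s..t}"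
        using s by (intro has_integral_neg trajectory_S2) auto
      moreover have "((\<lambda>s. L * M * S2 s) has_integral integral {s..t} (\<lambda>s. L * M * S2 s)) {s..t}"
        using s by (intro integrable_integral integrable_continuous_interval continuous_intros
            continuous_on_subset[OF trajectory_cont(2)[of t]]) auto
      moreover have "- (u r * f (S1 r) - \<mu> (S2 r) * (M - S1 r - S2 r)) \<le> L * M * S2 r" if "r \<in> {s..t}" for r
      proof -
        have r: "0 \<le> S1 r" "0 \<le> S2 r" "S1 r + S2 r < M" "0 \<le> u r" using trajectory_dom[of r] trajectory_u[of r] that s by auto
        have "\<mu> (S2 r) \<le> L * S2 r" using L(2)[of "S2 r"] r by auto
        then have "\<mu> (S2 r) * (M - S1 r - S2 r) \<le> (L * S2 r) * M"
          using r \<mu>_nonneg[of "S2 r"] L by (intro mult_mono) auto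
        moreover have "0 \<le> u r * f (S1 r)" using r f_nonneg by simp
        ultimately show ?thesis by (simp add: mult_ac)
      qed
      ultimately have "- (S2 t - S2 s) \<le> integral {s..t} (\<lambda>s. L * M * S2 s)"
        by (rule has_integral_le) auto
      then show ?thesis by simp
    qed
  qed (use L M_pos t in auto)
  then show ?thesis by simp
qed

lemma trajectory_S2_pos:
  assumes "0 < S2 0" "0 \<le> t"
  shows "0 < S2 t"
proof -
  obtain L where L: "L > 0" "\<And>a b. a \<in> {0..M} \<Longrightarrow> b \<in> {0..M} \<Longrightarrow> \<bar>\<mu> a - \<mu> b\<bar> \<le> L * \<bar>a - b\<bar>"
    using \<mu>_lipschitz by blast
  have "\<mu> a \<le> L * a" if "a \<in> {0..M}" for a
    using L(2)[of a 0] that M_pos by (auto simp: \<mu>_0)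
  then have "S2 0 \<le> S2 t * exp (L * M * t)" using L assms by (intro trajectory_S2_lower) auto
  then show ?thesis using assms trajectory_dom[of t] by (cases "S2 t = 0") auto
qed

definition logX :: "real \<Rightarrow> real" where "logX t = ln (M - S1 t - S2 t)"

lemma s2_logX: "0 \<le> t \<Longrightarrow> s2 (logX t) (S1 t) = S2 t"
  using trajectory_dom[of t] by (auto simp: logX_def s2_def)

text \<open>In the sum of the two equations the control cancels, so \<open>S1 + S2\<close> is
  continuously differentiable although the control is only measurable.\<close>

lemma logX_deriv:
  assumes t: "t \<in> {0..T}"
  shows "(logX has_real_derivative \<mu> (S2 t)) (at t within {0..T})"
proof -
  define g where "g s = \<mu> (S2 s) * (M - S1 s - S2 s)" for s
  have cg: "continuous_on {0..T} g"
    unfolding g_def by (intro continuous_intros trajectory_\<mu>_cont trajectory_cont) auto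
  have X: "M - S1 s - S2 s = (M - S1 0 - S2 0) + integral {0..s} g" if "s \<in> {0..T}" for s
  proof -
    have "((\<lambda>s. - (- u s * f (S1 s) + (u s * f (S1 s) - g s))) has_integral - ((S1 s - S1 0) + (S2 s - S2 0))) {0..s}"
      unfolding g_def using that by (intro has_integral_neg has_integral_add trajectory_S1 trajectory_S2) auto
    then have "integral {0..s} g = - ((S1 s - S1 0) + (S2 s - S2 0))" by (simp add: integral_unique)
    then show ?thesis by simp
  qed
  have "((\<lambda>s. (M - S1 0 - S2 0) + integral {0..s} g) has_real_derivative 0 + g t) (at t within {0..T})"
    by (intro derivative_intros integral_has_real_derivative[OF cg t])
  then have "((\<lambda>s. M - S1 s - S2 s) has_real_derivative 0 + g t) (at t within {0..T})"
    by (rule has_field_derivative_transform_within[where d = 1]) (use t X in auto)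
  moreover have "(ln has_real_derivative inverse (M - S1 t - S2 t)) (at (M - S1 t - S2 t))"
    using trajectory_dom[of t] t by (intro DERIV_ln) auto
  ultimately have "((\<lambda>s. ln (M - S1 s - S2 s)) has_real_derivative inverse (M - S1 t - S2 t) * (0 + g t)) (at t within {0..T})"
    by (rule DERIV_chain2[rotated])
  moreover have "inverse (M - S1 t - S2 t) * (0 + g t) = \<mu> (S2 t)"
    using trajectory_dom[of t] t by (simp add: g_def)
  ultimately show ?thesis unfolding logX_def[abs_def] by simp
qed

text \<open>\<open>S2\<close> stays positive, so \<open>logX\<close> is strictly increasing and has
  a continuous inverse \<open>\<theta>\<close>; the profile is \<open>S1\<close> composed with it.
  The last clause lets abscissas be pulled back to times.\<close>

lemma trajectory_profile:
  assumes pos: "0 < S1 0" "0 < S2 0" and T: "0 \<le> T"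
  shows "\<exists>\<rho>. prof \<rho> (logX 0) (logX T) \<and> logX 0 \<le> logX T \<and>
    (\<forall>s\<in>{0..T}. logX s \<in> {logX 0..logX T} \<and> \<rho> (logX s) = S1 s \<and> cost \<rho> (logX 0) (logX s) = s) \<and>
    (\<forall>x\<in>{logX 0..logX T}. \<exists>s\<in>{0..T}. x = logX s)"
proof -
  have S2p: "0 < S2 t" and S1p: "0 < S1 t" if "0 \<le> t" for t
    using trajectory_S2_pos trajectory_S1_pos pos that by auto
  have mono: "logX p < logX q" if "0 \<le> p" "p < q" for p q
  proof (rule DERIV_pos_imp_increasing_open[OF that(2)])
    show "\<exists>y. (logX has_real_derivative y) (at x) \<and> 0 < y" if "p < x" "x < q" for x
      using logX_deriv[of x q] S2p[of x] \<open>0 \<le> p\<close> that \<mu>_pos[of "S2 x"]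
      by (intro exI[of _ "\<mu> (S2 x)"]) (auto simp: at_within_Icc_at)
    show "continuous_on {p..q} logX"
      using DERIV_continuous_on[OF logX_deriv, of q] by (rule continuous_on_subset) (use that in auto)
  qed
  have mono': "logX p \<le> logX q" if "0 \<le> p" "p \<le> q" for p q
    using mono[of p q] that by (cases "p = q") auto
  have cX: "continuous_on {0..T} logX" by (rule DERIV_continuous_on[OF logX_deriv])
  have inj: "inj_on logX {0..T}"
    by (rule inj_onI) (metis atLeastAtMost_iff linorder_neqE_linordered_idom mono order_less_irrefl)
  have img: "logX ` {0..T} = {logX 0..logX T}"
  proof
    show "logX ` {0..T} \<subseteq> {logX 0..logX T}" using mono' by auto
    show "{logX 0..logX T} \<subseteq> logX ` {0..T}"
    proof
      fix x assume "x \<in> {logX 0..logX T}"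
      then show "x \<in> logX ` {0..T}" using IVT'[of logX 0 x T] T cX by auto
    qed
  qed
  define \<theta> where "\<theta> = the_inv_into {0..T} logX"
  have \<theta>: "\<theta> (logX s) = s" if "s \<in> {0..T}" for s
    unfolding \<theta>_def using inj that by (rule the_inv_into_f_f)
  define \<rho> where "\<rho> = S1 \<circ> \<theta>"
  have \<rho>: "\<rho> (logX s) = S1 s" if "s \<in> {0..T}" for s using \<theta>[OF that] by (simp add: \<rho>_def)
  have "continuous_on (logX ` {0..T}) \<theta>"
    using \<theta> by (intro continuous_on_inv cX) auto
  then have c\<theta>: "continuous_on {logX 0..logX T} \<theta>" by (simp add: img)
  have \<theta>im: "\<theta> ` {logX 0..logX T} \<subseteq> {0..T}" unfolding img[symmetric] using \<theta> by auto
  have reg: "reg \<rho> (logX 0) (logX T)"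
  proof -
    have "continuous_on {logX 0..logX T} \<rho>"
      unfolding \<rho>_def by (rule continuous_on_compose[OF c\<theta> continuous_on_subset[OF trajectory_cont(1)[of T] \<theta>im]])
    moreover have "0 < \<rho> x \<and> 0 < s2 x (\<rho> x)" if "x \<in> {logX 0..logX T}" for x
    proof -
      have "x \<in> logX ` {0..T}" using that by (simp only: img)
      then obtain s where s: "s \<in> {0..T}" "x = logX s" by blast
      then have "0 \<le> s" by simp
      then show ?thesis unfolding s(2) \<rho>[OF s(1)] s2_logX[OF \<open>0 \<le> s\<close>] using S1p S2p by simp
    qed
    ultimately show ?thesis by (auto simp: reg_def)
  qed
  have dX: "(logX has_real_derivative \<mu> (s2 (logX s) (\<rho> (logX s)))) (at s within {0..t})" if "s \<in> {0..t}" "t \<le> T" for s t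
    using logX_deriv[of s t] \<rho>[of s] s2_logX[of s] that by auto
  have cost: "cost \<rho> (logX 0) (logX s) = s" if "s \<in> {0..T}" for s
    by (rule cost_along[OF reg_subset[OF reg]]) (use that mono' dX[of _ s] in auto)
  have "\<rho> q \<le> \<rho> p \<and> \<rho> p - \<rho> q \<le> integral {p..q} (\<lambda>x. G x (\<rho> x))"
    if pq: "logX 0 \<le> p" "p \<le> q" "q \<le> logX T" for p q
  proof -
    have "p \<in> logX ` {0..T}" "q \<in> logX ` {0..T}" using pq unfolding img by auto
    then obtain a b where a: "a \<in> {0..T}" "p = logX a" and b: "b \<in> {0..T}" "q = logX b" by blast
    have ab: "a \<le> b" using pq a b mono[of b a] by (cases "a \<le> b") auto
    have cG: "continuous_on {p..q} (\<lambda>x. G x (\<rho> x))" by (intro reg_G_cont reg_subset[OF reg] pq)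
    \<comment> \<open>Change of variable \<open>x = logX s\<close>: the factor
      \<open>1 / \<mu>\<close> in \<open>G\<close> compensates the speed \<open>\<mu>\<close>, so
      the bound by \<open>f (S1 s)\<close> in time becomes the bound by \<open>G\<close> in
      \<open>x\<close>.\<close>
    define \<Phi> where "\<Phi> s = integral {p..logX s} (\<lambda>x. G x (\<rho> x))" for s
    have "(\<Phi> has_real_derivative f (S1 s)) (at s within {a..b})" if s: "s \<in> {a..b}" for s
    proof -
      have sT: "s \<in> {0..T}" using s a b by auto
      have "logX ` {a..b} \<subseteq> {p..q}" unfolding a b using mono' a b by auto
      moreover have "logX s \<in> {p..q}" unfolding a b using mono' a b s by auto
      ultimately have 1: "((\<lambda>y. integral {p..y} (\<lambda>x. G x (\<rho> x))) has_real_derivative G (logX s) (\<rho> (logX s))) (at (logX s) within logX ` {a..b})"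
        using DERIV_subset[OF integral_has_real_derivative[OF cG]] by blast
      have 2: "(logX has_real_derivative \<mu> (S2 s)) (at s within {a..b})"
        using DERIV_subset[OF logX_deriv[OF sT], of "{a..b}"] a b by auto
      have "(\<Phi> has_real_derivative G (logX s) (\<rho> (logX s)) * \<mu> (S2 s)) (at s within {a..b})"
        unfolding \<Phi>_def[abs_def] using DERIV_image_chain[OF 1 2] by (simp add: o_def)
      then show ?thesis using \<rho>[OF sT] s2_logX[of s] \<mu>_pos[OF S2p[of s]] sT by (simp add: G_def)
    qed
    then have "((\<lambda>s. f (S1 s)) has_integral (\<Phi> b - \<Phi> a)) {a..b}"
      using ab by (intro fundamental_theorem_of_calculus) (auto simp: has_real_derivative_iff_has_vector_derivative)
    then have "integral {a..b} (\<lambda>s. f (S1 s)) = integral {p..q} (\<lambda>x. G x (\<rho> x))"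
      by (auto simp: integral_unique \<Phi>_def a b)
    then show ?thesis using trajectory_S1_step[of a b] a b ab \<rho> by auto
  qed
  then have "prof \<rho> (logX 0) (logX T)" using reg by (auto simp: prof_def)
  then show ?thesis using cost \<rho> mono' T img by (intro exI[of _ \<rho>]) auto
qed

end

subsection \<open>Profiles with a given control\<close>

text \<open>Here \<open>v\<close> is the control as a function of the abscissa \<open>x\<close>.\<close>

definition rprof :: "(real \<Rightarrow> real) \<Rightarrow> (real \<Rightarrow> real) \<Rightarrow> real \<Rightarrow> real \<Rightarrow> bool" where
  "rprof v \<kappa> a b \<longleftrightarrow> a \<le> b \<and> reg \<kappa> a b \<and> v \<in> borel_measurable borel \<and> (\<forall>x. v x \<in> {0..1}) \<and>
     (\<exists>K. finite K \<and> (\<forall>x\<in>{a<..<b} - K. (\<kappa> has_real_derivative - v x * G x (\<kappa> x)) (at x)))"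

lemma rprof_reg: "rprof v \<kappa> a b \<Longrightarrow> reg \<kappa> a b"
  by (simp add: rprof_def)

lemma rprof_integral:
  assumes "rprof v \<kappa> a b" "a \<le> p" "p \<le> q" "q \<le> b"
  shows "((\<lambda>x. v x * G x (\<kappa> x)) has_integral (\<kappa> p - \<kappa> q)) {p..q}"
proof -
  obtain K where K: "finite K" "\<And>x. x \<in> {a<..<b} - K \<Longrightarrow> (\<kappa> has_real_derivative - v x * G x (\<kappa> x)) (at x)"
    using assms(1) unfolding rprof_def by blast
  have "continuous_on {p..q} \<kappa>"
    using reg_subset[OF rprof_reg[OF assms(1)] assms(2,4)] by (simp add: reg_def)
  moreover have "(\<kappa> has_vector_derivative - v x * G x (\<kappa> x)) (at x)" if "x \<in> {p<..<q} - K" for x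
    unfolding has_real_derivative_iff_has_vector_derivative[symmetric] using that assms by (intro K(2)) auto
  ultimately have "((\<lambda>x. - v x * G x (\<kappa> x)) has_integral (\<kappa> q - \<kappa> p)) {p..q}"
    by (intro fundamental_theorem_of_calculus_interior_strong[OF K(1) assms(3)])
  from has_integral_neg[OF this] show ?thesis by simp
qed

lemma G_nonneg: "0 < c \<Longrightarrow> 0 < s2 x c \<Longrightarrow> 0 < G x c"
  by (simp add: G_def f_pos \<mu>_pos)

lemma rprof_bound:
  assumes "rprof v \<kappa> a b" "x \<in> {a..b}"
  shows "0 \<le> v x * G x (\<kappa> x)" "v x * G x (\<kappa> x) \<le> G x (\<kappa> x)"
proof -
  have "0 < \<kappa> x" "0 < s2 x (\<kappa> x)" using rprof_reg[OF assms(1)] assms(2) unfolding reg_def by blast+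
  moreover have "0 \<le> v x" "v x \<le> 1" using assms(1) unfolding rprof_def by auto
  ultimately show "0 \<le> v x * G x (\<kappa> x)" "v x * G x (\<kappa> x) \<le> G x (\<kappa> x)"
    using G_nonneg[of "\<kappa> x" x] by (auto intro: mult_left_le_one_le)
qed

lemma rprof_prof:
  assumes "rprof v \<kappa> a b"
  shows "prof \<kappa> a b"
  unfolding prof_def
proof (intro conjI allI impI)
  fix p q assume pq: "a \<le> p" "p \<le> q" "q \<le> b"
  note int = rprof_integral[OF assms pq]
  have bd: "0 \<le> v x * G x (\<kappa> x)" "v x * G x (\<kappa> x) \<le> G x (\<kappa> x)" if "x \<in> {p..q}" for x
    using rprof_bound[OF assms, of x] that pq by auto
  show "\<kappa> q \<le> \<kappa> p" using has_integral_nonneg[OF int bd(1)] by simp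
  have "continuous_on {p..q} (\<lambda>x. G x (\<kappa> x))"
    by (intro reg_G_cont reg_subset[OF rprof_reg[OF assms]] pq)
  then show "\<kappa> p - \<kappa> q \<le> integral {p..q} (\<lambda>x. G x (\<kappa> x))"
    by (intro has_integral_le[OF int integrable_integral bd(2)] integrable_continuous_interval)
qed (rule rprof_reg[OF assms])

text \<open>Prepares the equation that recovers time from the abscissa: its right-hand side contains
  the profile and has to be Lipschitz.\<close>

lemma rprof_lipschitz:
  assumes "rprof v \<kappa> a b"
  shows "\<exists>L>0. \<forall>p\<in>{a..b}. \<forall>q\<in>{a..b}. \<bar>\<kappa> p - \<kappa> q\<bar> \<le> L * \<bar>p - q\<bar>"
proof -
  have "compact ((\<lambda>x. G x (\<kappa> x)) ` {a..b})"
    by (intro compact_continuous_image reg_G_cont rprof_reg[OF assms]) auto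
  then obtain B where B: "\<And>x. x \<in> {a..b} \<Longrightarrow> \<bar>G x (\<kappa> x)\<bar> \<le> B"
    unfolding compact_eq_bounded_closed bounded_iff by force
  define L where "L = max 1 B"
  have L: "\<bar>\<kappa> p - \<kappa> q\<bar> \<le> L * (q - p)" if "a \<le> p" "p \<le> q" "q \<le> b" for p q
  proof -
    have "norm (v x * G x (\<kappa> x)) \<le> L" if x: "x \<in> {p..q}" for x
    proof -
      have x': "x \<in> {a..b}" using x \<open>a \<le> p\<close> \<open>q \<le> b\<close> by auto
      show ?thesis using rprof_bound[OF assms x'] B[OF x'] by (auto simp: L_def)
    qed
    then have "norm (\<kappa> p - \<kappa> q) \<le> L * measure lborel {p..q}"
      by (intro has_integral_bound_real[OF _ _ rprof_integral[OF assms that]] ) (auto simp: L_def)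
    then show ?thesis using that by simp
  qed
  have "\<bar>\<kappa> p - \<kappa> q\<bar> \<le> L * \<bar>p - q\<bar>" if "p \<in> {a..b}" "q \<in> {a..b}" for p q
    using L[of p q] L[of q p] that by (cases "p \<le> q") (auto simp: abs_minus_commute)
  moreover have "L > 0" by (simp add: L_def)
  ultimately show ?thesis by blast
qed

lemma exp_min_lipschitz:
  fixes x y l :: real
  shows "\<bar>exp (min x l) - exp (min y l)\<bar> \<le> exp l * \<bar>x - y\<bar>"
proof -
  have "norm (exp (min x l) - exp (min y l)) \<le> exp l * norm (min x l - min y l)"
    by (rule field_differentiable_bound[of "{..l}" exp exp]) (auto intro!: derivative_eq_intros)
  also have "\<dots> \<le> exp l * \<bar>x - y\<bar>" by (intro mult_left_mono) auto
  finally show ?thesis by simp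
qed

text \<open>Inverts the passage to profiles: the abscissa as a function of time when
  \<open>S1\<close> is prescribed as \<open>k x\<close>. Truncations make the field globally
  Lipschitz; \<open>S2\<close> cannot reach 0, since that would be an equilibrium reached in finite
  time.\<close>

lemma biomass_flow:
  assumes lip: "0 \<le> L" "\<And>x y. \<bar>k x - k y\<bar> \<le> L * \<bar>x - y\<bar>" and k: "\<And>x. 0 < k x" and s0: "0 < s2 a (k a)"
  shows "\<exists>x. x 0 = a \<and> (\<forall>t. isCont x t) \<and> (\<forall>t\<ge>0. 0 < s2 (x t) (k (x t)) \<and> (x has_real_derivative \<mu> (s2 (x t) (k (x t)))) (at t))"
proof -
  define sc where "sc x = max 0 (min M (M - k x - exp (min x (ln M))))" for x
  have sc: "sc x \<in> {0..M}" for x using M_pos by (auto simp: sc_def)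
  have sc_lip: "\<bar>sc x - sc y\<bar> \<le> (L + M) * \<bar>x - y\<bar>" for x y
  proof -
    have "\<bar>sc x - sc y\<bar> \<le> \<bar>k x - k y\<bar> + \<bar>exp (min x (ln M)) - exp (min y (ln M))\<bar>"
    proof -
      have *: "\<bar>max 0 (min M p) - max 0 (min M q)\<bar> \<le> \<bar>p - q\<bar>" for p q
        by (simp add: max_def min_def abs_if)
      have "\<bar>(M - k x - exp (min x (ln M))) - (M - k y - exp (min y (ln M)))\<bar>
        \<le> \<bar>k x - k y\<bar> + \<bar>exp (min x (ln M)) - exp (min y (ln M))\<bar>"
        using abs_triangle_ineq4[of "k y - k x" "exp (min x (ln M)) - exp (min y (ln M))"]
        by (simp add: algebra_simps abs_minus_commute)
      then show ?thesis unfolding sc_def by (rule order_trans[OF *])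
    qed
    also have "\<dots> \<le> L * \<bar>x - y\<bar> + exp (ln M) * \<bar>x - y\<bar>"
      by (intro add_mono lip exp_min_lipschitz)
    finally show ?thesis using M_pos by (simp add: algebra_simps)
  qed
  obtain Lm where Lm: "Lm > 0" "\<And>a b. a \<in> {0..M} \<Longrightarrow> b \<in> {0..M} \<Longrightarrow> \<bar>\<mu> a - \<mu> b\<bar> \<le> Lm * \<bar>a - b\<bar>"
    using \<mu>_lipschitz by blast
  define K where "K = Lm * (L + M)"
  have K: "K > 0" using Lm lip M_pos by (auto simp: K_def)
  define F where "F x = \<mu> (sc x)" for x
  have F_lip: "\<bar>F x - F y\<bar> \<le> K * \<bar>x - y\<bar>" for x y
  proof -
    have "\<bar>F x - F y\<bar> \<le> Lm * \<bar>sc x - sc y\<bar>" unfolding F_def by (intro Lm sc)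
    also have "\<dots> \<le> Lm * ((L + M) * \<bar>x - y\<bar>)" using Lm by (intro mult_left_mono sc_lip) auto
    finally show ?thesis by (simp add: K_def mult_ac)
  qed
  have F_nn: "0 \<le> F x" "F x \<le> \<mu> S2s" for x using sc[of x] \<mu>_nonneg \<mu>_max by (auto simp: F_def)
  have "K-lipschitz_on UNIV F" using F_lip K by (intro lipschitz_onI) (auto simp: dist_real_def)
  then have "continuous_on UNIV F" by (rule lipschitz_on_continuous_on)
  then have cF: "continuous_on UNIV (\<lambda>(t :: real, y). F y)"
    using continuous_on_compose2[of UNIV F UNIV snd] by (simp add: case_prod_beta continuous_on_snd continuous_on_id)
  have Fb: "\<bar>F y\<bar> \<le> \<mu> S2s" for y using F_nn[of y] by simp
  obtain x where x0: "x 0 = a" and dx: "\<And>t. (x has_real_derivative F (x t)) (at t)"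
    using picard[of "\<lambda>t y. F y", OF cF F_lip K Fb, of 0 a] by blast
  have cx: "isCont x t" for t using dx by (rule DERIV_isCont)
  have mono: "x p \<le> x q" if "p \<le> q" for p q
    by (rule nonneg_deriv_imp_le[OF that, of x "\<lambda>t. F (x t)"]) (auto intro: has_field_derivative_at_within dx F_nn)
  have s2lim: "sc y = s2 y (k y)" if "0 \<le> s2 y (k y)" for y
  proof -
    have "exp y < M" using that k[of y] unfolding s2_def by linarith
    then have "y < ln M" by (metis M_pos exp_less_mono exp_ln not_less_iff_gr_or_eq linorder_less_linear)
    then have "min y (ln M) = y" by simp
    moreover have "0 \<le> M - k y - exp y" "M - k y - exp y \<le> M"
      using that k[of y] exp_gt_zero[of y] unfolding s2_def by linarith+
    ultimately show ?thesis unfolding sc_def s2_def by (simp add: min_absorb2 max_absorb2)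
  qed
  have "continuous_on UNIV k"
  proof -
    have "L-lipschitz_on UNIV k" using lip by (intro lipschitz_onI) (auto simp: dist_real_def)
    then show ?thesis by (rule lipschitz_on_continuous_on)
  qed
  moreover have "continuous_on UNIV x" using cx by (simp add: continuous_at_imp_continuous_on)
  ultimately have ck: "continuous_on UNIV (\<lambda>t. k (x t))"
    by (rule continuous_on_compose2) auto
  have pos: "0 < s2 (x t) (k (x t))" if t: "0 \<le> t" for t
  proof (rule ccontr)
    assume "\<not> ?thesis"
    moreover have "continuous_on {0..t} (\<lambda>t. s2 (x t) (k (x t)))"
      unfolding s2_def by (intro continuous_intros continuous_on_subset[OF ck] continuous_at_imp_continuous_on) (auto intro: cx)
    ultimately obtain q where q: "0 \<le> q" "q \<le> t" "s2 (x q) (k (x q)) = 0"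
      using IVT2'[of "\<lambda>t. s2 (x t) (k (x t))" t 0 0] s0 t by (auto simp: x0)
    have Fq: "F (x q) = 0" using s2lim[of "x q"] q by (simp add: F_def \<mu>_0)
    \<comment> \<open>The distance to the equilibrium satisfies a backward Gronwall inequality
      ending in 0, so \<open>x\<close> is constant on \<open>{0..q}\<close> and \<open>S2\<close>
      would vanish already at time 0.\<close>
    have "x q - x 0 \<le> 0 * exp (K * (q - 0))"
    proof (rule gronwall_backward[of 0 q "\<lambda>t. x q - x t" K 0 0])
      show "continuous_on {0..q} (\<lambda>t. x q - x t)"
        by (intro continuous_intros continuous_at_imp_continuous_on) (auto intro: cx)
      show "x q - x s \<le> 0 + K * integral {s..q} (\<lambda>t. x q - x t)" if s: "s \<in> {0..q}" for s
      proof -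
        have "((\<lambda>t. F (x t)) has_integral (x q - x s)) {s..q}"
          using s by (intro fundamental_theorem_of_calculus)
            (auto simp: has_real_derivative_iff_has_vector_derivative[symmetric] intro: has_field_derivative_at_within dx)
        moreover have "((\<lambda>t. K * (x q - x t)) has_integral integral {s..q} (\<lambda>t. K * (x q - x t))) {s..q}"
          by (intro integrable_integral integrable_continuous_interval continuous_intros continuous_at_imp_continuous_on) (auto intro: cx)
        moreover have "F (x r) \<le> K * (x q - x r)" if "r \<in> {s..q}" for r
          using F_lip[of "x r" "x q"] mono[of r q] that F_nn(1)[of "x r"] by (simp add: Fq)
        ultimately have "x q - x s \<le> integral {s..q} (\<lambda>t. K * (x q - x t))" by (rule has_integral_le)
        then show ?thesis by simp
      qed
    qed (use K q in auto)
    then have "x 0 = x q" using mono[of 0 q] q by simp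
    then show False using q s0 by (simp add: x0)
  qed
  have "(x has_real_derivative \<mu> (s2 (x t) (k (x t)))) (at t)" if "0 \<le> t" for t
    using dx[of t] s2lim[of "x t"] pos[OF that] by (simp add: F_def)
  then show ?thesis using x0 cx pos by blast
qed

text \<open>A trajectory is defined for all times, so beyond \<open>b\<close> the profile is
  continued by a constant with control 0. Before \<open>b\<close> the control is given at each
  single time, which serves to recognise singular arcs.\<close>

lemma rprof_realize:
  assumes rp: "rprof v \<kappa> a b"
  shows "\<exists>u S1 S2. trajectory M f \<mu> u S1 S2 \<and> S1 0 = \<kappa> a \<and> S2 0 = s2 a (\<kappa> a) \<and>
    (\<forall>t\<in>{0..cost \<kappa> a b}. \<exists>x\<in>{a..b}. cost \<kappa> a x = t \<and> S1 t = \<kappa> x \<and> S2 t = s2 x (\<kappa> x) \<and> (x < b \<longrightarrow> u t = v x))"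
proof -
  have ab: "a \<le> b" and reg: "reg \<kappa> a b" and vm: "v \<in> borel_measurable borel" and v01: "\<And>x. v x \<in> {0..1}"
    using rp by (auto simp: rprof_def)
  obtain K where K: "finite K" "\<And>x. x \<in> {a<..<b} - K \<Longrightarrow> (\<kappa> has_real_derivative - v x * G x (\<kappa> x)) (at x)"
    using rp unfolding rprof_def by blast
  obtain L where L: "L > 0" "\<And>p q. p \<in> {a..b} \<Longrightarrow> q \<in> {a..b} \<Longrightarrow> \<bar>\<kappa> p - \<kappa> q\<bar> \<le> L * \<bar>p - q\<bar>"
    using rprof_lipschitz[OF rp] by blast
  define pr where "pr x = max a (min b x)" for x
  have pr: "pr x \<in> {a..b}" for x using ab by (auto simp: pr_def)
  have pr_id: "pr x = x" if "x \<in> {a..b}" for x using that by (auto simp: pr_def)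
  define k where "k x = \<kappa> (pr x)" for x
  have k_lip: "\<bar>k x - k y\<bar> \<le> L * \<bar>x - y\<bar>" for x y
  proof -
    have "\<bar>k x - k y\<bar> \<le> L * \<bar>pr x - pr y\<bar>" unfolding k_def by (intro L pr)
    also have "\<dots> \<le> L * \<bar>x - y\<bar>" using L(1) by (intro mult_left_mono) (auto simp: pr_def)
    finally show ?thesis .
  qed
  have k_pos: "0 < k x" for x using reg pr[of x] unfolding reg_def k_def by blast
  have k_id: "k x = \<kappa> x" if "x \<in> {a..b}" for x using pr_id[OF that] by (simp add: k_def)
  have s0: "0 < s2 a (k a)" using reg ab by (simp add: k_id reg_def)
  obtain x where x0: "x 0 = a" and cx: "\<And>t. isCont x t"
    and sp: "\<And>t. 0 \<le> t \<Longrightarrow> 0 < s2 (x t) (k (x t))"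
    and dx: "\<And>t. 0 \<le> t \<Longrightarrow> (x has_real_derivative \<mu> (s2 (x t) (k (x t)))) (at t)"
    using biomass_flow[of L k a, OF _ k_lip k_pos s0] L(1) by auto
  have mono: "x p < x q" if "0 \<le> p" "p < q" for p q
  proof (rule DERIV_pos_imp_increasing_open[OF that(2)])
    show "\<exists>y. (x has_real_derivative y) (at t) \<and> 0 < y" if "p < t" "t < q" for t
      using dx[of t] \<mu>_pos[OF sp[of t]] that \<open>0 \<le> p\<close> by auto
    show "continuous_on {p..q} x" using cx by (simp add: continuous_at_imp_continuous_on)
  qed
  have inj: "inj_on x {0..}"
    by (rule inj_onI) (metis atLeast_iff linorder_neqE_linordered_idom mono order_less_irrefl)
  have ge_a: "a \<le> x t" if "0 \<le> t" for t using mono[of 0 t] that x0 by (cases "t = 0") auto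
  define S1 where "S1 t = k (x t)" for t
  define S2 where "S2 t = s2 (x t) (k (x t))" for t
  define u where "u t = (if x t < b then v (x t) else 0)" for t
  have X: "M - S1 t - S2 t = exp (x t)" for t by (simp add: S1_def S2_def s2_def)
  have cX: "continuous_on UNIV x" using cx by (simp add: continuous_at_imp_continuous_on)
  have "continuous_on UNIV k"
  proof -
    have "L-lipschitz_on UNIV k" using k_lip L(1) by (intro lipschitz_onI) (auto simp: dist_real_def)
    then show ?thesis by (rule lipschitz_on_continuous_on)
  qed
  then have cS1: "continuous_on UNIV S1"
    unfolding S1_def by (rule continuous_on_compose2[OF _ cX]) auto
  have xm': "x \<in> borel_measurable borel" by (rule borel_measurable_continuous_onI[OF cX])
  have "u \<in> borel_measurable borel"
    unfolding u_def using measurable_compose[OF xm' vm] xm' by measurable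
  then have um: "u \<in> borel_measurable (lebesgue_on {0..})"
    by (intro measurable_restrict_space1) (simp add: measurable_completion)
  have dS1: "(S1 has_real_derivative - u t * f (S1 t)) (at t)" if t: "0 < t" "x t \<notin> insert b K" for t
  proof (cases "x t < b")
    case True
    have at: "a < x t" using mono[of 0 t] t x0 by simp
    have kx: "k (x t) = \<kappa> (x t)" using at True by (intro k_id) auto
    have "(\<kappa> has_real_derivative - v (x t) * G (x t) (\<kappa> (x t))) (at (x t))"
      using K(2)[of "x t"] at True t by auto
    then have "(k has_real_derivative - v (x t) * G (x t) (\<kappa> (x t))) (at (x t))"
      by (rule has_field_derivative_transform_within_open[where S = "{a<..<b}"]) (use at True k_id in auto)
    from DERIV_chain2[OF this dx[of t]] have "(S1 has_real_derivative - v (x t) * G (x t) (\<kappa> (x t)) * \<mu> (s2 (x t) (k (x t)))) (at t)"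
      unfolding S1_def[abs_def] using t by simp
    moreover have "0 < \<mu> (s2 (x t) (k (x t)))" using sp[of t] t by (intro \<mu>_pos) simp
    ultimately show ?thesis using True by (simp add: u_def S1_def G_def kx)
  next
    case False
    then have bt: "b < x t" using t by auto
    have "((\<lambda>_. \<kappa> b) has_real_derivative 0) (at (x t))" by simp
    then have "(k has_real_derivative 0) (at (x t))"
      by (rule has_field_derivative_transform_within_open[where S = "{b<..}"]) (use bt ab in \<open>auto simp: k_def pr_def\<close>)
    from DERIV_chain2[OF this dx[of t]] have "(S1 has_real_derivative 0) (at t)"
      unfolding S1_def[abs_def] using t by simp
    then show ?thesis using False by (simp add: u_def)
  qed
  \<comment> \<open>The profile fails to be differentiable at finitely many abscissas;
    \<open>x\<close> is injective, so these are finitely many times, which the strong form of the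
    fundamental theorem tolerates.\<close>
  have int1: "((\<lambda>s. - u s * f (S1 s)) has_integral (S1 t - S1 0)) {0..t}" if t: "0 \<le> t" for t
  proof (rule fundamental_theorem_of_calculus_interior_strong[OF _ t])
    show "finite {s \<in> {0..}. x s \<in> insert b K}"
      using finite_vimage_IntI[OF _ inj, of "insert b K"] K(1)
      by (auto simp: vimage_def Int_def conj_commute)
    show "(S1 has_vector_derivative - u s * f (S1 s)) (at s)" if "s \<in> {0<..<t} - {s \<in> {0..}. x s \<in> insert b K}" for s
      unfolding has_real_derivative_iff_has_vector_derivative[symmetric] using that by (intro dS1) auto
    show "continuous_on {0..t} S1" by (rule continuous_on_subset[OF cS1]) simp
  qed
  have int2: "((\<lambda>s. u s * f (S1 s) - \<mu> (S2 s) * (M - S1 s - S2 s)) has_integral (S2 t - S2 0)) {0..t}" if t: "0 \<le> t" for t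
  proof -
    \<comment> \<open>The equation for \<open>S2\<close> follows from the one for
      \<open>M - S1 - S2 = exp (x t)\<close> together with the one for \<open>S1\<close>.\<close>
    have "((\<lambda>s. \<mu> (S2 s) * (M - S1 s - S2 s)) has_integral (exp (x t) - exp (x 0))) {0..t}"
    proof (rule fundamental_theorem_of_calculus[OF t])
      fix s assume s: "s \<in> {0..t}"
      have "((\<lambda>s. exp (x s)) has_real_derivative exp (x s) * \<mu> (s2 (x s) (k (x s)))) (at s within {0..t})"
        by (rule has_field_derivative_at_within, rule DERIV_chain2[where f = exp and g = x, OF DERIV_exp dx])
          (use s in simp)
      then show "((\<lambda>s. exp (x s)) has_vector_derivative \<mu> (S2 s) * (M - S1 s - S2 s)) (at s within {0..t})"
        unfolding has_real_derivative_iff_has_vector_derivative[symmetric] X by (simp add: S2_def S1_def mult.commute)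
    qed
    from has_integral_neg[OF has_integral_add[OF int1[OF t] this]]
    have "((\<lambda>s. - (- u s * f (S1 s) + \<mu> (S2 s) * (M - S1 s - S2 s))) has_integral - (S1 t - S1 0 + (exp (x t) - exp (x 0)))) {0..t}" .
    moreover have "- (S1 t - S1 0 + (exp (x t) - exp (x 0))) = S2 t - S2 0"
      using X[of t] X[of 0] by linarith
    moreover have "(\<lambda>s. - (- u s * f (S1 s) + \<mu> (S2 s) * (M - S1 s - S2 s)))
      = (\<lambda>s. u s * f (S1 s) - \<mu> (S2 s) * (M - S1 s - S2 s))" by (simp add: fun_eq_iff)
    ultimately show ?thesis by (simp only:)
  qed
  have "trajectory M f \<mu> u S1 S2"
    unfolding trajectory_def
  proof (intro conjI allI impI um int1 int2)
    show "u t \<in> {0..1}" for t using v01[of "x t"] by (simp add: u_def)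
    show "(S1 t, S2 t) \<in> state_domain M" if "0 \<le> t" for t
    proof -
      have "0 < S1 t" "0 < S2 t" using k_pos sp[OF that] by (simp_all add: S1_def S2_def)
      moreover have "S1 t + S2 t < M" using exp_gt_zero[of "x t"] X[of t] by linarith
      ultimately show ?thesis by (simp add: state_domain_def)
    qed
  qed
  moreover have "\<exists>y\<in>{a..b}. cost \<kappa> a y = t \<and> S1 t = \<kappa> y \<and> S2 t = s2 y (\<kappa> y) \<and> (y < b \<longrightarrow> u t = v y)"
    if t: "t \<in> {0..cost \<kappa> a b}" for t
  proof -
    have along: "cost \<kappa> a (x r) = r" if r: "0 \<le> r" "x r \<le> b" for r
    proof (rule cost_along[where x = x, OF reg r(1) x0])
      fix s assume s: "s \<in> {0..r}"
      then have "x s \<le> x r" using mono[of s r] by (cases "s = r") auto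
      then show xs: "x s \<in> {a..b}" using ge_a[of s] s r by auto
      show "(x has_real_derivative \<mu> (s2 (x s) (\<kappa> (x s)))) (at s within {0..r})"
        by (rule has_field_derivative_at_within) (use dx[of s] s k_id[OF xs] in simp)
    qed
    have "x t \<le> b"
    proof (rule ccontr)
      assume nb: "\<not> x t \<le> b"
      then obtain r where r: "0 \<le> r" "r \<le> t" "x r = b"
        using IVT'[of x 0 b t] continuous_on_subset[OF cX] x0 ab t by auto
      then have "cost \<kappa> a b = r" using along[of r] by simp
      moreover have "r \<noteq> t" using r nb by auto
      ultimately show False using r t by auto
    qed
    then have "x t \<in> {a..b}" using ge_a[of t] t by auto
    then show ?thesis using along[of t] t \<open>x t \<le> b\<close>
      by (intro bexI[of _ "x t"]) (auto simp: S1_def S2_def u_def k_id)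
  qed
  ultimately show ?thesis
    using x0 ab by (intro exI[of _ u] exI[of _ S1] exI[of _ S2]) (auto simp: S1_def S2_def k_id)
qed

subsection \<open>The fastest profiles\<close>

text \<open>
  The clamp below \<open>cm\<close> does not affect profiles that end at \<open>S1 \<ge> cm\<close>. On these, \<open>beta cm b\<close> is
  the curve of control 1 that meets the line \<open>S2 = S2s\<close> at \<open>b\<close>, \<open>mcurve cm b\<close> follows the line
  instead as long as the curve lies on the side \<open>S2 < S2s\<close> and \<open>x < b\<close>, and \<open>kap cm y b c\<close>
  consists of an arc of control 0 at \<open>S1 = y\<close>, a piece of \<open>mcurve cm b\<close>, and an arc of control 0
  at \<open>S1 = c\<close>.
\<close>

definition m0 :: "real \<Rightarrow> real" where "m0 cm = min (f cm / M) (\<mu> M)"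

definition Gb :: "real \<Rightarrow> real \<Rightarrow> real \<Rightarrow> real" where "Gb cm = Gc cm (m0 cm)"

definition beta :: "real \<Rightarrow> real \<Rightarrow> real \<Rightarrow> real" where
  "beta cm b = (SOME \<beta>. \<beta> b = E b \<and> (\<forall>x. (\<beta> has_real_derivative - Gb cm x (\<beta> x)) (at x)))"

definition mcurve :: "real \<Rightarrow> real \<Rightarrow> real \<Rightarrow> real" where
  "mcurve cm b x = beta cm b x - max 0 (beta cm b (min x b) - E (min x b))"

definition kap :: "real \<Rightarrow> real \<Rightarrow> real \<Rightarrow> real \<Rightarrow> real \<Rightarrow> real" where
  "kap cm y b c x = min y (max c (mcurve cm b x))"

section \<open>Curves of control 1 and their position relative to the line\<close>

context
  fixes cm :: real
  assumes cm_pos: "0 < cm" and cm_le: "cm \<le> S1m"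
begin

lemma cm_M: "cm \<le> M"
  using cm_le S1m(2) S2s_pos by linarith

lemma m0_pos: "0 < m0 cm"
  using f_pos[OF cm_pos] \<mu>_pos[OF M_pos] M_pos by (simp add: m0_def)

text \<open>The two terms of \<open>m0\<close> have separate purposes. Being at most
  \<open>\<mu> M\<close>, the clamp does not act for \<open>S2\<close> between \<open>S2s\<close>
  and \<open>M\<close>. And \<open>m0 cm * M \<le> f cm\<close> makes the slope at least
  \<open>M\<close> wherever it acts, hence at least \<open>exp x\<close> for
  \<open>x \<le> ln M\<close>, so that \<open>S2\<close> does not decrease there.\<close>

lemma m0_le: "m0 cm \<le> \<mu> M" "m0 cm * M \<le> f cm" "m0 cm < \<mu> S2s"
proof -
  show "m0 cm \<le> \<mu> M" by (simp add: m0_def)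
  then show "m0 cm < \<mu> S2s" using \<mu>_greater[of S2s M] S2s_less by simp
  have "m0 cm \<le> f cm / M" by (simp add: m0_def)
  then show "m0 cm * M \<le> f cm" using M_pos by (simp add: field_simps)
qed

lemma Gb_pos: "0 < Gb cm x c"
  unfolding Gb_def by (rule Gc_bounds[OF cm_pos cm_M m0_pos])

lemma beta_ex: "\<exists>\<beta>. \<beta> p = e \<and> (\<forall>x. (\<beta> has_real_derivative - Gb cm x (\<beta> x)) (at x))"
proof -
  obtain K where K: "K > 0" "\<And>x c d. \<bar>Gb cm x c - Gb cm x d\<bar> \<le> K * \<bar>c - d\<bar>"
    using Gc_lipschitz[OF cm_pos cm_M m0_pos] unfolding Gb_def by blast
  show ?thesis
  proof (rule picard)
    show "continuous_on UNIV (\<lambda>(x, c). - Gb cm x c)"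
      using continuous_on_minus[OF Gc_cont[OF cm_pos cm_M m0_pos]] by (simp add: Gb_def case_prod_beta)
    show "\<bar>- Gb cm t y - - Gb cm t z\<bar> \<le> K * \<bar>y - z\<bar>" for t y z
      using K(2)[of t y z] by linarith
    show "\<bar>- Gb cm t y\<bar> \<le> f M / m0 cm" for t y
      using Gb_pos[of t y] Gc_bounds(2)[OF cm_pos cm_M m0_pos, of t y] by (simp add: Gb_def)
  qed (rule K)
qed

lemma beta_b [simp]: "beta cm b b = E b"
  and beta_deriv: "(beta cm b has_real_derivative - Gb cm x (beta cm b x)) (at x)"
  using someI_ex[OF beta_ex[of b "E b"]] unfolding beta_def by blast+

text \<open>One constant \<open>K\<close> for all curves of the flow, so that curves with different
  crossing points are compared with a uniform exponential factor.\<close>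

lemma beta_dist:
  "\<exists>K>0. \<forall>\<beta> \<gamma>. (\<forall>x. (\<beta> has_real_derivative - Gb cm x (\<beta> x)) (at x)) \<longrightarrow>
     (\<forall>x. (\<gamma> has_real_derivative - Gb cm x (\<gamma> x)) (at x)) \<longrightarrow>
     (\<forall>x p. \<bar>\<beta> x - \<gamma> x\<bar> \<le> \<bar>\<beta> p - \<gamma> p\<bar> * exp (K * \<bar>x - p\<bar>))"
proof -
  obtain K where K: "K > 0" "\<And>x c d. \<bar>Gb cm x c - Gb cm x d\<bar> \<le> K * \<bar>c - d\<bar>"
    using Gc_lipschitz[OF cm_pos cm_M m0_pos] unfolding Gb_def by blast
  have K': "\<bar>- Gb cm x c - - Gb cm x d\<bar> \<le> K * \<bar>c - d\<bar>" for x c d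
    using K(2)[of x c d] by linarith
  show ?thesis
    using solution_distance[where F = "\<lambda>x c. - Gb cm x c", OF _ _ K'] K(1) by blast
qed

lemma beta_unique:
  assumes "\<And>x. (\<beta> has_real_derivative - Gb cm x (\<beta> x)) (at x)" "\<And>x. (\<gamma> has_real_derivative - Gb cm x (\<gamma> x)) (at x)"
    and "\<beta> p = \<gamma> p"
  shows "\<beta> x = \<gamma> x"
proof -
  obtain K where "\<bar>\<beta> x - \<gamma> x\<bar> \<le> \<bar>\<beta> p - \<gamma> p\<bar> * exp (K * \<bar>x - p\<bar>)"
    using beta_dist assms(1,2) by blast
  then show ?thesis using assms(3) by simp
qed

text \<open>Beyond \<open>xm\<close> the line lies at \<open>S1 \<le> S1m\<close>, where
  \<open>f\<close> is at most \<open>f S1m\<close>. Control 1 is thus too weak to follow the line,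
  whose slope is \<open>exp x \<ge> exp xm\<close>.\<close>

lemma Gb_E: "xm \<le> x \<Longrightarrow> Gb cm x (E x) \<le> exp xm"
proof -
  assume x: "xm \<le> x"
  have "E x \<le> S1m" using E_le[of x xm] x by (simp add: E_xm)
  then have "f (max cm (min M (E x))) \<le> f S1m" using cm_pos cm_le by (intro f_le) auto
  moreover have "max (m0 cm) (\<mu> (max 0 (min M (s2 x (E x))))) = \<mu> S2s"
    using m0_le S2s_pos S2s_less by simp
  ultimately show ?thesis using S1m(3) \<mu>_S2s_pos by (simp add: Gb_def Gc_def exp_xm field_simps)
qed

lemma Gb_cont_comp: "continuous_on X g \<Longrightarrow> continuous_on X (\<lambda>x. Gb cm x (g x))"
  unfolding Gb_def by (rule Gc_cont_comp[OF cm_pos cm_M m0_pos])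

lemma Gb_eq:
  assumes "cm \<le> c" "0 < s2 x c" "m0 cm \<le> \<mu> (s2 x c)"
  shows "Gb cm x c = G x c"
proof -
  have "c \<le> M \<and> s2 x c \<le> M" using assms(1,2) cm_pos exp_gt_zero[of x] unfolding s2_def by linarith
  then show ?thesis unfolding Gb_def using assms by (intro Gc_eq) auto
qed

lemma Gb_eq_left:
  assumes "cm \<le> c" "c \<le> E x"
  shows "Gb cm x c = G x c"
proof (rule Gb_eq[OF assms(1)])
  have s: "S2s \<le> s2 x c" using assms(2) by (simp add: le_E_iff)
  then show "0 < s2 x c" using S2s_pos by simp
  have "s2 x c < M" using assms(1) cm_pos exp_gt_zero[of x] unfolding s2_def by linarith
  then have "\<mu> M \<le> \<mu> (s2 x c)" using s by (intro \<mu>_ge) auto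
  then show "m0 cm \<le> \<mu> (s2 x c)" using m0_le by simp
qed

context
  fixes \<beta> :: "real \<Rightarrow> real"
  assumes d\<beta>: "\<And>x. (\<beta> has_real_derivative - Gb cm x (\<beta> x)) (at x)"
begin

lemma curve_cont: "continuous_on X \<beta>"
  by (rule DERIV_continuous_on) (rule has_field_derivative_at_within[OF d\<beta>])

lemma curve_less: "x < y \<Longrightarrow> \<beta> y < \<beta> x"
proof -
  assume "x < y"
  then have "- \<beta> x < - \<beta> y"
  proof (rule DERIV_pos_imp_increasing)
    show "\<exists>d. ((\<lambda>x. - \<beta> x) has_real_derivative d) (at t) \<and> 0 < d" for t
      using DERIV_minus[OF d\<beta>[of t]] Gb_pos by auto
  qed
  then show ?thesis by simp
qed

lemma curve_le: "x \<le> y \<Longrightarrow> \<beta> y \<le> \<beta> x"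
  using curve_less[of x y] by (cases "x = y") auto

lemma curve_integral: "p \<le> q \<Longrightarrow> integral {p..q} (\<lambda>x. Gb cm x (\<beta> x)) = \<beta> p - \<beta> q"
  by (rule integral_slope) (auto intro!: Gb_cont_comp curve_cont has_field_derivative_at_within d\<beta>)

text \<open>
  Where \<open>\<mu> S2\<close> is below the clamp, the curve is steeper than the lines of constant \<open>S2\<close>, so that
  \<open>S2\<close> increases along it.
\<close>

lemma curve_s2_lower:
  assumes b: "S2s \<le> s2 b (\<beta> b)" and x: "b \<le> x" "x \<le> ln M"
  shows "0 < s2 x (\<beta> x)" "cm \<le> \<beta> x \<Longrightarrow> m0 cm \<le> \<mu> (s2 x (\<beta> x))"
proof -
  have "\<mu> 0 \<le> m0 cm" "m0 cm \<le> \<mu> S2s" using m0_pos m0_le \<mu>_0 by auto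
  then obtain sm where sm: "0 \<le> sm" "sm \<le> S2s" "\<mu> sm = m0 cm"
    using IVT'[of \<mu> 0 "m0 cm" S2s] S2s_pos continuous_on_subset[OF \<mu>_cont, of "{0..S2s}"] by auto
  have smp: "0 < sm" using sm m0_pos \<mu>_0 by (cases "sm = 0") auto
  have ge: "sm \<le> s2 x (\<beta> x)"
  proof (rule ccontr)
    let ?h = "\<lambda>x. sm - s2 x (\<beta> x)"
    assume "\<not> ?thesis"
    then have "0 < ?h x" by simp
    moreover have "continuous_on {b..x} ?h" by (intro continuous_intros s2_cont curve_cont)
    ultimately obtain p where p: "b \<le> p" "p < x" "?h p = 0" "\<And>t. p < t \<Longrightarrow> t \<le> x \<Longrightarrow> 0 < ?h t"
      using last_zero[of b x ?h] b sm x(1) by auto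
    have "s2 p (\<beta> p) \<le> s2 x (\<beta> x)"
    proof (rule nonneg_deriv_imp_le[of p x "\<lambda>t. s2 t (\<beta> t)" "\<lambda>t. Gb cm t (\<beta> t) - exp t"])
      show "p \<le> x" using p by simp
      show "((\<lambda>t. s2 t (\<beta> t)) has_real_derivative (Gb cm t (\<beta> t) - exp t)) (at t within {p..x})" for t
        unfolding s2_def by (rule derivative_eq_intros has_field_derivative_at_within[OF d\<beta>] refl | simp)+
      show "0 \<le> Gb cm t (\<beta> t) - exp t" if t: "t \<in> {p..x}" for t
      proof -
        let ?s = "max 0 (min M (s2 t (\<beta> t)))"
        have "s2 t (\<beta> t) \<le> sm" using p(3) p(4)[of t] t by (cases "t = p") auto
        then have "\<mu> ?s \<le> \<mu> sm" using sm by (intro \<mu>_le) auto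
        then have m: "max (m0 cm) (\<mu> ?s) = m0 cm" using sm by simp
        have "exp t \<le> exp (ln M)" using t x(2) by simp
        then have "exp t \<le> M" using M_pos by simp
        then have "exp t * m0 cm \<le> M * m0 cm" using m0_pos by simp
        also have "\<dots> \<le> f cm" using m0_le(2) by (simp add: mult.commute)
        also have "\<dots> \<le> f (max cm (min M (\<beta> t)))" using cm_pos by (intro f_le) auto
        finally have "exp t \<le> Gb cm t (\<beta> t)"
          unfolding Gb_def Gc_def m using m0_pos by (simp add: field_simps)
        then show ?thesis by simp
      qed
    qed
    then show False using p(3) \<open>0 < ?h x\<close> by simp
  qed
  then show "0 < s2 x (\<beta> x)" using smp by simp
  assume cx: "cm \<le> \<beta> x"
  show "m0 cm \<le> \<mu> (s2 x (\<beta> x))"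
  proof (cases "s2 x (\<beta> x) \<le> S2s")
    case True
    then show ?thesis using \<mu>_le[of sm "s2 x (\<beta> x)"] sm ge by simp
  next
    case False
    have "s2 x (\<beta> x) < M" using cx cm_pos exp_gt_zero[of x] unfolding s2_def by linarith
    then show ?thesis using \<mu>_ge[of "s2 x (\<beta> x)" M] False m0_le(1) by simp
  qed
qed

lemma curve_true_right:
  assumes "S2s \<le> s2 b (\<beta> b)" "b \<le> x" "x \<le> ln M" "cm \<le> \<beta> x"
  shows "Gb cm x (\<beta> x) = G x (\<beta> x)"
  using curve_s2_lower[OF assms(1-3)] assms(4) by (intro Gb_eq) auto

text \<open>By \<open>Gb_E\<close> the line falls at least as fast as the field on it, so it is a
  lower barrier beyond \<open>xm\<close>. Gronwall takes the place of a strict inequality, which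
  fails at \<open>xm\<close> itself, where both slopes agree.\<close>

lemma curve_ge_E:
  assumes p: "xm \<le> p" "E p \<le> \<beta> p" and x: "p \<le> x"
  shows "E x \<le> \<beta> x"
proof (rule ccontr)
  let ?h = "\<lambda>x. E x - \<beta> x"
  assume "\<not> ?thesis"
  moreover have ch: "continuous_on X ?h" for X by (intro continuous_intros E_cont curve_cont)
  ultimately obtain q where q: "p \<le> q" "q < x" "?h q = 0" "\<And>t. q < t \<Longrightarrow> t \<le> x \<Longrightarrow> 0 < ?h t"
    using last_zero[of p x ?h] p x by auto
  obtain K where K: "K > 0" "\<And>x c d. \<bar>Gb cm x c - Gb cm x d\<bar> \<le> K * \<bar>c - d\<bar>"
    using Gc_lipschitz[OF cm_pos cm_M m0_pos] unfolding Gb_def by blast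
  have "?h x \<le> 0 * exp (K * (x - q))"
  proof (rule gronwall_forward[OF ch])
    show "?h t \<le> 0 + K * integral {q..t} ?h" if t: "t \<in> {q..x}" for t
    proof -
      have "integral {q..t} exp = E q - E t"
        using t by (intro integral_slope) (auto intro!: E_deriv continuous_intros)
      then have "?h t = integral {q..t} (\<lambda>x. Gb cm x (\<beta> x)) - integral {q..t} exp"
        using curve_integral[of q t] t q(3) by simp
      also have "\<dots> = integral {q..t} (\<lambda>x. Gb cm x (\<beta> x) - exp x)"
        by (intro Henstock_Kurzweil_Integration.integral_diff[symmetric] integrable_continuous_interval
            Gb_cont_comp curve_cont continuous_intros)
      also have "\<dots> \<le> integral {q..t} (\<lambda>x. K * ?h x)"
      proof (rule integral_le)
        fix r assume r: "r \<in> {q..t}"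
        have "Gb cm r (E r) \<le> exp xm" using r q p by (intro Gb_E) auto
        also have "\<dots> \<le> exp r" using r q p by auto
        finally have "Gb cm r (E r) \<le> exp r" .
        moreover have "\<bar>E r - \<beta> r\<bar> = ?h r" using q(3) q(4)[of r] r t by (cases "r = q") auto
        ultimately show "Gb cm r (\<beta> r) - exp r \<le> K * ?h r" using K(2)[of r "\<beta> r" "E r"] by (simp add: abs_minus_commute)
      qed (intro integrable_continuous_interval continuous_intros Gb_cont_comp curve_cont E_cont)+
      finally show ?thesis by simp
    qed
  qed (use K q in auto)
  then show False using q(4)[of x] q by simp
qed

text \<open>At \<open>b > xm\<close> the curve crosses the line strictly, so it is below the line
  just before \<open>b\<close>. Had it been on or above the line at an earlier point beyond
  \<open>xm\<close>, the barrier would have kept it there.\<close>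

lemma curve_less_E_right:
  assumes b: "xm < b" "\<beta> b = E b" and x: "xm \<le> x" "x < b"
  shows "\<beta> x < E x"
proof (rule ccontr)
  assume n: "\<not> ?thesis"
  have "((\<lambda>t. \<beta> t - E t) has_real_derivative (- Gb cm b (\<beta> b) - - exp b)) (at b)"
    by (intro derivative_intros d\<beta> E_deriv)
  moreover have "0 < - Gb cm b (\<beta> b) - - exp b"
    using Gb_E[OF less_imp_le[OF b(1)]] iffD2[OF exp_less_cancel_iff b(1)] unfolding b(2) by linarith
  ultimately obtain d where d: "0 < d" "\<And>h. 0 < h \<Longrightarrow> h < d \<Longrightarrow> \<beta> (b - h) - E (b - h) < \<beta> b - E b"
    using DERIV_pos_inc_left by blast
  define h where "h = min (d / 2) ((b - x) / 2)"
  have h: "0 < h" "h < d" "x \<le> b - h" using d x by (auto simp: h_def min_def field_simps)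
  have "\<beta> (b - h) < E (b - h)" using d(2)[OF h(1,2)] b by simp
  moreover have "E (b - h) \<le> \<beta> (b - h)" using curve_ge_E[of x "b - h"] x n h by simp
  ultimately show False by simp
qed

text \<open>A second meeting point would be a strict crossing as well, and the curve would be below
  the line at the earlier point \<open>b\<close>.\<close>

lemma curve_greater_E_right:
  assumes b: "xm < b" "\<beta> b = E b" and x: "b < x"
  shows "E x < \<beta> x"
proof (rule ccontr)
  assume n: "\<not> ?thesis"
  have xx: "xm < x" "\<beta> x = E x" using b x n curve_ge_E[of b x] by auto
  have "\<beta> b < E b" by (rule curve_less_E_right[OF xx]) (use b x in auto)
  then show False using b by simp
qed

text \<open>Up to \<open>xm\<close> the line is itself admissible, so \<open>no_cross_left\<close>
  applies with the line as upper curve: a curve of control 1 that met it from below would have to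
  coincide with it before.\<close>

lemma curve_less_E_left:
  assumes p: "\<beta> p < E p" and x: "p \<le> x" "x \<le> xm"
  shows "\<beta> x < E x"
proof (rule ccontr)
  let ?h = "\<lambda>x. E x - \<beta> x"
  assume "\<not> ?thesis"
  moreover have ch: "continuous_on X ?h" for X by (intro continuous_intros E_cont curve_cont)
  ultimately obtain q where q: "p < q" "q \<le> x" "?h q = 0" "\<And>t. p \<le> t \<Longrightarrow> t < q \<Longrightarrow> 0 < ?h t"
    using first_zero[of p x ?h] p x by auto
  have le: "\<beta> t \<le> E t" if "t \<in> {p..q}" for t using q(3) q(4)[of t] that by (cases "t = q") auto
  have "S1m \<le> E q" using E_le[of xm q] q x by (simp add: E_xm)
  then have cmb: "cm \<le> \<beta> t" if "t \<in> {p..q}" for t using curve_le[of t q] that q(3) cm_le by auto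
  have reg: "reg \<beta> p q"
    unfolding reg_def using cmb le cm_pos S2s_pos by (force intro!: curve_cont simp: le_E_iff)
  have "E p = \<beta> p"
  proof (rule no_cross_left[OF prof_E(1) reg])
    fix t assume t: "t \<in> {p..q}"
    show "E t - E q \<le> integral {t..q} (\<lambda>x. G x (E x))"
      using t q x by (intro prof_E(2)[of p q]) auto
    have "integral {t..q} (\<lambda>x. G x (\<beta> x)) = integral {t..q} (\<lambda>x. Gb cm x (\<beta> x))"
      using t cmb le by (intro integral_cong) (auto intro!: Gb_eq_left[symmetric])
    then show "integral {t..q} (\<lambda>x. G x (\<beta> x)) \<le> \<beta> t - \<beta> q" using curve_integral[of t q] t by simp
  qed (use q x le in auto)
  then show False using p by simp
qed

end

end

section \<open>The explicit competitors and the domination theorem\<close>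

context
  fixes cm :: real
  assumes cm_pos: "0 < cm" and cm_le: "cm \<le> S1m"
begin

lemmas beta_facts = beta_deriv[OF cm_pos cm_le]

lemma beta_self [simp]: "beta cm b b = E b"
  by (rule beta_b[OF cm_pos cm_le])

lemma beta_less: "x < y \<Longrightarrow> beta cm b y < beta cm b x"
  by (rule curve_less[OF cm_pos cm_le beta_facts])

lemma beta_le: "x \<le> y \<Longrightarrow> beta cm b y \<le> beta cm b x"
  by (rule curve_le[OF cm_pos cm_le beta_facts])

lemma beta_cont: "continuous_on X (beta cm b)"
  by (rule curve_cont[OF cm_pos cm_le beta_facts])

lemma beta_ge_E: "xm \<le> b \<Longrightarrow> b \<le> x \<Longrightarrow> E x \<le> beta cm b x"
  using curve_ge_E[OF cm_pos cm_le beta_facts, of b b x] by simp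

lemma beta_less_E: "xm < b \<Longrightarrow> xm \<le> x \<Longrightarrow> x < b \<Longrightarrow> beta cm b x < E x"
  using curve_less_E_right[OF cm_pos cm_le beta_facts, of b b x] by simp

lemma beta_greater_E: "xm < b \<Longrightarrow> b < x \<Longrightarrow> E x < beta cm b x"
  using curve_greater_E_right[OF cm_pos cm_le beta_facts, of b b x] by simp

lemma beta_less_E_left: "beta cm b p < E p \<Longrightarrow> p \<le> x \<Longrightarrow> x \<le> xm \<Longrightarrow> beta cm b x < E x"
  using curve_less_E_left[OF cm_pos cm_le beta_facts, of b p x] by simp

text \<open>At \<open>xm\<close> the curve meets the line with equal slope. A point below the line
  before \<open>xm\<close> would keep the curve strictly below at \<open>xm\<close> too; beyond
  \<open>xm\<close> the line is a barrier.\<close>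

lemma beta_xm_ge_E: "E x \<le> beta cm xm x"
proof (cases "x \<le> xm")
  case True
  then show ?thesis using beta_less_E_left[of xm x xm] by fastforce
qed (use beta_ge_E[of xm x] in auto)

lemma beta_s2_pos: "b \<le> x \<Longrightarrow> x \<le> ln M \<Longrightarrow> 0 < s2 x (beta cm b x)"
  using curve_s2_lower(1)[OF cm_pos cm_le beta_facts, of b b x] by simp

lemma beta_true_right: "b \<le> x \<Longrightarrow> x \<le> ln M \<Longrightarrow> cm \<le> beta cm b x \<Longrightarrow> Gb cm x (beta cm b x) = G x (beta cm b x)"
  using curve_true_right[OF cm_pos cm_le beta_facts, of b b x] by simp

lemma beta_true_left: "cm \<le> beta cm b x \<Longrightarrow> beta cm b x \<le> E x \<Longrightarrow> Gb cm x (beta cm b x) = G x (beta cm b x)"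
  by (rule Gb_eq_left[OF cm_pos cm_le])

lemma beta_integral: "p \<le> q \<Longrightarrow> integral {p..q} (\<lambda>x. Gb cm x (beta cm b x)) = beta cm b p - beta cm b q"
  by (rule curve_integral[OF cm_pos cm_le beta_facts])

lemma mcurve_left: "x \<le> b \<Longrightarrow> mcurve cm b x = min (E x) (beta cm b x)"
  by (simp add: mcurve_def min_def max_def)

lemma mcurve_right: "b \<le> x \<Longrightarrow> mcurve cm b x = beta cm b x"
  by (simp add: mcurve_def min_def)

lemma mcurve_self [simp]: "mcurve cm b b = E b"
  by (simp add: mcurve_left)

lemma mcurve_cont: "continuous_on X (mcurve cm b)"
  unfolding mcurve_def
  by (intro continuous_intros beta_cont continuous_on_compose2[OF beta_cont[of UNIV]] continuous_on_compose2[OF E_cont[of UNIV]]) auto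

lemma mcurve_less: "x < y \<Longrightarrow> mcurve cm b y < mcurve cm b x"
proof -
  have l: "mcurve cm b y < mcurve cm b x" if "x < y" "y \<le> b" for x y
    using that beta_less[OF that(1), of b] E_less[of y x] by (auto simp: mcurve_left min_less_iff_disj)
  have r: "mcurve cm b y < mcurve cm b x" if "x < y" "b \<le> x" for x y
    using that beta_less[OF that(1), of b] by (auto simp: mcurve_right)
  assume "x < y"
  then show ?thesis using l[of x y] r[of x y] l[of x b] r[of b y]
    by (cases "y \<le> b"; cases "b \<le> x") auto
qed

lemma mcurve_le: "x \<le> y \<Longrightarrow> mcurve cm b y \<le> mcurve cm b x"
  using mcurve_less[of x y b] by (cases "x = y") auto

lemma mcurve_inj: "mcurve cm b x = mcurve cm b y \<Longrightarrow> x = y"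
  using mcurve_less[of x y b] mcurve_less[of y x b] by (cases x y rule: linorder_cases) auto

lemma kap_cont: "continuous_on X (kap cm y b c)"
  unfolding kap_def by (intro continuous_intros mcurve_cont)

text \<open>Up to \<open>xm\<close> the curve stays below the line once it is below, so the
  abscissas with \<open>E x \<le> beta cm b x\<close> form an initial piece. Its end
  \<open>z\<close> is where \<open>mcurve\<close> changes from the line to control 1; if the piece
  is empty, \<open>z \<le> x0\<close>.\<close>

lemma singular_end:
  assumes b: "xm \<le> b"
  shows "\<exists>z\<le>xm. (\<forall>x. x0 \<le> x \<longrightarrow> x < z \<longrightarrow> E x \<le> beta cm b x) \<and>
    (\<forall>x. x0 \<le> x \<longrightarrow> z < x \<longrightarrow> x \<le> b \<longrightarrow> beta cm b x \<le> E x)"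
proof -
  have r: "beta cm b x \<le> E x" if "xm < x" "x \<le> b" for x
    using beta_less_E[of b x] that by (cases "x = b") auto
  define S where "S = {x. x0 \<le> x \<and> x \<le> xm \<and> E x \<le> beta cm b x}"
  show ?thesis
  proof (cases "S = {}")
    case True
    then have "beta cm b x \<le> E x" if "x0 \<le> x" "x \<le> b" for x
      using r[of x] that by (cases "x \<le> xm") (force simp: S_def)+
    then show ?thesis by (intro exI[of _ "min x0 xm"]) auto
  next
    case False
    have bdd: "bdd_above S" unfolding S_def by (auto intro!: bdd_aboveI[of _ xm])
    have "Sup S \<le> xm" using False by (intro cSup_least) (auto simp: S_def)
    moreover have "E x \<le> beta cm b x" if x: "x < Sup S" for x
    proof (rule ccontr)
      assume n: "\<not> ?thesis"
      obtain s where "s \<in> S" "x < s" using less_cSup_iff[OF False bdd] x by blast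
      then show False using beta_less_E_left[of b x s] n by (force simp: S_def)
    qed
    moreover have "beta cm b x \<le> E x" if x: "x0 \<le> x" "Sup S < x" "x \<le> b" for x
    proof (cases "x \<le> xm")
      case True
      then have "x \<notin> S" using cSup_upper[OF _ bdd, of x] x by auto
      then show ?thesis using True x by (auto simp: S_def)
    qed (use r x in auto)
    ultimately show ?thesis by blast
  qed
qed

text \<open>The expression before \<open>z\<close> is the singular control in terms of
  \<open>x\<close>. Since \<open>z \<le> xm\<close> in all uses, \<open>min x xm\<close> does not
  change it there; it keeps the denominator positive and the function Borel on the whole
  line.\<close>

definition kctl :: "real \<Rightarrow> real \<Rightarrow> real \<Rightarrow> real \<Rightarrow> real \<Rightarrow> real" where
  "kctl y b c z x = (if y \<le> mcurve cm b x \<or> mcurve cm b x \<le> c then 0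
     else if x < z then exp x * \<mu> S2s / f (E (min x xm)) else 1)"

lemma kctl_measurable: "kctl y b c z \<in> borel_measurable borel"
proof -
  have m: "mcurve cm b \<in> borel_measurable borel"
    by (rule borel_measurable_continuous_onI[OF mcurve_cont])
  have Ep: "0 < E (min x xm)" for x
    using E_le[of xm "min x xm"] S1m(1) by (simp add: E_xm)
  have "continuous_on UNIV (\<lambda>x. E (min x xm))"
    unfolding E_def by (intro continuous_intros)
  moreover have "(\<lambda>x. E (min x xm)) ` UNIV \<subseteq> {0..}"
    using Ep less_imp_le by blast
  ultimately have "continuous_on UNIV (\<lambda>x. f (E (min x xm)))"
    by (rule continuous_on_compose2[OF f_cont])
  moreover have "f (E (min x xm)) \<noteq> 0" for x
    using f_pos[OF Ep[of x]] by simp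
  ultimately have "continuous_on UNIV (\<lambda>x. exp x * \<mu> S2s / f (E (min x xm)))"
    by (intro continuous_on_divide continuous_on_mult continuous_on_exp continuous_on_id continuous_on_const) auto
  then have "(\<lambda>x. exp x * \<mu> S2s / f (E (min x xm))) \<in> borel_measurable borel"
    by (rule borel_measurable_continuous_onI)
  then show ?thesis unfolding kctl_def using m by measurable
qed

lemma kctl_range: "z \<le> xm \<Longrightarrow> kctl y b c z x \<in> {0..1}"
proof -
  assume z: "z \<le> xm"
  have "0 \<le> exp x * \<mu> S2s / f (E (min x xm)) \<and> exp x * \<mu> S2s / f (E (min x xm)) \<le> 1" if "x < z"
  proof -
    have "0 < E x" using E_le[of xm x] S1m(1) that z by (simp add: E_xm)
    then have "0 < f (E x)" by (rule f_pos)
    moreover have "min x xm = x" using that z by simp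
    ultimately show ?thesis
      using singular_slope_le[of x] that z \<mu>_S2s_pos by (simp add: G_def field_simps)
  qed
  then show ?thesis by (auto simp: kctl_def)
qed

lemma kap_reg:
  assumes b: "xm \<le> b" and c: "0 < c" "c \<le> y" and xf: "0 < s2 xf c"
  shows "reg (kap cm y b c) x0 xf"
  unfolding reg_def
proof (intro conjI ballI kap_cont)
  fix x assume x: "x \<in> {x0..xf}"
  have k: "c \<le> kap cm y b c x" "kap cm y b c x \<le> y" using c by (auto simp: kap_def)
  then show "0 < kap cm y b c x" using c by simp
  have ex: "exp x \<le> exp xf" using x by simp
  have "exp xf < M" using xf c by (simp add: s2_def)
  then have "exp x < M" by (rule le_less_trans[OF ex])
  then have xM: "x \<le> ln M" using M_pos by (simp add: ln_ge_iff)
  have "kap cm y b c x \<le> max c (mcurve cm b x)" by (simp add: kap_def)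
  then have "kap cm y b c x \<le> c \<or> kap cm y b c x \<le> mcurve cm b x" by linarith
  then show "0 < s2 x (kap cm y b c x)"
  proof
    assume "kap cm y b c x \<le> c"
    then show ?thesis using xf ex unfolding s2_def by linarith
  next
    assume le: "kap cm y b c x \<le> mcurve cm b x"
    have "0 < s2 x (mcurve cm b x)"
    proof (cases "x \<le> b")
      case True
      then have "mcurve cm b x \<le> E x" by (simp add: mcurve_left)
      then show ?thesis using S2s_pos by (simp add: le_E_iff)
    qed (use beta_s2_pos[of b x] xM mcurve_right[of b x] in simp)
    then show ?thesis using le by (simp add: s2_def)
  qed
qed

lemma mcurve_deriv:
  assumes b: "xm \<le> b" and z: "z \<le> xm" "\<And>x. x0 \<le> x \<Longrightarrow> x < z \<Longrightarrow> E x \<le> beta cm b x"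
      "\<And>x. x0 \<le> x \<Longrightarrow> z < x \<Longrightarrow> x \<le> b \<Longrightarrow> beta cm b x \<le> E x"
    and x: "x0 < x" "x \<le> ln M" "x \<noteq> z" "x \<noteq> b" "cm \<le> mcurve cm b x"
  shows "(mcurve cm b has_real_derivative - (if x < z then exp x * \<mu> S2s / f (E (min x xm)) else 1) * G x (mcurve cm b x)) (at x)"
proof -
  consider "x < z" | "z < x" "x < b" | "z < x" "b < x" using x(3,4) by linarith
  then show ?thesis
  proof cases
    case 1
    have eq: "E t = mcurve cm b t" if "t \<in> {x0<..<z}" for t
      using that z b by (simp add: mcurve_left min_absorb1)
    have "(mcurve cm b has_real_derivative - exp x) (at x)"
      by (rule has_field_derivative_transform_within_open[OF E_deriv, where S = "{x0<..<z}"]) (use x 1 eq in auto)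
    moreover have "0 < f (E x)" using 1 z E_le[of xm x] S1m(1) by (intro f_pos) (simp add: E_xm)
    moreover have "mcurve cm b x = E x" using eq[of x] 1 x by simp
    moreover have "min x xm = x" using 1 z by simp
    ultimately show ?thesis using 1 \<mu>_S2s_pos by (simp add: G_def)
  next
    case 2
    have eq: "beta cm b t = mcurve cm b t" if "t \<in> {max x0 z<..<b}" for t
      using that z b by (simp add: mcurve_left min_absorb2)
    have "(mcurve cm b has_real_derivative - Gb cm x (beta cm b x)) (at x)"
      by (rule has_field_derivative_transform_within_open[OF beta_facts, where S = "{max x0 z<..<b}"]) (use x 2 eq in auto)
    then show ?thesis
      using beta_true_left[of b x] eq[of x] z(3)[of x] 2 x by simp
  next
    case 3
    have eq: "beta cm b t = mcurve cm b t" if "t \<in> {b<..}" for t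
      using that by (simp add: mcurve_right)
    have "(mcurve cm b has_real_derivative - Gb cm x (beta cm b x)) (at x)"
      by (rule has_field_derivative_transform_within_open[OF beta_facts, where S = "{b<..}"]) (use 3 eq in auto)
    then show ?thesis
      using beta_true_right[of b x] eq[of x] 3 x by simp
  qed
qed

lemma kap_rprof:
  assumes b: "xm \<le> b" and z: "z \<le> xm" "\<And>x. x0 \<le> x \<Longrightarrow> x < z \<Longrightarrow> E x \<le> beta cm b x"
      "\<And>x. x0 \<le> x \<Longrightarrow> z < x \<Longrightarrow> x \<le> b \<Longrightarrow> beta cm b x \<le> E x"
    and c: "cm \<le> c" "c \<le> y" and x0: "x0 \<le> xf" and xf: "0 < s2 xf c"
  shows "rprof (kctl y b c z) (kap cm y b c) x0 xf"
proof -
  have cp: "0 < c" using c cm_pos by simp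
  \<comment> \<open>\<open>mcurve\<close> is strictly decreasing, so it takes each of the values
    \<open>y\<close> and \<open>c\<close> at most once; the remaining corners are \<open>z\<close>
    and \<open>b\<close>.\<close>
  define K where "K = {x. mcurve cm b x = y} \<union> {x. mcurve cm b x = c} \<union> {z, b}"
  have fin1: "finite {x. mcurve cm b x = e}" for e
  proof (cases "{x. mcurve cm b x = e} = {}")
    case False
    then obtain x where "mcurve cm b x = e" by blast
    then have "{t. mcurve cm b t = e} \<subseteq> {x}"
      by (intro subsetI) (simp add: mcurve_inj[of b])
    then show ?thesis by (rule finite_subset) simp
  qed simp
  then have "finite K" by (simp add: K_def)
  moreover have "(kap cm y b c has_real_derivative - kctl y b c z x * G x (kap cm y b c x)) (at x)"
    if x: "x \<in> {x0<..<xf} - K" for x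
  proof -
    let ?m = "mcurve cm b"
    have gt: "eventually (\<lambda>t. e < ?m t) (nhds x)" if "e < ?m x" for e
      using eventually_nhds_in_open[OF open_Collect_less[OF continuous_on_const[of UNIV e] mcurve_cont[of UNIV b]], of x] that by simp
    have lt: "eventually (\<lambda>t. ?m t < e) (nhds x)" if "?m x < e" for e
      using eventually_nhds_in_open[OF open_Collect_less[OF mcurve_cont[of UNIV b] continuous_on_const[of UNIV e]], of x] that by simp
    have ne: "?m x \<noteq> y" "?m x \<noteq> c" "x \<noteq> z" "x \<noteq> b" using x by (auto simp: K_def)
    consider "y < ?m x" | "?m x < c" | "c < ?m x" "?m x < y" using ne by linarith
    then show ?thesis
    proof cases
      case 1
      have "eventually (\<lambda>t. y < ?m t) (nhds x)"
        by (rule gt[OF 1])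
      then have "eventually (\<lambda>t. kap cm y b c t = y) (nhds x)"
        by eventually_elim (use c in \<open>auto simp: kap_def\<close>)
      then have "(kap cm y b c has_real_derivative 0) (at x)"
        using DERIV_cong_ev[OF refl _ refl, of "kap cm y b c" "\<lambda>_. y" x 0] by simp
      then show ?thesis using 1 by (simp add: kctl_def)
    next
      case 2
      have "eventually (\<lambda>t. ?m t < c) (nhds x)"
        by (rule lt[OF 2])
      then have "eventually (\<lambda>t. kap cm y b c t = c) (nhds x)"
        by eventually_elim (use c in \<open>auto simp: kap_def\<close>)
      then have "(kap cm y b c has_real_derivative 0) (at x)"
        using DERIV_cong_ev[OF refl _ refl, of "kap cm y b c" "\<lambda>_. c" x 0] by simp
      then show ?thesis using 2 by (simp add: kctl_def)
    next
      case 3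
      have "eventually (\<lambda>t. ?m t < y) (nhds x)" "eventually (\<lambda>t. c < ?m t) (nhds x)"
        by (rule lt[OF 3(2)], rule gt[OF 3(1)])
      then have ev: "eventually (\<lambda>t. kap cm y b c t = ?m t) (nhds x)"
        by eventually_elim (use c in \<open>auto simp: kap_def\<close>)
      have "exp x < exp xf" using x by simp
      also have "\<dots> < M" using xf cp by (simp add: s2_def)
      finally have xM: "x \<le> ln M" using M_pos by (simp add: ln_ge_iff)
      have "(?m has_real_derivative - (if x < z then exp x * \<mu> S2s / f (E (min x xm)) else 1) * G x (?m x)) (at x)"
        by (rule mcurve_deriv[OF b z]) (use x ne xM 3 c in auto)
      then have "(kap cm y b c has_real_derivative - (if x < z then exp x * \<mu> S2s / f (E (min x xm)) else 1) * G x (?m x)) (at x)"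
        using DERIV_cong_ev[OF refl ev refl] by simp
      moreover have "kap cm y b c x = ?m x" using 3 by (simp add: kap_def)
      ultimately show ?thesis using 3 by (simp add: kctl_def)
    qed
  qed
  ultimately show ?thesis
    unfolding rprof_def using kap_reg[OF b cp c(2) xf] kctl_measurable kctl_range[OF z(1)] x0 by blast
qed

text \<open>In general \<open>b\<close> is the first point at or beyond \<open>x0\<close> and
  \<open>xm\<close> where the profile meets the line. If \<open>x0 \<le> xm\<close> and the profile
  ends before \<open>xm\<close> or is on or above the line there, \<open>b = xm\<close> is taken: by
  \<open>beta_xm_ge_E\<close> its curve is never below the line, so the competitor may use the line
  all the way to \<open>xm\<close>.\<close>

theorem domination:
  assumes \<rho>: "prof \<rho> x0 xf" and x0: "x0 \<le> xf" "\<rho> x0 \<le> E x0" and c: "cm \<le> c" "c \<le> \<rho> xf" and xf: "E xf \<le> \<rho> xf"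
  shows "\<exists>b. xm \<le> b \<and> x0 \<le> b \<and> \<rho> x0 \<le> mcurve cm b x0 \<and>
    (\<forall>x\<in>{x0..xf}. closer x (kap cm (\<rho> x0) b c x) (\<rho> x)) \<and>
    (b = xm \<and> (xm \<le> xf \<longrightarrow> E xm \<le> \<rho> xm) \<or> xm < b \<and> b \<le> xf \<and> \<rho> b = E b)"
proof -
  have reg: "reg \<rho> x0 xf" using \<rho> by (simp add: prof_def)
  have c\<rho>: "continuous_on {p..q} \<rho>" if "x0 \<le> p" "q \<le> xf" for p q
    using reg_subset[OF reg that] by (simp add: reg_def)
  have mono: "\<rho> q \<le> \<rho> p" and step: "\<rho> p - \<rho> q \<le> integral {p..q} (\<lambda>x. G x (\<rho> x))" if "x0 \<le> p" "p \<le> q" "q \<le> xf" for p q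
    using \<rho> that by (auto simp: prof_def)
  have "exp xf < M"
  proof -
    have "0 < \<rho> xf" "0 < s2 xf (\<rho> xf)" using reg x0 by (auto simp: reg_def)
    then show ?thesis unfolding s2_def by linarith
  qed
  then have xfM: "x \<le> ln M" if "x \<le> xf" for x
    using that M_pos by (meson exp_le_cancel_iff ln_ge_iff less_imp_le order_trans)
  text \<open>Beyond the crossing with the line \<open>S2 = S2s\<close> the control 1 keeps \<open>S1\<close> lowest, before it highest.\<close>
  have right: "beta cm b x \<le> \<rho> x" if b: "x0 \<le> b" "xm \<le> b" "E b \<le> \<rho> b" and x: "b \<le> x" "x \<le> xf" for b x
  proof (rule ccontr)
    let ?h = "\<lambda>x. beta cm b x - \<rho> x"
    assume "\<not> ?thesis"
    moreover have "continuous_on {b..x} ?h" using b x by (intro continuous_intros beta_cont c\<rho>) auto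
    ultimately obtain p where p: "b \<le> p" "p < x" "?h p = 0" "\<And>t. p < t \<Longrightarrow> t \<le> x \<Longrightarrow> 0 < ?h t"
      using last_zero[of b x ?h] b x by auto
    have le: "\<rho> t \<le> beta cm b t" if "t \<in> {p..x}" for t using p(3) p(4)[of t] that by (cases "t = p") auto
    have cmb: "cm \<le> beta cm b t" if "t \<in> {p..x}" for t
      using le[OF that] mono[of t xf] that p(1) b(1) x(2) c by auto
    have regb: "reg (beta cm b) p x"
      unfolding reg_def
    proof (intro conjI ballI beta_cont)
      fix t assume t: "t \<in> {p..x}"
      show "0 < beta cm b t" using cmb[OF t] cm_pos by simp
      show "0 < s2 t (beta cm b t)" by (rule beta_s2_pos) (use t p(1) xfM[of t] x in auto)
    qed
    have "\<rho> x = beta cm b x"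
    proof (rule no_cross_right[OF reg_subset[OF reg] regb])
      fix t assume t: "t \<in> {p..x}"
      show "\<rho> p - \<rho> t \<le> integral {p..t} (\<lambda>x. G x (\<rho> x))" using t p b x by (intro step) auto
      have "integral {p..t} (\<lambda>x. G x (beta cm b x)) = integral {p..t} (\<lambda>x. Gb cm x (beta cm b x))"
      proof (rule integral_cong)
        fix r assume r: "r \<in> {p..t}"
        show "G r (beta cm b r) = Gb cm r (beta cm b r)"
          by (rule beta_true_right[symmetric]) (use r t p(1) xfM[of r] x cmb[of r] in auto)
      qed
      then show "integral {p..t} (\<lambda>x. G x (beta cm b x)) \<le> beta cm b p - beta cm b t" using beta_integral[of p t b] t by simp
    qed (use p b x le in auto)
    then show False using p(4)[of x] p(2) by simp
  qed
  have left: "min (\<rho> x) (E x) \<le> beta cm b x"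
    if b: "xm < b" "b \<le> xf" "\<rho> b = E b" and below: "\<And>t. x0 \<le> t \<Longrightarrow> xm < t \<Longrightarrow> t \<le> b \<Longrightarrow> \<rho> t \<le> E t"
      and x: "x0 \<le> x" "x \<le> b" for b x
  proof (rule ccontr)
    \<comment> \<open>The minimum, because before \<open>xm\<close> a profile may lie above the
      line; the competitor then stays on the line, and only the line has to be bounded.\<close>
    let ?h = "\<lambda>x. min (\<rho> x) (E x) - beta cm b x"
    assume n: "\<not> ?thesis"
    have ch: "continuous_on {x..b} ?h" using b x by (intro continuous_intros beta_cont c\<rho> E_cont) auto
    have hx: "0 < ?h x" using n by linarith
    have hb: "?h b \<le> 0" using b by simp
    obtain q where q: "x < q" "q \<le> b" "?h q = 0" "\<And>t. x \<le> t \<Longrightarrow> t < q \<Longrightarrow> 0 < ?h t"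
      using first_zero[OF ch x(2) hx hb] by blast
    have le: "beta cm b t \<le> min (\<rho> t) (E t)" if "t \<in> {x..q}" for t using q(3) q(4)[of t] that by (cases "t = q") auto
    have "cm \<le> min (\<rho> q) (E q)"
    proof (cases "\<rho> q \<le> E q")
      case True
      then show ?thesis using mono[of q xf] q x b c by auto
    next
      case False
      then have "q \<le> xm" using below[of q] q x by force
      then have "S1m \<le> E q" using E_le[of xm q] by (simp add: E_xm)
      then show ?thesis using False cm_le by simp
    qed
    then have cmb: "cm \<le> beta cm b t" if "t \<in> {x..q}" for t using beta_le[of t q b] that q(3) by auto
    have regb: "reg (beta cm b) x q"
      unfolding reg_def
    proof (intro conjI ballI beta_cont)
      fix t assume t: "t \<in> {x..q}"
      show "0 < beta cm b t" using cmb[OF t] cm_pos by simp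
      have "beta cm b t \<le> E t" using le[OF t] by simp
      then show "0 < s2 t (beta cm b t)" using S2s_pos by (simp add: le_E_iff)
    qed
    have ib: "integral {t..q} (\<lambda>x. G x (beta cm b x)) \<le> beta cm b t - beta cm b q" if t: "t \<in> {x..q}" for t
    proof -
      have "integral {t..q} (\<lambda>x. G x (beta cm b x)) = integral {t..q} (\<lambda>x. Gb cm x (beta cm b x))"
      proof (rule integral_cong)
        fix r assume r: "r \<in> {t..q}"
        show "G r (beta cm b r) = Gb cm r (beta cm b r)"
          by (rule beta_true_left[symmetric]) (use r t cmb[of r] le[of r] in auto)
      qed
      then show ?thesis using beta_integral[of t q b] t by simp
    qed
    \<comment> \<open>At the meeting point \<open>q\<close> the smaller of the two is the profile or
      the line, and that one is compared with the curve backwards from \<open>q\<close>. The second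
      case occurs only up to \<open>xm\<close>, where the line is admissible.\<close>
    show False
    proof (cases "\<rho> q \<le> E q")
      case True
      have "\<rho> x = beta cm b x"
      proof (rule no_cross_left[OF reg_subset[OF reg] regb])
        show "\<rho> t - \<rho> q \<le> integral {t..q} (\<lambda>x. G x (\<rho> x))" if "t \<in> {x..q}" for t
          using that q x b by (intro step) auto
        show "beta cm b t \<le> \<rho> t" if "t \<in> {x..q}" for t using le[OF that] by simp
      qed (use q x b True ib in auto)
      then show False using q(4)[of x] q(1) by simp
    next
      case False
      then have qm: "q \<le> xm" using below[of q] q x by force
      have "E x = beta cm b x"
      proof (rule no_cross_left[OF prof_E(1) regb])
        show "E t - E q \<le> integral {t..q} (\<lambda>x. G x (E x))" if "t \<in> {x..q}" for t
          using that qm q by (intro prof_E(2)[of x q]) auto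
        show "beta cm b t \<le> E t" if "t \<in> {x..q}" for t using le[OF that] by simp
      qed (use q x False ib qm in auto)
      then show False using q(4)[of x] q(1) by simp
    qed
  qed
  have main: "\<rho> x0 \<le> mcurve cm b x0 \<and> (\<forall>x\<in>{x0..xf}. closer x (kap cm (\<rho> x0) b c x) (\<rho> x))"
    if b: "xm \<le> b" "x0 \<le> b"
      and L: "\<And>x. x0 \<le> x \<Longrightarrow> x \<le> xf \<Longrightarrow> x \<le> b \<Longrightarrow> min (\<rho> x) (E x) \<le> beta cm b x"
      and R: "\<And>x. b \<le> x \<Longrightarrow> x \<le> xf \<Longrightarrow> beta cm b x \<le> \<rho> x" for b
  proof
    show "\<rho> x0 \<le> mcurve cm b x0" using L[of x0] x0 b by (simp add: mcurve_left)
    show "\<forall>x\<in>{x0..xf}. closer x (kap cm (\<rho> x0) b c x) (\<rho> x)"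
    proof
      fix x assume x: "x \<in> {x0..xf}"
      have b1: "\<rho> x \<le> \<rho> x0" "c \<le> \<rho> x" using mono[of x0 x] mono[of x xf] x c by auto
      show "closer x (kap cm (\<rho> x0) b c x) (\<rho> x)"
      proof (cases "x \<le> b")
        case True
        then have m: "mcurve cm b x = min (E x) (beta cm b x)" by (rule mcurve_left)
        have l: "\<rho> x \<le> beta cm b x \<or> E x \<le> beta cm b x \<and> E x \<le> \<rho> x" using L[of x] x True by (auto simp: min_le_iff_disj)
        show ?thesis
        proof (cases "\<rho> x \<le> E x")
          case True
          then show ?thesis using l b1 unfolding closer_def kap_def m by auto
        next
          case False
          then have "min (E x) (beta cm b x) = E x" using l by auto
          then show ?thesis using False b1 unfolding closer_def kap_def m by auto
        qed
      next
        case False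
        have m: "mcurve cm b x = beta cm b x" using False by (simp add: mcurve_right)
        have "E x \<le> beta cm b x" "beta cm b x \<le> \<rho> x" using False b x by (auto intro!: beta_ge_E R)
        then show ?thesis using b1 unfolding closer_def kap_def m by auto
      qed
    qed
  qed
  show ?thesis
  proof (cases "x0 \<le> xm \<and> (xm \<le> xf \<longrightarrow> E xm \<le> \<rho> xm)")
    case True
    have "\<rho> x0 \<le> mcurve cm xm x0 \<and> (\<forall>x\<in>{x0..xf}. closer x (kap cm (\<rho> x0) xm c x) (\<rho> x))"
    proof (rule main)
      show "min (\<rho> x) (E x) \<le> beta cm xm x" for x using beta_xm_ge_E[of x] by simp
      show "beta cm xm x \<le> \<rho> x" if "xm \<le> x" "x \<le> xf" for x by (rule right) (use True that in auto)
    qed (use True in auto)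
    then show ?thesis using True by auto
  next
    case False
    define p0 where "p0 = max x0 xm"
    have p0: "p0 \<le> xf" "\<rho> p0 \<le> E p0" "x0 \<le> p0" "xm \<le> p0" using False x0 unfolding p0_def max_def by auto
    obtain b where b: "p0 \<le> b" "b \<le> xf" "\<rho> b = E b" "\<And>t. p0 \<le> t \<Longrightarrow> t < b \<Longrightarrow> \<rho> t < E t"
    proof (cases "\<rho> p0 = E p0")
      case True
      then show ?thesis using that[of p0] p0 by auto
    next
      case ne: False
      have "continuous_on {p0..xf} (\<lambda>x. E x - \<rho> x)" using p0 by (intro continuous_intros E_cont c\<rho>) auto
      then obtain q where "p0 < q" "q \<le> xf" "E q - \<rho> q = 0" "\<And>t. p0 \<le> t \<Longrightarrow> t < q \<Longrightarrow> 0 < E t - \<rho> t"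
        using first_zero[of p0 xf "\<lambda>x. E x - \<rho> x"] p0 ne xf by auto
      then show ?thesis using that[of q] by auto
    qed
    have xmb: "xm < b"
    proof (rule ccontr)
      assume "\<not> xm < b"
      then have "b = xm" "p0 = xm" using b p0 by auto
      then show False using False b p0 unfolding p0_def by (auto simp: max_def split: if_splits)
    qed
    have "\<rho> x0 \<le> mcurve cm b x0 \<and> (\<forall>x\<in>{x0..xf}. closer x (kap cm (\<rho> x0) b c x) (\<rho> x))"
    proof (rule main)
      show "min (\<rho> x) (E x) \<le> beta cm b x" if "x0 \<le> x" "x \<le> xf" "x \<le> b" for x
      proof (rule left[OF xmb b(2,3) _ that(1,3)])
        show "\<rho> t \<le> E t" if "x0 \<le> t" "xm < t" "t \<le> b" for t
          using b(3) b(4)[of t] that by (cases "t = b") (auto simp: p0_def)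
      qed
      show "beta cm b x \<le> \<rho> x" if "b \<le> x" "x \<le> xf" for x by (rule right) (use b p0 xmb that in auto)
    qed (use xmb b p0 in auto)
    then show ?thesis using xmb b p0 by (intro exI[of _ b]) auto
  qed
qed

end

lemma rprof_subset:
  assumes "rprof v \<kappa> a b" "a \<le> p" "p \<le> q" "q \<le> b"
  shows "rprof v \<kappa> p q"
proof -
  obtain K where "finite K" "\<And>x. x \<in> {a<..<b} - K \<Longrightarrow> (\<kappa> has_real_derivative - v x * G x (\<kappa> x)) (at x)"
    using assms(1) unfolding rprof_def by blast
  then show ?thesis
    using assms reg_subset[OF rprof_reg[OF assms(1)] assms(2,4)] unfolding rprof_def by (auto intro!: exI[of _ K])
qed

lemma rprof_cong:
  assumes "rprof v \<kappa> a b" "\<And>x. x \<in> {a..b} \<Longrightarrow> \<kappa> x = \<sigma> x"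
  shows "rprof v \<sigma> a b"
proof -
  obtain K where K: "finite K" "\<And>x. x \<in> {a<..<b} - K \<Longrightarrow> (\<kappa> has_real_derivative - v x * G x (\<kappa> x)) (at x)"
    using assms(1) unfolding rprof_def by blast
  have "(\<sigma> has_real_derivative - v x * G x (\<sigma> x)) (at x)" if x: "x \<in> {a<..<b} - K" for x
  proof -
    have "(\<sigma> has_real_derivative - v x * G x (\<kappa> x)) (at x)"
      by (rule has_field_derivative_transform_within_open[OF K(2)[OF x], where S = "{a<..<b}"]) (use x assms(2) in auto)
    then show ?thesis using assms(2)[of x] x by simp
  qed
  moreover have "reg \<sigma> a b" by (rule reg_cong[OF rprof_reg[OF assms(1)] assms(2)])
  ultimately show ?thesis using assms(1) K(1) unfolding rprof_def by (auto intro!: exI[of _ K])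
qed

lemma reg_glue:
  assumes "reg \<kappa> a b" "reg \<kappa> b c" "a \<le> b" "b \<le> c"
  shows "reg \<kappa> a c"
proof -
  have "continuous_on ({a..b} \<union> {b..c}) \<kappa>"
    using assms by (intro continuous_on_closed_Un) (auto simp: reg_def)
  moreover have "{a..b} \<union> {b..c} = {a..c}" using assms by auto
  ultimately have "continuous_on {a..c} \<kappa>" by simp
  moreover have "0 < \<kappa> x \<and> 0 < s2 x (\<kappa> x)" if "x \<in> {a..c}" for x
    using that assms(1,2) unfolding reg_def by (cases "x \<le> b") auto
  ultimately show ?thesis by (simp add: reg_def)
qed

lemma rprof_glue:
  assumes "rprof v \<kappa> a b" "rprof w \<kappa> b c"
  shows "rprof (\<lambda>x. if x \<le> b then v x else w x) \<kappa> a c"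
proof -
  obtain K where K: "finite K" "\<And>x. x \<in> {a<..<b} - K \<Longrightarrow> (\<kappa> has_real_derivative - v x * G x (\<kappa> x)) (at x)"
    using assms(1) unfolding rprof_def by blast
  obtain J where J: "finite J" "\<And>x. x \<in> {b<..<c} - J \<Longrightarrow> (\<kappa> has_real_derivative - w x * G x (\<kappa> x)) (at x)"
    using assms(2) unfolding rprof_def by blast
  have abc: "a \<le> b" "b \<le> c" using assms by (auto simp: rprof_def)
  have vw: "v \<in> borel_measurable borel" "w \<in> borel_measurable borel" "\<And>x. v x \<in> {0..1}" "\<And>x. w x \<in> {0..1}"
    using assms unfolding rprof_def by blast+
  have 1: "(\<lambda>x. if x \<le> b then v x else w x) \<in> borel_measurable borel" using vw(1,2) by measurable
  have 2: "(if x \<le> b then v x else w x) \<in> {0..1}" for x using vw(3)[of x] vw(4)[of x] by simp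
  have 3: "(\<kappa> has_real_derivative - (if x \<le> b then v x else w x) * G x (\<kappa> x)) (at x)"
    if x: "x \<in> {a<..<c} - (K \<union> J \<union> {b})" for x
    using K(2)[of x] J(2)[of x] x by (cases "x \<le> b") auto
  have 4: "reg \<kappa> a c" by (rule reg_glue[OF rprof_reg[OF assms(1)] rprof_reg[OF assms(2)] abc])
  have 5: "finite (K \<union> J \<union> {b})" using K(1) J(1) by simp
  show ?thesis
    unfolding rprof_def
    by (intro conjI exI[of _ "K \<union> J \<union> {b}"] allI ballI) (rule order_trans[OF abc] 4 1 2 5 3 | assumption)+
qed

lemma rprof_const:
  assumes "0 < c" "a \<le> b" "0 < s2 b c"
  shows "rprof (\<lambda>_. 0) (\<lambda>_. c) a b"
proof -
  have "0 < s2 x c" if "x \<in> {a..b}" for x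
  proof -
    have "exp x \<le> exp b" using that by simp
    then show ?thesis using assms(3) unfolding s2_def by linarith
  qed
  then show ?thesis using assms by (auto simp: rprof_def reg_def intro!: exI[of _ "{}"])
qed

section \<open>Optimal profiles and their explicit form\<close>

definition reaches :: "real \<Rightarrow> real \<Rightarrow> real \<Rightarrow> bool" where
  "reaches y x0 t \<longleftrightarrow> (\<exists>u S1 S2. trajectory M f \<mu> u S1 S2 \<and> S1 0 = y \<and> S2 0 = s2 x0 y \<and>
     0 \<le> t \<and> (S1 t, S2 t) \<in> target B1 B2)"

text \<open>Minimality is asked against all trajectories from the same point rather than against
  profiles, so it carries over directly from \<open>optimal\<close>.\<close>

definition opt :: "(real \<Rightarrow> real) \<Rightarrow> real \<Rightarrow> real \<Rightarrow> bool" where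
  "opt \<rho> x0 xf \<longleftrightarrow> prof \<rho> x0 xf \<and> x0 \<le> xf \<and> B2 < s2 x0 (\<rho> x0) \<and> \<rho> xf \<le> B1 \<and> s2 xf (\<rho> xf) \<le> B2 \<and>
     (\<forall>t. reaches (\<rho> x0) x0 t \<longrightarrow> cost \<rho> x0 xf \<le> t)"

lemma rprof_reaches:
  assumes rp: "rprof v \<kappa> x0 xf" and tg: "\<kappa> xf \<le> B1" "s2 xf (\<kappa> xf) \<le> B2"
  shows "reaches (\<kappa> x0) x0 (cost \<kappa> x0 xf)"
proof -
  have reg: "reg \<kappa> x0 xf" and le: "x0 \<le> xf" using rp by (auto simp: rprof_def)
  have nn: "0 \<le> cost \<kappa> x0 xf" by (rule cost_nonneg[OF reg le])
  obtain u S1 S2 where tr: "trajectory M f \<mu> u S1 S2" "S1 0 = \<kappa> x0" "S2 0 = s2 x0 (\<kappa> x0)"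
    "\<forall>t\<in>{0..cost \<kappa> x0 xf}. \<exists>x\<in>{x0..xf}. cost \<kappa> x0 x = t \<and> S1 t = \<kappa> x \<and> S2 t = s2 x (\<kappa> x) \<and> (x < xf \<longrightarrow> u t = v x)"
    using rprof_realize[OF rp] by blast
  obtain x where x: "x \<in> {x0..xf}" "cost \<kappa> x0 x = cost \<kappa> x0 xf" "S1 (cost \<kappa> x0 xf) = \<kappa> x" "S2 (cost \<kappa> x0 xf) = s2 x (\<kappa> x)"
    using tr(4) nn by fastforce
  have "x = xf" using cost_strict_mono[OF reg, of x] x by (cases "x < xf") auto
  moreover have "0 < \<kappa> xf" "0 < s2 xf (\<kappa> xf)" using reg le by (auto simp: reg_def)
  ultimately show ?thesis unfolding reaches_def using tr(1-3) x nn tg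
    by (intro exI[of _ u] exI[of _ S1] exI[of _ S2]) (auto simp: target_def)
qed

lemma logX_0:
  assumes "trajectory M f \<mu> u S1 S2" "S1 0 = y" "S2 0 = s2 x0 y"
  shows "logX S1 S2 0 = x0"
  using assms(2,3) by (simp add: logX_def[OF assms(1)] s2_def)

text \<open>A trajectory that arrives at time \<open>t\<close> still has at least the fraction
  \<open>exp (- L * t)\<close> of its initial \<open>S1\<close> and \<open>S2\<close>, with
  \<open>L\<close> independent of the control. These bounds give compactness in
  \<open>opt_exists\<close>.\<close>

lemma reaches_prof:
  "\<exists>L>0. \<forall>y x0 t. reaches y x0 t \<longrightarrow> 0 < y \<longrightarrow> 0 < s2 x0 y \<longrightarrow>
    (\<exists>\<rho> xf. x0 \<le> xf \<and> prof \<rho> x0 xf \<and> \<rho> x0 = y \<and> cost \<rho> x0 xf = t \<and> \<rho> xf \<le> B1 \<and> s2 xf (\<rho> xf) \<le> B2 \<and>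
      y \<le> \<rho> xf * exp (L * t) \<and> s2 x0 y \<le> s2 xf (\<rho> xf) * exp (L * t) \<and> 0 \<le> t)"
proof -
  obtain Lf where Lf: "Lf > 0" "\<And>a b. a \<in> {0..M} \<Longrightarrow> b \<in> {0..M} \<Longrightarrow> \<bar>f a - f b\<bar> \<le> Lf * \<bar>a - b\<bar>"
    using f_lipschitz by blast
  obtain Lm where Lm: "Lm > 0" "\<And>a b. a \<in> {0..M} \<Longrightarrow> b \<in> {0..M} \<Longrightarrow> \<bar>\<mu> a - \<mu> b\<bar> \<le> Lm * \<bar>a - b\<bar>"
    using \<mu>_lipschitz by blast
  have Lf0: "f a \<le> Lf * a" if "a \<in> {0..M}" for a using Lf(2)[of a 0] that M_pos by (auto simp: f_0)
  have Lm0: "\<mu> a \<le> Lm * a" if "a \<in> {0..M}" for a using Lm(2)[of a 0] that M_pos by (auto simp: \<mu>_0)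
  define L where "L = Lf + Lm * M"
  have L: "0 < L" "Lf \<le> L" "Lm * M \<le> L" using Lf(1) Lm(1) M_pos by (auto simp: L_def intro!: add_pos_pos)
  have "\<exists>\<rho> xf. x0 \<le> xf \<and> prof \<rho> x0 xf \<and> \<rho> x0 = y \<and> cost \<rho> x0 xf = t \<and> \<rho> xf \<le> B1 \<and> s2 xf (\<rho> xf) \<le> B2 \<and>
      y \<le> \<rho> xf * exp (L * t) \<and> s2 x0 y \<le> s2 xf (\<rho> xf) * exp (L * t) \<and> 0 \<le> t"
    if r: "reaches y x0 t" and y: "0 < y" "0 < s2 x0 y" for y x0 t
  proof -
    obtain u S1 S2 where tr: "trajectory M f \<mu> u S1 S2" and init: "S1 0 = y" "S2 0 = s2 x0 y"
      and t: "0 \<le> t" and tg: "(S1 t, S2 t) \<in> target B1 B2"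
      using r unfolding reaches_def by blast
    let ?X = "logX S1 S2"
    have X0: "?X 0 = x0" by (rule logX_0[OF tr init])
    obtain \<rho> where \<rho>: "prof \<rho> (?X 0) (?X t)" "?X 0 \<le> ?X t"
      "\<forall>s\<in>{0..t}. ?X s \<in> {?X 0..?X t} \<and> \<rho> (?X s) = S1 s \<and> cost \<rho> (?X 0) (?X s) = s"
      using trajectory_profile[OF tr _ _ t] init y by auto
    have \<rho>t: "\<rho> (?X t) = S1 t" "cost \<rho> (?X 0) (?X t) = t" and \<rho>0: "\<rho> (?X 0) = S1 0" using \<rho>(3) t by auto
    have s2t: "s2 (?X t) (S1 t) = S2 t" by (rule s2_logX[OF tr t])
    have pos: "0 \<le> S1 t" "0 \<le> S2 t" using trajectory_dom[OF tr t] by auto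
    have "y \<le> S1 t * exp (Lf * t)"
      using trajectory_S1_lower[OF tr _ Lf0 t] Lf(1) init by simp
    also have "\<dots> \<le> S1 t * exp (L * t)" using pos L t by (intro mult_left_mono) (auto intro: mult_right_mono)
    finally have b1: "y \<le> S1 t * exp (L * t)" .
    have "s2 x0 y \<le> S2 t * exp (Lm * M * t)"
      using trajectory_S2_lower[OF tr _ Lm0 t] Lm(1) init by simp
    also have "\<dots> \<le> S2 t * exp (L * t)" using pos L t by (intro mult_left_mono) (auto intro: mult_right_mono)
    finally have b2: "s2 x0 y \<le> S2 t * exp (L * t)" .
    show ?thesis
      using \<rho>(1,2) \<rho>t \<rho>0 s2t b1 b2 t tg init unfolding X0
      by (intro exI[of _ \<rho>] exI[of _ "?X t"]) (auto simp: target_def)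
  qed
  then show ?thesis using L(1) by blast
qed

lemma optimal_opt:
  assumes o: "optimal M B1 B2 f \<mu> u S1 S2 tf" and pos: "0 < S1 0" "B2 < S2 0"
  shows "\<exists>\<rho>. opt \<rho> (logX S1 S2 0) (logX S1 S2 tf) \<and>
    (\<forall>s\<in>{0..tf}. logX S1 S2 s \<in> {logX S1 S2 0..logX S1 S2 tf} \<and> \<rho> (logX S1 S2 s) = S1 s \<and>
       cost \<rho> (logX S1 S2 0) (logX S1 S2 s) = s) \<and>
    (\<forall>x\<in>{logX S1 S2 0..logX S1 S2 tf}. \<exists>s\<in>{0..tf}. x = logX S1 S2 s)"
proof -
  let ?X = "logX S1 S2"
  have tr: "trajectory M f \<mu> u S1 S2" and tf: "0 \<le> tf" "(S1 tf, S2 tf) \<in> target B1 B2"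
    and best: "\<And>v R1 R2 t. trajectory M f \<mu> v R1 R2 \<Longrightarrow> R1 0 = S1 0 \<Longrightarrow> R2 0 = S2 0 \<Longrightarrow> 0 \<le> t \<Longrightarrow>
      (R1 t, R2 t) \<in> target B1 B2 \<Longrightarrow> tf \<le> t"
    using o unfolding optimal_def by blast+
  have "0 < S2 0" using pos B2_pos by simp
  then obtain \<rho> where \<rho>: "prof \<rho> (?X 0) (?X tf)" "?X 0 \<le> ?X tf"
    "\<forall>s\<in>{0..tf}. ?X s \<in> {?X 0..?X tf} \<and> \<rho> (?X s) = S1 s \<and> cost \<rho> (?X 0) (?X s) = s"
    "\<forall>x\<in>{?X 0..?X tf}. \<exists>s\<in>{0..tf}. x = ?X s"
    using trajectory_profile[OF tr pos(1) _ tf(1)] by blast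
  have \<rho>t: "\<rho> (?X tf) = S1 tf" "cost \<rho> (?X 0) (?X tf) = tf" and \<rho>0: "\<rho> (?X 0) = S1 0" using \<rho>(3) tf by auto
  have "tf \<le> t" if "reaches (S1 0) (?X 0) t" for t
  proof -
    have "s2 (?X 0) (S1 0) = S2 0" by (rule s2_logX[OF tr]) simp
    then show ?thesis using that best unfolding reaches_def by auto
  qed
  then have "opt \<rho> (?X 0) (?X tf)"
    unfolding opt_def using \<rho>(1,2) \<rho>t \<rho>0 s2_logX[OF tr, of 0] s2_logX[OF tr tf(1)] pos tf(2)
    by (auto simp: target_def)
  then show ?thesis using \<rho>(3,4) by blast
qed

lemma opt_le_rprof:
  assumes "opt \<rho> x0 xf" "rprof v \<kappa> x0 x1" "\<kappa> x0 = \<rho> x0" "\<kappa> x1 \<le> B1" "s2 x1 (\<kappa> x1) \<le> B2"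
  shows "cost \<rho> x0 xf \<le> cost \<kappa> x0 x1"
  using rprof_reaches[OF assms(2,4,5)] assms(1,3) unfolding opt_def by simp

lemma opt_less: "opt \<rho> x0 xf \<Longrightarrow> x0 < xf"
  using B2_pos by (cases "x0 = xf") (auto simp: opt_def)

text \<open>The competitor \<open>kap\<close> is admissible and at least as fast, so by minimality
  the costs agree and \<open>cost_eq_imp_eq\<close> identifies the profiles. The clamp
  \<open>cm\<close> remains free below \<open>S1m\<close> and the last value of \<open>S1\<close>,
  so that it can be made small.\<close>

lemma opt_structure:
  assumes o: "opt \<rho> x0 xf" and y: "\<rho> x0 \<le> E x0" and cm: "0 < cm" "cm \<le> S1m" "cm \<le> \<rho> xf"
  shows "\<exists>b z. xm \<le> b \<and> x0 \<le> b \<and> \<rho> x0 \<le> mcurve cm b x0 \<and>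
    (b = xm \<and> (xm \<le> xf \<longrightarrow> E xm \<le> \<rho> xm) \<or> xm < b \<and> b \<le> xf \<and> \<rho> b = E b) \<and>
    (\<forall>x\<in>{x0..xf}. \<rho> x = kap cm (\<rho> x0) b (\<rho> xf) x) \<and>
    z \<le> xm \<and> (\<forall>x. x0 \<le> x \<longrightarrow> x < z \<longrightarrow> E x \<le> beta cm b x) \<and> (\<forall>x. x0 \<le> x \<longrightarrow> z < x \<longrightarrow> x \<le> b \<longrightarrow> beta cm b x \<le> E x) \<and>
    rprof (kctl cm (\<rho> x0) b (\<rho> xf) z) \<rho> x0 xf"
proof -
  have p: "prof \<rho> x0 xf" and x0: "x0 \<le> xf" and tg: "\<rho> xf \<le> B1" "s2 xf (\<rho> xf) \<le> B2" using o by (auto simp: opt_def)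
  have reg: "reg \<rho> x0 xf" using p by (simp add: prof_def)
  let ?c = "\<rho> xf" and ?y = "\<rho> x0"
  have Exf: "E xf < ?c" using tg B2_less by (simp add: E_less_iff)
  obtain b where b: "xm \<le> b" "x0 \<le> b" "?y \<le> mcurve cm b x0"
    "\<And>x. x \<in> {x0..xf} \<Longrightarrow> closer x (kap cm ?y b ?c x) (\<rho> x)"
    "b = xm \<and> (xm \<le> xf \<longrightarrow> E xm \<le> \<rho> xm) \<or> xm < b \<and> b \<le> xf \<and> \<rho> b = E b"
    using domination[OF cm(1,2) p x0 y cm(3) order_refl less_imp_le[OF Exf]] by blast
  obtain z where z: "z \<le> xm" "\<And>x. x0 \<le> x \<Longrightarrow> x < z \<Longrightarrow> E x \<le> beta cm b x"
    "\<And>x. x0 \<le> x \<Longrightarrow> z < x \<Longrightarrow> x \<le> b \<Longrightarrow> beta cm b x \<le> E x"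
    using singular_end[OF cm(1,2) b(1), of x0] by blast
  have cy: "?c \<le> ?y" using p x0 by (simp add: prof_def)
  have s2c: "0 < s2 xf ?c" using reg x0 by (simp add: reg_def)
  have rp: "rprof (kctl cm ?y b ?c z) (kap cm ?y b ?c) x0 xf"
    by (rule kap_rprof[OF cm(1,2) b(1) z cm(3) cy x0 s2c])
  have k0: "kap cm ?y b ?c x0 = ?y" using b(3) cy by (simp add: kap_def)
  \<comment> \<open>At \<open>xf\<close> the profile is on the side \<open>S2 < S2s\<close>, so
    \<open>closer\<close> leaves only values up to \<open>\<rho> xf\<close>, while
    \<open>kap\<close> is at least its last level: both end at the same point of the target.\<close>
  have "?c \<le> kap cm ?y b ?c xf" using cy by (simp add: kap_def)
  then have kf: "kap cm ?y b ?c xf = ?c" using b(4)[of xf] x0 Exf by (auto simp: closer_def)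
  have le: "cost \<rho> x0 xf \<le> cost (kap cm ?y b ?c) x0 xf"
    by (rule opt_le_rprof[OF o rp k0]) (use kf tg in auto)
  have eq: "\<rho> x = kap cm ?y b ?c x" if "x \<in> {x0..xf}" for x
    by (rule cost_eq_imp_eq[OF reg rprof_reg[OF rp] b(4) le that opt_less[OF o]])
  have "rprof (kctl cm ?y b ?c z) \<rho> x0 xf" by (rule rprof_cong[OF rp]) (rule eq[symmetric])
  then show ?thesis
    by (intro exI[of _ b] exI[of _ z] conjI allI impI ballI) (rule b z eq | assumption)+
qed

lemma opt_rprof:
  assumes "opt \<rho> x0 xf" "\<rho> x0 \<le> E x0"
  shows "\<exists>v. rprof v \<rho> x0 xf"
proof -
  have "0 < \<rho> xf" using assms(1) by (auto simp: opt_def prof_def reg_def)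
  then show ?thesis
    using opt_structure[OF assms, of "min S1m (\<rho> xf)"] S1m(1) by auto
qed

text \<open>Otherwise the restriction to \<open>{x0..x}\<close> would reach the target in less
  time.\<close>

lemma opt_before:
  assumes o: "opt \<rho> x0 xf" and y: "\<rho> x0 \<le> E x0" and x: "x0 \<le> x" "x < xf"
  shows "B1 < \<rho> x \<or> B2 < s2 x (\<rho> x)"
proof (rule ccontr)
  assume n: "\<not> ?thesis"
  obtain v where rp: "rprof v \<rho> x0 xf" using opt_rprof[OF o y] by blast
  have "rprof v \<rho> x0 x" by (rule rprof_subset[OF rp]) (use x in auto)
  then have "cost \<rho> x0 xf \<le> cost \<rho> x0 x" by (rule opt_le_rprof[OF o]) (use n in auto)
  then show False using cost_strict_mono[OF rprof_reg[OF rp] x] by simp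
qed

lemma f_DERIV: "0 < c \<Longrightarrow> (f has_real_derivative f' c) (at c)"
  and \<mu>_DERIV: "0 < c \<Longrightarrow> (\<mu> has_real_derivative \<mu>' c) (at c)"
  using f_deriv[of c] \<mu>_deriv[of c] at_within_interior[of c "{0..}"] by auto

lemma f_isCont: "0 < c \<Longrightarrow> isCont f c" and \<mu>_isCont: "0 < c \<Longrightarrow> isCont \<mu> c"
  using f_DERIV \<mu>_DERIV DERIV_isCont by blast+

lemma deriv_\<mu>: "0 < s \<Longrightarrow> deriv \<mu> s = \<mu>' s"
  using \<mu>_DERIV DERIV_imp_deriv by blast

lemma \<mu>'_nonneg: "0 < s \<Longrightarrow> s \<le> S2s \<Longrightarrow> 0 \<le> \<mu>' s"
proof (rule ccontr)
  assume s: "0 < s" "s \<le> S2s" "\<not> 0 \<le> \<mu>' s"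
  then obtain d where d: "d > 0" "\<And>h. 0 < h \<Longrightarrow> h < d \<Longrightarrow> \<mu> s < \<mu> (s - h)"
    using DERIV_neg_dec_left[OF \<mu>_DERIV[OF s(1)]] by auto
  define h where "h = min (d / 2) (s / 2)"
  have h: "0 < h" "h < d" "h < s" using d(1) s(1) by (auto simp: h_def min_def)
  then show False using d(2)[OF h(1,2)] \<mu>_le[of "s - h" s] s by simp
qed

lemma \<mu>'_nonpos: "S2s \<le> s \<Longrightarrow> \<mu>' s \<le> 0"
proof (rule ccontr)
  assume s: "S2s \<le> s" "\<not> \<mu>' s \<le> 0"
  then obtain d where d: "d > 0" "\<And>h. 0 < h \<Longrightarrow> h < d \<Longrightarrow> \<mu> s < \<mu> (s + h)"
    using DERIV_pos_inc_right[OF \<mu>_DERIV[of s]] S2s_pos by auto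
  show False using d(2)[of "d / 2"] d(1) \<mu>_ge[of s "s + d / 2"] s by simp
qed

text \<open>A strictly increasing function may have critical points; the mean value theorem still
  yields one point of positive derivative, enough for strict inequalities between integrals of
  continuous functions.\<close>

lemma \<mu>'_pos_between:
  assumes "0 \<le> a" "a < b" "b \<le> S2s"
  shows "\<exists>r. a < r \<and> r < b \<and> 0 < \<mu>' r"
proof -
  have "continuous_on {a..b} \<mu>" by (rule continuous_on_subset[OF \<mu>_cont]) (use assms in auto)
  then obtain r l where r: "a < r" "r < b" "(\<mu> has_real_derivative l) (at r)" "\<mu> b - \<mu> a = (b - a) * l"
    using MVT[OF assms(2), of \<mu>] \<mu>_DERIV assms(1) real_differentiable_def by (metis less_le_trans not_le order_less_imp_le le_less_trans)
  have "l = \<mu>' r" using DERIV_unique[OF r(3) \<mu>_DERIV[of r]] r(1) assms(1) by simp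
  moreover have "0 < (b - a) * l" using \<mu>_less[OF assms] r(4) by simp
  ultimately show ?thesis using r assms(2) by (auto simp: zero_less_mult_iff)
qed

subsection \<open>Final arcs of control 0\<close>

text \<open>\<open>A c s\<close> is the time needed to go down from \<open>(c, s)\<close> to \<open>(c, B2)\<close> with the control 0.\<close>

definition A :: "real \<Rightarrow> real \<Rightarrow> real" where
  "A c s = integral {B2..s} (\<lambda>r. 1 / (\<mu> r * (M - c - r)))"

definition Q :: "real \<Rightarrow> real \<Rightarrow> real" where
  "Q c s = integral {B2..s} (\<lambda>r. \<mu>' r / ((\<mu> r)\<^sup>2 * (M - c - r)))"

lemma Q_cont: "s < M - c \<Longrightarrow> a \<ge> B2 \<Longrightarrow> continuous_on {a..s} (\<lambda>r. \<mu>' r / ((\<mu> r)\<^sup>2 * (M - c - r)))"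
proof (intro continuous_intros continuous_on_subset[OF \<mu>'_cont] continuous_on_subset[OF \<mu>_cont] ballI)
  assume s: "s < M - c" "a \<ge> B2"
  show "(\<mu> r)\<^sup>2 * (M - c - r) \<noteq> 0" if "r \<in> {a..s}" for r
    using \<mu>_pos[of r] that s B2_pos by auto
qed (use B2_pos in auto)

lemma phi_eq:
  assumes "B2 \<le> s" "s < M - c"
  shows "phi M B2 \<mu> c s = \<mu> B2 * (M - c - B2) * Q c s"
proof -
  have "phi M B2 \<mu> c s = integral {B2..s} (\<lambda>r. (\<mu> B2 * (M - c - B2)) * (\<mu>' r / ((\<mu> r)\<^sup>2 * (M - c - r))))"
    unfolding phi_def using B2_pos by (intro integral_cong) (auto simp: deriv_\<mu>)
  then show ?thesis by (simp only: Q_def Henstock_Kurzweil_Integration.integral_mult_right)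
qed

lemma phi_B2: "phi M B2 \<mu> c B2 = 0"
  by (simp add: phi_def)

lemma Q_cont_s: "s < M - c \<Longrightarrow> continuous_on {B2..s} (Q c)"
  unfolding Q_def[abs_def]
  by (intro indefinite_integral_continuous_1 integrable_continuous_interval Q_cont) auto

lemma phi_cont_s:
  assumes "s < M - c"
  shows "continuous_on {B2..s} (phi M B2 \<mu> c)"
proof (rule continuous_on_eq)
  show "continuous_on {B2..s} (\<lambda>s. \<mu> B2 * (M - c - B2) * Q c s)"
    by (intro continuous_intros Q_cont_s assms)
qed (use assms phi_eq in auto)

lemma Q_split:
  assumes "B2 \<le> a" "a \<le> s" "s < M - c"
  shows "Q c s = Q c a + integral {a..s} (\<lambda>r. \<mu>' r / ((\<mu> r)\<^sup>2 * (M - c - r)))"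
  unfolding Q_def using assms
  by (intro Henstock_Kurzweil_Integration.integral_combine[symmetric] integrable_continuous_interval Q_cont) auto

lemma phi_less:
  assumes "B2 \<le> a" "a < s" "s \<le> S2s" "S2s < M - c"
  shows "phi M B2 \<mu> c a < phi M B2 \<mu> c s"
proof -
  obtain r where r: "a < r" "r < s" "0 < \<mu>' r" using \<mu>'_pos_between[of a s] assms B2_pos by auto
  have "0 < integral {a..s} (\<lambda>r. \<mu>' r / ((\<mu> r)\<^sup>2 * (M - c - r)))"
  proof (rule integral_pos)
    show "continuous_on {a..s} (\<lambda>r. \<mu>' r / ((\<mu> r)\<^sup>2 * (M - c - r)))" using assms by (intro Q_cont) auto
    show "0 \<le> \<mu>' r / ((\<mu> r)\<^sup>2 * (M - c - r))" if "r \<in> {a..s}" for r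
      using \<mu>'_nonneg[of r] that assms B2_pos by (auto intro!: divide_nonneg_nonneg)
    show "0 < \<mu>' r / ((\<mu> r)\<^sup>2 * (M - c - r))"
      using r assms B2_pos \<mu>_pos[of r] by (auto intro!: divide_pos_pos)
  qed (use r in auto)
  then have "Q c a < Q c s" using Q_split[of a s c] assms by simp
  moreover have "0 < \<mu> B2 * (M - c - B2)" using \<mu>_pos[OF B2_pos] B2_less assms by simp
  ultimately have "\<mu> B2 * (M - c - B2) * Q c a < \<mu> B2 * (M - c - B2) * Q c s" by (rule mult_strict_left_mono)
  then show ?thesis using assms by (simp add: phi_eq)
qed

text \<open>The integrand of \<open>phi\<close> has the sign of \<open>\<mu>'\<close>, which changes
  from nonnegative to nonpositive at \<open>S2s\<close>.\<close>

lemma phi_le_S2s: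
  assumes "B2 \<le> s" "s < M - c" "S2s < M - c"
  shows "phi M B2 \<mu> c s \<le> phi M B2 \<mu> c S2s"
proof (cases "s < S2s")
  case True
  then show ?thesis using phi_less[of s S2s c] assms by auto
next
  case False
  have "integral {S2s..s} (\<lambda>r. \<mu>' r / ((\<mu> r)\<^sup>2 * (M - c - r))) \<le> integral {S2s..s} (\<lambda>_. 0)"
  proof (rule integral_le)
    show "(\<lambda>r. \<mu>' r / ((\<mu> r)\<^sup>2 * (M - c - r))) integrable_on {S2s..s}"
      using assms B2_less by (intro integrable_continuous_interval Q_cont) auto
    show "\<mu>' r / ((\<mu> r)\<^sup>2 * (M - c - r)) \<le> 0" if "r \<in> {S2s..s}" for r
      using \<mu>'_nonpos[of r] that assms by (auto intro!: divide_nonpos_nonneg)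
  qed auto
  then have "Q c s \<le> Q c S2s" using Q_split[of S2s s c] assms False B2_less by simp
  moreover have "0 \<le> \<mu> B2 * (M - c - B2)" using \<mu>_pos[OF B2_pos] B2_less assms by simp
  ultimately show ?thesis using assms B2_less by (simp add: phi_eq mult_left_mono)
qed

text \<open>For fixed \<open>r > B2\<close> the factor \<open>(M - c - B2) / (M - c - r)\<close>
  increases with \<open>c\<close>, and up to \<open>S2s\<close> its weight is nonnegative and
  somewhere positive.\<close>

lemma phi_less_c:
  assumes c: "c < d" "B2 < s" "s \<le> S2s" "s < M - d"
  shows "phi M B2 \<mu> c s < phi M B2 \<mu> d s"
proof -
  let ?g = "\<lambda>c r. (M - c - B2) * (\<mu>' r / ((\<mu> r)\<^sup>2 * (M - c - r)))"
  have cg: "continuous_on {B2..s} (?g e)" if "e \<le> d" for e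
    using that c by (intro continuous_intros Q_cont) auto
  have eq: "phi M B2 \<mu> e s = \<mu> B2 * integral {B2..s} (?g e)" if "e \<le> d" for e
  proof -
    have "phi M B2 \<mu> e s = \<mu> B2 * (M - e - B2) * Q e s" using that c by (intro phi_eq) auto
    then show ?thesis by (simp only: Q_def Henstock_Kurzweil_Integration.integral_mult_right mult.assoc)
  qed
  have diff: "?g d r - ?g c r = \<mu>' r / (\<mu> r)\<^sup>2 * ((r - B2) * (d - c) / ((M - d - r) * (M - c - r)))"
    if "r \<in> {B2..s}" for r
  proof -
    have "M - d - r \<noteq> 0" "M - c - r \<noteq> 0" "\<mu> r \<noteq> 0" using \<mu>_pos[of r] that c B2_pos by auto
    then have "(M - d - B2) / (M - d - r) - (M - c - B2) / (M - c - r) = (r - B2) * (d - c) / ((M - d - r) * (M - c - r))"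
      by (simp add: divide_simps) (simp add: algebra_simps)
    moreover have "?g d r - ?g c r = \<mu>' r / (\<mu> r)\<^sup>2 * ((M - d - B2) / (M - d - r) - (M - c - B2) / (M - c - r))"
      by (simp add: right_diff_distrib mult_ac)
    ultimately show ?thesis by simp
  qed
  obtain r where r: "B2 < r" "r < s" "0 < \<mu>' r" using \<mu>'_pos_between[of B2 s] c B2_pos by auto
  have "0 < integral {B2..s} (\<lambda>r. ?g d r - ?g c r)"
  proof (rule integral_pos)
    show "continuous_on {B2..s} (\<lambda>r. ?g d r - ?g c r)" using cg[of d] cg[of c] c by (intro continuous_on_diff) auto
    show "0 \<le> ?g d r - ?g c r" if "r \<in> {B2..s}" for r
      unfolding diff[OF that] using \<mu>'_nonneg[of r] that c B2_pos by (auto intro!: mult_nonneg_nonneg divide_nonneg_nonneg)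
    show "r \<in> {B2..s}" using r by simp
    then show "0 < ?g d r - ?g c r"
      unfolding diff[OF \<open>r \<in> {B2..s}\<close>] using r c B2_pos \<mu>_pos[of r] by (auto intro!: mult_pos_pos divide_pos_pos)
  qed (use c in auto)
  also have "\<dots> = integral {B2..s} (?g d) - integral {B2..s} (?g c)"
    using c by (intro Henstock_Kurzweil_Integration.integral_diff integrable_continuous_interval cg) auto
  finally show ?thesis using eq[of d] eq[of c] c \<mu>_pos[OF B2_pos] by (simp add: mult_strict_left_mono)
qed

text \<open>The identity behind \<open>phi\<close>: an integration by parts in the derivative of \<open>A\<close> with respect to \<open>c\<close>.\<close>

lemma A_parts:
  assumes "B2 \<le> s" "s < M - c"
  shows "integral {B2..s} (\<lambda>r. 1 / (\<mu> r * (M - c - r)\<^sup>2)) = 1 / (\<mu> s * (M - c - s)) - 1 / (\<mu> B2 * (M - c - B2)) + Q c s"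
proof -
  let ?h = "\<lambda>r. 1 / (\<mu> r * (M - c - r))"
  have ne: "\<mu> r \<noteq> 0" "M - c - r \<noteq> 0" if "r \<in> {B2..s}" for r using \<mu>_pos[of r] that assms B2_pos by auto
  have "((\<lambda>r. 1 / (\<mu> r * (M - c - r)\<^sup>2) - \<mu>' r / ((\<mu> r)\<^sup>2 * (M - c - r))) has_integral (?h s - ?h B2)) {B2..s}"
  proof (rule fundamental_theorem_of_calculus[OF assms(1)])
    fix r assume r: "r \<in> {B2..s}"
    have "(?h has_real_derivative 1 / (\<mu> r * (M - c - r)\<^sup>2) - \<mu>' r / ((\<mu> r)\<^sup>2 * (M - c - r))) (at r within {B2..s})"
      by (rule derivative_eq_intros has_field_derivative_at_within[OF \<mu>_DERIV[of r]] refl | use r B2_pos ne[OF r] in \<open>simp add: divide_simps power2_eq_square\<close>)+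
        (use ne[OF r] in \<open>simp add: field_simps power2_eq_square\<close>)?
    then show "(?h has_vector_derivative 1 / (\<mu> r * (M - c - r)\<^sup>2) - \<mu>' r / ((\<mu> r)\<^sup>2 * (M - c - r))) (at r within {B2..s})"
      by (simp add: has_real_derivative_iff_has_vector_derivative)
  qed
  moreover have "((\<lambda>r. \<mu>' r / ((\<mu> r)\<^sup>2 * (M - c - r))) has_integral Q c s) {B2..s}"
    unfolding Q_def using assms by (intro integrable_integral integrable_continuous_interval Q_cont) auto
  ultimately have "((\<lambda>r. 1 / (\<mu> r * (M - c - r)\<^sup>2) - \<mu>' r / ((\<mu> r)\<^sup>2 * (M - c - r)) + \<mu>' r / ((\<mu> r)\<^sup>2 * (M - c - r)))
      has_integral (?h s - ?h B2 + Q c s)) {B2..s}" by (rule has_integral_add)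
  then show ?thesis by (simp add: integral_unique)
qed

text \<open>Differentiation under the integral in \<open>c\<close> and the fundamental theorem in
  \<open>s\<close>, with \<open>A_parts\<close> inserted. The derivative is taken within
  \<open>S\<close> because the variations that use it are one-sided; \<open>s1 + d < M\<close>
  provides a rectangle on which the integrand and its derivative in \<open>c\<close> are
  continuous.\<close>

lemma A_along:
  assumes c: "(c has_real_derivative c') (at q within S)" and s: "(s has_real_derivative s') (at q within S)"
    and q: "q \<in> S" and lim: "s1 + d < M" "\<And>t. t \<in> S \<Longrightarrow> c t < d" "\<And>t. t \<in> S \<Longrightarrow> B2 \<le> s t \<and> s t \<le> s1"
  shows "((\<lambda>t. A (c t) (s t)) has_real_derivative
      (1 / (\<mu> (s q) * (M - c q - s q)) - 1 / (\<mu> B2 * (M - c q - B2)) + Q (c q) (s q)) * c' + 1 / (\<mu> (s q) * (M - c q - s q)) * s') (at q within S)"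
proof -
  define X where "X = {..<d}"
  define Y where "Y = {B2..s1}"
  let ?h = "\<lambda>c r. 1 / (\<mu> r * (M - c - r))"
  have pos: "0 < \<mu> r" "0 < M - c - r" if "c \<in> X" "r \<in> Y" for c r
    using that lim(1) B2_pos \<mu>_pos[of r] by (auto simp: X_def Y_def)
  have XY: "c q \<in> X" "s q \<in> Y" using lim q by (auto simp: X_def Y_def)
  have \<mu>Y: "continuous_on T (\<lambda>p. \<mu> (snd p))" if "T \<subseteq> X \<times> Y" for T
    by (rule continuous_on_compose2[OF \<mu>_cont continuous_on_snd[OF continuous_on_id]]) (use that B2_pos in \<open>auto simp: Y_def\<close>)
  have ch: "continuous_on (X \<times> Y) (\<lambda>p. ?h (fst p) (snd p))"
    using pos by (intro continuous_intros \<mu>Y) force+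
  have chc: "continuous_on {B2..s1} (?h c)" if "c \<in> X" for c
    using continuous_on_compose2[OF ch continuous_on_Pair[OF continuous_on_const[of _ c] continuous_on_id], of Y] that by (auto simp: Y_def)
  have fx: "((\<lambda>c. A c (s q)) has_real_derivative integral {B2..s q} (\<lambda>r. 1 / (\<mu> r * (M - c q - r)\<^sup>2))) (at (c q) within X)"
    unfolding A_def cbox_interval[symmetric]
  proof (rule leibniz_rule_field_derivative)
    have sub: "{B2..s q} \<subseteq> Y" using XY by (auto simp: Y_def)
    show "((\<lambda>c. ?h c r) has_real_derivative 1 / (\<mu> r * (M - c - r)\<^sup>2)) (at c within X)" if "c \<in> X" "r \<in> cbox B2 (s q)" for c r
      using pos[of c r] that sub
      by (auto intro!: derivative_eq_intros simp: power2_eq_square)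
    show "(?h c) integrable_on cbox B2 (s q)" if "c \<in> X" for c
      using continuous_on_subset[OF chc[OF that]] XY by (auto intro!: integrable_continuous_interval simp: Y_def)
    show "continuous_on (X \<times> cbox B2 (s q)) (\<lambda>(c, r). 1 / (\<mu> r * (M - c - r)\<^sup>2))"
      unfolding case_prod_beta using pos sub by (intro continuous_intros \<mu>Y) force+
  qed (use XY in \<open>auto simp: X_def\<close>)
  have fy: "((\<lambda>r. A c r) has_derivative blinfun_apply (blinfun_mult_right (?h c r))) (at r within Y)" if "c \<in> X" "r \<in> Y" for c r
    using integral_has_real_derivative[OF chc[OF that(1)], of r] that
    by (simp add: A_def has_field_derivative_def Y_def)
  have "((\<lambda>(c, r). A c r) has_derivative (\<lambda>(tc, tr). (*) (integral {B2..s q} (\<lambda>r. 1 / (\<mu> r * (M - c q - r)\<^sup>2))) tc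
      + blinfun_apply (blinfun_mult_right (?h (c q) (s q))) tr)) (at (c q, s q) within X \<times> Y)"
  proof (rule has_derivative_partialsI[OF _ fy])
    show "((\<lambda>c. A c (s q)) has_derivative (*) (integral {B2..s q} (\<lambda>r. 1 / (\<mu> r * (M - c q - r)\<^sup>2)))) (at (c q) within X)"
      using fx by (simp add: has_field_derivative_def)
    have "continuous_on (X \<times> Y) (\<lambda>p. blinfun_mult_right (?h (fst p) (snd p)))"
      by (intro bounded_linear.continuous_on[OF bounded_linear_blinfun_mult_right] ch)
    then show "continuous (at (c q, s q) within X \<times> Y) (\<lambda>(c, r). blinfun_mult_right (?h c r))"
      using XY by (auto simp: continuous_on_eq_continuous_within case_prod_unfold)
  qed (use XY in \<open>auto simp: Y_def\<close>)
  then have D: "((\<lambda>(c, r). A c r) has_derivative (\<lambda>(tc, tr). integral {B2..s q} (\<lambda>r. 1 / (\<mu> r * (M - c q - r)\<^sup>2)) * tc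
      + ?h (c q) (s q) * tr)) (at (c q, s q) within (\<lambda>t. (c t, s t)) ` S)"
    by (rule has_derivative_subset[OF has_derivative_eq_rhs]) (use lim in \<open>auto simp: X_def Y_def fun_eq_iff\<close>)
  have "((\<lambda>t. (c t, s t)) has_derivative (\<lambda>h. (c' * h, s' * h))) (at q within S)"
    using c s by (intro has_derivative_Pair) (auto simp: has_field_derivative_def)
  from has_derivative_in_compose[OF this D]
  have "((\<lambda>t. A (c t) (s t)) has_derivative (\<lambda>h. integral {B2..s q} (\<lambda>r. 1 / (\<mu> r * (M - c q - r)\<^sup>2)) * (c' * h) + ?h (c q) (s q) * (s' * h))) (at q within S)"
    by simp
  then have "((\<lambda>t. A (c t) (s t)) has_real_derivative integral {B2..s q} (\<lambda>r. 1 / (\<mu> r * (M - c q - r)\<^sup>2)) * c' + ?h (c q) (s q) * s') (at q within S)"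
    unfolding has_field_derivative_def by (rule has_derivative_eq_rhs) (simp add: fun_eq_iff algebra_simps)
  moreover have "B2 \<le> s q" "s q < M - c q" using XY lim(1) by (auto simp: X_def Y_def)
  ultimately show ?thesis by (simp add: A_parts)
qed

text \<open>Substitution \<open>r = s2 t c\<close>, under which
  \<open>exp t = M - c - r\<close>.\<close>

lemma cost_const:
  assumes c: "0 < c" and s: "B2 \<le> s2 x c"
  shows "x \<le> ln (M - c - B2)" "cost (\<lambda>_. c) x (ln (M - c - B2)) = A c (s2 x c)" "s2 (ln (M - c - B2)) c = B2"
proof -
  let ?e = "ln (M - c - B2)"
  have ex: "exp x \<le> M - c - B2" using s by (simp add: s2_def)
  then have p: "0 < M - c - B2" using exp_gt_zero[of x] by linarith
  show xe: "x \<le> ?e" using ex p by (simp add: ln_ge_iff)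
  show e: "s2 ?e c = B2" using p by (simp add: s2_def)
  have rng: "B2 \<le> s2 t c \<and> s2 t c \<le> s2 x c" if "t \<in> {x..?e}" for t
  proof -
    have "exp x \<le> exp t" "exp t \<le> exp ?e" using that by auto
    then show ?thesis using e unfolding s2_def by linarith
  qed
  have lim: "s2 x c < M - c" using exp_gt_zero[of x] unfolding s2_def by linarith
  have ch: "continuous_on {B2..s2 x c} (\<lambda>r. 1 / (\<mu> r * (M - c - r)))"
  proof (intro continuous_intros continuous_on_subset[OF \<mu>_cont] ballI)
    show "\<mu> r * (M - c - r) \<noteq> 0" if "r \<in> {B2..s2 x c}" for r
      using \<mu>_pos[of r] that lim B2_pos by auto
  qed (use B2_pos in auto)
  have "((\<lambda>t. - (1 / \<mu> (s2 t c))) has_integral (A c (s2 ?e c) - A c (s2 x c))) {x..?e}"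
  proof (rule fundamental_theorem_of_calculus[OF xe])
    fix t assume t: "t \<in> {x..?e}"
    have 1: "(A c has_real_derivative 1 / (\<mu> (s2 t c) * (M - c - s2 t c))) (at (s2 t c) within (\<lambda>t. s2 t c) ` {x..?e})"
      unfolding A_def[abs_def]
      by (rule DERIV_subset[OF integral_has_real_derivative[OF ch]]) (use rng t in auto)
    have 2: "((\<lambda>t. s2 t c) has_real_derivative - exp t) (at t within {x..?e})"
      unfolding s2_def by (auto intro!: derivative_eq_intros)
    have "((\<lambda>t. A c (s2 t c)) has_real_derivative 1 / (\<mu> (s2 t c) * (M - c - s2 t c)) * - exp t) (at t within {x..?e})"
      using DERIV_image_chain[OF 1 2] by (simp add: o_def)
    moreover have "1 / (\<mu> (s2 t c) * (M - c - s2 t c)) * - exp t = - (1 / \<mu> (s2 t c))"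
      by (simp add: s2_def)
    ultimately show "((\<lambda>t. A c (s2 t c)) has_vector_derivative - (1 / \<mu> (s2 t c))) (at t within {x..?e})"
      by (simp add: has_real_derivative_iff_has_vector_derivative)
  qed
  from has_integral_neg[OF this] show "cost (\<lambda>_. c) x ?e = A c (s2 x c)"
    by (simp add: cost_def integral_unique e A_def)
qed

text \<open>The control is the quotient of the slope by \<open>G\<close>, set to 0 outside the
  interval to be Borel.\<close>

lemma rprof_smooth:
  assumes reg: "reg \<kappa> a b" and ab: "a \<le> b" and c: "continuous_on {a..b} g"
    and d: "\<And>x. a < x \<Longrightarrow> x < b \<Longrightarrow> (\<kappa> has_real_derivative - g x) (at x)"
    and g: "\<And>x. x \<in> {a..b} \<Longrightarrow> 0 \<le> g x \<and> g x \<le> G x (\<kappa> x)"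
  shows "\<exists>v. rprof v \<kappa> a b"
proof -
  define v where "v x = indicat_real {a..b} x *\<^sub>R (g x / G x (\<kappa> x))" for x
  have Gp: "0 < G x (\<kappa> x)" if "x \<in> {a..b}" for x
    using reg that by (intro G_nonneg) (auto simp: reg_def)
  have "continuous_on {a..b} (\<lambda>x. g x / G x (\<kappa> x))"
    using Gp by (intro continuous_on_divide c reg_G_cont reg) force
  then have "v \<in> borel_measurable borel"
    unfolding v_def by (intro borel_measurable_continuous_on_indicator) auto
  moreover have "v x \<in> {0..1}" for x
    using g[of x] Gp[of x] by (cases "x \<in> {a..b}") (auto simp: v_def)
  moreover have "(\<kappa> has_real_derivative - v x * G x (\<kappa> x)) (at x)" if "x \<in> {a<..<b} - {}" for x
    using d[of x] Gp[of x] that by (simp add: v_def)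
  ultimately show ?thesis unfolding rprof_def using reg ab by (intro exI[of _ v] conjI allI exI[of _ "{}"]) auto
qed

text \<open>While \<open>S1\<close> rests at \<open>c \<le> B1\<close>, the target is entered
  exactly when \<open>S2\<close> reaches \<open>B2\<close>, and an optimal profile stops
  there.\<close>

lemma opt_end:
  assumes o: "opt \<rho> x0 xf" and y: "\<rho> x0 \<le> E x0" and x3: "x0 \<le> x3" "x3 < xf" and c: "\<And>x. x \<in> {x3..xf} \<Longrightarrow> \<rho> x = c"
  shows "0 < c" "c \<le> B1" "B2 < s2 x3 c" "xf = ln (M - c - B2)" "cost \<rho> x0 xf = cost \<rho> x0 x3 + A c (s2 x3 c)"
proof -
  have reg: "reg \<rho> x0 xf" using o by (simp add: opt_def prof_def)
  have cf: "\<rho> xf = c" "\<rho> x3 = c" using c x3 by auto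
  show c0: "0 < c" using reg x3 cf by (auto simp: reg_def)
  show cB: "c \<le> B1" using o cf by (auto simp: opt_def)
  have s2f: "s2 xf c \<le> B2" using o cf by (auto simp: opt_def)
  show s3: "B2 < s2 x3 c" using opt_before[OF o y x3] cf cB by auto
  note cc = cost_const[OF c0 less_imp_le[OF s3]]
  let ?e = "ln (M - c - B2)"
  have "exp ?e \<le> exp xf" using s2f cc(3) unfolding s2_def by linarith
  then have ef: "?e \<le> xf" by simp
  have "\<not> ?e < xf"
  proof
    assume l: "?e < xf"
    have "\<rho> ?e = c" using cc(1) ef c by auto
    then show False using opt_before[OF o y _ l] cc(1,3) x3 cB by auto
  qed
  then show xe: "xf = ?e" using ef by simp
  have "cost \<rho> x0 xf = cost \<rho> x0 x3 + cost \<rho> x3 xf" using x3 by (intro cost_combine[OF reg]) auto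
  also have "cost \<rho> x3 xf = cost (\<lambda>_. c) x3 xf" by (rule cost_cong) (rule c)
  finally show "cost \<rho> x0 xf = cost \<rho> x0 x3 + A c (s2 x3 c)" using cc(2) xe by simp
qed

lemma phi_Q:
  assumes "B2 \<le> s" "s < M - c"
  shows "phi M B2 \<mu> c s < 1 \<longleftrightarrow> Q c s < 1 / (\<mu> B2 * (M - c - B2))"
    and "1 < phi M B2 \<mu> c s \<longleftrightarrow> 1 / (\<mu> B2 * (M - c - B2)) < Q c s"
proof -
  have "0 < \<mu> B2 * (M - c - B2)" using assms \<mu>_pos[OF B2_pos] by simp
  then show "phi M B2 \<mu> c s < 1 \<longleftrightarrow> Q c s < 1 / (\<mu> B2 * (M - c - B2))"
    and "1 < phi M B2 \<mu> c s \<longleftrightarrow> 1 / (\<mu> B2 * (M - c - B2)) < Q c s"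
    unfolding phi_eq[OF assms] by (simp_all only: pos_less_divide_eq pos_divide_less_eq mult.commute)
qed

text \<open>First variation: a short descent with slope \<open>\<eta>\<close> is inserted before the
  final arc, which then starts at a smaller \<open>S1\<close>. The time \<open>W q\<close> so
  obtained has at \<open>x3\<close> the derivative
  \<open>- \<eta> * (Q c s - 1 / (\<mu> B2 * (M - c - B2)))\<close>, with
  \<open>s = s2 x3 c\<close>; it is negative if \<open>phi > 1\<close>.\<close>

lemma opt_final_phi_le:
  assumes o: "opt \<rho> x0 xf" and y: "\<rho> x0 \<le> E x0" and x3: "x0 \<le> x3" "x3 < xf" and c: "\<And>x. x \<in> {x3..xf} \<Longrightarrow> \<rho> x = c"
  shows "phi M B2 \<mu> c (s2 x3 c) \<le> 1"
proof (rule ccontr)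
  assume phi: "\<not> ?thesis"
  note e = opt_end[OF o y x3 c]
  obtain v where rp: "rprof v \<rho> x0 xf" using opt_rprof[OF o y] by blast
  let ?s = "s2 x3 c"
  have sp: "0 < ?s" using e(3) B2_pos by simp
  have Ms: "M - c - ?s = exp x3" by (simp add: s2_def)
  have sM: "?s < M - c" using Ms exp_gt_zero[of x3] by linarith
  \<comment> \<open>Half of the maximal slope, so that the segment \<open>l\<close> stays admissible
    in a neighbourhood of \<open>x3\<close>.\<close>
  define \<eta> where "\<eta> = G x3 c / 2"
  have G3: "0 < G x3 c" using e(1) sp by (rule G_nonneg)
  have \<eta>: "0 < \<eta>" "\<eta> < G x3 c" using G3 by (auto simp: \<eta>_def)
  define l where "l x = c - \<eta> * (x - x3)" for x
  have l3: "l x3 = c" by (simp add: l_def)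
  have cl: "isCont l x" for x unfolding l_def[abs_def] by (intro continuous_intros)
  have cs: "isCont (\<lambda>x. s2 x (l x)) x" for x unfolding s2_def by (intro continuous_intros cl)
  obtain d1 where d1: "d1 > 0" "\<And>t. \<bar>t - x3\<bar> \<le> d1 \<Longrightarrow> 0 < l t"
    using isCont_pos_nbhd[OF cl[of x3]] e(1) l3 by auto
  obtain d2 where d2: "d2 > 0" "\<And>t. \<bar>t - x3\<bar> \<le> d2 \<Longrightarrow> 0 < s2 t (l t) - B2"
    using isCont_pos_nbhd[of x3 "\<lambda>t. s2 t (l t) - B2"] e(3) l3 cs by (auto intro!: continuous_intros)
  have "isCont (\<lambda>t. G t (l t) - \<eta>) x3"
    unfolding G_def using l3 e(1) sp \<mu>_pos[OF sp]
    by (intro continuous_intros isCont_o2[OF cl f_isCont] isCont_o2[OF cs \<mu>_isCont]) auto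
  then obtain d3 where d3: "d3 > 0" "\<And>t. \<bar>t - x3\<bar> \<le> d3 \<Longrightarrow> 0 < G t (l t) - \<eta>"
    using isCont_pos_nbhd[of x3 "\<lambda>t. G t (l t) - \<eta>"] \<eta> l3 by auto
  \<comment> \<open>Since \<open>M - c - s2 x3 c = exp x3\<close>, two margins of a quarter fit into
    the strict bound of \<open>A_along\<close>.\<close>
  define \<epsilon> where "\<epsilon> = exp x3 / 4"
  have \<epsilon>: "0 < \<epsilon>" by (simp add: \<epsilon>_def)
  define d where "d = min (min d1 d2) (min d3 (\<epsilon> / \<eta>))"
  have d: "0 < d" "d \<le> d1" "d \<le> d2" "d \<le> d3" "d \<le> \<epsilon> / \<eta>"
    using d1(1) d2(1) d3(1) \<epsilon> \<eta>(1) by (auto simp: d_def)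
  define S where "S = {x3..x3 + d}"
  have near: "0 < l t \<and> B2 < s2 t (l t) \<and> \<eta> \<le> G t (l t) \<and> l t \<le> c \<and> s2 t (l t) \<le> ?s + \<epsilon>" if "t \<in> S" for t
  proof -
    have t: "\<bar>t - x3\<bar> \<le> d" "x3 \<le> t" "t - x3 \<le> d" using that by (auto simp: S_def)
    have "\<eta> * (t - x3) \<le> \<eta> * (\<epsilon> / \<eta>)" using t d(5) \<eta>(1) by (intro mult_left_mono) auto
    then have "\<eta> * (t - x3) \<le> \<epsilon>" using \<eta>(1) by simp
    moreover have "0 \<le> \<eta> * (t - x3)" using t \<eta>(1) by simp
    moreover have "exp x3 \<le> exp t" using t by simp
    ultimately have "l t \<le> c \<and> s2 t (l t) \<le> ?s + \<epsilon>" unfolding l_def s2_def by linarith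
    then show ?thesis using d1(2)[of t] d2(2)[of t] d3(2)[of t] t(1) d by auto
  qed
  have regl: "reg l x3 (x3 + d)"
    unfolding reg_def
  proof (intro conjI ballI)
    show "continuous_on {x3..x3 + d} l" using cl by (simp add: continuous_at_imp_continuous_on)
    show "0 < l t" "0 < s2 t (l t)" if "t \<in> {x3..x3 + d}" for t using near[of t] that B2_pos by (auto simp: S_def)
  qed
  define W where "W q = cost l x3 q + A (l q) (s2 q (l q))" for q
  have x3S: "x3 \<in> S" using d(1) by (simp add: S_def)
  have dl: "(l has_real_derivative - \<eta>) (at q within T)" for q T
    unfolding l_def[abs_def] by (auto intro!: derivative_eq_intros)
  have ds: "((\<lambda>q. s2 q (l q)) has_real_derivative \<eta> - exp x3) (at x3 within S)"
    unfolding s2_def by (rule derivative_eq_intros dl refl | simp)+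
  have "((\<lambda>q. A (l q) (s2 q (l q))) has_real_derivative
      (1 / (\<mu> (s2 x3 (l x3)) * (M - l x3 - s2 x3 (l x3))) - 1 / (\<mu> B2 * (M - l x3 - B2)) + Q (l x3) (s2 x3 (l x3))) * (- \<eta>)
      + 1 / (\<mu> (s2 x3 (l x3)) * (M - l x3 - s2 x3 (l x3))) * (\<eta> - exp x3)) (at x3 within S)"
  proof (rule A_along[OF dl ds x3S, of "?s + \<epsilon>" "c + \<epsilon>"])
    show "?s + \<epsilon> + (c + \<epsilon>) < M" using Ms \<epsilon> unfolding \<epsilon>_def by linarith
    show "l t < c + \<epsilon>" "B2 \<le> s2 t (l t) \<and> s2 t (l t) \<le> ?s + \<epsilon>" if "t \<in> S" for t
      using near[OF that] \<epsilon> by auto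
  qed
  then have dA: "((\<lambda>q. A (l q) (s2 q (l q))) has_real_derivative
      (1 / (\<mu> ?s * exp x3) - 1 / (\<mu> B2 * (M - c - B2)) + Q c ?s) * (- \<eta>) + 1 / (\<mu> ?s * exp x3) * (\<eta> - exp x3)) (at x3 within S)"
    by (simp only: l3 Ms)
  have dC: "(cost l x3 has_real_derivative 1 / \<mu> ?s) (at x3 within S)"
    using cost_deriv[OF regl, of x3] d(1) l3 by (simp add: S_def)
  have "(W has_real_derivative 1 / \<mu> ?s + ((1 / (\<mu> ?s * exp x3) - 1 / (\<mu> B2 * (M - c - B2)) + Q c ?s) * (- \<eta>) + 1 / (\<mu> ?s * exp x3) * (\<eta> - exp x3))) (at x3 within S)"
    unfolding W_def[abs_def] by (rule DERIV_add[OF dC dA])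
  moreover have "1 / \<mu> ?s + ((1 / (\<mu> ?s * exp x3) - 1 / (\<mu> B2 * (M - c - B2)) + Q c ?s) * (- \<eta>) + 1 / (\<mu> ?s * exp x3) * (\<eta> - exp x3))
      = - (\<eta> * (Q c ?s - 1 / (\<mu> B2 * (M - c - B2))))"
  proof -
    have "1 / (\<mu> ?s * exp x3) * exp x3 = 1 / \<mu> ?s" by simp
    then show ?thesis by algebra
  qed
  moreover have "0 < Q c ?s - 1 / (\<mu> B2 * (M - c - B2))"
    using phi_Q(2)[of ?s c] e(3) sM phi by auto
  ultimately have "\<exists>e>0. \<forall>h>0. x3 + h \<in> S \<longrightarrow> h < e \<longrightarrow> W (x3 + h) < W x3"
    using \<eta>(1) by (intro has_real_derivative_neg_dec_right[where l = "- (\<eta> * (Q c ?s - 1 / (\<mu> B2 * (M - c - B2))))"]) auto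
  then obtain e' where e': "e' > 0" "\<And>h. 0 < h \<Longrightarrow> x3 + h \<in> S \<Longrightarrow> h < e' \<Longrightarrow> W (x3 + h) < W x3" by blast
  define h where "h = min (d / 2) (e' / 2)"
  have h: "0 < h" "h \<le> d" "h < e'" using d(1) e'(1) by (auto simp: h_def min_def)
  define q where "q = x3 + h"
  have q: "x3 < q" "q \<in> S" "q \<le> x3 + d" using h by (auto simp: q_def S_def)
  have Wq: "W q < W x3" unfolding q_def using e'(2)[of h] h q by (simp add: q_def)
  note nq = near[OF q(2)]
  note ccq = cost_const[of "l q" q]
  let ?e = "ln (M - l q - B2)"
  have qe: "q \<le> ?e" "cost (\<lambda>_. l q) q ?e = A (l q) (s2 q (l q))" "s2 ?e (l q) = B2" using ccq nq by auto
  define k where "k x = (if x \<le> x3 then \<rho> x else if x \<le> q then l x else l q)" for x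
  have r1: "rprof v k x0 x3"
    by (rule rprof_cong[OF rprof_subset[OF rp order_refl x3(1) less_imp_le[OF x3(2)]]]) (simp add: k_def)
  have k2: "l x = k x" if "x \<in> {x3..q}" for x
  proof (cases "x = x3")
    case True
    then show ?thesis using c[of x3] x3 by (simp add: k_def l3)
  next
    case False
    then show ?thesis using that by (simp add: k_def)
  qed
  have k3: "l q = k x" if "x \<in> {q..?e}" for x using that q by (auto simp: k_def)
  have "\<exists>v. rprof v l x3 q"
  proof (rule rprof_smooth[OF reg_subset[OF regl]])
    show "continuous_on {x3..q} (\<lambda>_. \<eta>)" by simp
    show "(l has_real_derivative - \<eta>) (at x)" for x by (rule dl)
    show "0 \<le> \<eta> \<and> \<eta> \<le> G x (l x)" if "x \<in> {x3..q}" for x using near[of x] that q \<eta> by (auto simp: S_def)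
  qed (use q in auto)
  then obtain v2 where "rprof v2 l x3 q" by blast
  then have r2: "rprof v2 k x3 q" by (rule rprof_cong) (rule k2)
  have r3: "rprof (\<lambda>_. 0) k q ?e"
    by (rule rprof_cong[OF rprof_const k3]) (use nq qe B2_pos in auto)
  note r12 = rprof_glue[OF r1 r2]
  note r123 = rprof_glue[OF r12 r3]
  have regk: "reg k x0 ?e" by (rule rprof_reg[OF r123])
  have ke: "k ?e = l q" using k3[of ?e] qe by simp
  have "cost \<rho> x0 xf \<le> cost k x0 ?e"
    by (rule opt_le_rprof[OF o r123]) (use x3 nq e(2) qe ke in \<open>auto simp: k_def\<close>)
  also have "cost k x0 ?e = cost k x0 x3 + cost k x3 ?e"
    using x3 q qe by (intro cost_combine[OF regk]) auto
  also have "cost k x3 ?e = cost k x3 q + cost k q ?e"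
    using x3 q qe by (intro cost_combine[OF reg_subset[OF regk]]) auto
  also have "cost k x0 x3 = cost \<rho> x0 x3" by (rule cost_cong) (simp add: k_def)
  also have "cost k x3 q = cost l x3 q" by (rule cost_cong[symmetric]) (rule k2)
  also have "cost k q ?e = A (l q) (s2 q (l q))"
    unfolding qe(2)[symmetric] by (rule cost_cong[symmetric]) (rule k3)
  finally have "cost \<rho> x0 xf \<le> cost \<rho> x0 x3 + W q" by (simp add: W_def)
  then show False using Wq e(5) by (simp add: W_def l3)
qed

text \<open>The opposite variation: the descent is stopped at some \<open>q < x3\<close> and control
  0 is used from there on. \<open>S1\<close> then ends slightly above \<open>c\<close>, still in the
  target because \<open>c < B1\<close>. The left derivative of the time \<open>W\<close> at
  \<open>x3\<close> is \<open>(Q c s - 1 / (\<mu> B2 * (M - c - B2))) * D\<close>, with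
  \<open>s = s2 x3 c\<close>; it is positive if \<open>phi < 1\<close>, so stopping earlier would be
  faster.\<close>

lemma opt_before_final_phi_ge:
  assumes o: "opt \<rho> x0 xf" and y: "\<rho> x0 \<le> E x0" and x3: "x0 \<le> p" "p < x3" "x3 \<le> xf"
    and c: "\<And>x. x \<in> {x3..xf} \<Longrightarrow> \<rho> x = c" and cB: "c < B1"
    and D: "(\<rho> has_real_derivative D) (at x3 within {p..x3})" "D < 0"
  shows "1 \<le> phi M B2 \<mu> c (s2 x3 c)"
proof (rule ccontr)
  assume phi: "\<not> ?thesis"
  obtain v where rp: "rprof v \<rho> x0 xf" using opt_rprof[OF o y] by blast
  have pr: "prof \<rho> x0 xf" using o by (simp add: opt_def)
  have reg: "reg \<rho> x0 xf" using pr by (simp add: prof_def)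
  have c3: "\<rho> x3 = c" "\<rho> xf = c" using c x3 by auto
  have c0: "0 < c" using reg x3 c3 by (auto simp: reg_def)
  let ?s = "s2 x3 c"
  have Ms: "M - c - ?s = exp x3" by (simp add: s2_def)
  have sM: "?s < M - c" using Ms exp_gt_zero[of x3] by linarith
  define \<epsilon> where "\<epsilon> = exp x3 / 4"
  have \<epsilon>: "0 < \<epsilon>" by (simp add: \<epsilon>_def)
  have "continuous_on {p..x3} \<rho>" using reg_subset[OF reg] x3 by (auto simp: reg_def)
  then have "continuous (at x3 within {p..x3}) \<rho>" using x3 by (simp add: continuous_on_eq_continuous_within)
  then obtain d1 where d1: "d1 > 0" "\<And>t. t \<in> {p..x3} \<Longrightarrow> dist t x3 < d1 \<Longrightarrow> dist (\<rho> t) (\<rho> x3) < min \<epsilon> (B1 - c)"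
    using \<epsilon> cB unfolding continuous_within_eps_delta by (metis diff_gt_0_iff_gt min_less_iff_conj)
  have "isCont exp x3" for x3 :: real by simp
  then obtain d2 where d2: "d2 > 0" "\<And>t. dist t x3 < d2 \<Longrightarrow> dist (exp t) (exp x3) < \<epsilon>"
    using \<epsilon> unfolding continuous_at_eps_delta by blast
  define d where "d = min d1 d2 / 2"
  have d: "0 < d" "d < d1" "d < d2" using d1(1) d2(1) by (auto simp: d_def)
  define p' where "p' = max p (x3 - d)"
  have p': "p \<le> p'" "p' < x3" "x3 - d \<le> p'" using x3 d by (auto simp: p'_def)
  define S where "S = {p'..x3}"
  have near1: "\<rho> t < c + \<epsilon> \<and> \<rho> t \<le> B1 \<and> s2 t (\<rho> t) \<le> ?s + \<epsilon>" if "t \<in> S" for t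
  proof -
    have t: "t \<in> {p..x3}" "dist t x3 < d1" "dist t x3 < d2" using that p' d by (auto simp: S_def dist_real_def)
    have r: "\<bar>\<rho> t - c\<bar> < min \<epsilon> (B1 - c)" using d1(2)[OF t(1,2)] c3 by (simp add: dist_real_def)
    have ex: "\<bar>exp t - exp x3\<bar> < \<epsilon>" using d2(2)[OF t(3)] by (simp add: dist_real_def)
    have "c \<le> \<rho> t" using pr t x3 c3 unfolding prof_def by force
    then show ?thesis using r ex unfolding s2_def by auto
  qed
  have B2lt: "B2 < s2 t (\<rho> t)" if "t \<in> S" "t < x3" for t
    using opt_before[OF o y, of t] near1[OF that(1)] that x3 p' by (auto simp: S_def)
  \<comment> \<open>Shortly before \<open>x3\<close> already \<open>S1 \<le> B1\<close>, so
    \<open>S2 > B2\<close> there because the target is not reached yet; the bound passes to the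
    limit.\<close>
  have s3: "B2 \<le> ?s"
  proof (rule tendsto_lowerbound)
    have "continuous_on S (\<lambda>t. s2 t (\<rho> t))"
      using reg_subset[OF reg, of p' x3] x3 p' unfolding S_def by (intro s2_cont) (auto simp: reg_def)
    then show "((\<lambda>t. s2 t (\<rho> t)) \<longlongrightarrow> ?s) (at x3 within S)"
      using p' c3 by (auto simp: continuous_on S_def)
    show "\<forall>\<^sub>F t in at x3 within S. B2 \<le> s2 t (\<rho> t)"
      unfolding eventually_at using B2lt by (intro exI[of _ 1]) (force simp: S_def)
    show "at x3 within S \<noteq> bot"
      using p' by (simp add: S_def at_within_Icc_at_left trivial_limit_at_left_real)
  qed
  have B2le: "B2 \<le> s2 t (\<rho> t)" if "t \<in> S" for t using B2lt[OF that] s3 c3 that by (cases "t = x3") (auto simp: S_def)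
  \<comment> \<open>The final arc may be empty; then \<open>S2 = B2\<close> at \<open>x3\<close> and
    \<open>A\<close> contributes 0.\<close>
  have tot: "cost \<rho> x0 xf = cost \<rho> x0 x3 + A c ?s"
  proof (cases "x3 < xf")
    case True
    then show ?thesis using opt_end(5)[OF o y _ True c] x3 by simp
  next
    case False
    then have xx: "x3 = xf" using x3 by simp
    have "?s \<le> B2" using o c3 xx by (simp add: opt_def)
    then have "?s = B2" using s3 by simp
    then show ?thesis using xx by (simp add: A_def)
  qed
  define W where "W q = cost \<rho> x0 q + A (\<rho> q) (s2 q (\<rho> q))" for q
  have x3S: "x3 \<in> S" using p' by (simp add: S_def)
  have d\<rho>: "(\<rho> has_real_derivative D) (at x3 within S)"
    by (rule DERIV_subset[OF D(1)]) (use p' in \<open>auto simp: S_def\<close>)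
  have ds: "((\<lambda>q. s2 q (\<rho> q)) has_real_derivative - D - exp x3) (at x3 within S)"
    unfolding s2_def by (rule derivative_eq_intros d\<rho> refl | simp)+
  have "((\<lambda>q. A (\<rho> q) (s2 q (\<rho> q))) has_real_derivative
      (1 / (\<mu> (s2 x3 (\<rho> x3)) * (M - \<rho> x3 - s2 x3 (\<rho> x3))) - 1 / (\<mu> B2 * (M - \<rho> x3 - B2)) + Q (\<rho> x3) (s2 x3 (\<rho> x3))) * D
      + 1 / (\<mu> (s2 x3 (\<rho> x3)) * (M - \<rho> x3 - s2 x3 (\<rho> x3))) * (- D - exp x3)) (at x3 within S)"
  proof (rule A_along[OF d\<rho> ds x3S, of "?s + \<epsilon>" "c + \<epsilon>"])
    show "?s + \<epsilon> + (c + \<epsilon>) < M" using Ms \<epsilon> unfolding \<epsilon>_def by linarith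
    show "\<rho> t < c + \<epsilon>" "B2 \<le> s2 t (\<rho> t) \<and> s2 t (\<rho> t) \<le> ?s + \<epsilon>" if "t \<in> S" for t
      using near1[OF that] B2le[OF that] by auto
  qed
  then have dA: "((\<lambda>q. A (\<rho> q) (s2 q (\<rho> q))) has_real_derivative
      (1 / (\<mu> ?s * exp x3) - 1 / (\<mu> B2 * (M - c - B2)) + Q c ?s) * D + 1 / (\<mu> ?s * exp x3) * (- D - exp x3)) (at x3 within S)"
    by (simp only: c3 Ms)
  have dC: "(cost \<rho> x0 has_real_derivative 1 / \<mu> ?s) (at x3 within S)"
    by (rule DERIV_subset[OF cost_deriv[OF reg, of x3, unfolded c3]]) (use x3 p' in \<open>auto simp: S_def\<close>)
  have "(W has_real_derivative 1 / \<mu> ?s + ((1 / (\<mu> ?s * exp x3) - 1 / (\<mu> B2 * (M - c - B2)) + Q c ?s) * D + 1 / (\<mu> ?s * exp x3) * (- D - exp x3))) (at x3 within S)"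
    unfolding W_def[abs_def] by (rule DERIV_add[OF dC dA])
  moreover have "1 / \<mu> ?s + ((1 / (\<mu> ?s * exp x3) - 1 / (\<mu> B2 * (M - c - B2)) + Q c ?s) * D + 1 / (\<mu> ?s * exp x3) * (- D - exp x3))
      = (Q c ?s - 1 / (\<mu> B2 * (M - c - B2))) * D"
  proof -
    have "1 / (\<mu> ?s * exp x3) * exp x3 = 1 / \<mu> ?s" by simp
    then show ?thesis by algebra
  qed
  moreover have "0 < (Q c ?s - 1 / (\<mu> B2 * (M - c - B2))) * D"
    using phi_Q(1)[of ?s c] s3 sM phi D(2) by (intro mult_neg_neg) auto
  ultimately obtain e' where e': "e' > 0" "\<And>h. 0 < h \<Longrightarrow> x3 - h \<in> S \<Longrightarrow> h < e' \<Longrightarrow> W (x3 - h) < W x3"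
    using has_real_derivative_pos_inc_left[of W "(Q c ?s - 1 / (\<mu> B2 * (M - c - B2))) * D" x3 S] by auto
  define h where "h = min ((x3 - p') / 2) (e' / 2)"
  have h: "0 < h" "h \<le> x3 - p'" "h < e'" using p' e'(1) by (auto simp: h_def min_def)
  define q where "q = x3 - h"
  have q: "q < x3" "q \<in> S" "p' \<le> q" using h by (auto simp: q_def S_def)
  have Wq: "W q < W x3" unfolding q_def using e'(2)[of h] h q by (simp add: q_def)
  have x0q: "x0 \<le> q" "q \<le> xf" using q p' x3 by auto
  have rq: "0 < \<rho> q" using reg x0q by (auto simp: reg_def)
  let ?e = "ln (M - \<rho> q - B2)"
  note qe = cost_const[OF rq B2le[OF q(2)]]
  define k where "k x = (if x \<le> q then \<rho> x else \<rho> q)" for x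
  have r1: "rprof v k x0 q"
    by (rule rprof_cong[OF rprof_subset[OF rp order_refl x0q]]) (simp add: k_def)
  have k3: "\<rho> q = k x" if "x \<in> {q..?e}" for x using that by (auto simp: k_def)
  have r3: "rprof (\<lambda>_. 0) k q ?e"
    by (rule rprof_cong[OF rprof_const k3]) (use rq qe B2_pos in auto)
  note r13 = rprof_glue[OF r1 r3]
  have regk: "reg k x0 ?e" by (rule rprof_reg[OF r13])
  have ke: "k ?e = \<rho> q" using k3[of ?e] qe by simp
  have "cost \<rho> x0 xf \<le> cost k x0 ?e"
    by (rule opt_le_rprof[OF o r13]) (use x0q near1[OF q(2)] qe ke in \<open>auto simp: k_def\<close>)
  also have "cost k x0 ?e = cost k x0 q + cost k q ?e"
    using x0q qe by (intro cost_combine[OF regk]) auto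
  also have "cost k x0 q = cost \<rho> x0 q" by (rule cost_cong) (simp add: k_def)
  also have "cost k q ?e = A (\<rho> q) (s2 q (\<rho> q))"
    unfolding qe(2)[symmetric] by (rule cost_cong[symmetric]) (rule k3)
  finally have "cost \<rho> x0 xf \<le> W q" by (simp add: W_def)
  then show False using Wq tot by (simp add: W_def c3)
qed

subsection \<open>The extended target\<close>

definition S1s :: real where "S1s = S1_star M B1 B2 \<mu> S2s"

lemma C0_iff:
  assumes "0 < c" "c \<le> B1" "B2 < s" "c + s < M"
  shows "(c, s) \<in> C0 M B1 B2 \<mu> \<longleftrightarrow> phi M B2 \<mu> c s = 1"
  using assms B2_pos by (auto simp: C0_def Z0_def state_domain_def target_def)

lemma phi_IVT:
  assumes c: "0 < c" "c \<le> B1" and s: "s \<le> S2s" "B2 \<le> s" "1 \<le> phi M B2 \<mu> c s"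
  shows "\<exists>r. B2 < r \<and> r \<le> s \<and> phi M B2 \<mu> c r = 1 \<and> (c, r) \<in> C0 M B1 B2 \<mu>"
proof -
  have sM: "s < M - c" using c s B1_S2s by simp
  obtain r where r: "B2 \<le> r" "r \<le> s" "phi M B2 \<mu> c r = 1"
    using IVT'[of "phi M B2 \<mu> c" B2 1 s] phi_B2[of c] s phi_cont_s[OF sM] by auto
  have "r \<noteq> B2" using r(3) phi_B2[of c] by auto
  then have "B2 < r" using r(1) by simp
  then show ?thesis using r c sM by (intro exI[of _ r]) (auto simp: C0_iff)
qed

text \<open>If \<open>C0\<close> is nonempty, then \<open>phi\<close> at height \<open>S2s\<close>
  is at least 1 for some \<open>S1 \<le> B1\<close>, hence greater than 1 for every
  \<open>S1\<close> slightly above \<open>B1\<close>; the set in the infimum comes arbitrarily close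
  to \<open>B1\<close>.\<close>

lemma S1s_le: "S1s \<le> B1"
proof (cases "C0 M B1 B2 \<mu> = {}")
  case True
  then show ?thesis by (simp add: S1s_def S1_star_def)
next
  case False
  then obtain c s where cs: "(c, s) \<in> C0 M B1 B2 \<mu>" by auto
  then have c: "0 \<le> c" "c \<le> B1" "B2 < s" "s < M - c" "phi M B2 \<mu> c s = 1"
    by (auto simp: C0_def Z0_def state_domain_def)
  have "1 \<le> phi M B2 \<mu> c S2s" using phi_le_S2s[of s c] c B1_S2s by simp
  let ?Y = "{s1. 0 < s1 \<and> s1 + S2s < M \<and> phi M B2 \<mu> s1 S2s > 1}"
  have bdd: "bdd_below ?Y" by (auto intro!: bdd_belowI[of _ 0])
  have "Inf ?Y \<le> d" if d: "B1 < d" "d + S2s < M" for d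
  proof (rule cInf_lower[OF _ bdd])
    have "phi M B2 \<mu> c S2s < phi M B2 \<mu> d S2s" using c d B2_less by (intro phi_less_c) auto
    then show "d \<in> ?Y" using \<open>1 \<le> phi M B2 \<mu> c S2s\<close> d c by auto
  qed
  note low = this
  have "Inf ?Y \<le> B1"
  proof (rule ccontr)
    assume n: "\<not> ?thesis"
    define d where "d = (B1 + min (Inf ?Y) (M - S2s)) / 2"
    have "B1 < d" "d < Inf ?Y" "d < M - S2s" using n B1_S2s by (auto simp: d_def min_def field_simps)
    then show False using low[of d] by simp
  qed
  then show ?thesis using False by (simp add: S1s_def S1_star_def)
qed

text \<open>At a midpoint between \<open>c\<close> and \<open>S1s\<close> one has
  \<open>phi \<le> 1\<close> at height \<open>S2s\<close>, and strict monotonicity in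
  \<open>S1\<close> gives less than 1 at \<open>c\<close>. If \<open>C0\<close> is empty, a value of
  at least 1 would produce a point of it.\<close>

lemma phi_less_1:
  assumes c: "0 < c" "c < S1s" and s: "B2 \<le> s" "s \<le> S2s"
  shows "phi M B2 \<mu> c s < 1"
proof -
  have cM: "S2s < M - c" "c < B1" using c S1s_le B1_S2s by auto
  have "phi M B2 \<mu> c S2s < 1"
  proof (cases "C0 M B1 B2 \<mu> = {}")
    case True
    then show ?thesis using phi_IVT[of c S2s] c cM B2_less by force
  next
    case False
    let ?Y = "{s1. 0 < s1 \<and> s1 + S2s < M \<and> phi M B2 \<mu> s1 S2s > 1}"
    have bdd: "bdd_below ?Y" by (auto intro!: bdd_belowI[of _ 0])
    define d where "d = (c + S1s) / 2"
    have d: "c < d" "d < S1s" using c by (auto simp: d_def)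
    have dM: "d + S2s < M" using d S1s_le B1_S2s by simp
    have "d \<notin> ?Y"
    proof
      assume "d \<in> ?Y"
      then have "Inf ?Y \<le> d" by (rule cInf_lower[OF _ bdd])
      then show False using d False by (simp add: S1s_def S1_star_def)
    qed
    then have "phi M B2 \<mu> d S2s \<le> 1" using d c dM by auto
    moreover have "phi M B2 \<mu> c S2s < phi M B2 \<mu> d S2s" using d dM B2_less by (intro phi_less_c) auto
    ultimately show ?thesis by simp
  qed
  then show ?thesis using phi_le_S2s[of s c] s cM by simp
qed

lemma phi_greater_1:
  assumes pos: "0 < S1s" and c: "S1s < c" "c \<le> B1"
  shows "1 < phi M B2 \<mu> c S2s"
proof -
  have ne: "C0 M B1 B2 \<mu> \<noteq> {}" using c by (auto simp: S1s_def S1_star_def)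
  let ?Y = "{s1. 0 < s1 \<and> s1 + S2s < M \<and> phi M B2 \<mu> s1 S2s > 1}"
  obtain a s where "(a, s) \<in> C0 M B1 B2 \<mu>" using ne by auto
  then have a: "0 \<le> a" "a \<le> B1" "B2 < s" "s < M - a" "phi M B2 \<mu> a s = 1"
    by (auto simp: C0_def Z0_def state_domain_def)
  define d where "d = (B1 + (M - S2s)) / 2"
  have d: "B1 < d" "d + S2s < M" using B1_S2s by (auto simp: d_def field_simps)
  have "1 \<le> phi M B2 \<mu> a S2s" using phi_le_S2s[of s a] a B1_S2s by simp
  also have "\<dots> < phi M B2 \<mu> d S2s" using a d B2_less by (intro phi_less_c) auto
  finally have "d \<in> ?Y" using d a by auto
  then have Y: "?Y \<noteq> {}" by blast
  have "Inf ?Y < c" using c ne by (simp add: S1s_def S1_star_def)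
  from cInf_lessD[OF Y this] obtain e where e: "e \<in> ?Y" "e < c" by (rule bexE)
  have "phi M B2 \<mu> e S2s < phi M B2 \<mu> c S2s" using e c B2_less B1_S2s by (intro phi_less_c) auto
  then show ?thesis using e by auto
qed

text \<open>\<open>E0\<close> is a closure, so a neighbourhood has to be excluded. For
  \<open>S1s < d < c\<close> there is a height \<open>r < S2s\<close> with \<open>phi > 1\<close> at
  \<open>(d, r)\<close>; every vertical line with \<open>d < S1 \<le> B1\<close> has met
  \<open>C0\<close> by that height.\<close>

lemma not_E0:
  assumes pos: "0 < S1s" and c: "S1s < c" and s: "S2s \<le> s"
  shows "(c, s) \<notin> E0 M B1 B2 \<mu>"
proof (cases "c \<le> B1")
  case False
  have "E0 M B1 B2 \<mu> \<subseteq> {..B1} \<times> UNIV"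
    unfolding E0_def by (intro closure_minimal closed_Times closed_atMost closed_UNIV) (auto simp: Z0_def)
  then show ?thesis using False by auto
next
  case True
  define d where "d = (S1s + c) / 2"
  have d: "S1s < d" "d < c" using c by (auto simp: d_def)
  have dM: "S2s < M - d" using d True B1_S2s by simp
  have "1 < phi M B2 \<mu> d S2s" using d True by (intro phi_greater_1 pos) auto
  moreover have "continuous_on {B2..S2s} (phi M B2 \<mu> d)" by (rule phi_cont_s[OF dM])
  ultimately obtain r where r: "B2 \<le> r" "r \<le> S2s" "phi M B2 \<mu> d r = (1 + phi M B2 \<mu> d S2s) / 2"
    using IVT'[of "phi M B2 \<mu> d" B2 "(1 + phi M B2 \<mu> d S2s) / 2" S2s] phi_B2[of d] B2_less by auto
  have r1: "1 < phi M B2 \<mu> d r" "r \<noteq> S2s" "r \<noteq> B2" using r(3) \<open>1 < phi M B2 \<mu> d S2s\<close> phi_B2[of d] by (auto simp: field_simps)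
  have r2: "B2 < r" "r < S2s" using r r1 by auto
  have "{d<..} \<times> {r<..} \<inter> {(S1, S2) \<in> Z0 M B1 B2. \<forall>s2<S2. (S1, s2) \<notin> C0 M B1 B2 \<mu>} = {}"
  proof (rule ccontr)
    assume "\<not> ?thesis"
    then obtain a t where a: "d < a" "r < t" "(a, t) \<in> Z0 M B1 B2" "\<And>s2. s2 < t \<Longrightarrow> (a, s2) \<notin> C0 M B1 B2 \<mu>"
      by auto
    have aB: "a \<le> B1" using a(3) by (auto simp: Z0_def)
    have "phi M B2 \<mu> d r < phi M B2 \<mu> a r" using a(1) r2 aB B1_S2s by (intro phi_less_c) auto
    then obtain q where q: "q \<le> r" "(a, q) \<in> C0 M B1 B2 \<mu>"
      using phi_IVT[of a r] aB a(1) d pos r2 r1 by auto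
    then show False using a(4)[of q] a(2) by simp
  qed
  moreover have "open ({d<..} \<times> {r<..})" by (intro open_Times open_greaterThan)
  ultimately have "{d<..} \<times> {r<..} \<inter> E0 M B1 B2 \<mu> = {}"
    unfolding E0_def by (simp add: open_Int_closure_eq_empty)
  moreover have "(c, s) \<in> {d<..} \<times> {r<..}" using d r2 s by simp
  ultimately show ?thesis by blast
qed

text \<open>A point of \<open>Z0\<close> outside \<open>E0\<close> has a point of \<open>C0\<close>
  below it, and \<open>phi\<close> increases strictly up to \<open>S2s\<close>.\<close>

lemma not_E0_phi:
  assumes c: "0 < c" "c \<le> B1" and s: "B2 < s" "s \<le> S2s" and n: "(c, s) \<notin> E0 M B1 B2 \<mu>"
  shows "1 < phi M B2 \<mu> c s"
proof -
  have Z: "(c, s) \<in> Z0 M B1 B2"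
    using c s B1_S2s B2_pos by (auto simp: Z0_def state_domain_def target_def)
  have "{(S1, S2) \<in> Z0 M B1 B2. \<forall>s2<S2. (S1, s2) \<notin> C0 M B1 B2 \<mu>} \<subseteq> E0 M B1 B2 \<mu>"
    unfolding E0_def by (rule closure_subset)
  from contra_subsetD[OF this n] have "\<not> (\<forall>r<s. (c, r) \<notin> C0 M B1 B2 \<mu>)" using Z by simp
  then obtain r where r: "r < s" "(c, r) \<in> C0 M B1 B2 \<mu>" by blast
  then have "phi M B2 \<mu> c r = 1" "B2 < r" by (auto simp: C0_def Z0_def)
  moreover have "phi M B2 \<mu> c r < phi M B2 \<mu> c s"
    using r s c B1_S2s \<open>B2 < r\<close> by (intro phi_less) auto
  ultimately show ?thesis by simp
qed

subsection \<open>Existence of optimal profiles\<close>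

text \<open>Rescaling to a fixed interval makes the end point a parameter under the
  integral.\<close>

lemma cost_affine:
  assumes reg: "reg \<kappa> a b" and ab: "a \<le> b"
  shows "cost \<kappa> a b = integral {0..1} (\<lambda>\<theta>. (b - a) / \<mu> (s2 (a + \<theta> * (b - a)) (\<kappa> (a + \<theta> * (b - a)))))"
proof -
  let ?x = "\<lambda>\<theta>. a + \<theta> * (b - a)"
  have x: "?x \<theta> \<in> {a..b}" if "\<theta> \<in> {0..1}" for \<theta>
  proof -
    have "0 \<le> \<theta> * (b - a)" "\<theta> * (b - a) \<le> b - a" using that ab by (auto intro: mult_left_le_one_le)
    then show ?thesis by simp
  qed
  have "((\<lambda>\<theta>. (b - a) / \<mu> (s2 (?x \<theta>) (\<kappa> (?x \<theta>)))) has_integral (cost \<kappa> a (?x 1) - cost \<kappa> a (?x 0))) {0..1}"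
  proof (rule fundamental_theorem_of_calculus)
    fix \<theta> :: real assume \<theta>: "\<theta> \<in> {0..1}"
    have 1: "(cost \<kappa> a has_real_derivative 1 / \<mu> (s2 (?x \<theta>) (\<kappa> (?x \<theta>)))) (at (?x \<theta>) within ?x ` {0..1})"
      by (rule DERIV_subset[OF cost_deriv[OF reg x[OF \<theta>]]]) (use x in auto)
    have 2: "(?x has_real_derivative (b - a)) (at \<theta> within {0..1})" by (auto intro!: derivative_eq_intros)
    show "((\<lambda>\<theta>. cost \<kappa> a (?x \<theta>)) has_vector_derivative (b - a) / \<mu> (s2 (?x \<theta>) (\<kappa> (?x \<theta>)))) (at \<theta> within {0..1})"
      using DERIV_image_chain[OF 1 2] by (simp add: o_def has_real_derivative_iff_has_vector_derivative[symmetric])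
  qed simp
  then show ?thesis by (simp add: integral_unique)
qed

context
  fixes cm :: real
  assumes cm_pos: "0 < cm" and cm_le: "cm \<le> S1m"
begin

text \<open>The distance of the curves for \<open>b\<close> and \<open>b0\<close> is governed by
  their distance at \<open>b\<close>, which is that of \<open>E b\<close> and
  \<open>beta cm b0 b\<close> and tends to 0 as \<open>b\<close> tends to \<open>b0\<close>.\<close>

lemma beta_joint_cont: "continuous_on UNIV (\<lambda>p. beta cm (fst p) (snd p))"
  unfolding continuous_on
proof
  fix p0 :: "real \<times> real"
  obtain b0 x0 where p0: "p0 = (b0, x0)" by (cases p0)
  obtain K where K: "K > 0" "\<And>b x p. \<bar>beta cm b x - beta cm b0 x\<bar> \<le> \<bar>beta cm b p - beta cm b0 p\<bar> * exp (K * \<bar>x - p\<bar>)"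
    using beta_dist[OF cm_pos cm_le] beta_deriv[OF cm_pos cm_le] by blast
  let ?h = "\<lambda>p. \<bar>E (fst p) - beta cm b0 (fst p)\<bar> * exp (K * \<bar>snd p - fst p\<bar>)"
  have ch: "continuous_on UNIV ?h"
    by (intro continuous_intros continuous_on_compose2[OF E_cont[of UNIV]] continuous_on_compose2[OF beta_cont[OF cm_pos cm_le, of UNIV b0]]) auto
  have "(?h \<longlongrightarrow> ?h p0) (at p0 within UNIV)" by (rule bspec[OF ch[unfolded continuous_on] UNIV_I])
  then have h0: "(?h \<longlongrightarrow> 0) (at p0 within UNIV)" by (simp add: p0 beta_self[OF cm_pos cm_le])
  have "((\<lambda>p. beta cm (fst p) (snd p) - beta cm b0 (snd p)) \<longlongrightarrow> 0) (at p0 within UNIV)"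
  proof (rule Lim_null_comparison[OF always_eventually h0], rule allI)
    show "norm (beta cm (fst p) (snd p) - beta cm b0 (snd p)) \<le> ?h p" for p
      using K(2)[of "fst p" "snd p" "fst p"] by (simp add: beta_self[OF cm_pos cm_le])
  qed
  moreover have "continuous_on UNIV (\<lambda>p :: real \<times> real. beta cm b0 (snd p))"
    by (rule continuous_on_compose2[OF beta_cont[OF cm_pos cm_le, of UNIV]]) (auto intro!: continuous_intros)
  from bspec[OF this[unfolded continuous_on] UNIV_I]
  have "((\<lambda>p. beta cm b0 (snd p)) \<longlongrightarrow> beta cm b0 (snd p0)) (at p0 within UNIV)" .
  ultimately have "((\<lambda>p. (beta cm (fst p) (snd p) - beta cm b0 (snd p)) + beta cm b0 (snd p)) \<longlongrightarrow> 0 + beta cm b0 (snd p0)) (at p0 within UNIV)"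
    by (rule tendsto_add)
  then show "((\<lambda>p. beta cm (fst p) (snd p)) \<longlongrightarrow> beta cm (fst p0) (snd p0)) (at p0 within UNIV)"
    by (simp add: p0)
qed

lemma beta_cont2:
  assumes "continuous_on X b" "continuous_on X x"
  shows "continuous_on X (\<lambda>t. beta cm (b t) (x t))"
  using continuous_on_compose2[OF beta_joint_cont continuous_on_Pair[OF assms]] by simp

lemma kap_cont2:
  assumes "continuous_on X b" "continuous_on X c" "continuous_on X x"
  shows "continuous_on X (\<lambda>t. kap cm y (b t) (c t) (x t))"
  unfolding kap_def mcurve_def E_def
  by (intro continuous_on_min continuous_on_max continuous_on_diff continuous_on_const continuous_on_exp beta_cont2 assms)

lemma kap_admissible:
  assumes "xm \<le> b" "cm \<le> c" "c \<le> y" "x0 \<le> xf" "0 < s2 xf c"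
  shows "\<exists>v. rprof v (kap cm y b c) x0 xf"
proof -
  obtain z where z: "z \<le> xm" "\<And>x. x0 \<le> x \<Longrightarrow> x < z \<Longrightarrow> E x \<le> beta cm b x"
    "\<And>x. x0 \<le> x \<Longrightarrow> z < x \<Longrightarrow> x \<le> b \<Longrightarrow> beta cm b x \<le> E x"
    using singular_end[OF cm_pos cm_le assms(1), of x0] by blast
  show ?thesis using kap_rprof[OF cm_pos cm_le assms(1) z assms(2-5)] by blast
qed

text \<open>At \<open>x = ln M\<close> one has \<open>exp x = M\<close>, so positivity of
  \<open>S2\<close> forces a negative value of the curve; it has passed \<open>c\<close>
  before.\<close>

lemma beta_reaches:
  assumes "xm \<le> b" "b \<le> ln M" "0 < c" "c \<le> E b"
  shows "\<exists>x\<ge>b. beta cm b x = c \<and> 0 < s2 x c"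
proof -
  have "0 < s2 (ln M) (beta cm b (ln M))"
    by (rule beta_s2_pos[OF cm_pos cm_le assms(2)]) simp
  then have "beta cm b (ln M) < 0" using M_pos by (simp add: s2_def)
  then obtain x where x: "b \<le> x" "x \<le> ln M" "beta cm b x = c"
    using IVT2'[of "beta cm b" "ln M" c b] assms beta_cont[OF cm_pos cm_le] beta_self[OF cm_pos cm_le, of b] by auto
  then show ?thesis using beta_s2_pos[OF cm_pos cm_le x(1,2)] by auto
qed

end

text \<open>The competitor through \<open>xm\<close>: along the line to \<open>xm\<close>, then
  control 1 down to the smaller of \<open>S1m\<close> and \<open>B1\<close>, then control 0 until
  \<open>S2 \<le> B2\<close>.\<close>

lemma reaches_exists:
  assumes y: "S1m < y" and x0: "E x0 = y"
  shows "\<exists>t. reaches y x0 t"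
proof -
  define c where "c = min S1m B1"
  have c: "0 < c" "c \<le> S1m" "c \<le> B1" "c \<le> y" using S1m(1) B1_pos y by (auto simp: c_def)
  have x0m: "x0 < xm" using y x0 E_less[of xm x0] by (simp add: E_xm)
  have "exp xm \<le> M" using S1m S2s_pos by (simp add: exp_xm)
  then have xmM: "xm \<le> ln M" using M_pos by (simp add: ln_ge_iff)
  obtain x1 where x1: "xm \<le> x1" "beta c xm x1 = c" "0 < s2 x1 c"
    using beta_reaches[OF c(1,2) order_refl xmM c(1)] c(2) by (auto simp: E_xm)
  define xf where "xf = max x1 (ln (M - c - B2))"
  have cM: "0 < M - c - B2" using c B1_S2s B2_less by simp
  have s: "0 < s2 xf c" "s2 xf c \<le> B2"
  proof -
    have "s2 (ln (M - c - B2)) c = B2" using cM by (simp add: s2_def)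
    moreover have "s2 xf c = min (s2 x1 c) (s2 (ln (M - c - B2)) c)"
      unfolding xf_def s2_def by (simp add: max_def min_def)
    ultimately show "0 < s2 xf c" "s2 xf c \<le> B2" using x1(3) B2_pos by auto
  qed
  have x0f: "x0 \<le> xf" using x0m x1 by (simp add: xf_def)
  obtain v where rp: "rprof v (kap c y xm c) x0 xf"
    using kap_admissible[OF c(1,2) order_refl order_refl c(4) x0f s(1)] by blast
  have m0: "mcurve c xm x0 = y"
    using mcurve_left[OF c(1,2), of x0 xm] beta_xm_ge_E[OF c(1,2), of x0] x0m x0 by simp
  have "mcurve c xm xf \<le> c"
    using mcurve_right[OF c(1,2), of xm xf] beta_le[OF c(1,2), of x1 xf xm] x1 by (simp add: xf_def)
  then have kf: "kap c y xm c xf = c" using c by (simp add: kap_def)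
  have "reaches (kap c y xm c x0) x0 (cost (kap c y xm c) x0 xf)"
    by (rule rprof_reaches[OF rp]) (use kf c s in auto)
  then show ?thesis using m0 c by (auto simp: kap_def)
qed

text \<open>Starting points on the line with \<open>S1 > S1m\<close> are those from which optimal
  profiles are continued backwards or compared with \<open>\<xi>\<close>. By
  \<open>domination\<close> it suffices to minimise over \<open>(b, c, xf)\<close>.\<close>

lemma opt_exists:
  assumes y: "S1m < y" and x0: "E x0 = y"
  shows "\<exists>\<rho> xf. opt \<rho> x0 xf \<and> \<rho> x0 = y"
proof -
  obtain T0 where T0: "reaches y x0 T0" using reaches_exists[OF assms] by blast
  have yp: "0 < y" using y S1m(1) by simp
  have s20: "s2 x0 y = S2s" using x0 s2_E[of x0] by simp
  have x0m: "x0 < xm" using y x0 E_less[of xm x0] by (simp add: E_xm)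
  have "exp xm \<le> M" using S1m S2s_pos by (simp add: exp_xm)
  then have xmM: "xm \<le> ln M" using M_pos by (simp add: ln_ge_iff)
  obtain L where L: "L > 0" "\<And>t. reaches y x0 t \<Longrightarrow>
    \<exists>\<rho> xf. x0 \<le> xf \<and> prof \<rho> x0 xf \<and> \<rho> x0 = y \<and> cost \<rho> x0 xf = t \<and> \<rho> xf \<le> B1 \<and> s2 xf (\<rho> xf) \<le> B2 \<and>
      y \<le> \<rho> xf * exp (L * t) \<and> S2s \<le> s2 xf (\<rho> xf) * exp (L * t) \<and> 0 \<le> t"
    using reaches_prof yp S2s_pos s20 by metis
  \<comment> \<open>Only times up to \<open>T0\<close>, that of one successful trajectory, compete,
    so at least the fraction \<open>\<sigma>\<close> of \<open>S1\<close> and \<open>S2\<close> is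
    left at the end.\<close>
  define \<sigma> where "\<sigma> = exp (- (L * T0))"
  have \<sigma>: "0 < \<sigma>" by (simp add: \<sigma>_def)
  define c0 s0 where "c0 = y * \<sigma>" and "s0 = S2s * \<sigma>"
  have cs0: "0 < c0" "0 < s0" using \<sigma> yp S2s_pos by (auto simp: c0_def s0_def)
  define cm where "cm = min S1m c0"
  have cm: "0 < cm" "cm \<le> S1m" "cm \<le> c0" using S1m(1) cs0 by (auto simp: cm_def)
  define b c e where "b = (\<lambda>p :: real \<times> real \<times> real. fst p)" and "c = (\<lambda>p :: real \<times> real \<times> real. fst (snd p))"
    and "e = (\<lambda>p :: real \<times> real \<times> real. snd (snd p))"
  have cont: "continuous_on X b" "continuous_on X c" "continuous_on X e" for X
    unfolding b_def c_def e_def by (intro continuous_intros)+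
  \<comment> \<open>The closed conditions say in turn that the profile starts at \<open>y\<close>,
    that it ends at \<open>c\<close>, that \<open>S2\<close> stays away from 0 at the end, and that
    it has come down to the target.\<close>
  define Ks where "Ks = ({xm..ln M} \<times> {c0..min y B1} \<times> {x0..ln M}) \<inter>
    ({p. y \<le> mcurve cm (b p) x0} \<inter> {p. kap cm y (b p) (c p) (e p) = c p} \<inter> {p. s0 \<le> s2 (e p) (c p)} \<inter> {p. s2 (e p) (c p) \<le> B2})"
  define J where "J p = cost (kap cm y (b p) (c p)) x0 (e p)" for p
  have "continuous_on UNIV (\<lambda>p. mcurve cm (b p) x0)"
    unfolding mcurve_def E_def
    by (intro continuous_on_min continuous_on_max continuous_on_diff continuous_on_const continuous_on_exp beta_cont2[OF cm(1,2)] cont)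
  moreover have "continuous_on UNIV (\<lambda>p. kap cm y (b p) (c p) (e p))"
    by (intro kap_cont2[OF cm(1,2)] cont)
  moreover have "continuous_on UNIV (\<lambda>p. s2 (e p) (c p))"
    unfolding s2_def by (intro continuous_on_diff continuous_on_const continuous_on_exp cont)
  ultimately have "compact Ks"
    unfolding Ks_def
    by (intro compact_Int_closed compact_Times compact_Icc closed_Int closed_Collect_le closed_Collect_eq continuous_on_const cont)
  have dest: "xm \<le> b p" "cm \<le> c p" "c p \<le> y" "c p \<le> B1" "x0 \<le> e p" "y \<le> mcurve cm (b p) x0"
    "kap cm y (b p) (c p) (e p) = c p" "0 < s2 (e p) (c p)" "s2 (e p) (c p) \<le> B2" if "p \<in> Ks" for p
    using that cm cs0 unfolding Ks_def b_def c_def e_def by auto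
  have adm: "\<exists>v. rprof v (kap cm y (b p) (c p)) x0 (e p)" if "p \<in> Ks" for p
    using kap_admissible[OF cm(1,2) dest(1,2,3,5,8)[OF that]] .
  have reg: "reg (kap cm y (b p) (c p)) x0 (e p)" if "p \<in> Ks" for p
    using adm[OF that] rprof_reg by blast
  let ?x = "\<lambda>p \<theta>. x0 + \<theta> * (e p - x0)"
  let ?g = "\<lambda>p \<theta>. (e p - x0) / \<mu> (s2 (?x p \<theta>) (kap cm y (b p) (c p) (?x p \<theta>)))"
  have Jeq: "J p = integral (cbox 0 1) (?g p)" if "p \<in> Ks" for p
    unfolding J_def cbox_interval by (rule cost_affine[OF reg dest(5)]) (use that in auto)
  have spos: "0 < s2 (?x p \<theta>) (kap cm y (b p) (c p) (?x p \<theta>))" if p: "p \<in> Ks" and \<theta>: "\<theta> \<in> {0..1}" for p \<theta>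
  proof -
    have "0 \<le> \<theta> * (e p - x0)" "\<theta> * (e p - x0) \<le> e p - x0" using \<theta> dest(5)[OF p] by (auto intro: mult_left_le_one_le)
    then have "?x p \<theta> \<in> {x0..e p}" by simp
    then show ?thesis using reg[OF p] unfolding reg_def by blast
  qed
  have "continuous_on Ks J"
  proof (rule continuous_on_eq[of Ks "\<lambda>p. integral (cbox 0 1) (?g p)"])
    show "continuous_on Ks (\<lambda>p. integral (cbox 0 1) (?g p))"
    proof (rule integral_continuous_on_param)
      let ?P = "Ks \<times> cbox 0 (1 :: real)"
      have cf: "continuous_on ?P (\<lambda>q. h (fst q))" if "continuous_on UNIV h" for h :: "real \<times> real \<times> real \<Rightarrow> real"
        by (rule continuous_on_compose2[OF that]) (auto intro!: continuous_intros)
      have cx: "continuous_on ?P (\<lambda>q. ?x (fst q) (snd q))"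
        by (intro continuous_on_add continuous_on_mult continuous_on_diff continuous_on_const continuous_on_snd continuous_on_id cf cont)
      have ck: "continuous_on ?P (\<lambda>q. s2 (?x (fst q) (snd q)) (kap cm y (b (fst q)) (c (fst q)) (?x (fst q) (snd q))))"
        unfolding s2_def by (intro continuous_on_diff continuous_on_const continuous_on_exp cx kap_cont2[OF cm(1,2)] cf cont)
      have "continuous_on ?P (\<lambda>q. \<mu> (s2 (?x (fst q) (snd q)) (kap cm y (b (fst q)) (c (fst q)) (?x (fst q) (snd q)))))"
      proof (rule continuous_on_compose2[OF \<mu>_cont ck], rule image_subsetI)
        fix q assume "q \<in> ?P"
        then show "s2 (?x (fst q) (snd q)) (kap cm y (b (fst q)) (c (fst q)) (?x (fst q) (snd q))) \<in> {0..}"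
          using spos[of "fst q" "snd q"] by (auto simp: mem_Times_iff intro: less_imp_le)
      qed
      then have "continuous_on ?P (\<lambda>q. ?g (fst q) (snd q))"
      proof (rule continuous_on_divide[rotated])
        show "continuous_on ?P (\<lambda>q. e (fst q) - x0)" by (intro continuous_on_diff continuous_on_const cf cont)
        show "\<forall>q\<in>?P. \<mu> (s2 (?x (fst q) (snd q)) (kap cm y (b (fst q)) (c (fst q)) (?x (fst q) (snd q)))) \<noteq> 0"
        proof
          fix q assume "q \<in> ?P"
          then have "0 < \<mu> (s2 (?x (fst q) (snd q)) (kap cm y (b (fst q)) (c (fst q)) (?x (fst q) (snd q))))"
            by (intro \<mu>_pos spos) (auto simp: mem_Times_iff)
          then show "\<mu> (s2 (?x (fst q) (snd q)) (kap cm y (b (fst q)) (c (fst q)) (?x (fst q) (snd q)))) \<noteq> 0" by simp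
        qed
      qed
      then show "continuous_on ?P (\<lambda>(p, \<theta>). ?g p \<theta>)" by (simp only: case_prod_unfold)
    qed
    show "integral (cbox 0 1) (?g p) = J p" if "p \<in> Ks" for p using Jeq[OF that] by simp
  qed
  moreover have dom: "\<exists>p\<in>Ks. J p \<le> t" if t: "reaches y x0 t" "t \<le> T0" for t
  proof -
    obtain \<rho> xf where r: "x0 \<le> xf" "prof \<rho> x0 xf" "\<rho> x0 = y" "cost \<rho> x0 xf = t" "\<rho> xf \<le> B1" "s2 xf (\<rho> xf) \<le> B2"
      "y \<le> \<rho> xf * exp (L * t)" "S2s \<le> s2 xf (\<rho> xf) * exp (L * t)"
      using L(2)[OF t(1)] by blast
    have reg\<rho>: "reg \<rho> x0 xf" using r by (simp add: prof_def)
    then have pos: "0 < \<rho> xf" "0 < s2 xf (\<rho> xf)" using r by (auto simp: reg_def)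
    have ex: "exp (L * t) \<le> exp (L * T0)" using t L(1) by simp
    have ee: "exp (L * T0) * \<sigma> = 1" by (simp add: \<sigma>_def flip: exp_add)
    have "y \<le> \<rho> xf * exp (L * T0)" using r(7) mult_left_mono[OF ex, of "\<rho> xf"] pos by linarith
    then have "y * \<sigma> \<le> \<rho> xf * exp (L * T0) * \<sigma>" using \<sigma> by (intro mult_right_mono) auto
    then have c0: "c0 \<le> \<rho> xf" using ee by (simp add: c0_def mult.assoc)
    have "S2s \<le> s2 xf (\<rho> xf) * exp (L * T0)" using r(8) mult_left_mono[OF ex, of "s2 xf (\<rho> xf)"] pos by linarith
    then have "S2s * \<sigma> \<le> s2 xf (\<rho> xf) * exp (L * T0) * \<sigma>" using \<sigma> by (intro mult_right_mono) auto
    then have s0: "s0 \<le> s2 xf (\<rho> xf)" using ee by (simp add: s0_def mult.assoc)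
    have "exp xf \<le> M" using pos unfolding s2_def by linarith
    then have xfM: "xf \<le> ln M" using M_pos by (simp add: ln_ge_iff)
    have Ef: "E xf < \<rho> xf" using r(6) B2_less by (simp add: E_less_iff)
    have cy: "\<rho> xf \<le> y" using r by (auto simp: prof_def)
    have cmc: "cm \<le> \<rho> xf" using cm c0 by simp
    have yE: "\<rho> x0 \<le> E x0" using r(3) x0 by simp
    obtain d where d: "xm \<le> d" "y \<le> mcurve cm d x0" "\<And>x. x \<in> {x0..xf} \<Longrightarrow> closer x (kap cm y d (\<rho> xf) x) (\<rho> x)"
      "d = xm \<or> d \<le> xf"
      using domination[OF cm(1,2) r(2,1) yE cmc order_refl less_imp_le[OF Ef]] unfolding r(3) by blast
    have "\<rho> xf \<le> kap cm y d (\<rho> xf) xf" using cy by (simp add: kap_def)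
    then have kf: "kap cm y d (\<rho> xf) xf = \<rho> xf" using d(3)[of xf] r(1) Ef by (auto simp: closer_def)
    have p: "(d, \<rho> xf, xf) \<in> Ks"
      unfolding Ks_def b_def c_def e_def using d xmM xfM c0 cy r s0 kf by auto
    have "J (d, \<rho> xf, xf) \<le> cost \<rho> x0 xf"
      unfolding J_def using cost_le[OF reg\<rho> _ d(3)] reg[OF p] by (simp add: b_def c_def e_def)
    then show ?thesis using p r(4) by blast
  qed
  moreover have "Ks \<noteq> {}" using dom[OF T0 order_refl] by blast
  ultimately obtain p where p: "p \<in> Ks" "\<And>q. q \<in> Ks \<Longrightarrow> J p \<le> J q"
    using continuous_attains_inf[OF \<open>compact Ks\<close>] by blast
  have best: "J p \<le> t" if "reaches y x0 t" for t
  proof (cases "t \<le> T0")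
    case True
    then show ?thesis using dom[OF that] p(2) by force
  next
    case False
    then show ?thesis using dom[OF T0 order_refl] p(2) by force
  qed
  let ?k = "kap cm y (b p) (c p)"
  have k0: "?k x0 = y" using dest(3,6)[OF p(1)] by (simp add: kap_def)
  have "opt ?k x0 (e p)"
    unfolding opt_def k0
    using adm[OF p(1)] rprof_prof dest[OF p(1)] best s20 B2_less by (auto simp: J_def)
  then show ?thesis using k0 by blast
qed

subsection \<open>Singular arcs\<close>

text \<open>Connects \<open>singular_optimal\<close>, a notion in time, with profiles. The cost is
  strictly increasing, so times and abscissas correspond one to one; the control is compared inside
  the arc, its two end points being a null set.\<close>

lemma singular_arc_optimal:
  assumes o: "opt \<rho> x0 xf" and rp: "rprof v \<rho> x0 xf"
    and pq: "x0 \<le> p" "p < q" "q \<le> xf" "q \<le> xm"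
    and E: "\<And>x. x \<in> {p..q} \<Longrightarrow> \<rho> x = E x"
    and v: "\<And>x. p < x \<Longrightarrow> x < q \<Longrightarrow> v x = exp x * \<mu> S2s / f (E x)"
  shows "singular_optimal M B1 B2 f \<mu> S2s (E q) (E p)"
proof -
  have reg: "reg \<rho> x0 xf" by (rule rprof_reg[OF rp])
  have x0f: "x0 \<le> xf" using pq by simp
  obtain u S1 S2 where tr: "trajectory M f \<mu> u S1 S2" "S1 0 = \<rho> x0" "S2 0 = s2 x0 (\<rho> x0)"
    "\<forall>t\<in>{0..cost \<rho> x0 xf}. \<exists>x\<in>{x0..xf}. cost \<rho> x0 x = t \<and> S1 t = \<rho> x \<and> S2 t = s2 x (\<rho> x) \<and> (x < xf \<longrightarrow> u t = v x)"
    using rprof_realize[OF rp] by blast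
  have inj: "x < x' \<longleftrightarrow> cost \<rho> x0 x < cost \<rho> x0 x'" if "x \<in> {x0..xf}" "x' \<in> {x0..xf}" for x x'
    using cost_strict_mono[OF reg_subset[OF reg order_refl], of x' x] cost_strict_mono[OF reg_subset[OF reg order_refl], of x x'] that
    by (cases x x' rule: linorder_cases) auto
  have at: "S1 (cost \<rho> x0 x) = \<rho> x \<and> S2 (cost \<rho> x0 x) = s2 x (\<rho> x) \<and> (x < xf \<longrightarrow> u (cost \<rho> x0 x) = v x)"
    if x: "x \<in> {x0..xf}" for x
  proof -
    have "cost \<rho> x0 x \<in> {0..cost \<rho> x0 xf}"
      using inj[of x xf] inj[of xf x] cost_nonneg[OF reg_subset[OF reg order_refl], of x] x by auto
    then obtain x' where x': "x' \<in> {x0..xf}" "cost \<rho> x0 x' = cost \<rho> x0 x" "S1 (cost \<rho> x0 x) = \<rho> x'"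
      "S2 (cost \<rho> x0 x) = s2 x' (\<rho> x')" "x' < xf \<longrightarrow> u (cost \<rho> x0 x) = v x'"
      using tr(4) by blast
    have "x' = x" using inj[OF x x'(1)] inj[OF x'(1) x] x'(2) by auto
    then show ?thesis using x' by simp
  qed
  define t1 t2 tf where "t1 = cost \<rho> x0 p" and "t2 = cost \<rho> x0 q" and "tf = cost \<rho> x0 xf"
  have t: "0 \<le> t1" "t1 < t2" "t2 \<le> tf"
    using cost_nonneg[OF reg_subset[OF reg order_refl], of p] inj[of p q] inj[of xf q] pq
    by (auto simp: t1_def t2_def tf_def)
  have surj: "\<exists>x\<in>{p..q}. t = cost \<rho> x0 x" if "t \<in> {t1..t2}" for t
  proof -
    have "t \<in> {0..cost \<rho> x0 xf}" using that t by (auto simp: tf_def)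
    then obtain x where x: "x \<in> {x0..xf}" "cost \<rho> x0 x = t" using tr(4) by blast
    have "p \<le> x" using inj[of x p] x that pq by (force simp: t1_def)
    moreover have "x \<le> q" using inj[of q x] x that pq by (force simp: t2_def)
    ultimately show ?thesis using x by auto
  qed
  have us: "u_sing M f \<mu> S2s (E x) = exp x * \<mu> S2s / f (E x)" for x
    by (simp add: u_sing_def E_def mult.commute)
  have "optimal M B1 B2 f \<mu> u S1 S2 tf"
    unfolding optimal_def
  proof (intro conjI allI impI)
    have "(S1 0, S2 0) \<in> state_domain M" using tr(1) unfolding trajectory_def by auto
    then show "(S1 0, S2 0) \<in> state_domain M - target B1 B2"
      using o tr(3) by (auto simp: opt_def target_def)
    show "0 \<le> tf" using t by simp
    have "S1 tf = \<rho> xf \<and> S2 tf = s2 xf (\<rho> xf)" using at[of xf] x0f by (simp add: tf_def)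
    moreover have "0 < \<rho> xf" "0 < s2 xf (\<rho> xf)" using reg x0f by (auto simp: reg_def)
    ultimately show "(S1 tf, S2 tf) \<in> target B1 B2" using o by (auto simp: opt_def target_def)
    fix w R1 R2 s
    assume "trajectory M f \<mu> w R1 R2 \<and> R1 0 = S1 0 \<and> R2 0 = S2 0 \<and> 0 \<le> s \<and> (R1 s, R2 s) \<in> target B1 B2"
    then have "reaches (\<rho> x0) x0 s" unfolding reaches_def using tr(2,3) by auto
    then show "tf \<le> s" using o unfolding opt_def tf_def by blast
  qed (rule tr(1))
  moreover have "singular_on M f \<mu> S2s u S1 S2 t1 t2"
    unfolding singular_on_def
  proof (intro conjI ballI)
    fix t assume "t \<in> {t1..t2}"
    then obtain x where x: "x \<in> {p..q}" "t = cost \<rho> x0 x" using surj by blast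
    have S: "S1 t = E x" "S2 t = S2s" using at[of x] x E[OF x(1)] pq by auto
    then show "S2 t = S2s" by simp
    have "0 < E x" using E_le[of xm x] S1m(1) x pq by (simp add: E_xm)
    then have "0 < f (E x)" by (rule f_pos)
    moreover have "exp x \<le> G x (E x)" using x pq by (intro singular_slope_le) auto
    ultimately show "u_sing M f \<mu> S2s (S1 t) \<in> {0..1}"
      unfolding S us using \<mu>_S2s_pos by (simp add: G_def field_simps)
  next
    show "AE t in lebesgue. t \<in> {t1..t2} \<longrightarrow> u t = u_sing M f \<mu> S2s (S1 t)"
    proof (rule AE_lebesgue_except[of "{t1, t2}"])
      fix t assume n: "t \<notin> {t1, t2}"
      show "t \<in> {t1..t2} \<longrightarrow> u t = u_sing M f \<mu> S2s (S1 t)"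
      proof
        assume "t \<in> {t1..t2}"
        then obtain x where x: "x \<in> {p..q}" "t = cost \<rho> x0 x" using surj by blast
        have "x \<noteq> p" "x \<noteq> q" using n x by (auto simp: t1_def t2_def)
        then have xx: "p < x" "x < q" using x by auto
        then show "u t = u_sing M f \<mu> S2s (S1 t)"
          using at[of x] x E[OF x(1)] pq v[OF xx] us[of x] by auto
      qed
    qed simp
  qed
  moreover have "S1 t1 = E p" "S1 t2 = E q"
    using at[of p] at[of q] E[of p] E[of q] pq by (auto simp: t1_def t2_def)
  ultimately show ?thesis unfolding singular_optimal_def using t by blast
qed

text \<open>On the line with \<open>S1m < S1 \<le> sb\<close> no singular arc is optimal, and
  control 1 is strictly steeper than the line. So an optimal profile leaves at once with control 1
  and meets the line next at some \<open>b > xm\<close>. The bound \<open>cm0\<close> on the clamp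
  allows a combination with \<open>curve_above_xi\<close>.\<close>

lemma opt_from_singular_line:
  assumes nos: "\<And>x y. S1m \<le> x \<Longrightarrow> x < y \<Longrightarrow> y \<le> sb \<Longrightarrow> \<not> singular_optimal M B1 B2 f \<mu> S2s x y"
    and pos: "0 < S1s" and y: "S1m < y" "S1s < y" "y \<le> sb" and x0: "E x0 = y" and cm0: "0 < cm0"
  shows "\<exists>\<rho> xf cm b. opt \<rho> x0 xf \<and> \<rho> x0 = y \<and> 0 < cm \<and> cm \<le> S1m \<and> cm \<le> cm0 \<and> cm \<le> \<rho> xf \<and> xm < b \<and> b \<le> xf \<and>
    \<rho> b = E b \<and> beta cm b x0 = y \<and> (\<forall>x\<in>{x0..xf}. \<rho> x = max (\<rho> xf) (beta cm b x)) \<and>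
    (\<forall>x. x0 < x \<longrightarrow> x < b \<longrightarrow> beta cm b x < E x)"
proof -
  obtain \<rho> xf where o: "opt \<rho> x0 xf" and \<rho>0: "\<rho> x0 = y" using opt_exists[OF y(1) x0] by blast
  have yE: "\<rho> x0 \<le> E x0" using \<rho>0 x0 by simp
  have pr: "prof \<rho> x0 xf" using o by (simp add: opt_def)
  have x0f: "x0 < xf" by (rule opt_less[OF o])
  let ?c = "\<rho> xf"
  have c: "0 < ?c" "?c \<le> B1" "?c \<le> y" using pr o \<rho>0 x0f by (auto simp: prof_def reg_def opt_def)
  \<comment> \<open>A constant profile would be a final arc starting on the line with
    \<open>S1 > S1s\<close>, where \<open>phi > 1\<close>.\<close>
  have cy: "?c < y"
  proof (rule ccontr)
    assume "\<not> ?thesis"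
    then have cy: "?c = y" using c by simp
    have const: "\<rho> x = y" if "x \<in> {x0..xf}" for x
      using pr that \<rho>0 cy unfolding prof_def by (metis atLeastAtMost_iff order_antisym order_refl)
    have "phi M B2 \<mu> y (s2 x0 y) \<le> 1" by (rule opt_final_phi_le[OF o yE order_refl x0f const])
    moreover have "1 < phi M B2 \<mu> y S2s" using phi_greater_1[OF pos y(2)] c cy by simp
    ultimately show False using x0 s2_E[of x0] by simp
  qed
  define cm where "cm = min S1m (min ?c cm0)"
  have cm: "0 < cm" "cm \<le> S1m" "cm \<le> ?c" "cm \<le> cm0" using S1m(1) c cm0 by (auto simp: cm_def)
  obtain b z where b: "xm \<le> b" "x0 \<le> b" "y \<le> mcurve cm b x0"
    "b = xm \<and> (xm \<le> xf \<longrightarrow> E xm \<le> \<rho> xm) \<or> xm < b \<and> b \<le> xf \<and> \<rho> b = E b"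
    and kap: "\<And>x. x \<in> {x0..xf} \<Longrightarrow> \<rho> x = kap cm y b ?c x"
    and z: "z \<le> xm" "\<And>x. x0 \<le> x \<Longrightarrow> x < z \<Longrightarrow> E x \<le> beta cm b x" "\<And>x. x0 \<le> x \<Longrightarrow> z < x \<Longrightarrow> x \<le> b \<Longrightarrow> beta cm b x \<le> E x"
    and rp: "rprof (kctl cm y b ?c z) \<rho> x0 xf"
    using opt_structure[OF o yE cm(1,2,3)] unfolding \<rho>0 by blast
  have x0m: "x0 < xm" using y(1) x0 E_less[of xm x0] by (simp add: E_xm)
  have b0: "y \<le> beta cm b x0" using b(2,3) mcurve_left[OF cm(1,2), of x0 b] by simp
  have nosing: False if pq: "x0 < q" "q \<le> xf" "q \<le> xm" and EE: "\<And>x. x0 \<le> x \<Longrightarrow> x \<le> q \<Longrightarrow> ?c < E x"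
      and EB: "\<And>x. x0 \<le> x \<Longrightarrow> x \<le> q \<Longrightarrow> E x \<le> beta cm b x" and qz: "q \<le> z" for q
  proof -
    have m: "mcurve cm b x = E x" if "x0 \<le> x" "x \<le> q" for x
      using mcurve_left[OF cm(1,2), of x b] EB[OF that] that pq(3) b(1) by simp
    have "E x \<le> y" if "x0 \<le> x" for x using E_le[of x x0] x0 that by simp
    then have r: "\<rho> x = E x" if "x \<in> {x0..q}" for x
      using kap[of x] m[of x] EE[of x] that pq(2) by (auto simp: kap_def)
    have "singular_optimal M B1 B2 f \<mu> S2s (E q) (E x0)"
    proof (rule singular_arc_optimal[OF o rp order_refl pq])
      show "\<rho> x = E x" if "x \<in> {x0..q}" for x using r[OF that] .
      fix x assume x: "x0 < x" "x < q"
      have "E x < y" using E_less[of x x0] x0 x by simp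
      moreover have "min x xm = x" using x pq by simp
      ultimately show "kctl cm y b ?c z x = exp x * \<mu> S2s / f (E x)"
        using m[of x] EE[of x] x qz by (simp add: kctl_def[OF cm(1,2)])
    qed
    moreover have "S1m \<le> E q" using E_le[of xm q] pq by (simp add: E_xm)
    moreover have "E q < E x0" using E_less[of q x0] pq by simp
    ultimately show False using nos[of "E q" "E x0"] x0 y by simp
  qed
  have Econt: "isCont (\<lambda>x. E x - ?c) x0"
    unfolding E_def by (intro continuous_intros)
  obtain d1 where d1: "d1 > 0" "\<And>t. \<bar>t - x0\<bar> \<le> d1 \<Longrightarrow> 0 < E t - ?c"
    using isCont_pos_nbhd[OF Econt] cy x0 by auto
  \<comment> \<open>If the curve were above the line at \<open>x0\<close>, then
    \<open>mcurve\<close> would begin with a stretch of the line, and this would be an optimal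
    singular arc.\<close>
  have b0': "beta cm b x0 = y"
  proof (rule ccontr)
    assume "beta cm b x0 \<noteq> y"
    then have gt: "0 < beta cm b x0 - E x0" using b0 x0 by simp
    have "isCont (\<lambda>x. beta cm b x - E x) x0"
      using DERIV_isCont[OF beta_deriv[OF cm(1,2)]] DERIV_isCont[OF E_deriv] by (intro continuous_diff)
    from isCont_pos_nbhd[where g = "\<lambda>x. beta cm b x - E x", OF this gt]
    obtain d2 where d2: "d2 > 0" "\<And>t. \<bar>t - x0\<bar> \<le> d2 \<Longrightarrow> 0 < beta cm b t - E t" by blast
    define q where "q = min (x0 + min d1 d2) (min xf xm)"
    have q: "x0 < q" "q \<le> xf" "q \<le> xm" "q - x0 \<le> d1" "q - x0 \<le> d2" using d1(1) d2(1) x0f x0m by (auto simp: q_def)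
    show False
    proof (rule nosing[OF q(1,2,3)])
      show "?c < E x" if "x0 \<le> x" "x \<le> q" for x using d1(2)[of x] that q by simp
      show "E x \<le> beta cm b x" if "x0 \<le> x" "x \<le> q" for x using d2(2)[of x] that q by simp
      show "q \<le> z"
      proof (rule ccontr)
        assume "\<not> q \<le> z"
        then have "beta cm b q \<le> E q" using z(3)[of q] q b(1) by simp
        then show False using d2(2)[of q] q by simp
      qed
    qed
  qed
  have slope: "((\<lambda>x. beta cm b x - E x) has_real_derivative - G x0 y - - exp x0) (at x0)"
  proof -
    have "Gb cm x0 (beta cm b x0) = G x0 (beta cm b x0)"
      by (rule beta_true_left[OF cm(1,2)]) (use b0' x0 cm c in auto)
    then show ?thesis
      using DERIV_diff[OF beta_deriv[OF cm(1,2), of b x0] E_deriv[of x0]] b0' by simp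
  qed
  have "- G x0 y - - exp x0 < 0" using singular_slope_less[OF x0m] x0 by simp
  from DERIV_neg_dec_right[OF slope this]
  obtain d where d: "d > 0" "\<And>h. 0 < h \<Longrightarrow> h < d \<Longrightarrow> beta cm b (x0 + h) - E (x0 + h) < 0"
    using b0' x0 by auto
  have below1: "beta cm b x < E x" if x: "x0 < x" "x \<le> xm" for x
  proof -
    define h where "h = min (d / 2) (x - x0)"
    have h: "0 < h" "h < d" "x0 + h \<le> x" using d(1) x by (auto simp: h_def)
    show ?thesis by (rule beta_less_E_left[OF cm(1,2) _ h(3) x(2)]) (use d(2)[OF h(1,2)] in simp)
  qed
  \<comment> \<open>The curve through \<open>xm\<close> is nowhere below the line, whereas this one
    is below it at \<open>xm\<close>.\<close>
  have xmb: "xm < b"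
  proof (rule ccontr)
    assume "\<not> xm < b"
    then have "b = xm" using b(1) by simp
    then show False using below1[of xm] x0m beta_xm_ge_E[OF cm(1,2), of xm] by simp
  qed
  have strict: "beta cm b x < E x" if "x0 < x" "x < b" for x
    using below1[of x] beta_less_E[OF cm(1,2) xmb, of x] that by (cases "x \<le> xm") auto
  have below: "beta cm b x \<le> E x" if "x0 \<le> x" "x \<le> b" for x
  proof -
    consider "x = x0" | "x0 < x" "x < b" | "x = b" using \<open>x0 \<le> x\<close> \<open>x \<le> b\<close> by linarith
    then show ?thesis
      by cases (use b0' x0 strict[of x] beta_self[OF cm(1,2), of b] in auto)
  qed
  have "\<rho> x = max ?c (beta cm b x)" if x: "x \<in> {x0..xf}" for x
  proof -
    have "mcurve cm b x = beta cm b x"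
      using below[of x] x mcurve_left[OF cm(1,2), of x b] mcurve_right[OF cm(1,2), of b x] by (cases "x \<le> b") auto
    moreover have "beta cm b x \<le> y" using beta_le[OF cm(1,2), of x0 x b] x b0' by simp
    ultimately show ?thesis using kap[OF x] c by (simp add: kap_def)
  qed
  then show ?thesis using o \<rho>0 cm xmb b(4) b0' strict by blast
qed

text \<open>In the coordinates \<open>(x, c)\<close> the graph of \<open>\<xi>\<close> is a curve of control 1.\<close>

lemma curve_above_xi:
  assumes pos: "0 < S1s" and lt: "S1s < S1m" and xi: "xi_star_on M B1 B2 f \<mu> S2s T \<xi>"
    and y: "S1s < y" "y \<le> T" and above: "\<xi> y < s2 p y"
  shows "\<exists>cm0>0. \<forall>cm b. 0 < cm \<longrightarrow> cm \<le> cm0 \<longrightarrow> cm \<le> S1m \<longrightarrow> xm < b \<longrightarrow> beta cm b p = y \<longrightarrow> E b < S1s"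
proof -
  have x0: "\<xi> S1s = S2s" using xi by (simp add: xi_star_on_def S1s_def)
  have dom: "0 < M - s - \<xi> s" "0 \<le> \<xi> s" if "s \<in> {S1s..T}" for s
  proof -
    have "(s, \<xi> s) \<in> state_domain M" using xi that unfolding xi_star_on_def S1s_def[symmetric] by blast
    then have "s + \<xi> s < M" "0 \<le> \<xi> s" by (auto simp: state_domain_def)
    then show "0 < M - s - \<xi> s" "0 \<le> \<xi> s" by linarith+
  qed
  have d\<xi>: "(\<xi> has_real_derivative - 1 + \<mu> (\<xi> s) * (M - s - \<xi> s) / f s) (at s within {S1s..T})" if "s \<in> {S1s..T}" for s
    using xi that unfolding xi_star_on_def S1s_def[symmetric] by blast
  have c\<xi>: "continuous_on {S1s..T} \<xi>" by (rule DERIV_continuous_on[OF d\<xi>])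
  \<comment> \<open>The graph of \<open>\<xi>\<close> parametrised by \<open>S1 = s\<close>, with
    abscissa \<open>X s\<close>.\<close>
  define X where "X s = ln (M - s - \<xi> s)" for s
  have eX: "exp (X s) = M - s - \<xi> s" if "s \<in> {S1s..T}" for s using dom(1)[OF that] by (simp add: X_def)
  have s2X: "s2 (X s) s = \<xi> s" if "s \<in> {S1s..T}" for s using eX[OF that] by (simp add: s2_def)
  have fpos: "0 < f s" if "s \<in> {S1s..T}" for s using that pos by (intro f_pos) auto
  have dX: "(X has_real_derivative - (\<mu> (\<xi> s) / f s)) (at s within {S1s..T})" if s: "s \<in> {S1s..T}" for s
  proof -
    have "((\<lambda>s. M - s - \<xi> s) has_real_derivative 0 - 1 - (- 1 + \<mu> (\<xi> s) * (M - s - \<xi> s) / f s)) (at s within {S1s..T})"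
      by (intro derivative_intros d\<xi>[OF s])
    from DERIV_chain2[OF DERIV_ln[OF dom(1)[OF s]] this]
    have "(X has_real_derivative inverse (M - s - \<xi> s) * (0 - 1 - (- 1 + \<mu> (\<xi> s) * (M - s - \<xi> s) / f s))) (at s within {S1s..T})"
      unfolding X_def[abs_def] .
    moreover have "inverse (M - s - \<xi> s) * (0 - 1 - (- 1 + \<mu> (\<xi> s) * (M - s - \<xi> s) / f s)) = - (\<mu> (\<xi> s) / f s)"
    proof -
      have "inverse w * (0 - 1 - (- 1 + m * w / F)) = - (m / F)" if "0 < w" "0 < F" for w m F :: real
        using that by (simp add: field_simps)
      then show ?thesis using dom(1)[OF s] fpos[OF s] by blast
    qed
    ultimately show ?thesis by (simp only:)
  qed
  \<comment> \<open>Where \<open>\<xi>\<close> vanishes its slope is -1, so it would become negative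
    immediately afterwards. At the right end \<open>T\<close> there is nothing afterwards, hence the
    restriction \<open>s < T\<close>.\<close>
  have \<xi>pos: "0 < \<xi> s" if s: "S1s \<le> s" "s < T" for s
  proof (rule ccontr)
    assume "\<not> ?thesis"
    then have z: "\<xi> s = 0" using dom(2)[of s] s by auto
    have "(\<xi> has_real_derivative - 1) (at s within {S1s..T})" using d\<xi>[of s] s z by (simp add: \<mu>_0)
    then obtain d where d: "d > 0" "\<And>h. 0 < h \<Longrightarrow> s + h \<in> {S1s..T} \<Longrightarrow> h < d \<Longrightarrow> \<xi> (s + h) < \<xi> s"
      using has_real_derivative_neg_dec_right[of \<xi> "- 1" s "{S1s..T}"] by auto
    define h where "h = min (d / 2) (T - s)"
    have h: "0 < h" "h < d" "s + h \<in> {S1s..T}" using d(1) s by (auto simp: h_def)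
    show False using d(2)[OF h(1,3,2)] dom(2)[OF h(3)] z by simp
  qed
  have Xmono: "X t \<le> X s" if "S1s \<le> s" "s \<le> t" "t \<le> T" for s t
  proof -
    have "- X s \<le> - X t"
    proof (rule nonneg_deriv_imp_le[OF that(2), of "\<lambda>s. - X s" "\<lambda>s. \<mu> (\<xi> s) / f s"])
      fix r assume r: "r \<in> {s..t}"
      have "((\<lambda>s. - X s) has_real_derivative - (- (\<mu> (\<xi> r) / f r))) (at r within {s..t})"
        by (rule DERIV_minus[OF DERIV_subset[OF dX[of r]]]) (use r that in auto)
      then show "((\<lambda>s. - X s) has_real_derivative \<mu> (\<xi> r) / f r) (at r within {s..t})" by simp
      show "0 \<le> \<mu> (\<xi> r) / f r"
        using \<mu>_nonneg[OF dom(2)[of r]] fpos[of r] r that by (auto intro!: divide_nonneg_nonneg)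
    qed
    then show ?thesis by simp
  qed
  have yT: "y \<in> {S1s..T}" using y by simp
  have "exp p < exp (X y)" using above eX[OF yT] unfolding s2_def by linarith
  then have pX: "p < X y" by simp
  define g where "g = f (y / 2) / \<mu> S2s"
  have y0: "0 < y" using y pos by simp
  have g: "0 < g" using f_pos[of "y / 2"] y0 \<mu>_S2s_pos by (simp add: g_def)
  \<comment> \<open>While \<open>S1 \<ge> y / 2\<close>, control 1 has slope at least
    \<open>g\<close>. Between \<open>p\<close> and \<open>X y\<close> the curve therefore drops by
    at least \<open>\<delta>\<close>, a gap to \<open>\<xi>\<close> independent of \<open>cm\<close>
    and \<open>b\<close>.\<close>
  define \<delta> where "\<delta> = min (y / 2) (g * (X y - p))"
  have \<delta>: "0 < \<delta>" "\<delta> \<le> y / 2" "\<delta> \<le> g * (X y - p)" using y0 g pX by (auto simp: \<delta>_def)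
  \<comment> \<open>The comparison runs over \<open>{S1s..s1}\<close> with \<open>s1 < y\<close>,
    where \<open>\<mu> (\<xi> s)\<close> is bounded away from 0; \<open>s1 > y - \<delta>\<close>
    preserves the gap.\<close>
  define s1 where "s1 = max S1s (y - \<delta> / 2)"
  have s1: "S1s \<le> s1" "s1 < y" "y - \<delta> < s1" using y \<delta>(1) by (auto simp: s1_def)
  have c\<mu>: "continuous_on {S1s..s1} (\<lambda>s. \<mu> (\<xi> s))"
  proof (rule continuous_on_compose2[OF \<mu>_cont continuous_on_subset[OF c\<xi>]])
    show "\<xi> ` {S1s..s1} \<subseteq> {0..}" using dom(2) s1 y by force
  qed (use s1 y in auto)
  have "compact {S1s..s1}" "{S1s..s1} \<noteq> {}" using s1 by auto
  from continuous_attains_inf[OF this c\<mu>] obtain r where r: "r \<in> {S1s..s1}" "\<And>s. s \<in> {S1s..s1} \<Longrightarrow> \<mu> (\<xi> r) \<le> \<mu> (\<xi> s)"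
    by blast
  define m' where "m' = \<mu> (\<xi> r)"
  have m': "0 < m'" using \<mu>_pos[OF \<xi>pos[of r]] r(1) s1 y by (simp add: m'_def)
  obtain Lf where Lf: "Lf > 0" "\<And>a b. a \<in> {0..M} \<Longrightarrow> b \<in> {0..M} \<Longrightarrow> \<bar>f a - f b\<bar> \<le> Lf * \<bar>a - b\<bar>"
    using f_lipschitz by blast
  \<comment> \<open>The Lipschitz bound of \<open>f\<close> turns this into
    \<open>m0 cm \<le> f cm / M \<le> m'\<close>, so that on this part of the graph of
    \<open>\<xi>\<close> the clamped slope is the true one.\<close>
  define cm0 where "cm0 = min S1s (m' * M / Lf)"
  have "0 < cm0" using pos m' M_pos Lf(1) by (simp add: cm0_def)
  moreover have "E b < S1s" if cm: "0 < cm" "cm \<le> cm0" "cm \<le> S1m" and b: "xm < b" and bp: "beta cm b p = y" for cm b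
  proof -
    have cms: "cm \<le> S1s" "cm \<le> m' * M / Lf" "cm \<le> M" using cm cm_M[OF cm(1,3)] by (auto simp: cm0_def)
    have "f cm \<le> Lf * cm" using Lf(2)[of cm 0] cm(1) cms(3) f_nonneg[of cm] M_pos by (simp add: f_0)
    also have "\<dots> \<le> m' * M" using cms(2) Lf(1) by (simp add: field_simps)
    finally have "f cm / M \<le> m'" using M_pos by (simp add: field_simps)
    then have m0: "m0 cm \<le> m'" by (simp add: m0_def)
    note db = beta_deriv[OF cm(1,3), of b]
    have Gbs: "Gb cm (X s) s = f s / \<mu> (\<xi> s)" if s: "s \<in> {S1s..s1}" for s
    proof -
      have sT: "s \<in> {S1s..T}" using s s1 y by auto
      have "Gb cm (X s) s = G (X s) s"
      proof (rule Gb_eq[OF cm(1,3)])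
        show "cm \<le> s" using cms s by simp
        show "0 < s2 (X s) s" using s2X[OF sT] \<xi>pos[of s] s s1 y by simp
        show "m0 cm \<le> \<mu> (s2 (X s) s)" using s2X[OF sT] r(2)[OF s] m0 by (simp add: m'_def)
      qed
      then show ?thesis using s2X[OF sT] by (simp add: G_def)
    qed
    have bXy: "beta cm b (X y) \<le> y - \<delta>"
    proof (rule ccontr)
      assume n: "\<not> ?thesis"
      have "integral {p..X y} (\<lambda>_. g) \<le> integral {p..X y} (\<lambda>x. Gb cm x (beta cm b x))"
      proof (rule integral_le)
        show "(\<lambda>x. Gb cm x (beta cm b x)) integrable_on {p..X y}"
          by (intro integrable_continuous_interval Gb_cont_comp[OF cm(1,3)] beta_cont[OF cm(1,3)])
        fix x assume x: "x \<in> {p..X y}"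
        have "y / 2 \<le> beta cm b x" using beta_le[OF cm(1,3), of x "X y" b] x n \<delta>(2) by simp
        moreover have "y / 2 \<le> M" using y dom[of y] y0 by auto
        ultimately have "f (y / 2) \<le> f (max cm (min M (beta cm b x)))" using y0 by (intro f_le) auto
        moreover have "\<mu> (max 0 (min M (s2 x (beta cm b x)))) \<le> \<mu> S2s" by (intro \<mu>_max) simp
        then have "max (m0 cm) (\<mu> (max 0 (min M (s2 x (beta cm b x))))) \<le> \<mu> S2s"
          using m0_le(3)[OF cm(1,3)] by simp
        ultimately show "g \<le> Gb cm x (beta cm b x)"
          unfolding g_def Gb_def Gc_def using m0_pos[OF cm(1,3)] f_nonneg[of "y / 2"] y0 by (intro frac_le) auto
      qed auto
      then have "g * (X y - p) \<le> y - beta cm b (X y)"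
        using beta_integral[OF cm(1,3), of p "X y" b] pX bp by (simp add: mult.commute)
      then show False using n \<delta>(3) by simp
    qed
    let ?h = "\<lambda>s. s - beta cm b (X s)"
    have "X y \<le> X s1" using s1 y by (intro Xmono) auto
    then have "beta cm b (X s1) \<le> beta cm b (X y)" by (rule beta_le[OF cm(1,3)])
    then have h1: "0 < ?h s1" using bXy s1 by simp
    have dh: "(?h has_real_derivative 1 - Gb cm (X s) (beta cm b (X s)) * (\<mu> (\<xi> s) / f s)) (at s within {S1s..s1})"
      if s: "s \<in> {S1s..s1}" for s
    proof -
      have "(X has_real_derivative - (\<mu> (\<xi> s) / f s)) (at s within {S1s..s1})"
        by (rule DERIV_subset[OF dX]) (use s s1 y in auto)
      from DERIV_chain2[OF db this]
      have "((\<lambda>s. beta cm b (X s)) has_real_derivative - Gb cm (X s) (beta cm b (X s)) * - (\<mu> (\<xi> s) / f s)) (at s within {S1s..s1})" .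
      from DERIV_diff[OF DERIV_ident this] show ?thesis by simp
    qed
    have ch: "continuous_on {S1s..s1} ?h" by (rule DERIV_continuous_on[OF dh])
    \<comment> \<open>Both are curves of the same flow: after a last zero \<open>q\<close> Gronwall
      would make the difference nonpositive at \<open>s1\<close>, against the gap there.\<close>
    have hS: "0 < ?h S1s"
    proof (rule ccontr)
      assume "\<not> ?thesis"
      then obtain q where q: "S1s \<le> q" "q < s1" "?h q = 0" "\<And>t. q < t \<Longrightarrow> t \<le> s1 \<Longrightarrow> 0 < ?h t"
        using last_zero[OF ch s1(1) _ h1] by auto
      obtain K where K: "K > 0" "\<And>x c d. \<bar>Gb cm x c - Gb cm x d\<bar> \<le> K * \<bar>c - d\<bar>"
        using Gc_lipschitz[OF cm(1) cms(3) m0_pos[OF cm(1,3)]] unfolding Gb_def by blast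
      define gl where "gl = f cm / max (m0 cm) (\<mu> S2s)"
      have gl: "0 < gl" using f_pos[OF cm(1)] \<mu>_S2s_pos by (simp add: gl_def less_max_iff_disj)
      have glb: "gl \<le> Gb cm x c" for x c
        unfolding gl_def Gb_def by (rule Gc_bounds(1)[OF cm(1) cms(3) m0_pos[OF cm(1,3)]])
      have sub: "{q..s1} \<subseteq> {S1s..s1}" using q by auto
      have "?h s1 \<le> 0 * exp (K / gl * (s1 - q))"
      proof (rule gronwall_forward[OF continuous_on_subset[OF ch sub]])
        show "?h t \<le> 0 + K / gl * integral {q..t} ?h" if t: "t \<in> {q..s1}" for t
        proof -
          have "((\<lambda>s. 1 - Gb cm (X s) (beta cm b (X s)) * (\<mu> (\<xi> s) / f s)) has_integral (?h t - ?h q)) {q..t}"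
          proof (rule fundamental_theorem_of_calculus)
            show "q \<le> t" using t by simp
            fix s assume s: "s \<in> {q..t}"
            have "(?h has_real_derivative 1 - Gb cm (X s) (beta cm b (X s)) * (\<mu> (\<xi> s) / f s)) (at s within {q..t})"
              by (rule DERIV_subset[OF dh]) (use s t q in auto)
            then show "(?h has_vector_derivative 1 - Gb cm (X s) (beta cm b (X s)) * (\<mu> (\<xi> s) / f s)) (at s within {q..t})"
              by (simp add: has_real_derivative_iff_has_vector_derivative)
          qed
          moreover have "((\<lambda>s. K / gl * ?h s) has_integral integral {q..t} (\<lambda>s. K / gl * ?h s)) {q..t}"
            using t q by (intro integrable_integral integrable_continuous_interval continuous_on_mult continuous_on_const continuous_on_subset[OF ch]) auto
          moreover have "1 - Gb cm (X s) (beta cm b (X s)) * (\<mu> (\<xi> s) / f s) \<le> K / gl * ?h s" if s: "s \<in> {q..t}" for s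
          proof -
            have sS: "s \<in> {S1s..s1}" using s t q by auto
            have hp: "0 \<le> ?h s" using q(3) q(4)[of s] s t by (cases "s = q") auto
            let ?a = "Gb cm (X s) s" and ?b = "Gb cm (X s) (beta cm b (X s))"
            have a: "gl \<le> ?a" by (rule glb)
            have "1 - ?b * (\<mu> (\<xi> s) / f s) = (?a - ?b) / ?a"
            proof -
              have f0: "0 < f s" using sS s1 y by (intro fpos) auto
              have mu0: "0 < \<mu> (\<xi> s)" using sS s1 y by (intro \<mu>_pos \<xi>pos) auto
              show ?thesis unfolding Gbs[OF sS] using f0 mu0 by (simp add: field_simps)
            qed
            also have "\<dots> \<le> (K * ?h s) / ?a"
              using K(2)[of "X s" s "beta cm b (X s)"] hp a gl by (intro divide_right_mono) auto
            also have "\<dots> \<le> (K * ?h s) / gl" using K(1) hp a gl by (intro divide_left_mono) auto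
            finally show ?thesis by simp
          qed
          ultimately have "?h t - ?h q \<le> integral {q..t} (\<lambda>s. K / gl * ?h s)" by (rule has_integral_le)
          then show ?thesis using q(3) by simp
        qed
      qed (use K gl q in auto)
      then show False using h1 by simp
    qed
    \<comment> \<open>At \<open>S1s\<close> the graph of \<open>\<xi>\<close> is on the line, beyond
      \<open>xm\<close>. The curve is below the line there, so its crossing \<open>b\<close> is
      still to come, at a smaller value of \<open>S1\<close>.\<close>
    have eXs: "exp (X S1s) = M - S1s - S2s" using eX[of S1s] x0 s1 y by simp
    have Exs: "E (X S1s) = S1s" by (simp add: E_def eXs)
    have "xm < X S1s" using Exs lt E_less[of "X S1s" xm] by (simp add: E_xm)
    then have "X S1s < b" using beta_ge_E[OF cm(1,3), of b "X S1s"] b hS Exs by (cases "X S1s < b") auto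
    then show ?thesis using E_less[of b "X S1s"] Exs by simp
  qed
  ultimately show ?thesis by blast
qed

subsection \<open>Switching on the line\<close>

lemma cost_le_add:
  assumes reg: "reg \<rho> a b" "reg \<kappa> a b" and ab: "a \<le> b"
    and le: "\<And>x. x \<in> {a..b} \<Longrightarrow> 1 / \<mu> (s2 x (\<kappa> x)) \<le> 1 / \<mu> (s2 x (\<rho> x)) + e"
  shows "cost \<kappa> a b \<le> cost \<rho> a b + e * (b - a)"
proof -
  have "cost \<kappa> a b \<le> integral {a..b} (\<lambda>x. 1 / \<mu> (s2 x (\<rho> x)) + e)"
    unfolding cost_def using le
    by (intro integral_le integrable_continuous_interval continuous_on_add continuous_on_const reg_cost_cont reg)
  also have "\<dots> = cost \<rho> a b + integral {a..b} (\<lambda>x. e)"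
    unfolding cost_def
    by (intro Henstock_Kurzweil_Integration.integral_add integrable_continuous_interval continuous_on_const reg_cost_cont reg)
  finally show ?thesis using ab by (simp add: mult.commute)
qed

text \<open>
  If the control 1 started exactly on the line \<open>S2 = S2s\<close> where \<open>S1 < S1m\<close>, starting it a little
  earlier would lose only to second order near the line, since \<open>\<mu>\<close> is maximal there, and gain to
  first order afterwards.
\<close>

lemma switch_not_on_line:
  assumes o: "opt \<rho> x0 xf" and \<rho>0: "\<rho> x0 = y" and y: "y < E x0" "y < S1m"
    and cm: "0 < cm" "cm \<le> S1m" "cm \<le> \<rho> xf" and cy: "\<rho> xf < y" and b: "E b = y"
    and kap: "\<And>x. x \<in> {x0..xf} \<Longrightarrow> \<rho> x = kap cm y b (\<rho> xf) x"
  shows False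
proof -
  let ?c = "\<rho> xf"
  note b' = beta_deriv[OF cm(1,2)]
  have pr: "prof \<rho> x0 xf" and x0f: "x0 < xf" using o opt_less[OF o] by (auto simp: opt_def)
  have reg: "reg \<rho> x0 xf" using pr by (simp add: prof_def)
  have s2c: "0 < s2 xf ?c" and c0: "0 < ?c" using reg x0f by (auto simp: reg_def)
  have xmb: "xm < b" using y(2) b E_less[of b xm] by (simp add: E_xm)
  have x0b: "x0 < b" using y(1) b E_less[of b x0] by simp
  define \<beta> where "\<beta> = beta cm b"
  have \<beta>b: "\<beta> b = y" using b by (simp add: \<beta>_def beta_self[OF cm(1,2)])
  have \<beta>less: "\<beta> t < \<beta> s" if "s < t" for s t using beta_less[OF cm(1,2) that] by (simp add: \<beta>_def)
  have mf: "mcurve cm b xf \<le> ?c" using kap[of xf] x0f cy by (auto simp: kap_def)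
  have bxf: "b < xf"
  proof (rule ccontr)
    assume "\<not> b < xf"
    then have "mcurve cm b b \<le> mcurve cm b xf" by (intro mcurve_le[OF cm(1,2)]) simp
    then show False using mf cy b mcurve_self[OF cm(1,2), of b] by simp
  qed
  have \<beta>xf: "\<beta> xf \<le> ?c" using mf mcurve_right[OF cm(1,2), of b xf] bxf by (simp add: \<beta>_def)
  have exf: "exp xf < M" using s2c c0 by (simp add: s2_def)
  have c\<beta>: "continuous_on T \<beta>" for T using beta_cont[OF cm(1,2)] by (simp add: \<beta>_def)
  obtain xe where xe: "b \<le> xe" "xe \<le> xf" "\<beta> xe = ?c"
    using IVT2'[of \<beta> xf ?c b] \<beta>xf \<beta>b cy bxf c\<beta> by auto
  have bxe: "b < xe" using xe \<beta>b cy by (cases "b = xe") auto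
  define xx where "xx = (b + xe) / 2"
  have xx: "b < xx" "xx < xe" using bxe by (auto simp: xx_def)
  have "E xx < \<beta> xx" using beta_greater_E[OF cm(1,2) xmb xx(1)] by (simp add: \<beta>_def)
  then have sxx: "s2 xx (\<beta> xx) < S2s" by (simp add: E_less_iff)
  have "0 < s2 xx (\<beta> xx)"
  proof -
    have "exp xx \<le> exp xf" using xx xe by simp
    then have "exp xx \<le> M" using exf by linarith
    then have "xx \<le> ln M" using M_pos by (simp add: ln_ge_iff)
    then show ?thesis using beta_s2_pos[OF cm(1,2), of b xx] xx by (simp add: \<beta>_def)
  qed
  \<comment> \<open>\<open>\<mu>'\<close> may vanish in places. So a level \<open>ss\<close> with
    \<open>\<mu>' ss > 0\<close> is chosen between \<open>S2s\<close> and the value of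
    \<open>S2\<close> at \<open>xx\<close>; the gain is collected near the point \<open>xs\<close>
    where the curve passes this level.\<close>
  then obtain ss where ss: "s2 xx (\<beta> xx) < ss" "ss < S2s" "0 < \<mu>' ss" "0 < ss"
    using \<mu>'_pos_between[of "s2 xx (\<beta> xx)" S2s] sxx by auto
  have "s2 b (\<beta> b) = S2s" using b \<beta>b s2_E[of b] by simp
  then obtain xs where xs: "b \<le> xs" "xs \<le> xx" "s2 xs (\<beta> xs) = ss"
    using IVT2'[of "\<lambda>x. s2 x (\<beta> x)" xx ss b] ss xx s2_cont[OF c\<beta>] by auto
  have xs': "b < xs" "xs < xx" using xs ss \<open>s2 b (\<beta> b) = S2s\<close> by (cases "b = xs"; cases "xs = xx"; auto)+
  define m1 where "m1 = \<mu>' ss / 2"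
  have m1: "0 < m1" using ss by (simp add: m1_def)
  have "isCont \<mu>' ss" by (rule continuous_on_interior[OF \<mu>'_cont]) (use ss in simp)
  then have "isCont (\<lambda>s. \<mu>' s - m1) ss" by (intro continuous_diff continuous_const)
  from isCont_pos_nbhd[where g = "\<lambda>s. \<mu>' s - m1", OF this] obtain \<eta>0 where \<eta>0: "\<eta>0 > 0" "\<And>s. \<bar>s - ss\<bar> \<le> \<eta>0 \<Longrightarrow> 0 < \<mu>' s - m1"
    using ss by (auto simp: m1_def)
  define \<eta> where "\<eta> = min (\<eta>0 / 2) (min (ss / 2) ((S2s - ss) / 2))"
  have \<eta>: "0 < \<eta>" "2 * \<eta> \<le> \<eta>0" "\<eta> < ss" "ss + 2 * \<eta> \<le> S2s" using \<eta>0(1) ss by (auto simp: \<eta>_def min_def field_simps)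
  have "isCont (\<lambda>x. s2 x (\<beta> x)) xs"
    using s2_cont[OF c\<beta>[of UNIV]] by (simp add: continuous_on_eq_continuous_at)
  then have "isCont (\<lambda>x. \<eta> - \<bar>s2 x (\<beta> x) - ss\<bar>) xs" by (intro continuous_intros)
  from isCont_pos_nbhd[where g = "\<lambda>x. \<eta> - \<bar>s2 x (\<beta> x) - ss\<bar>", OF this] obtain \<epsilon>0 where \<epsilon>0: "\<epsilon>0 > 0" "\<And>x. \<bar>x - xs\<bar> \<le> \<epsilon>0 \<Longrightarrow> 0 < \<eta> - \<bar>s2 x (\<beta> x) - ss\<bar>"
    using xs(3) \<eta>(1) by auto
  define \<epsilon> where "\<epsilon> = min \<epsilon>0 (min ((xs - b) / 2) ((xx - xs) / 2))"
  have \<epsilon>: "0 < \<epsilon>" "\<epsilon> \<le> \<epsilon>0" "b < xs - \<epsilon>" "xs + \<epsilon> < xx" using \<epsilon>0(1) xs' by (auto simp: \<epsilon>_def min_def field_simps)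
  define p q where "p = xs - \<epsilon>" and "q = xs + \<epsilon>"
  have pq: "b < p" "p < q" "q < xx" using \<epsilon> by (auto simp: p_def q_def)
  have spq: "\<bar>s2 x (\<beta> x) - ss\<bar> < \<eta>" if "x \<in> {p..q}" for x
    using \<epsilon>0(2)[of x] that \<epsilon>(2) by (auto simp: p_def q_def abs_if split: if_splits)
  define \<eta>' where "\<eta>' = \<beta> q - ?c"
  have \<eta>': "0 < \<eta>'" using \<beta>less[of q xe] pq xx xe(3) by (simp add: \<eta>'_def)
  obtain K where K: "K > 0" "\<And>b1 x t. \<bar>\<beta> x - beta cm b1 x\<bar> \<le> \<bar>\<beta> t - beta cm b1 t\<bar> * exp (K * \<bar>x - t\<bar>)"
    using beta_dist[OF cm(1,2)] b' unfolding \<beta>_def by blast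
  define eK where "eK = exp (K * (xf - x0))"
  have eK: "1 \<le> eK" using K(1) x0f by (simp add: eK_def)
  define C1 where "C1 = M * eK"
  have C1: "0 < C1" "M \<le> C1" using eK M_pos by (auto simp: C1_def)
  obtain Lm where Lm: "Lm > 0" "\<And>a b. a \<in> {0..M} \<Longrightarrow> b \<in> {0..M} \<Longrightarrow> \<bar>\<mu> a - \<mu> b\<bar> \<le> Lm * \<bar>a - b\<bar>"
    using \<mu>_lipschitz by blast
  define ml where "ml = min (\<mu> (S2s / 2)) (\<mu> M)"
  have ml: "0 < ml" using \<mu>_pos S2s_pos M_pos by (simp add: ml_def)
  have mle: "ml \<le> \<mu> s" if "S2s / 2 \<le> s" "s \<le> M" for s
    using \<mu>_le[of "S2s / 2" s] \<mu>_ge[of s M] that S2s_pos by (cases "s \<le> S2s") (auto simp: ml_def)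
  define Li where "Li = Lm / ml\<^sup>2"
  have Li: "0 < Li" using Lm(1) ml by (simp add: Li_def)
  have inv_lip: "\<bar>1 / \<mu> s - 1 / \<mu> t\<bar> \<le> Li * \<bar>s - t\<bar>" if "S2s / 2 \<le> s" "s \<le> M" "S2s / 2 \<le> t" "t \<le> M" for s t
  proof -
    have "max ml (\<mu> s) = \<mu> s" "max ml (\<mu> t) = \<mu> t" using mle that by (simp_all add: max_absorb2)
    then have "\<bar>1 / \<mu> s - 1 / \<mu> t\<bar> \<le> \<bar>\<mu> s - \<mu> t\<bar> / ml\<^sup>2" using inverse_max_lipschitz[OF ml, of "\<mu> s" "\<mu> t"] by simp
    also have "\<dots> \<le> (Lm * \<bar>s - t\<bar>) / ml\<^sup>2" using Lm(2)[of s t] that S2s_pos by (intro divide_right_mono) auto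
    finally show ?thesis by (simp add: Li_def)
  qed
  define g1 where "g1 = f cm / max (m0 cm) (\<mu> S2s)"
  have g1: "0 < g1" using f_pos[OF cm(1)] \<mu>_S2s_pos by (simp add: g1_def less_max_iff_disj)
  have g1le: "g1 \<le> Gb cm x e" for x e
    unfolding g1_def Gb_def by (rule Gc_bounds(1)[OF cm(1) cm_M[OF cm(1,2)] m0_pos[OF cm(1,2)]])
  \<comment> \<open>The rate at which the curve separates from the line at \<open>b\<close>,
    positive because \<open>b > xm\<close>. It makes the distance of the two competing curves of
    first order in \<open>\<delta>\<close> from below, not only from above.\<close>
  define r0 where "r0 = exp b - Gb cm b y"
  have r0: "0 < r0" using Gb_E[OF cm(1,2) less_imp_le[OF xmb]] iffD2[OF exp_less_cancel_iff xmb] unfolding r0_def b[symmetric] by linarith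
  have "((\<lambda>x. \<beta> x - E x - r0 / 2 * (x - b)) has_real_derivative - Gb cm b (\<beta> b) - - exp b - r0 / 2) (at b)"
    unfolding \<beta>_def by (rule derivative_eq_intros b' E_deriv refl | simp)+
  moreover have "0 < - Gb cm b (\<beta> b) - - exp b - r0 / 2" using r0 \<beta>b by (simp add: r0_def)
  ultimately obtain d0 where d0: "d0 > 0" "\<And>h. 0 < h \<Longrightarrow> h < d0 \<Longrightarrow> \<beta> b - E b - r0 / 2 * (b - b) < \<beta> (b + h) - E (b + h) - r0 / 2 * (b + h - b)"
    using DERIV_pos_inc_right by blast
  define c1 where "c1 = r0 / 2 / eK"
  have c1: "0 < c1" using r0 eK by (simp add: c1_def)
  \<comment> \<open>The loss will be at most \<open>C3 * \<delta> * \<delta>\<close> and the gain at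
    least \<open>C4 * \<delta>\<close>.\<close>
  define C3 where "C3 = Li * C1 * (C1 / g1 + 1)"
  define C4 where "C4 = m1 * c1 / (\<mu> S2s)\<^sup>2 * (q - p)"
  have C3: "0 < C3" using Li C1 g1 by (auto simp: C3_def intro!: mult_pos_pos add_pos_pos)
  have C4: "0 < C4" using m1 c1 \<mu>_S2s_pos pq by (simp add: C4_def)
  \<comment> \<open>In this order: the new crossing stays before \<open>p\<close>; on
    \<open>{p..q}\<close> both curves stay above the last value of \<open>S1\<close> and in the
    range where \<open>\<mu>' > m1\<close>; the derivative estimate at \<open>b\<close> applies; the
    new descent begins after \<open>x0\<close>; near the crossing \<open>S2 \<ge> S2s / 2\<close>
    and the line is above the last value of \<open>S1\<close>; the gain exceeds the loss.\<close>
  obtain \<delta> where \<delta>0: "0 < \<delta>" and "\<delta> < p - b \<and> \<delta> < \<eta>' / C1 \<and> \<delta> < \<eta> / C1 \<and> \<delta> < d0 \<and>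
    \<delta> < (b - x0) * g1 / C1 \<and> \<delta> < S2s / 2 / C1 \<and> \<delta> < (y - ?c) / C1 \<and> \<delta> < C4 / C3"
  proof -
    have pos: "0 < p - b" "0 < \<eta>' / C1" "0 < \<eta> / C1" "0 < (b - x0) * g1 / C1" "0 < S2s / 2 / C1" "0 < (y - ?c) / C1" "0 < C4 / C3"
      using pq \<eta>' \<eta> x0b g1 S2s_pos cy C1 C3 C4 by simp_all
    obtain e1 where e1: "0 < e1" "e1 < p - b" "e1 < \<eta>' / C1" using field_lbound_gt_zero[OF pos(1,2)] by blast
    obtain e2 where e2: "0 < e2" "e2 < \<eta> / C1" "e2 < d0" using field_lbound_gt_zero[OF pos(3) d0(1)] by blast
    obtain e3 where e3: "0 < e3" "e3 < (b - x0) * g1 / C1" "e3 < S2s / 2 / C1" using field_lbound_gt_zero[OF pos(4,5)] by blast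
    obtain e4 where e4: "0 < e4" "e4 < (y - ?c) / C1" "e4 < C4 / C3" using field_lbound_gt_zero[OF pos(6,7)] by blast
    obtain e5 where e5: "0 < e5" "e5 < e1" "e5 < e2" using field_lbound_gt_zero[OF e1(1) e2(1)] by blast
    obtain e6 where e6: "0 < e6" "e6 < e3" "e6 < e4" using field_lbound_gt_zero[OF e3(1) e4(1)] by blast
    obtain e7 where e7: "0 < e7" "e7 < e5" "e7 < e6" using field_lbound_gt_zero[OF e5(1) e6(1)] by blast
    show ?thesis by (rule that[of e7]) (use e1 e2 e3 e4 e5 e6 e7 in linarith)+
  qed
  then have \<delta>: "\<delta> < p - b" "C1 * \<delta> < \<eta>'" "C1 * \<delta> < \<eta>" "\<delta> < d0" "C1 * \<delta> < (b - x0) * g1" "C1 * \<delta> < S2s / 2" "C1 * \<delta> < y - ?c" "C3 * \<delta> < C4"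
    using C1(1) C3 by (simp_all only: pos_less_divide_eq mult.commute)
  \<comment> \<open>A later crossing of the line means a lower curve, hence an earlier start of
    control 1 from the level \<open>y\<close>.\<close>
  define b1 where "b1 = b + \<delta>"
  have b1: "b < b1" "b1 < p" "xm < b1" "x0 < b1" "b1 < xf" using \<delta>0 \<delta>(1) xmb x0b pq xx xe by (auto simp: b1_def)
  define \<gamma> where "\<gamma> = beta cm b1"
  have c\<gamma>: "continuous_on T \<gamma>" for T using beta_cont[OF cm(1,2)] by (simp add: \<gamma>_def)
  have \<gamma>b1: "\<gamma> b1 = E b1" by (simp add: \<gamma>_def beta_self[OF cm(1,2)])
  \<comment> \<open>Curves of the flow never meet, so the order at \<open>b1\<close> holds
    everywhere.\<close>
  have dpos: "0 < \<beta> x - \<gamma> x" for x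
  proof -
    have at: "E b1 < \<beta> b1" using beta_greater_E[OF cm(1,2) xmb b1(1)] by (simp add: \<beta>_def)
    have ne: "\<beta> t \<noteq> \<gamma> t" for t
    proof
      assume "\<beta> t = \<gamma> t"
      then have "\<beta> b1 = \<gamma> b1" unfolding \<beta>_def \<gamma>_def by (rule beta_unique[OF cm(1,2) b' b'])
      then show False using at \<gamma>b1 by simp
    qed
    show ?thesis
    proof (rule ccontr)
      assume n: "\<not> ?thesis"
      have cd: "continuous_on T (\<lambda>x. \<beta> x - \<gamma> x)" for T by (intro continuous_on_diff c\<beta> c\<gamma>)
      show False
      proof (cases "x \<le> b1")
        case True
        then show ?thesis using IVT'[of "\<lambda>x. \<beta> x - \<gamma> x" x 0 b1] n at \<gamma>b1 cd ne by force
      next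
        case False
        then show ?thesis using IVT2'[of "\<lambda>x. \<beta> x - \<gamma> x" x 0 b1] n at \<gamma>b1 cd ne by force
      qed
    qed
  qed
  have eb1: "exp b1 - exp b \<le> M * \<delta>"
  proof -
    have "norm (exp b1 - exp b) \<le> M * norm (b1 - b)"
    proof (rule field_differentiable_bound[of "{b..b1}" exp exp])
      fix z assume z: "z \<in> {b..b1}"
      have "exp z \<le> exp xf" using z b1 by simp
      then have "exp z \<le> M" using exf by linarith
      then show "norm (exp z) \<le> M" by simp
    qed (use b1 in \<open>auto intro!: derivative_eq_intros\<close>)
    then show ?thesis using b1 by (simp add: b1_def)
  qed
  have db1: "\<beta> b1 - \<gamma> b1 \<le> M * \<delta>" using \<beta>less[OF b1(1)] \<beta>b b \<gamma>b1 eb1 by (simp add: E_def)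
  have db1': "r0 / 2 * \<delta> \<le> \<beta> b1 - \<gamma> b1" using d0(2)[OF \<delta>0 \<delta>(4)] \<beta>b b \<gamma>b1 by (simp add: b1_def)
  have dist_e: "exp (K * \<bar>x - b1\<bar>) \<le> eK" if "x \<in> {x0..xf}" for x
    using that b1 K(1) by (auto simp: eK_def intro!: mult_left_mono)
  have dup: "\<beta> x - \<gamma> x \<le> C1 * \<delta>" if x: "x \<in> {x0..xf}" for x
  proof -
    have "\<beta> x - \<gamma> x \<le> (\<beta> b1 - \<gamma> b1) * exp (K * \<bar>x - b1\<bar>)"
      using K(2)[of x b1 b1] dpos[of x] dpos[of b1] by (simp add: \<gamma>_def)
    also have "\<dots> \<le> (M * \<delta>) * eK" using db1 dist_e[OF x] dpos[of b1] M_pos \<delta>0 by (intro mult_mono) auto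
    finally show ?thesis by (simp add: C1_def mult_ac)
  qed
  have dlow: "c1 * \<delta> \<le> \<beta> x - \<gamma> x" if x: "x \<in> {x0..xf}" for x
  proof -
    have "r0 / 2 * \<delta> \<le> (\<beta> x - \<gamma> x) * exp (K * \<bar>b1 - x\<bar>)"
      using K(2)[of b1 b1 x] dpos[of x] dpos[of b1] db1' by (simp add: \<gamma>_def)
    also have "\<dots> \<le> (\<beta> x - \<gamma> x) * eK"
      using dist_e[OF x] dpos[of x] by (intro mult_left_mono) (auto simp: abs_minus_commute)
    finally show ?thesis using eK by (simp add: c1_def field_simps)
  qed
  define \<kappa> where "\<kappa> = kap cm y b1 ?c"
  have \<gamma>E: "\<gamma> x \<le> E x" if "xm < x" "x \<le> b1" for x
    using beta_less_E[OF cm(1,2) b1(3), of x] that \<gamma>b1 by (cases "x = b1") (auto simp: \<gamma>_def)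
  have m_le: "mcurve cm b1 x = min (E x) (\<gamma> x)" if "x \<le> b1" for x
    using mcurve_left[OF cm(1,2) that] by (simp add: \<gamma>_def)
  have m_ge: "mcurve cm b1 x = \<gamma> x" if "b1 \<le> x" for x
    using mcurve_right[OF cm(1,2) that] by (simp add: \<gamma>_def)
  \<comment> \<open>Backwards from \<open>b\<close> the old curve rises with slope at least
    \<open>g1\<close>, and the new one is at most \<open>C1 * \<delta>\<close> lower. So the new
    profile is still at \<open>y\<close> up to \<open>\<alpha>\<close>, whose distance from
    \<open>b\<close> is of order \<open>\<delta>\<close>.\<close>
  define \<alpha> where "\<alpha> = b - C1 * \<delta> / g1"
  have \<alpha>: "x0 < \<alpha>" "\<alpha> < b"
  proof -
    have "C1 * \<delta> / g1 < b - x0" using \<delta>(5) g1 by (simp add: field_simps)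
    then show "x0 < \<alpha>" by (simp add: \<alpha>_def)
    show "\<alpha> < b" using C1 \<delta>0 g1 by (simp add: \<alpha>_def)
  qed
  have \<beta>left: "y + g1 * (b - x) \<le> \<beta> x" if "x \<le> b" for x
  proof -
    have "integral {x..b} (\<lambda>_. g1) \<le> integral {x..b} (\<lambda>x. Gb cm x (beta cm b x))"
      by (intro integral_le integrable_continuous_interval Gb_cont_comp[OF cm(1,2)] beta_cont[OF cm(1,2)] continuous_on_const g1le)
    then show ?thesis using beta_integral[OF cm(1,2) that, of b] that \<beta>b by (simp add: \<beta>_def mult.commute)
  qed
  have first: "y \<le> mcurve cm b1 x" if x: "x0 \<le> x" "x \<le> \<alpha>" for x
  proof -
    have "g1 * (b - \<alpha>) \<le> g1 * (b - x)" using x g1 by (intro mult_left_mono) auto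
    then have "C1 * \<delta> \<le> g1 * (b - x)" using g1 by (simp add: \<alpha>_def)
    then have "y \<le> \<gamma> x" using \<beta>left[of x] dup[of x] x \<alpha> bxf by simp
    moreover have "y \<le> E x" using E_le[of b x] b x \<alpha> by simp
    ultimately show ?thesis using m_le[of x] x \<alpha> b1 by simp
  qed
  obtain v where rp: "rprof v \<kappa> x0 xf"
    unfolding \<kappa>_def using kap_admissible[OF cm(1,2) less_imp_le[OF b1(3)] cm(3) less_imp_le[OF cy] less_imp_le[OF x0f] s2c] by blast
  have regk: "reg \<kappa> x0 xf" by (rule rprof_reg[OF rp])
  have k0: "\<kappa> x0 = \<rho> x0" using first[of x0] \<alpha> \<rho>0 cy by (simp add: \<kappa>_def kap_def)
  have "\<gamma> xf < ?c" using dpos[of xf] \<beta>xf by simp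
  then have kf: "\<kappa> xf = ?c" using m_ge[of xf] b1 cy by (simp add: \<kappa>_def kap_def)
  have le: "cost \<rho> x0 xf \<le> cost \<kappa> x0 xf"
    by (rule opt_le_rprof[OF o rp k0]) (use kf o in \<open>auto simp: opt_def\<close>)
  have \<rho>left: "\<rho> x = y" if "x0 \<le> x" "x \<le> b" for x
  proof -
    have "y \<le> mcurve cm b x" using mcurve_le[OF cm(1,2) that(2), of b] mcurve_self[OF cm(1,2), of b] b by simp
    then show ?thesis using kap[of x] that bxf cy by (simp add: kap_def)
  qed
  have \<rho>right: "\<rho> x = max ?c (\<beta> x)" if "b \<le> x" "x \<le> xf" for x
  proof -
    have "\<beta> x \<le> y" using \<beta>less[of b x] that \<beta>b by (cases "b = x") auto
    then show ?thesis using kap[of x] that x0b cy mcurve_right[OF cm(1,2) that(1)] by (simp add: kap_def \<beta>_def)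
  qed
  have \<kappa>right: "\<kappa> x = max ?c (\<gamma> x)" if "b \<le> x" "x \<le> xf" for x
  proof -
    have "\<gamma> x \<le> y" using \<beta>less[of b x] that \<beta>b dpos[of x] by (cases "b = x") auto
    moreover have "mcurve cm b1 x = \<gamma> x" using \<gamma>E[of x] m_le[of x] m_ge[of x] that xmb by (cases "x \<le> b1") auto
    ultimately show ?thesis using cy by (simp add: \<kappa>_def kap_def)
  qed
  have s2M: "s2 x (g x) \<le> M" if "reg g x0 xf" "x \<in> {x0..xf}" for g x
  proof -
    have "0 < g x" using that unfolding reg_def by blast
    then show ?thesis using exp_gt_zero[of x] unfolding s2_def by linarith
  qed
  have P1: "cost \<kappa> x0 \<alpha> = cost \<rho> x0 \<alpha>"
  proof (rule cost_cong)
    fix x assume "x \<in> {x0..\<alpha>}"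
    then show "\<kappa> x = \<rho> x" using first[of x] \<rho>left[of x] \<alpha> cy by (simp add: \<kappa>_def kap_def)
  qed
  \<comment> \<open>The only part where the new profile can be slower: the integrand is worse by at
    most order \<open>\<delta>\<close> on an interval of length of order
    \<open>\<delta>\<close>.\<close>
  have P2: "cost \<kappa> \<alpha> b1 \<le> cost \<rho> \<alpha> b1 + Li * C1 * \<delta> * (b1 - \<alpha>)"
  proof (rule cost_le_add[OF reg_subset[OF reg] reg_subset[OF regk]])
    fix x assume x: "x \<in> {\<alpha>..b1}"
    have xx0: "x \<in> {x0..xf}" using x \<alpha> b1 by auto
    have cE: "?c \<le> E x"
    proof -
      have "E b1 \<le> E x" using x E_le[of b1 x] by simp
      moreover have "y - M * \<delta> \<le> E b1" using eb1 b by (simp add: E_def)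
      moreover have "M * \<delta> \<le> C1 * \<delta>" using C1(2) \<delta>0 by simp
      ultimately show ?thesis using \<delta>(7) by linarith
    qed
    have "\<kappa> x \<le> max ?c (mcurve cm b1 x)" by (simp add: \<kappa>_def kap_def)
    also have "\<dots> \<le> E x" using cE m_le[of x] x by simp
    finally have kE: "S2s \<le> s2 x (\<kappa> x)" by (simp add: le_E_iff)
    have dk: "\<bar>\<kappa> x - \<rho> x\<bar> \<le> C1 * \<delta>"
    proof (cases "x \<le> b")
      case True
      have "y \<le> E x" using E_le[of b x] b True by simp
      moreover have "y \<le> \<beta> x" using \<beta>left[OF True] g1 True mult_nonneg_nonneg[of g1 "b - x"] by linarith
      moreover have C\<delta>: "0 \<le> C1 * \<delta>" using C1 \<delta>0 by simp
      ultimately have "y - C1 * \<delta> \<le> E x" "y - C1 * \<delta> \<le> \<gamma> x" using dup[OF xx0] by linarith+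
      then have "y - C1 * \<delta> \<le> mcurve cm b1 x" using m_le[of x] x by simp
      moreover note C\<delta>
      ultimately have "y - C1 * \<delta> \<le> \<kappa> x" "\<kappa> x \<le> y" by (auto simp: \<kappa>_def kap_def)
      then show ?thesis using \<rho>left[of x] True xx0 by simp
    next
      case False
      then show ?thesis using \<kappa>right[of x] \<rho>right[of x] xx0 dup[OF xx0] dpos[of x] by auto
    qed
    have ds: "\<bar>s2 x (\<kappa> x) - s2 x (\<rho> x)\<bar> \<le> C1 * \<delta>" using dk by (simp add: s2_def)
    have "S2s / 2 \<le> s2 x (\<rho> x)" using ds kE \<delta>(6) by linarith
    then have "\<bar>1 / \<mu> (s2 x (\<kappa> x)) - 1 / \<mu> (s2 x (\<rho> x))\<bar> \<le> Li * \<bar>s2 x (\<kappa> x) - s2 x (\<rho> x)\<bar>"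
      using kE S2s_pos s2M[OF regk xx0] s2M[OF reg xx0] by (intro inv_lip) auto
    also have "\<dots> \<le> Li * (C1 * \<delta>)" using ds Li by (intro mult_left_mono) auto
    finally show "1 / \<mu> (s2 x (\<kappa> x)) \<le> 1 / \<mu> (s2 x (\<rho> x)) + Li * C1 * \<delta>" by (simp add: mult.assoc)
  qed (use \<alpha> b1 in auto)
  have cl: "closer x (\<kappa> x) (\<rho> x)" if "b1 \<le> x" "x \<le> xf" for x
  proof -
    have "E x \<le> \<gamma> x" using beta_ge_E[OF cm(1,2) less_imp_le[OF b1(3)] that(1)] by (simp add: \<gamma>_def)
    then show ?thesis using \<kappa>right[of x] \<rho>right[of x] that b1 dpos[of x] by (auto simp: closer_def)
  qed
  have P3: "cost \<kappa> b1 p \<le> cost \<rho> b1 p"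
    by (rule cost_le[OF reg_subset[OF reg] reg_subset[OF regk] cl]) (use b1 pq xx xe in auto)
  have P5: "cost \<kappa> q xf \<le> cost \<rho> q xf"
    by (rule cost_le[OF reg_subset[OF reg] reg_subset[OF regk] cl]) (use b1 pq xx xe in auto)
  \<comment> \<open>Here \<open>S2\<close>, which is below \<open>S2s\<close>, is raised by at least
    \<open>c1 * \<delta>\<close> in a range where \<open>\<mu>'\<close> exceeds
    \<open>m1\<close>.\<close>
  have P4: "cost \<kappa> p q \<le> cost \<rho> p q + (- (m1 * c1 / (\<mu> S2s)\<^sup>2 * \<delta>)) * (q - p)"
  proof (rule cost_le_add[OF reg_subset[OF reg] reg_subset[OF regk]])
    fix x assume x: "x \<in> {p..q}"
    have xx0: "x \<in> {x0..xf}" using x pq xx xe b1 by auto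
    have "\<beta> q \<le> \<beta> x" using \<beta>less[of x q] x by (cases "x = q") auto
    then have bx: "?c < \<gamma> x" "?c < \<beta> x" using dup[OF xx0] \<delta>(2) \<eta>' by (auto simp: \<eta>'_def)
    have kx: "\<kappa> x = \<gamma> x" "\<rho> x = \<beta> x" using \<kappa>right[of x] \<rho>right[of x] bx xx0 x b1 by auto
    define s t where "s = s2 x (\<beta> x)" and "t = s2 x (\<gamma> x)"
    have st: "t - s = \<beta> x - \<gamma> x" by (simp add: s_def t_def s2_def)
    have sl: "\<bar>s - ss\<bar> < \<eta>" using spq[OF x] by (simp add: s_def)
    have tl: "t - s \<le> \<eta>" "0 < t - s" "c1 * \<delta> \<le> t - s" using dup[OF xx0] dlow[OF xx0] dpos[of x] \<delta>(3) st by auto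
    have s0: "0 < s" using sl \<eta>(3) by linarith
    have "m1 * (t - s) \<le> \<mu> t - \<mu> s"
    proof -
      have "\<mu> s - m1 * s \<le> \<mu> t - m1 * t"
      proof (rule nonneg_deriv_imp_le[of s t "\<lambda>r. \<mu> r - m1 * r" "\<lambda>r. \<mu>' r - m1"])
        fix r assume r: "r \<in> {s..t}"
        have r0: "0 < r" using r s0 by simp
        show "((\<lambda>r. \<mu> r - m1 * r) has_real_derivative \<mu>' r - m1) (at r within {s..t})"
          by (rule derivative_eq_intros has_field_derivative_at_within[OF \<mu>_DERIV[OF r0]] refl | simp)+
        have "\<bar>r - ss\<bar> \<le> \<eta>0" using r sl tl(1) \<eta>(2) by (auto simp: abs_if split: if_splits)
        then show "0 \<le> \<mu>' r - m1" using \<eta>0(2)[of r] by simp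
      qed (use tl in simp)
      then show ?thesis by (simp add: algebra_simps)
    qed
    moreover have "m1 * (c1 * \<delta>) \<le> m1 * (t - s)" using tl(3) m1 by (intro mult_left_mono) auto
    ultimately have dm: "m1 * (c1 * \<delta>) \<le> \<mu> t - \<mu> s" by linarith
    have mp: "0 < \<mu> s" "0 < \<mu> t" using s0 tl by (auto intro!: \<mu>_pos)
    have mm: "\<mu> s * \<mu> t \<le> (\<mu> S2s)\<^sup>2"
      unfolding power2_eq_square using mp \<mu>_max[of s] \<mu>_max[of t] s0 tl by (intro mult_mono) auto
    have "m1 * c1 / (\<mu> S2s)\<^sup>2 * \<delta> = m1 * (c1 * \<delta>) / (\<mu> S2s)\<^sup>2" by simp
    also have "\<dots> \<le> (\<mu> t - \<mu> s) / (\<mu> s * \<mu> t)"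
    proof (rule frac_le)
      have "0 \<le> m1 * (c1 * \<delta>)" using m1 c1 \<delta>0 by simp
      then show "0 \<le> \<mu> t - \<mu> s" using dm by linarith
    qed (use dm mm mp in simp_all)
    also have "\<dots> = 1 / \<mu> s - 1 / \<mu> t" using mp by (simp add: field_simps)
    finally show "1 / \<mu> (s2 x (\<kappa> x)) \<le> 1 / \<mu> (s2 x (\<rho> x)) + - (m1 * c1 / (\<mu> S2s)\<^sup>2 * \<delta>)"
      unfolding kx s_def[symmetric] t_def[symmetric] by linarith
  qed (use pq x0b xx xe in auto)
  have split: "cost g x0 xf = cost g x0 \<alpha> + cost g \<alpha> b1 + cost g b1 p + cost g p q + cost g q xf" if g: "reg g x0 xf" for g
  proof -
    have o1: "x0 \<le> \<alpha>" "\<alpha> \<le> b1" "b1 \<le> p" "p \<le> q" "q \<le> xf" using \<alpha> b1 pq xx xe by auto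
    have "cost g x0 xf = cost g x0 \<alpha> + cost g \<alpha> xf" by (rule cost_combine[OF g]) (use o1 in auto)
    moreover have "cost g \<alpha> xf = cost g \<alpha> b1 + cost g b1 xf" by (rule cost_combine[OF reg_subset[OF g]]) (use o1 in auto)
    moreover have "cost g b1 xf = cost g b1 p + cost g p xf" by (rule cost_combine[OF reg_subset[OF g]]) (use o1 in auto)
    moreover have "cost g p xf = cost g p q + cost g q xf" by (rule cost_combine[OF reg_subset[OF g]]) (use o1 in auto)
    ultimately show ?thesis by simp
  qed
  have "cost \<kappa> x0 xf \<le> cost \<rho> x0 xf + Li * C1 * \<delta> * (b1 - \<alpha>) - m1 * c1 / (\<mu> S2s)\<^sup>2 * \<delta> * (q - p)"
    unfolding split[OF reg] split[OF regk] using P1 P2 P3 P4[unfolded mult_minus_left] P5 by linarith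
  moreover have "Li * C1 * \<delta> * (b1 - \<alpha>) = C3 * \<delta> * \<delta>"
    by (simp add: C3_def b1_def \<alpha>_def field_simps)
  moreover have "m1 * c1 / (\<mu> S2s)\<^sup>2 * \<delta> * (q - p) = C4 * \<delta>" by (simp add: C4_def)
  moreover have "C3 * \<delta> * \<delta> < C4 * \<delta>" using \<delta>(8) \<delta>0 by (rule mult_strict_right_mono)
  ultimately show False using le by linarith
qed

subsection \<open>The form of optimal trajectories\<close>

text \<open>The last value of \<open>S1\<close> is at most \<open>E b < S1s \<le> B1\<close>, so the
  descent could be stopped earlier, which requires \<open>phi \<ge> 1\<close> at the start of the
  final arc. But for \<open>S1 < S1s\<close> one has \<open>phi < 1\<close> up to
  \<open>S2s\<close>.\<close>

lemma no_low_crossing: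
  assumes o: "opt \<rho> x0 xf" and yE: "\<rho> x0 \<le> E x0" and cm: "0 < cm" "cm \<le> S1m"
    and b: "xm < b" "b \<le> xf" "\<rho> b = E b" and x1: "x0 \<le> x1" "x1 < b"
    and r: "\<And>x. x \<in> {x1..xf} \<Longrightarrow> \<rho> x = max (\<rho> xf) (beta cm b x)" and low: "E b < S1s"
  shows False
proof -
  let ?c = "\<rho> xf"
  have pr: "prof \<rho> x0 xf" using o by (simp add: opt_def)
  have c0: "0 < ?c" using pr x1 b by (auto simp: prof_def reg_def)
  have cE: "?c \<le> E b" using pr b x1 unfolding prof_def by (metis less_imp_le order_refl order_trans)
  have bf: "beta cm b xf \<le> ?c" using r[of xf] b x1 by auto
  then obtain x3 where x3: "b \<le> x3" "x3 \<le> xf" "beta cm b x3 = ?c"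
    using IVT2'[of "beta cm b" xf ?c b] beta_self[OF cm, of b] cE b beta_cont[OF cm] by auto
  have const: "\<rho> x = ?c" if "x \<in> {x3..xf}" for x
    using r[of x] that x3 x1 beta_le[OF cm, of x3 x b] by auto
  have "((beta cm b) has_real_derivative - Gb cm x3 (beta cm b x3)) (at x3 within {x1..x3})"
    by (rule has_field_derivative_at_within[OF beta_deriv[OF cm]])
  then have d: "(\<rho> has_real_derivative - Gb cm x3 (beta cm b x3)) (at x3 within {x1..x3})"
  proof (rule has_field_derivative_transform_within[where d = 1])
    show "beta cm b t = \<rho> t" if "t \<in> {x1..x3}" for t
      using r[of t] that x3 beta_le[OF cm, of t x3 b] by auto
  qed (use x3 x1 in auto)
  have "1 \<le> phi M B2 \<mu> ?c (s2 x3 ?c)"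
    by (rule opt_before_final_phi_ge[OF o yE x1(1) _ x3(2) const _ d]) (use x1 x3 cE low S1s_le Gb_pos[OF cm] in auto)
  moreover have "s2 x3 ?c \<le> S2s"
    using beta_ge_E[OF cm less_imp_le[OF b(1)] x3(1)] x3(3) by (simp add: E_le_iff)
  ultimately show False
    using phi_less_1[of ?c "s2 x3 ?c"] c0 cE low by (cases "B2 \<le> s2 x3 ?c") (auto simp: phi_def)
qed

text \<open>
  Gluing \<open>\<rho>\<close> to an optimal profile that starts on the line \<open>S2 = S2s\<close> at some \<open>y' > y\<close> would give
  an optimal profile that is constant between two decreasing pieces.
\<close>

lemma no_descent_to_line:
  assumes nos: "\<And>x y. S1m \<le> x \<Longrightarrow> x < y \<Longrightarrow> y \<le> sb \<Longrightarrow> \<not> singular_optimal M B1 B2 f \<mu> S2s x y"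
    and pos: "0 < S1s" and y: "S1m \<le> y" "S1s < y" "y < sb" and sb: "sb < M - S2s"
    and o: "opt \<rho> x0 xf" and x1: "x0 < x1" "x1 \<le> xf" "E x1 = y" and const: "\<And>x. x \<in> {x0..x1} \<Longrightarrow> \<rho> x = y"
    and cy: "\<rho> xf < y"
  shows False
proof -
  have \<rho>0: "\<rho> x0 = y" using const x1 by simp
  have yE: "\<rho> x0 \<le> E x0" using E_le[of x1 x0] x1 \<rho>0 by simp
  have gap: "S2s < s2 x0 y" using x1 E_less[of x1 x0] by (simp add: less_E_iff[symmetric])
  \<comment> \<open>Below \<open>sb\<close>, so that no singular arc is optimal from
    \<open>y'\<close>, and close enough to \<open>y\<close> that the profile from \<open>y'\<close>
    comes down to \<open>y\<close> only after \<open>x0\<close>.\<close>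
  define y' where "y' = min ((y + sb) / 2) (y + (s2 x0 y - S2s) / 2)"
  have y': "y < y'" "y' < sb" "y' - y < s2 x0 y - S2s" using y gap by (auto simp: y'_def min_def field_simps)
  define z0 where "z0 = ln (M - S2s - y')"
  have z0: "E z0 = y'" unfolding z0_def by (rule E_ln) (use y' sb in simp)
  have yS: "S1m < y'" "S1s < y'" "y' \<le> sb" using y y' by auto
  obtain \<sigma> zf cm b where \<sigma>: "opt \<sigma> z0 zf" "\<sigma> z0 = y'" "0 < cm" "cm \<le> S1m" "cm \<le> \<sigma> zf" "xm < b" "b \<le> zf"
    "\<sigma> b = E b" "beta cm b z0 = y'" "\<And>x. x \<in> {z0..zf} \<Longrightarrow> \<sigma> x = max (\<sigma> zf) (beta cm b x)"
    "\<And>x. z0 < x \<Longrightarrow> x < b \<Longrightarrow> beta cm b x < E x"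
    using opt_from_singular_line[OF nos pos yS z0 zero_less_one] by blast
  note cm = \<sigma>(3,4)
  have Eb: "E b < S1m" using E_less[of b xm] \<sigma>(6) by (simp add: E_xm)
  have z0b: "z0 < b" using E_less[of b z0] z0 Eb y y' by simp
  obtain x2 where x2: "z0 \<le> x2" "x2 \<le> b" "beta cm b x2 = y"
    using IVT2'[of "beta cm b" b y z0] beta_self[OF cm, of b] Eb y y' \<sigma>(9) z0b beta_cont[OF cm] by auto
  have x2': "z0 < x2" "x2 < b" using x2 \<sigma>(9) y' beta_self[OF cm, of b] Eb y by (cases "x2 = z0"; cases "x2 = b"; auto)+
  have "y < E x2" using \<sigma>(11)[OF x2'] x2 by simp
  then have x21: "x2 < x1" using E_less[of x1 x2] x1 by simp
  have x02: "x0 < x2"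
  proof -
    have "exp z0 < exp x2" using x2' by simp
    moreover have "exp z0 = M - S2s - y'" using z0 by (simp add: E_def)
    ultimately have "exp x0 < exp x2" using y'(3) unfolding s2_def by linarith
    then show ?thesis by simp
  qed
  have prs: "prof \<sigma> z0 zf" using \<sigma>(1) by (simp add: opt_def)
  have c\<sigma>: "\<sigma> zf \<le> E b" using prs \<sigma>(7,8) z0b unfolding prof_def by (metis less_imp_le order_refl order_trans)
  have \<sigma>2: "\<sigma> x2 = y" using \<sigma>(10)[of x2] x2 \<sigma>(7) c\<sigma> Eb y by auto
  have \<rho>2: "\<rho> x2 = y" using const x02 x21 by simp
  obtain v where v: "rprof v \<rho> x0 xf" using opt_rprof[OF o yE] by blast
  obtain w where w: "rprof w \<sigma> z0 zf" using opt_rprof[OF \<sigma>(1)] \<sigma>(2) z0 by auto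
  have ord: "x2 \<le> zf" "x2 \<le> xf" using x2' \<sigma>(7) x21 x1 by auto
  \<comment> \<open>First exchange: switching from \<open>\<rho>\<close> to \<open>\<sigma>\<close>
    at their common point cannot be faster than \<open>\<rho>\<close>.\<close>
  have c1: "cost \<rho> x2 xf \<le> cost \<sigma> x2 zf"
  proof -
    define k where "k x = (if x \<le> x2 then \<rho> x else \<sigma> x)" for x
    have k2: "\<sigma> x = k x" if "x \<in> {x2..zf}" for x using that \<rho>2 \<sigma>2 by (auto simp: k_def)
    have r1: "rprof v k x0 x2"
      by (rule rprof_cong[OF rprof_subset[OF v]]) (use x02 ord in \<open>auto simp: k_def\<close>)
    have r2: "rprof w k x2 zf"
      by (rule rprof_cong[OF rprof_subset[OF w] k2]) (use x2' ord in auto)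
    note rk = rprof_glue[OF r1 r2]
    have kf: "k zf = \<sigma> zf" using k2[of zf] ord by simp
    have "cost \<rho> x0 xf \<le> cost k x0 zf"
      by (rule opt_le_rprof[OF o rk]) (use kf \<sigma>(1) x02 in \<open>auto simp: k_def opt_def\<close>)
    moreover have "cost \<rho> x0 xf = cost \<rho> x0 x2 + cost \<rho> x2 xf"
      by (rule cost_combine[OF rprof_reg[OF v]]) (use x02 ord in auto)
    moreover have "cost k x0 zf = cost k x0 x2 + cost k x2 zf"
      by (rule cost_combine[OF rprof_reg[OF rk]]) (use x02 ord in auto)
    moreover have "cost k x0 x2 = cost \<rho> x0 x2" by (rule cost_cong) (simp add: k_def)
    moreover have "cost k x2 zf = cost \<sigma> x2 zf" by (rule cost_cong[symmetric]) (rule k2)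
    ultimately show ?thesis by simp
  qed
  \<comment> \<open>Second exchange: consequently \<open>\<sigma>\<close> followed by the rest of
    \<open>\<rho>\<close> is optimal too.\<close>
  define k where "k x = (if x \<le> x2 then \<sigma> x else \<rho> x)" for x
  have k2: "\<rho> x = k x" if "x \<in> {x2..xf}" for x using that \<rho>2 \<sigma>2 by (auto simp: k_def)
  have r1: "rprof w k z0 x2"
    by (rule rprof_cong[OF rprof_subset[OF w]]) (use x2' ord in \<open>auto simp: k_def\<close>)
  have r2: "rprof v k x2 xf"
    by (rule rprof_cong[OF rprof_subset[OF v] k2]) (use x02 ord in auto)
  note rk = rprof_glue[OF r1 r2]
  have kf: "k xf = \<rho> xf" using k2[of xf] ord by simp
  have k0: "k z0 = y'" using x2' \<sigma>(2) by (simp add: k_def)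
  have "cost k z0 xf = cost k z0 x2 + cost k x2 xf"
    by (rule cost_combine[OF rprof_reg[OF rk]]) (use x2' ord in auto)
  moreover have "cost k z0 x2 = cost \<sigma> z0 x2" by (rule cost_cong) (simp add: k_def)
  moreover have "cost k x2 xf = cost \<rho> x2 xf" by (rule cost_cong[symmetric]) (rule k2)
  moreover have "cost \<sigma> z0 zf = cost \<sigma> z0 x2 + cost \<sigma> x2 zf"
    by (rule cost_combine[OF rprof_reg[OF w]]) (use x2' ord in auto)
  ultimately have "cost k z0 xf \<le> cost \<sigma> z0 zf" using c1 by simp
  then have ok: "opt k z0 xf"
    unfolding opt_def using rprof_prof[OF rk] x2' ord k0 kf o \<sigma>(1,2) by (auto simp: opt_def intro: order_trans)
  define cm' where "cm' = min S1m (\<rho> xf)"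
  have "0 < \<rho> xf" using o by (auto simp: opt_def prof_def reg_def)
  then have cm': "0 < cm'" "cm' \<le> S1m" "cm' \<le> k xf" using S1m(1) kf by (auto simp: cm'_def)
  have kE: "k z0 \<le> E z0" using k0 z0 by simp
  obtain d where d: "\<And>x. x \<in> {z0..xf} \<Longrightarrow> k x = kap cm' y' d (\<rho> xf) x"
    using opt_structure[OF ok kE cm'] unfolding k0 kf by blast
  \<comment> \<open>On \<open>{x2..x1}\<close> the glued profile rests strictly between its first
    and its last value, so \<open>mcurve\<close> would be constant there, although it is
    injective.\<close>
  have m: "mcurve cm' d x = y" if "x \<in> {x2..x1}" for x
  proof -
    have "k x = y" using k2[of x] const[of x] that x02 x1 by auto
    then have "kap cm' y' d (\<rho> xf) x = y" using d[of x] that x2' x1 by auto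
    then show ?thesis using cy y' by (auto simp: kap_def min_def max_def split: if_splits)
  qed
  have "x2 = x1" by (rule mcurve_inj[OF cm'(1,2), of d]) (use m[of x1] m[of x2] x21 in simp)
  then show False using x21 by simp
qed

text \<open>Where \<open>\<xi>\<close> meets the line at some \<open>S1 < S1m\<close>, its
  derivative is positive because \<open>f S1 < \<mu> S2s * (M - S1 - S2s)\<close>; so
  \<open>\<xi>\<close> cannot pass below the line there.\<close>

lemma xi_ge:
  assumes pos: "0 < S1s" and xi: "xi_star_on M B1 B2 f \<mu> S2s T \<xi>" and s: "S1s \<le> s" "s \<le> T" "s \<le> S1m"
  shows "S2s \<le> \<xi> s"
proof (rule ccontr)
  assume n: "\<not> ?thesis"
  have x0: "\<xi> S1s = S2s" using xi by (simp add: xi_star_on_def S1s_def)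
  have d\<xi>: "(\<xi> has_real_derivative - 1 + \<mu> (\<xi> s) * (M - s - \<xi> s) / f s) (at s within {S1s..T})" if "s \<in> {S1s..T}" for s
    using xi that unfolding xi_star_on_def S1s_def[symmetric] by blast
  have "continuous_on {S1s..T} \<xi>" by (rule DERIV_continuous_on[OF d\<xi>])
  then have "continuous_on {S1s..s} (\<lambda>t. S2s - \<xi> t)" using s by (intro continuous_on_diff continuous_on_const) (auto intro: continuous_on_subset)
  from last_zero[OF this s(1)] obtain a where a: "S1s \<le> a" "a < s" "S2s - \<xi> a = 0" "\<And>t. a < t \<Longrightarrow> t \<le> s \<Longrightarrow> 0 < S2s - \<xi> t"
    using x0 n by auto
  have aT: "a \<in> {S1s..T}" using a s by simp
  have "f a < f S1m" using a s pos by (intro f_less) auto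
  also have "\<dots> = \<mu> S2s * (M - S2s - S1m)" by (rule S1m(3))
  also have "\<dots> \<le> \<mu> S2s * (M - a - S2s)" using a s \<mu>_S2s_pos by (intro mult_left_mono) auto
  finally have l: "f a < \<mu> (\<xi> a) * (M - a - \<xi> a)" using a(3) by simp
  have fa: "0 < f a" using a pos by (intro f_pos) auto
  have "0 < - 1 + \<mu> (\<xi> a) * (M - a - \<xi> a) / f a" using l fa by (simp add: field_simps)
  from has_real_derivative_pos_inc_right[OF d\<xi>[OF aT] this]
  obtain d where d: "d > 0" "\<And>h. 0 < h \<Longrightarrow> a + h \<in> {S1s..T} \<Longrightarrow> h < d \<Longrightarrow> \<xi> a < \<xi> (a + h)" by blast
  define h where "h = min (d / 2) (s - a)"
  have h: "0 < h" "h < d" "a + h \<le> s" using d(1) a(2) by (auto simp: h_def)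
  show False using d(2)[OF h(1) _ h(2)] a(3) a(4)[of "a + h"] h a(1) s by auto
qed

text \<open>Beyond \<open>S1m\<close> optimality takes over from the sign of the derivative. If
  \<open>\<xi> y < S2s\<close>, the point of the line at \<open>S1 = y\<close> is above
  \<open>\<xi>\<close>; the optimal profile from it leaves with control 1 and would cross the line
  below \<open>S1s\<close>.\<close>

lemma xi_ge_line:
  assumes nos: "\<And>x y. S1m \<le> x \<Longrightarrow> x < y \<Longrightarrow> y \<le> sb \<Longrightarrow> \<not> singular_optimal M B1 B2 f \<mu> S2s x y"
    and pos: "0 < S1s" and lt: "S1s < S1m" and y: "S1s < y" "y < sb" and sb: "sb < M - S2s"
    and xi: "xi_star_on M B1 B2 f \<mu> S2s y \<xi>"
  shows "S2s \<le> \<xi> y"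
proof (rule ccontr)
  assume n: "\<not> ?thesis"
  define xz where "xz = ln (M - S2s - y)"
  have xz: "E xz = y" unfolding xz_def by (rule E_ln) (use y sb in simp)
  have yS: "S1m < y" using xi_ge[OF pos xi, of y] y n by (cases "y \<le> S1m") auto
  have "\<xi> y < s2 xz y" using n xz s2_E[of xz] by simp
  from curve_above_xi[OF pos lt xi y(1) order_refl this]
  obtain cm0 where cm0: "cm0 > 0" "\<And>cm b. 0 < cm \<Longrightarrow> cm \<le> cm0 \<Longrightarrow> cm \<le> S1m \<Longrightarrow> xm < b \<Longrightarrow> beta cm b xz = y \<Longrightarrow> E b < S1s" by blast
  obtain \<sigma> zf cm b where \<sigma>: "opt \<sigma> xz zf" "\<sigma> xz = y" "0 < cm" "cm \<le> S1m" "cm \<le> cm0" "xm < b" "b \<le> zf"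
    "\<sigma> b = E b" "beta cm b xz = y" "\<And>x. x \<in> {xz..zf} \<Longrightarrow> \<sigma> x = max (\<sigma> zf) (beta cm b x)"
    using opt_from_singular_line[OF nos pos yS y(1) less_imp_le[OF y(2)] xz cm0(1)] by blast
  have "E b < S1s" using cm0(2) \<sigma> by blast
  moreover have "xz < b" using E_less[of b xz] xz \<open>E b < S1s\<close> y by simp
  ultimately show False
    using no_low_crossing[OF \<sigma>(1) _ \<sigma>(3,4,6,7,8) order_refl _ \<sigma>(10)] \<sigma>(2) xz by simp
qed

text \<open>The essential claims about the end \<open>x1\<close> of the first arc are
  \<open>x0 < x1\<close> and \<open>y < E x1\<close>. With \<open>x1 = x0\<close> the curve of
  control 1 would start above \<open>\<xi>\<close> and cross the line below \<open>S1s\<close>;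
  \<open>y = E x1\<close> is refuted separately for \<open>y < S1m\<close> and
  \<open>y \<ge> S1m\<close>.\<close>

lemma optimal_profile:
  assumes nos: "\<And>x y. S1m \<le> x \<Longrightarrow> x < y \<Longrightarrow> y \<le> sb \<Longrightarrow> \<not> singular_optimal M B1 B2 f \<mu> S2s x y"
    and pos: "0 < S1s" and lt: "S1s < S1m" and y: "S1s < y" "y < sb" and sb: "sb < M - S2s"
    and xi: "xi_star_on M B1 B2 f \<mu> S2s y \<xi>" and o: "opt \<rho> x0 xf" and \<rho>0: "\<rho> x0 = y" and above: "\<xi> y < s2 x0 y"
  shows "\<exists>x1 x3 \<beta>. x0 < x1 \<and> x1 < x3 \<and> x3 \<le> xf \<and> S2s < s2 x1 y \<and> (\<forall>x\<in>{x0..x1}. \<rho> x = y) \<and>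
    (\<forall>x\<in>{x1..x3}. \<rho> x = \<beta> x \<and> (\<beta> has_real_derivative - G x (\<rho> x)) (at x)) \<and>
    (x3 = xf \<or> (\<rho> x3, s2 x3 (\<rho> x3)) \<in> E0 M B1 B2 \<mu>)"
proof -
  let ?c = "\<rho> xf"
  have pr: "prof \<rho> x0 xf" and x0f: "x0 < xf" using o opt_less[OF o] by (auto simp: opt_def)
  have c: "0 < ?c" "?c \<le> B1" "?c \<le> y" using pr o \<rho>0 x0f by (auto simp: prof_def reg_def opt_def)
  define xz where "xz = ln (M - S2s - y)"
  have xz: "E xz = y" unfolding xz_def by (rule E_ln) (use y sb in simp)
  have "S2s < s2 x0 y" using xi_ge_line[OF nos pos lt y sb xi] above by simp
  then have yE0: "y < E x0" by (simp add: less_E_iff)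
  then have yE: "\<rho> x0 \<le> E x0" using \<rho>0 by simp
  have x0z: "x0 < xz" using yE0 xz E_less[of xz x0] by simp
  have Exf: "E xf < ?c" using o B2_less by (auto simp: opt_def E_less_iff)
  \<comment> \<open>A constant profile would contain a final arc starting on the line, where
    \<open>phi > 1\<close>.\<close>
  have cy: "?c < y"
  proof (rule ccontr)
    assume "\<not> ?thesis"
    then have cy: "?c = y" using c by simp
    have const: "\<rho> x = y" if x: "x \<in> {xz..xf}" for x
    proof (rule order_antisym)
      have d: "\<rho> b \<le> \<rho> a" if "x0 \<le> a" "a \<le> b" "b \<le> xf" for a b
        using pr that unfolding prof_def by blast
      show "\<rho> x \<le> y" using d[of x0 x] x x0z \<rho>0 by simp
      show "y \<le> \<rho> x" using d[of x xf] x x0z cy by simp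
    qed
    have "xz < xf" using Exf cy xz E_less[of xf xz] by simp
    then have "phi M B2 \<mu> y (s2 xz y) \<le> 1"
      by (intro opt_final_phi_le[OF o yE _ _ const]) (use x0z in auto)
    moreover have "1 < phi M B2 \<mu> y S2s" using phi_greater_1[OF pos y(1)] c cy by simp
    ultimately show False using xz s2_E[of xz] by simp
  qed
  obtain cm0 where cm0: "cm0 > 0" "\<And>cm b. 0 < cm \<Longrightarrow> cm \<le> cm0 \<Longrightarrow> cm \<le> S1m \<Longrightarrow> xm < b \<Longrightarrow> beta cm b x0 = y \<Longrightarrow> E b < S1s"
    using curve_above_xi[OF pos lt xi y(1) order_refl above] by blast
  define cm where "cm = min S1m (min ?c cm0)"
  have cm: "0 < cm" "cm \<le> S1m" "cm \<le> ?c" "cm \<le> cm0" using S1m(1) c cm0(1) by (auto simp: cm_def)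
  obtain b where b: "xm \<le> b" "x0 \<le> b" "y \<le> mcurve cm b x0"
    "b = xm \<and> (xm \<le> xf \<longrightarrow> E xm \<le> \<rho> xm) \<or> xm < b \<and> b \<le> xf \<and> \<rho> b = E b"
    and kap: "\<And>x. x \<in> {x0..xf} \<Longrightarrow> \<rho> x = kap cm y b ?c x"
    using opt_structure[OF o yE cm(1,2,3)] unfolding \<rho>0 by blast
  have mf: "mcurve cm b xf \<le> ?c" using kap[of xf] x0f cy by (auto simp: kap_def)
  \<comment> \<open>Until \<open>mcurve\<close> has come down to \<open>y\<close>, the profile
    \<open>kap\<close> rests at \<open>y\<close>.\<close>
  obtain x1 where x1: "x0 \<le> x1" "x1 \<le> xf" "mcurve cm b x1 = y"
    using IVT2'[of "mcurve cm b" xf y x0] mf cy b(3) x0f mcurve_cont[OF cm(1,2)] by auto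
  have x1f: "x1 < xf" using x1 mf cy by (cases "x1 = xf") auto
  have left: "\<rho> x = y" if x: "x \<in> {x0..x1}" for x
  proof -
    have "y \<le> mcurve cm b x" using mcurve_le[OF cm(1,2), of x x1 b] x x1 by simp
    then show ?thesis using kap[of x] x x1 cy by (auto simp: kap_def)
  qed
  have right: "\<rho> x = max ?c (mcurve cm b x)" if x: "x \<in> {x1..xf}" for x
  proof -
    have "mcurve cm b x \<le> y" using mcurve_le[OF cm(1,2), of x1 x b] x x1 by simp
    then show ?thesis using kap[of x] x x1 cy by (auto simp: kap_def)
  qed
  have x1b: "x1 \<le> b"
  proof (rule ccontr)
    assume n: "\<not> ?thesis"
    then have "\<rho> b = y" "E b \<le> \<rho> b" using left[of b] b(2,4) x1 by auto
    moreover have "mcurve cm b x1 < mcurve cm b b" by (rule mcurve_less[OF cm(1,2)]) (use n in simp)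
    ultimately show False using x1(3) mcurve_self[OF cm(1,2), of b] by simp
  qed
  have m1: "min (E x1) (beta cm b x1) = y" using mcurve_left[OF cm(1,2) x1b] x1(3) by simp
  have strict: "y < E x1"
  proof (rule ccontr)
    assume "\<not> ?thesis"
    then have E1: "E x1 = y" using m1 by simp
    have x01: "x0 < x1" using E1 yE0 E_less[of x1 x0] by simp
    show False
    proof (cases "y < S1m")
      case True
      then have x1m: "xm < x1" using E1 E_less[of x1 xm] by (simp add: E_xm)
      have "x1 = b"
      proof (rule ccontr)
        assume "x1 \<noteq> b"
        then have "beta cm b x1 < E x1" using x1b x1m by (intro beta_less_E[OF cm(1,2)]) auto
        then show False using m1 E1 by simp
      qed
      then show False using switch_not_on_line[OF o \<rho>0 yE0 True cm(1,2,3) cy _ kap] E1 by simp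
    next
      case False
      then show False using no_descent_to_line[OF nos pos _ y sb o x01 x1(2) E1 left cy] by simp
    qed
  qed
  have \<beta>1: "beta cm b x1 = y" using m1 strict by simp
  have x1b': "x1 < b"
    using x1b strict \<beta>1 beta_self[OF cm(1,2), of b] by (cases "x1 = b") auto
  have xmb: "xm < b"
  proof (rule ccontr)
    assume "\<not> xm < b"
    then have "b = xm" using b(1) by simp
    then show False using beta_xm_ge_E[OF cm(1,2), of x1] \<beta>1 strict by simp
  qed
  then have bf: "b \<le> xf" "\<rho> b = E b" using b(4) by auto
  have \<beta>E: "beta cm b x \<le> E x" if x: "x1 \<le> x" "x \<le> b" for x
  proof (cases "x \<le> xm")
    case True
    have "beta cm b x < E x" by (rule beta_less_E_left[OF cm(1,2) _ x(1) True]) (use \<beta>1 strict in simp)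
    then show ?thesis by simp
  next
    case False
    then show ?thesis using beta_less_E[OF cm(1,2) xmb, of x] x beta_self[OF cm(1,2), of b] by (cases "x = b") auto
  qed
  have m\<beta>: "mcurve cm b x = beta cm b x" if "x1 \<le> x" for x
    using \<beta>E[of x] that mcurve_left[OF cm(1,2), of x b] mcurve_right[OF cm(1,2), of b x] by (cases "x \<le> b") auto
  have r: "\<rho> x = max ?c (beta cm b x)" if x: "x \<in> {x1..xf}" for x
    using right[OF x] m\<beta>[of x] x by simp
  have x01: "x0 < x1"
  proof (rule ccontr)
    assume "\<not> ?thesis"
    then have "x1 = x0" using x1 by simp
    then have "E b < S1s" using cm0(2)[OF cm(1,4,2) xmb] \<beta>1 by simp
    then show False using no_low_crossing[OF o yE cm(1,2) xmb bf x1(1) x1b' r] by simp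
  qed
  have cE: "?c \<le> E b" using pr bf b(2) unfolding prof_def by (metis order_refl)
  have "beta cm b xf \<le> ?c" using r[of xf] x1 by auto
  then obtain x3 where x3: "b \<le> x3" "x3 \<le> xf" "beta cm b x3 = ?c"
    using IVT2'[of "beta cm b" xf ?c b] beta_self[OF cm(1,2), of b] cE bf beta_cont[OF cm(1,2)] by auto
  have mid: "\<rho> x = beta cm b x \<and> (beta cm b has_real_derivative - G x (\<rho> x)) (at x)" if x: "x \<in> {x1..x3}" for x
  proof -
    have ge: "?c \<le> beta cm b x" using beta_le[OF cm(1,2), of x x3 b] x x3 by simp
    then have \<rho>\<beta>: "\<rho> x = beta cm b x" using r[of x] x x3 by simp
    have "exp xf < M"
    proof -
      have "0 < \<rho> xf" "0 < s2 xf (\<rho> xf)" using pr x0f by (auto simp: prof_def reg_def)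
      then show ?thesis unfolding s2_def by linarith
    qed
    moreover have "exp x \<le> exp xf" using x x3 by simp
    ultimately have "exp x \<le> M" by linarith
    then have xM: "x \<le> ln M" using M_pos by (simp add: ln_ge_iff)
    have "Gb cm x (beta cm b x) = G x (beta cm b x)"
    proof (cases "x \<le> b")
      case True
      show ?thesis by (rule beta_true_left[OF cm(1,2)]) (use ge cm \<beta>E[of x] x True in auto)
    next
      case False
      show ?thesis by (rule beta_true_right[OF cm(1,2)]) (use ge cm False xM in auto)
    qed
    then show ?thesis using beta_deriv[OF cm(1,2), of b x] \<rho>\<beta> by simp
  qed
  \<comment> \<open>If an arc of control 0 follows, it starts at \<open>S2 \<le> S2s\<close> with
    \<open>phi \<le> 1\<close>, and outside \<open>E0\<close> one would have
    \<open>phi > 1\<close>.\<close>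
  have E0: "x3 = xf \<or> (\<rho> x3, s2 x3 (\<rho> x3)) \<in> E0 M B1 B2 \<mu>"
  proof (cases "x3 = xf")
    case False
    then have lt3: "x3 < xf" using x3 by simp
    have x03: "x0 \<le> x3" using x01 x1b' x3 by simp
    have const: "\<rho> x = ?c" if "x \<in> {x3..xf}" for x
      using r[of x] that x3 x1b' beta_le[OF cm(1,2), of x3 x b] by auto
    have "phi M B2 \<mu> ?c (s2 x3 ?c) \<le> 1" by (rule opt_final_phi_le[OF o yE x03 lt3 const])
    moreover have "B2 < s2 x3 ?c" using opt_end(3)[OF o yE x03 lt3 const] .
    moreover have "s2 x3 ?c \<le> S2s"
      using beta_ge_E[OF cm(1,2) less_imp_le[OF xmb] x3(1)] x3(3) by (simp add: E_le_iff)
    ultimately have "(?c, s2 x3 ?c) \<in> E0 M B1 B2 \<mu>"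
      using not_E0_phi[OF c(1,2), of "s2 x3 ?c"] by (cases "(?c, s2 x3 ?c) \<in> E0 M B1 B2 \<mu>") auto
    then show ?thesis using const[of x3] x3 by simp
  qed simp
  have "S2s < s2 x1 y" using strict by (simp add: less_E_iff)
  moreover have "x1 < x3" using x1b' x3 by simp
  moreover have "\<forall>x\<in>{x0..x1}. \<rho> x = y" using left by blast
  moreover have "\<forall>x\<in>{x1..x3}. \<rho> x = beta cm b x \<and> (beta cm b has_real_derivative - G x (\<rho> x)) (at x)" using mid by blast
  ultimately show ?thesis using x01 x3(2) E0 by blast
qed

text \<open>Back to time: the arcs fix the integrals of \<open>u * f (S1)\<close> at their least or
  greatest possible value, and since \<open>0 \<le> u \<le> 1\<close> and \<open>f (S1) > 0\<close>
  this determines \<open>u\<close> almost everywhere.\<close>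

lemma optimal_switching:
  assumes nos: "\<And>x y. S1m \<le> x \<Longrightarrow> x < y \<Longrightarrow> y \<le> sb \<Longrightarrow> \<not> singular_optimal M B1 B2 f \<mu> S2s x y"
    and pos: "0 < S1s" and lt: "S1s < S1m" and y: "S1s < S1 0" "S1 0 < sb" and sb: "sb < M - S2s"
    and xi: "xi_star_on M B1 B2 f \<mu> S2s (S1 0) \<xi>" and above: "\<xi> (S1 0) < S2 0"
    and o: "optimal M B1 B2 f \<mu> u S1 S2 tf"
    and fe: "first_entry (E0 M B1 B2 \<mu>) S1 S2 \<tau>" and \<tau>tf: "\<tau> \<le> tf"
  shows "\<exists>t0. {t. 0 \<le> t \<and> t < \<tau> \<and> switching_time u t} = {t0} \<and> S2s < S2 t0 \<and>
           (AE t in lebesgue. t \<in> {0..t0} \<longrightarrow> u t = 0) \<and> (AE t in lebesgue. t \<in> {t0<..<\<tau>} \<longrightarrow> u t = 1)"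
proof -
  let ?X = "logX S1 S2"
  have tr: "trajectory M f \<mu> u S1 S2" and tf: "0 \<le> tf" using o by (auto simp: optimal_def)
  have S20: "S2s < S2 0" using xi_ge_line[OF nos pos lt y sb xi] above by simp
  have S10: "0 < S1 0" using pos y by simp
  have S2p: "0 < S2 t" if "0 \<le> t" for t using trajectory_S2_pos[OF tr _ that] S20 S2s_pos by simp
  have S1p: "0 < S1 t" if "0 \<le> t" for t using trajectory_S1_pos[OF tr S10 that] .
  have S20': "B2 < S2 0" using S20 B2_less by simp
  obtain \<rho> where \<rho>: "opt \<rho> (?X 0) (?X tf)"
    "\<And>s. s \<in> {0..tf} \<Longrightarrow> ?X s \<in> {?X 0..?X tf} \<and> \<rho> (?X s) = S1 s \<and> cost \<rho> (?X 0) (?X s) = s"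
    "\<And>x. x \<in> {?X 0..?X tf} \<Longrightarrow> \<exists>s\<in>{0..tf}. x = ?X s"
    using optimal_opt[OF o S10 S20'] by blast
  have \<rho>S: "\<rho> (?X s) = S1 s" if "s \<in> {0..tf}" for s using \<rho>(2)[OF that] by simp
  have inj: "s = t" if "s \<in> {0..tf}" "t \<in> {0..tf}" "?X s = ?X t" for s t
    using \<rho>(2)[OF that(1)] \<rho>(2)[OF that(2)] that(3) by (metis (no_types))
  have mono: "?X s \<le> ?X t" if st: "0 \<le> s" "s \<le> t" for s t
  proof (rule nonneg_deriv_imp_le[OF st(2), where w' = "\<lambda>r. \<mu> (S2 r)"])
    show "(?X has_real_derivative \<mu> (S2 r)) (at r within {s..t})" if "r \<in> {s..t}" for r
      by (rule DERIV_subset[OF logX_deriv[OF tr, of r t]]) (use that st in auto)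
    show "0 \<le> \<mu> (S2 r)" if "r \<in> {s..t}" for r using \<mu>_pos[OF S2p[of r]] that st by auto
  qed
  have less: "s < t" if "s \<in> {0..tf}" "t \<in> {0..tf}" "?X s < ?X t" for s t
    using mono[of t s] that by (cases "s < t") auto
  have X0: "s2 (?X 0) (S1 0) = S2 0" by (rule s2_logX[OF tr]) simp
  have \<rho>0: "\<rho> (?X 0) = S1 0" using \<rho>S[of 0] tf by simp
  have above': "\<xi> (S1 0) < s2 (?X 0) (S1 0)" using above X0 by simp
  obtain x1 x3 \<beta> where x: "?X 0 < x1" "x1 < x3" "x3 \<le> ?X tf" "S2s < s2 x1 (S1 0)"
    and left: "\<And>x. x \<in> {?X 0..x1} \<Longrightarrow> \<rho> x = S1 0"
    and mid: "\<And>x. x \<in> {x1..x3} \<Longrightarrow> \<rho> x = \<beta> x \<and> (\<beta> has_real_derivative - G x (\<rho> x)) (at x)"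
    and e: "x3 = ?X tf \<or> (\<rho> x3, s2 x3 (\<rho> x3)) \<in> E0 M B1 B2 \<mu>"
    using optimal_profile[OF nos pos lt y sb xi \<rho>(1) \<rho>0 above'] by blast
  obtain t0 where t0: "t0 \<in> {0..tf}" "x1 = ?X t0" using \<rho>(3)[of x1] x by auto
  obtain t3 where t3: "t3 \<in> {0..tf}" "x3 = ?X t3" using \<rho>(3)[of x3] x by auto
  have t0p: "0 < t0" using less[of 0 t0] x t0 tf by simp
  have t03: "t0 < t3" using less[of t0 t3] x t0 t3 by simp
  have const: "S1 t = S1 0" if "t \<in> {0..t0}" for t
  proof -
    have t: "0 \<le> t" "t \<le> t0" "t \<in> {0..tf}" using that t0 by auto
    have "?X t \<in> {?X 0..x1}" using mono[OF order_refl t(1)] mono[OF t(1,2)] t0(2) by simp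
    from left[OF this] show ?thesis using \<rho>S[OF t(3)] by simp
  qed
  have S2t0: "s2 x1 (S1 0) = S2 t0" using s2_logX[OF tr, of t0] t0 const[of t0] by simp
  have u0: "AE t in lebesgue. t \<in> {0..t0} \<longrightarrow> u t = 0"
  proof -
    have "((\<lambda>s. - u s * f (S1 s)) has_integral 0) {0..t0}"
      using trajectory_S1[OF tr, of 0 t0] t0 const[of t0] by simp
    from has_integral_neg[OF this] have "((\<lambda>s. u s * f (S1 s)) has_integral 0) {0..t0}" by simp
    then have "AE t in lebesgue. t \<in> {0..t0} \<longrightarrow> u t * f (S1 t) = 0"
    proof (rule has_integral_0_nonneg_AE)
      show "0 \<le> u t * f (S1 t)" if "t \<in> {0..t0}" for t
        using trajectory_u[OF tr, of t] f_nonneg[OF less_imp_le[OF S1p, of t]] that by simp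
    qed
    then show ?thesis
    proof eventually_elim
      case (elim t)
      then show ?case using f_pos[of "S1 t"] S1p[of t] by auto
    qed
  qed
  have u1: "AE t in lebesgue. t \<in> {t0..t3} \<longrightarrow> u t = 1"
  proof -
    have tX: "?X t \<in> {x1..x3}" "t \<in> {0..tf}" if t: "t \<in> {t0..t3}" for t
    proof -
      have "0 \<le> t0" "t0 \<le> t" "0 \<le> t" "t \<le> t3" using t t0p by auto
      then show "?X t \<in> {x1..x3}" using mono[of t0 t] mono[of t t3] t0(2) t3(2) by simp
      show "t \<in> {0..tf}" using t t0p t3 by simp
    qed
    have S\<beta>: "\<beta> (?X t) = S1 t" if "t \<in> {t0..t3}" for t
      using mid[OF tX(1)[OF that]] \<rho>S[OF tX(2)[OF that]] by simp
    have "((\<lambda>t. - f (S1 t)) has_integral \<beta> (?X t3) - \<beta> (?X t0)) {t0..t3}"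
    proof (rule fundamental_theorem_of_calculus)
      fix t assume t: "t \<in> {t0..t3}"
      note t' = tX[OF t]
      have t0t: "0 \<le> t" using t'(2) by simp
      have "(?X has_real_derivative \<mu> (S2 t)) (at t within {0..tf})" by (rule logX_deriv[OF tr t'(2)])
      then have dX: "(?X has_real_derivative \<mu> (S2 t)) (at t within {t0..t3})"
        by (rule DERIV_subset) (use t0 t3 in auto)
      have "(\<beta> has_real_derivative - G (?X t) (\<rho> (?X t))) (at (?X t))" using mid[OF t'(1)] by blast
      from DERIV_chain2[OF this dX]
      have "((\<lambda>t. \<beta> (?X t)) has_real_derivative - G (?X t) (S1 t) * \<mu> (S2 t)) (at t within {t0..t3})"
        using \<rho>S[OF t'(2)] by simp
      moreover have "- G (?X t) (S1 t) * \<mu> (S2 t) = - f (S1 t)"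
        using s2_logX[OF tr t0t] \<mu>_pos[OF S2p[OF t0t]] by (simp add: G_def)
      ultimately show "((\<lambda>t. \<beta> (?X t)) has_vector_derivative - f (S1 t)) (at t within {t0..t3})"
        by (simp add: has_real_derivative_iff_has_vector_derivative)
    qed (use t03 in simp)
    then have i1: "((\<lambda>t. - f (S1 t)) has_integral S1 t3 - S1 t0) {t0..t3}"
      using S\<beta>[of t3] S\<beta>[of t0] t03 by simp
    have "((\<lambda>s. - u s * f (S1 s)) has_integral S1 t3 - S1 t0) {t0..t3}"
      by (rule trajectory_S1[OF tr]) (use t0p t03 in auto)
    from has_integral_diff[OF this i1] have "((\<lambda>s. (1 - u s) * f (S1 s)) has_integral 0) {t0..t3}"
      by (simp add: algebra_simps)
    then have "AE t in lebesgue. t \<in> {t0..t3} \<longrightarrow> (1 - u t) * f (S1 t) = 0"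
    proof (rule has_integral_0_nonneg_AE)
      show "0 \<le> (1 - u t) * f (S1 t)" if "t \<in> {t0..t3}" for t
        using trajectory_u[OF tr, of t] f_nonneg[OF less_imp_le[OF S1p, of t]] that t0p by simp
    qed
    then show ?thesis
    proof eventually_elim
      case (elim t)
      then show ?case using f_pos[of "S1 t"] S1p[of t] t0p by auto
    qed
  qed
  \<comment> \<open>The control is known up to \<open>t3\<close>. The extended target is entered no
    later: either \<open>t3 = tf\<close>, or the state at \<open>t3\<close> belongs to
    \<open>E0\<close>.\<close>
  have \<tau>3: "\<tau> \<le> t3"
  proof (cases "x3 = ?X tf")
    case True
    then show ?thesis using inj[of t3 tf] t3 tf \<tau>tf by simp
  next
    case False
    then have "(\<rho> x3, s2 x3 (\<rho> x3)) \<in> E0 M B1 B2 \<mu>" using e by simp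
    then have "(S1 t3, S2 t3) \<in> E0 M B1 B2 \<mu>" using t3 \<rho>S[of t3] s2_logX[OF tr, of t3] by simp
    then show ?thesis using fe t3 unfolding first_entry_def by (cases "\<tau> \<le> t3") auto
  qed
  \<comment> \<open>On the whole first arc \<open>S1 > S1s\<close> and \<open>S2 > S2s\<close>,
    which is outside \<open>E0\<close>.\<close>
  have \<tau>0: "t0 < \<tau>"
  proof (rule ccontr)
    assume "\<not> ?thesis"
    then have \<tau>: "\<tau> \<in> {0..t0}" using fe by (simp add: first_entry_def)
    have "S2s < s2 (?X \<tau>) (S1 0)"
    proof -
      have "exp (?X \<tau>) \<le> exp x1" using mono[of \<tau> t0] \<tau> t0 by simp
      then show ?thesis using x(4) unfolding s2_def by linarith
    qed
    then have "(S1 0, s2 (?X \<tau>) (S1 0)) \<notin> E0 M B1 B2 \<mu>" by (intro not_E0[OF pos y(1)]) simp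
    moreover have "s2 (?X \<tau>) (S1 0) = S2 \<tau>" using s2_logX[OF tr, of \<tau>] \<tau> const[OF \<tau>] by simp
    ultimately show False using fe const[OF \<tau>] by (simp add: first_entry_def)
  qed
  have sw: "t = t0" if t: "0 \<le> t" "t < \<tau>" "switching_time u t" for t
  proof (rule ccontr)
    assume n: "t \<noteq> t0"
    define \<epsilon> where "\<epsilon> = min \<bar>t - t0\<bar> (\<tau> - t)"
    have \<epsilon>: "0 < \<epsilon>" using n t by (simp add: \<epsilon>_def)
    define c :: real where "c = (if t < t0 then 0 else 1)"
    have "AE s in lebesgue. 0 \<le> s \<and> \<bar>s - t\<bar> < \<epsilon> \<longrightarrow> u s = c"
      using u0 u1
    proof eventually_elim
      case (elim s)
      show ?case
      proof
        assume s: "0 \<le> s \<and> \<bar>s - t\<bar> < \<epsilon>"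
        show "u s = c"
        proof (cases "t < t0")
          case True
          then have "s \<in> {0..t0}" using s by (auto simp: \<epsilon>_def)
          then show ?thesis using elim True by (simp add: c_def)
        next
          case False
          then have "s \<in> {t0..t3}" using s n \<tau>3 by (auto simp: \<epsilon>_def)
          then show ?thesis using elim False by (simp add: c_def)
        qed
      qed
    qed
    then show False using t(3) \<epsilon> unfolding switching_time_def by blast
  qed
  \<comment> \<open>Any constant disagrees with \<open>u\<close> on one side of \<open>t0\<close>,
    on an interval up to a null set.\<close>
  have sw0: "switching_time u t0"
    unfolding switching_time_def
  proof (intro allI impI notI)
    fix \<epsilon> :: real assume \<epsilon>: "0 < \<epsilon>" and "\<exists>c. AE t in lebesgue. 0 \<le> t \<and> \<bar>t - t0\<bar> < \<epsilon> \<longrightarrow> u t = c"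
    then obtain c where c: "AE t in lebesgue. 0 \<le> t \<and> \<bar>t - t0\<bar> < \<epsilon> \<longrightarrow> u t = c" by blast
    show False
    proof (cases "c = 0")
      case True
      have "AE t in lebesgue. t \<notin> {t0<..<min (t0 + \<epsilon>) t3}"
        using c u1 by eventually_elim (use True t0p in auto)
      then show False using not_AE_False_interval[of t0 "min (t0 + \<epsilon>) t3"] \<epsilon> t03 by simp
    next
      case False
      have "AE t in lebesgue. t \<notin> {max (t0 - \<epsilon>) 0<..<t0}"
        using c u0 by eventually_elim (use False in auto)
      then show False using not_AE_False_interval[of "max (t0 - \<epsilon>) 0" t0] \<epsilon> t0p by simp
    qed
  qed
  have "{t. 0 \<le> t \<and> t < \<tau> \<and> switching_time u t} = {t0}" using sw sw0 t0p \<tau>0 by auto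
  moreover have "AE t in lebesgue. t \<in> {t0<..<\<tau>} \<longrightarrow> u t = 1"
    using u1 by eventually_elim (use \<tau>3 in auto)
  moreover have "S2s < S2 t0" using x(4) S2t0 by simp
  ultimately show ?thesis using u0 by blast
qed

end

theorem proposition7:
  fixes M B1 B2 S2s S1bar S10 S20 tf \<tau> :: real
    and f \<mu> \<xi> u S1 S2 :: "real \<Rightarrow> real"
  assumes "M > 0" and "B1 > 0" and "B2 > 0" and "B1 + B2 < M"
    and "C1_half_line f" and "\<forall>x\<ge>0. f x \<ge> 0" and "C1_half_line \<mu>"
    and "H0 f" and "H1 \<mu> (ereal S2s)"
    and "B2 < S2s" and "S2s < M" and "B1 + S2s < M"
    and "S1_min M f \<mu> S2s > S1_star M B1 B2 \<mu> S2s" and "S1_star M B1 B2 \<mu> S2s > 0"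
    and "is_S1_bar M B1 B2 f \<mu> S2s S1bar"
    and "(S10, S20) \<in> state_domain M"
    and "S1_star M B1 B2 \<mu> S2s < S10" and "S10 < S1bar"
    and "xi_star_on M B1 B2 f \<mu> S2s S10 \<xi>" and "S20 > \<xi> S10"
    and "optimal M B1 B2 f \<mu> u S1 S2 tf" and "S1 0 = S10" and "S2 0 = S20"
    and "first_entry (E0 M B1 B2 \<mu>) S1 S2 \<tau>" and "\<tau> \<le> tf"
  shows "\<exists>t0. {t. 0 \<le> t \<and> t < \<tau> \<and> switching_time u t} = {t0} \<and>
           S2 t0 > S2s \<and>
           (AE t in lebesgue. t \<in> {0..t0} \<longrightarrow> u t = 0) \<and>
           (AE t in lebesgue. t \<in> {t0<..<\<tau>} \<longrightarrow> u t = 1)"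
proof -
  obtain f' where f': "continuous_on {0..} f'" "\<And>x. 0 \<le> x \<Longrightarrow> (f has_real_derivative f' x) (at x within {0..})"
    using assms(5) unfolding C1_half_line_def by blast
  obtain \<mu>' where \<mu>': "continuous_on {0..} \<mu>'" "\<And>x. 0 \<le> x \<Longrightarrow> (\<mu> has_real_derivative \<mu>' x) (at x within {0..})"
    using assms(7) unfolding C1_half_line_def by blast
  have \<mu>0: "\<mu> 0 = 0" and \<mu>pos: "0 < \<mu> s" if "0 < s" for s
    using assms(9) that unfolding H1_def by (auto simp: less_le)
  \<comment> \<open>\<open>ereal S2s\<close> is finite, which selects the first alternative of
    \<open>H1\<close>.\<close>
  have mon: "strict_mono_on {0..<S2s} \<mu>" "strict_antimono_on {S2s<..} \<mu>"
    using assms(9) unfolding H1_def by auto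
  interpret chemostat M S2s B1 B2 f \<mu> f' \<mu>'
    using assms f' \<mu>' \<mu>0[OF zero_less_one] \<mu>pos mon by unfold_locales (auto simp: H0_def)
  show ?thesis
  proof (rule optimal_switching)
    show "\<not> singular_optimal M B1 B2 f \<mu> S2s x y" if "S1m \<le> x" "x < y" "y \<le> S1bar" for x y
      using assms(15) that unfolding is_S1_bar_def no_singular_below_def S1m_def by blast
    show "S1bar < M - S2s" using assms(15) unfolding is_S1_bar_def no_singular_below_def by blast
  qed (use assms in \<open>simp_all add: S1s_def S1m_def\<close>)
qed

end
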